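(* There does not exist a left $\mathcal{O}_q(\mathrm{SU}_3)$-coinvariant non-degenerate form $\sigma\in\Omega^2_q(\mathrm{F}_3)$ that commutes with the elements of $\mathcal{O}_q(\mathrm{F}_3)$. (Here $\sigma$ is non-degenerate if $\sigma\wedge\sigma\wedge\sigma\neq0$, is left coinvariant if $\Delta_L(\sigma)=1\otimes\sigma$, and commutes with $\mathcal{O}_q(\mathrm{F}_3)$ if $b\sigma=\sigma b$ for all $b\in\mathcal{O}_q(\mathrm{F}_3)$.)
   Context: Let $q\in\mathbb{R}\setminus\{-1,0,1\}$. Let $\Delta^+=\{\alpha_1,\alpha_2,\alpha_1+\alpha_2\}$ be the positive roots of $\mathfrak{sl}_3$, with Cartan matrix $a_{11}=a_{22}=2$, $a_{12}=a_{21}=-1$. $U_q(\mathfrak{sl}_3)$ is the complex algebra generated by $E_i,F_i,K_i^{\pm1}$ ($i=1,2$) with $K_iK_j=K_jK_i$, $K_iE_j=q^{a_{ij}}E_jK_i$, $K_iF_j=q^{-a_{ij}}F_jK_i$, $[E_i,F_j]=\delta_{ij}\frac{K_i-K_i^{-1}}{q-q^{-1}}$, and $E_i^2E_j-(q+q^{-1})E_iE_jE_i+E_jE_i^2=0$, $F_i^2F_j-(q+q^{-1})F_iF_jF_i+F_jF_i^2=0$ for $i\ne j$. It is a Hopf $*$-algebra with $\Delta(E_i)=E_i\otimes K_i+1\otimes E_i$, $\Delta(F_i)=F_i\otimes1+K_i^{-1}\otimes F_i$, $\Delta(K_i)=K_i\otimes K_i$, $\varepsilon(E_i)=\varepsilon(F_i)=0$,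 $\varepsilon(K_i)=1$, $E_i^*=K_iF_i$, $F_i^*=E_iK_i^{-1}$, $K_i^*=K_i$. $A:=\mathcal{O}_q(\mathrm{SU}_3)$ is the Hopf subalgebra of the Hopf dual of $U_q(\mathfrak{sl}_3)$ generated by $u_{ij}$ ($1\le i,j\le3$), where $\Delta(u_{ij})=\sum_a u_{ia}\otimes u_{aj}$ and the only nonzero pairings of the $u_{ij}$ with the generators are $\langle E_1,u_{21}\rangle=\langle E_2,u_{32}\rangle=\langle F_1,u_{12}\rangle=\langle F_2,u_{23}\rangle=1$, $\langle K_i^{\pm1},u_{jj}\rangle=q^{\pm(\delta_{i,j-1}-\delta_{ij})}$. Put $X\triangleright a:=a_{(1)}\langle X,a_{(2)}\rangle$. Then $B:=\mathcal{O}_q(\mathrm{F}_3):=\{b\in A: K_i^{\pm1}\triangleright b=b,\ i=1,2\}$. Put $E_{\alpha_i}:=E_i$, $E_{\alpha_1+\alpha_2}:=E_2E_1-q^{-1}E_1E_2$, $F_\gamma:=E_\gamma^*$, and $T:=\mathrm{span}_{\mathbb{C}}\{E_\gamma,F_\gamma:\gamma\in\Delta^+\}$. $T$ defines the left $A$-covariant first-order differential calculus $\Omega^1_q(\mathrm{SU}_3)=A\otimes\Lambda^1$ over $A$: $\Lambda^1:=A^+/\{y\in A^+:X(y)=0\ \forall X\in T\}$ (with $A^+=\ker\varepsilon$) is a right $A$-module with basis $\{e_\gamma,f_\gamma\}$ dual to $\{E_\gamma,F_\gamma\}$, the bimodule structure is $a(b\otimes v)c=abc_{(1)}\otimes vc_{(2)}$,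 the left coaction is $\Delta\otimes\mathrm{id}$, and $\mathrm{d}a=\sum_\gamma (E_\gamma\triangleright a)\otimes e_\gamma+(F_\gamma\triangleright a)\otimes f_\gamma$. $\Omega^1_q(\mathrm{F}_3)$ is its restriction to $B$ (the $B$-sub-bimodule generated by $\mathrm{d}b$, $b\in B$). $\Omega^\bullet_q(\mathrm{F}_3)$ is the maximal prolongation of $\Omega^1_q(\mathrm{F}_3)$: the quotient of the tensor algebra of the $B$-bimodule $\Omega^1_q(\mathrm{F}_3)$ by the two-sided ideal generated by all $\sum_i\mathrm{d}b_i\otimes\mathrm{d}c_i$ with $b_i,c_i\in B$, $\sum_ib_i\,\mathrm{d}c_i=0$; its product is written $\wedge$, and it is a left $A$-comodule algebra with coaction $\Delta_L$ determined by $\mathrm{d}$ being a comodule map. *)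

theory Defs
  imports Complex_Main "HOL-Library.Poly_Mapping" "HOL-Library.Function_Algebras"
    "HOL-Library.Product_Plus"
begin

section \<open>Free algebras and their duals\<close>

datatype 'a fword = FWord (letters: "'a list")

instantiation fword :: (type) monoid_add
begin
definition zero_fword :: "'a fword" where "0 = FWord []"
definition plus_fword :: "'a fword \<Rightarrow> 'a fword \<Rightarrow> 'a fword"
  where "v + w = FWord (letters v @ letters w)"
instance by standard (simp_all add: zero_fword_def plus_fword_def)
end

text \<open>The monoid ring of the free monoid, i.e. the free unital complex algebra on \<open>'a\<close>.\<close>
type_synonym 'a free_alg = "'a fword \<Rightarrow>\<^sub>0 complex"

definition fw :: "'a list \<Rightarrow> 'a free_alg"
  where "fw ws = Poly_Mapping.single (FWord ws) 1"

definition scl :: "complex \<Rightarrow> ('b \<Rightarrow>\<^sub>0 complex) \<Rightarrow> ('b \<Rightarrow>\<^sub>0 complex)"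
  where "scl c x = Poly_Mapping.map (\<lambda>v. c * v) x"

lemma lookup_scl: "Poly_Mapping.lookup (scl c x) k = c * Poly_Mapping.lookup x k"
  unfolding scl_def by (simp add: Poly_Mapping.map.rep_eq when_def)

global_interpretation formal: vector_space scl
  by standard (auto intro!: poly_mapping_eqI simp: lookup_scl lookup_add algebra_simps)

definition lin_ext :: "('b \<Rightarrow> 'c \<Rightarrow>\<^sub>0 complex) \<Rightarrow> ('b \<Rightarrow>\<^sub>0 complex) \<Rightarrow> ('c \<Rightarrow>\<^sub>0 complex)"
  where "lin_ext g x = (\<Sum>w\<in>Poly_Mapping.keys x. scl (Poly_Mapping.lookup x w) (g w))"

text \<open>A linear functional on a free algebra is given by its values on words.\<close>
definition pairing :: "'a free_alg \<Rightarrow> ('a fword \<Rightarrow> complex) \<Rightarrow> complex"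
  where "pairing x f = (\<Sum>w\<in>Poly_Mapping.keys x. Poly_Mapping.lookup x w * f w)"

definition fscale :: "complex \<Rightarrow> ('b \<Rightarrow> complex) \<Rightarrow> ('b \<Rightarrow> complex)"
  where "fscale c f = (\<lambda>w. c * f w)"

inductive_set two_sided_ideal :: "'r::ring_1 set \<Rightarrow> 'r set" for R :: "'r set" where
  zero: "0 \<in> two_sided_ideal R"
| gen: "r \<in> R \<Longrightarrow> x * r * y \<in> two_sided_ideal R"
| add: "x \<in> two_sided_ideal R \<Longrightarrow> y \<in> two_sided_ideal R \<Longrightarrow> x + y \<in> two_sided_ideal R"


section \<open>The Hopf algebra \<open>U\<^sub>q(sl\<^sub>3)\<close>\<close>

datatype node = N1 | N2

datatype gen = E node | F node | K node | Kinv node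

fun num :: "node \<Rightarrow> nat" where
  "num N1 = 1"
| "num N2 = 2"

definition cartan :: "node \<Rightarrow> node \<Rightarrow> int"
  where "cartan i j = (if i = j then 2 else -1)"

abbreviation cq :: "real \<Rightarrow> complex" where "cq q \<equiv> complex_of_real q"

definition Uq_rels :: "real \<Rightarrow> gen free_alg set" where
  "Uq_rels q =
     {fw [K i, Kinv i] - 1 | i. True} \<union> {fw [Kinv i, K i] - 1 | i. True}
   \<union> {fw [K i, K j] - fw [K j, K i] | i j. True}
   \<union> {fw [K i, E j] - scl (cq q powi cartan i j) (fw [E j, K i]) | i j. True}
   \<union> {fw [K i, F j] - scl (cq q powi (- cartan i j)) (fw [F j, K i]) | i j. True}
   \<union> {fw [E i, F j] - fw [F j, E i]
        - (if i = j then scl (1 / (cq q - 1 / cq q)) (fw [K i] - fw [Kinv i]) else 0) | i j. True}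
   \<union> {fw [E i, E i, E j] - scl (cq q + 1 / cq q) (fw [E i, E j, E i]) + fw [E j, E i, E i]
        | i j. i \<noteq> j}
   \<union> {fw [F i, F i, F j] - scl (cq q + 1 / cq q) (fw [F i, F j, F i]) + fw [F j, F i, F i]
        | i j. i \<noteq> j}"

text \<open>\<open>U\<^sub>q(sl\<^sub>3)\<close> is the free algebra on the generators modulo this ideal. Its elements are
  represented by elements of the free algebra, and its linear functionals by those functionals
  on the free algebra that vanish on the ideal.\<close>
definition Uq_ideal :: "real \<Rightarrow> gen free_alg set"
  where "Uq_ideal q = two_sided_ideal (Uq_rels q)"

type_synonym fnl = "gen fword \<Rightarrow> complex"

definition Uq_dual :: "real \<Rightarrow> fnl set"
  where "Uq_dual q = {f. \<forall>x\<in>Uq_ideal q. pairing x f = 0}"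

text \<open>The tensor square of the free algebra is the monoid ring of pairs of words.\<close>
definition tw :: "gen list \<Rightarrow> gen list \<Rightarrow> (gen fword \<times> gen fword) \<Rightarrow>\<^sub>0 complex"
  where "tw v w = Poly_Mapping.single (FWord v, FWord w) 1"

fun coprod_gen :: "gen \<Rightarrow> (gen fword \<times> gen fword) \<Rightarrow>\<^sub>0 complex" where
  "coprod_gen (E i) = tw [E i] [K i] + tw [] [E i]"
| "coprod_gen (F i) = tw [F i] [] + tw [Kinv i] [F i]"
| "coprod_gen (K i) = tw [K i] [K i]"
| "coprod_gen (Kinv i) = tw [Kinv i] [Kinv i]"

definition coprod_word :: "gen fword \<Rightarrow> (gen fword \<times> gen fword) \<Rightarrow>\<^sub>0 complex"
  where "coprod_word w = prod_list (map coprod_gen (letters w))"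

fun counit_gen :: "gen \<Rightarrow> complex" where
  "counit_gen (E i) = 0"
| "counit_gen (F i) = 0"
| "counit_gen (K i) = 1"
| "counit_gen (Kinv i) = 1"

text \<open>The antipode, which is determined by the coproduct.\<close>
fun antipode_gen :: "gen \<Rightarrow> gen free_alg" where
  "antipode_gen (E i) = - fw [E i, Kinv i]"
| "antipode_gen (F i) = - fw [K i, F i]"
| "antipode_gen (K i) = fw [Kinv i]"
| "antipode_gen (Kinv i) = fw [K i]"

definition antipode_word :: "gen fword \<Rightarrow> gen free_alg"
  where "antipode_word w = prod_list (map antipode_gen (rev (letters w)))"

fun star_gen :: "gen \<Rightarrow> gen free_alg" where
  "star_gen (E i) = fw [K i, F i]"
| "star_gen (F i) = fw [E i, Kinv i]"
| "star_gen (K i) = fw [K i]"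
| "star_gen (Kinv i) = fw [Kinv i]"

definition star_word :: "gen fword \<Rightarrow> gen free_alg"
  where "star_word w = prod_list (map star_gen (rev (letters w)))"

definition Uq_star :: "gen free_alg \<Rightarrow> gen free_alg"
  where "Uq_star x = (\<Sum>w\<in>Poly_Mapping.keys x. scl (cnj (Poly_Mapping.lookup x w)) (star_word w))"


section \<open>The Hopf algebra \<open>O\<^sub>q(SU\<^sub>3)\<close> and the subalgebra \<open>O\<^sub>q(F\<^sub>3)\<close>\<close>

text \<open>The unit of the dual is the counit; its product is dual to the coproduct. (The pointwise
  operations \<open>1\<close> and \<open>*\<close> on functions are never used.)\<close>
definition unit :: fnl
  where "unit w = prod_list (map counit_gen (letters w))"

definition conv :: "fnl \<Rightarrow> fnl \<Rightarrow> fnl" (infixl "\<star>" 70)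
  where "(f \<star> g) w = (\<Sum>(v, v')\<in>Poly_Mapping.keys (coprod_word w).
           Poly_Mapping.lookup (coprod_word w) (v, v') * (f v * g v'))"

definition dual_counit :: "fnl \<Rightarrow> complex"
  where "dual_counit f = f 0"

definition dual_antipode :: "fnl \<Rightarrow> fnl"
  where "dual_antipode f w = pairing (antipode_word w) f"

text \<open>\<open>\<Sum> a\<^sub>i \<otimes> b\<^sub>i\<close> is the coproduct of \<open>f\<close>, i.e. \<open>\<langle>X Y, f\<rangle> = \<Sum> \<langle>X, a\<^sub>i\<rangle> \<langle>Y, b\<^sub>i\<rangle>\<close>.\<close>
definition is_coproduct :: "fnl \<Rightarrow> (fnl \<times> fnl) list \<Rightarrow> bool"
  where "is_coproduct f ts \<longleftrightarrow> (\<forall>v w. f (v + w) = (\<Sum>(a, b)\<leftarrow>ts. a v * b w))"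

text \<open>The last condition forces \<open>S\<close> to lie in the finite dual.\<close>
definition hopf_subalgebra :: "real \<Rightarrow> fnl set \<Rightarrow> bool" where
  "hopf_subalgebra q S \<longleftrightarrow>
     S \<subseteq> Uq_dual q \<and> unit \<in> S \<and>
     (\<forall>f\<in>S. \<forall>g\<in>S. f + g \<in> S \<and> f \<star> g \<in> S) \<and>
     (\<forall>c. \<forall>f\<in>S. fscale c f \<in> S) \<and>
     (\<forall>f\<in>S. dual_antipode f \<in> S) \<and>
     (\<forall>f\<in>S. \<exists>ts. set ts \<subseteq> S \<times> S \<and> is_coproduct f ts)"

fun u_gen :: "real \<Rightarrow> nat \<Rightarrow> nat \<Rightarrow> gen \<Rightarrow> complex" where
  "u_gen q i j (E n) = of_bool (i = num n + 1 \<and> j = num n)"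
| "u_gen q i j (F n) = of_bool (i = num n \<and> j = num n + 1)"
| "u_gen q i j (K n) = (if i = j
     then cq q powi (of_bool (num n + 1 = j) - of_bool (num n = j)) else 0)"
| "u_gen q i j (Kinv n) = (if i = j
     then cq q powi (- (of_bool (num n + 1 = j) - of_bool (num n = j))) else 0)"

fun u_list :: "real \<Rightarrow> nat \<Rightarrow> nat \<Rightarrow> gen list \<Rightarrow> complex" where
  "u_list q i j [] = of_bool (i = j)"
| "u_list q i j (g # ws) = (\<Sum>a\<in>{1..3}. u_gen q i a g * u_list q a j ws)"

text \<open>\<open>u\<^sub>i\<^sub>j\<close> for \<open>i, j \<in> {1, 2, 3}\<close>.\<close>
definition u_mat :: "real \<Rightarrow> nat \<Rightarrow> nat \<Rightarrow> fnl"
  where "u_mat q i j w = u_list q i j (letters w)"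

definition OqSU3 :: "real \<Rightarrow> fnl set" where
  "OqSU3 q = \<Inter>{S. hopf_subalgebra q S \<and> (\<forall>i\<in>{1..3}. \<forall>j\<in>{1..3}. u_mat q i j \<in> S)}"

text \<open>Sweedler notation: some representative \<open>\<Sum> a\<^sub>(\<^sub>1\<^sub>) \<otimes> a\<^sub>(\<^sub>2\<^sub>)\<close> of the coproduct with legs in
  \<open>S\<close> and \<open>S'\<close>.\<close>
definition sweedler :: "fnl set \<Rightarrow> fnl set \<Rightarrow> fnl \<Rightarrow> (fnl \<times> fnl) list"
  where "sweedler S S' a = (SOME ts. set ts \<subseteq> S \<times> S' \<and> is_coproduct a ts)"

definition lact :: "real \<Rightarrow> gen free_alg \<Rightarrow> fnl \<Rightarrow> fnl"
  where "lact q X a = (\<Sum>(a1, a2)\<leftarrow>sweedler (OqSU3 q) (OqSU3 q) a. fscale (pairing X a2) a1)"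

definition OqF3 :: "real \<Rightarrow> fnl set" where
  "OqF3 q = {b \<in> OqSU3 q. \<forall>i. lact q (fw [K i]) b = b \<and> lact q (fw [Kinv i]) b = b}"


section \<open>First-order calculi\<close>

datatype posroot = A1 | A2 | A12

fun E_root :: "real \<Rightarrow> posroot \<Rightarrow> gen free_alg" where
  "E_root q A1 = fw [E N1]"
| "E_root q A2 = fw [E N2]"
| "E_root q A12 = fw [E N2, E N1] - scl (1 / cq q) (fw [E N1, E N2])"

datatype tang = TE posroot | TF posroot

text \<open>The basis of \<open>T\<close>.\<close>
fun tvec :: "real \<Rightarrow> tang \<Rightarrow> gen free_alg" where
  "tvec q (TE \<gamma>) = E_root q \<gamma>"
| "tvec q (TF \<gamma>) = Uq_star (E_root q \<gamma>)"

definition OqSU3_plus :: "real \<Rightarrow> fnl set"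
  where "OqSU3_plus q = {y \<in> OqSU3 q. dual_counit y = 0}"

text \<open>\<open>\<Lambda>\<^sup>1\<close> is the quotient of \<open>A\<^sup>+\<close> by the common kernel of \<open>T\<close>. The class of \<open>y\<close> is recorded by
  its coordinates in the basis \<open>e\<^sub>\<gamma>, f\<^sub>\<gamma>\<close> dual to \<open>E\<^sub>\<gamma>, F\<^sub>\<gamma>\<close>, i.e. by the values of the basis of
  \<open>T\<close> on \<open>y\<close>; so two elements of \<open>A\<^sup>+\<close> have the same class iff their difference is killed by \<open>T\<close>.\<close>
type_synonym lam = "tang \<Rightarrow> complex"

definition lam_class :: "real \<Rightarrow> fnl \<Rightarrow> lam"
  where "lam_class q y = (\<lambda>\<delta>. pairing (tvec q \<delta>) y)"

definition lam_basis :: "tang \<Rightarrow> lam"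
  where "lam_basis \<gamma> = (\<lambda>\<delta>. of_bool (\<delta> = \<gamma>))"

definition lam_right :: "real \<Rightarrow> lam \<Rightarrow> fnl \<Rightarrow> lam"
  where "lam_right q v a = lam_class q ((SOME y. y \<in> OqSU3_plus q \<and> lam_class q y = v) \<star> a)"

text \<open>A form \<open>m\<close> stands for the element \<open>\<Sum>\<^sub>\<gamma> m \<gamma> \<otimes> (basis vector \<gamma>)\<close> of \<open>A \<otimes> \<Lambda>\<^sup>1\<close>.\<close>
type_synonym form = "tang \<Rightarrow> fnl"

definition form_scale :: "complex \<Rightarrow> form \<Rightarrow> form"
  where "form_scale c m = (\<lambda>\<gamma>. fscale c (m \<gamma>))"

definition form_left :: "fnl \<Rightarrow> form \<Rightarrow> form"
  where "form_left a m = (\<lambda>\<gamma>. a \<star> m \<gamma>)"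

text \<open>\<open>(b \<otimes> v) c = b c\<^sub>(\<^sub>1\<^sub>) \<otimes> v c\<^sub>(\<^sub>2\<^sub>)\<close>\<close>
definition form_right :: "real \<Rightarrow> form \<Rightarrow> fnl \<Rightarrow> form" where
  "form_right q m c = (\<lambda>\<delta>. \<Sum>\<gamma>\<in>UNIV. \<Sum>(c1, c2)\<leftarrow>sweedler (OqSU3 q) (OqSU3 q) c.
     fscale (lam_right q (lam_basis \<gamma>) c2 \<delta>) (m \<gamma> \<star> c1))"

definition dif :: "real \<Rightarrow> fnl \<Rightarrow> form"
  where "dif q a = (\<lambda>\<gamma>. lact q (tvec q \<gamma>) a)"

inductive_set Omega1F3 :: "real \<Rightarrow> form set" for q :: real where
  dif: "b \<in> OqF3 q \<Longrightarrow> dif q b \<in> Omega1F3 q"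
| add: "m \<in> Omega1F3 q \<Longrightarrow> n \<in> Omega1F3 q \<Longrightarrow> m + n \<in> Omega1F3 q"
| left: "b \<in> OqF3 q \<Longrightarrow> m \<in> Omega1F3 q \<Longrightarrow> form_left b m \<in> Omega1F3 q"
| right: "b \<in> OqF3 q \<Longrightarrow> m \<in> Omega1F3 q \<Longrightarrow> form_right q m b \<in> Omega1F3 q"


section \<open>The tensor algebra and the maximal prolongation\<close>

text \<open>Write \<open>M\<close> for the \<open>B\<close>-bimodule \<open>Omega1F3 q\<close>. The tensor algebra \<open>B \<oplus> M \<oplus> (M \<otimes>\<^sub>B M) \<oplus> \<dots>\<close> is
  represented by pairs \<open>(b, x)\<close>, where \<open>b \<in> B\<close> is the part of degree 0 and \<open>x\<close> is a formal complex
  combination of nonempty words in \<open>M\<close>, a word \<open>m\<^sub>1 \<dots> m\<^sub>n\<close> standing for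
  \<open>m\<^sub>1 \<otimes> \<dots> \<otimes> m\<^sub>n\<close>. Two such pairs are equal in the tensor algebra iff their difference lies in
  \<open>tensor_null\<close>.\<close>
type_synonym tensor = "fnl \<times> form free_alg"

definition tensor_carrier :: "real \<Rightarrow> tensor set" where
  "tensor_carrier q =
     OqF3 q \<times> formal.span {fw ms | ms. ms \<noteq> [] \<and> set ms \<subseteq> Omega1F3 q}"

definition tensor_scale :: "complex \<Rightarrow> tensor \<Rightarrow> tensor"
  where "tensor_scale c t = (fscale c (fst t), scl c (snd t))"

definition tensor_left :: "fnl \<Rightarrow> form free_alg \<Rightarrow> form free_alg" where
  "tensor_left b = lin_ext (\<lambda>w. case letters w of [] \<Rightarrow> 0 | m # ms \<Rightarrow> fw (form_left b m # ms))"

definition tensor_right :: "real \<Rightarrow> form free_alg \<Rightarrow> fnl \<Rightarrow> form free_alg" where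
  "tensor_right q x b = lin_ext (\<lambda>w. if letters w = [] then 0
     else fw (butlast (letters w) @ [form_right q (last (letters w)) b])) x"

fun wedge :: "real \<Rightarrow> tensor \<Rightarrow> tensor \<Rightarrow> tensor" where
  "wedge q (b, x) (c, y) = (b \<star> c, tensor_left b y + tensor_right q x c + x * y)"

definition tensor_null :: "real \<Rightarrow> tensor set" where
  "tensor_null q = {0} \<times> formal.span (
     {fw (ms @ [m + n] @ ns) - fw (ms @ [m] @ ns) - fw (ms @ [n] @ ns) | ms m n ns.
        set ms \<subseteq> Omega1F3 q \<and> m \<in> Omega1F3 q \<and> n \<in> Omega1F3 q \<and> set ns \<subseteq> Omega1F3 q}
   \<union> {fw (ms @ [form_scale c m] @ ns) - scl c (fw (ms @ [m] @ ns)) | c ms m ns.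
        set ms \<subseteq> Omega1F3 q \<and> m \<in> Omega1F3 q \<and> set ns \<subseteq> Omega1F3 q}
   \<union> {fw (ms @ [form_right q m b, n] @ ns) - fw (ms @ [m, form_left b n] @ ns) | b ms m n ns.
        b \<in> OqF3 q \<and> set ms \<subseteq> Omega1F3 q \<and> m \<in> Omega1F3 q \<and> n \<in> Omega1F3 q
        \<and> set ns \<subseteq> Omega1F3 q})"

text \<open>The maximal prolongation is \<open>tensor_carrier q\<close> modulo \<open>prolong_ideal q\<close>, with product induced
  by \<open>wedge\<close>.\<close>
inductive_set prolong_ideal :: "real \<Rightarrow> tensor set" for q :: real where
  null: "t \<in> tensor_null q \<Longrightarrow> t \<in> prolong_ideal q"
| gen: "set ts \<subseteq> OqF3 q \<times> OqF3 q \<Longrightarrow> (\<Sum>(b, c)\<leftarrow>ts. form_left b (dif q c)) = 0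
    \<Longrightarrow> (0, \<Sum>(b, c)\<leftarrow>ts. fw [dif q b, dif q c]) \<in> prolong_ideal q"
| add: "s \<in> prolong_ideal q \<Longrightarrow> t \<in> prolong_ideal q \<Longrightarrow> s + t \<in> prolong_ideal q"
| scale: "t \<in> prolong_ideal q \<Longrightarrow> tensor_scale c t \<in> prolong_ideal q"
| left: "s \<in> tensor_carrier q \<Longrightarrow> t \<in> prolong_ideal q \<Longrightarrow> wedge q s t \<in> prolong_ideal q"
| right: "s \<in> tensor_carrier q \<Longrightarrow> t \<in> prolong_ideal q \<Longrightarrow> wedge q t s \<in> prolong_ideal q"

definition prolong_eq :: "real \<Rightarrow> tensor \<Rightarrow> tensor \<Rightarrow> bool"
  where "prolong_eq q s t \<longleftrightarrow> s - t \<in> prolong_ideal q"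

text \<open>Representatives of the elements of \<open>\<Omega>\<^sup>2\<^sub>q(F\<^sub>3)\<close>.\<close>
definition Omega2F3 :: "real \<Rightarrow> tensor set" where
  "Omega2F3 q = {0} \<times> formal.span {fw [m, n] | m n. m \<in> Omega1F3 q \<and> n \<in> Omega1F3 q}"


section \<open>The left coaction\<close>

text \<open>The restriction of \<open>\<Delta> \<otimes> id\<close> to \<open>M\<close>, which takes values in \<open>A \<otimes> M\<close>, as a chosen representative.\<close>
definition coact_form :: "real \<Rightarrow> form \<Rightarrow> (fnl \<times> form) list" where
  "coact_form q m = (SOME ts. set ts \<subseteq> OqSU3 q \<times> Omega1F3 q \<and>
     (\<forall>\<gamma> v w. m \<gamma> (v + w) = (\<Sum>(a, n)\<leftarrow>ts. a v * n \<gamma> w)))"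

fun coact_forms :: "real \<Rightarrow> form list \<Rightarrow> (fnl \<times> form list) list" where
  "coact_forms q [] = [(unit, [])]"
| "coact_forms q (m # ms) =
     [(a \<star> a', n # ns). (a, n) \<leftarrow> coact_form q m, (a', ns) \<leftarrow> coact_forms q ms]"

text \<open>Elements of \<open>A \<otimes> \<Omega>\<close> are formal complex combinations of pairs, modulo \<open>comod_null\<close>.\<close>
definition pure :: "fnl \<Rightarrow> tensor \<Rightarrow> (fnl \<times> tensor) \<Rightarrow>\<^sub>0 complex"
  where "pure a t = Poly_Mapping.single (a, t) 1"

definition coaction :: "real \<Rightarrow> tensor \<Rightarrow> (fnl \<times> tensor) \<Rightarrow>\<^sub>0 complex" where
  "coaction q t =
     (\<Sum>(a, b)\<leftarrow>sweedler (OqSU3 q) (OqF3 q) (fst t). pure a (b, 0))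
   + lin_ext (\<lambda>w. \<Sum>(a, ns)\<leftarrow>coact_forms q (letters w). pure a (0, fw ns)) (snd t)"

definition comod_null :: "real \<Rightarrow> ((fnl \<times> tensor) \<Rightarrow>\<^sub>0 complex) set" where
  "comod_null q = formal.span (
     {pure (a + a') t - pure a t - pure a' t | a a' t.
        a \<in> OqSU3 q \<and> a' \<in> OqSU3 q \<and> t \<in> tensor_carrier q}
   \<union> {pure a (t + t') - pure a t - pure a t' | a t t'.
        a \<in> OqSU3 q \<and> t \<in> tensor_carrier q \<and> t' \<in> tensor_carrier q}
   \<union> {pure (fscale c a) t - scl c (pure a t) | c a t. a \<in> OqSU3 q \<and> t \<in> tensor_carrier q}
   \<union> {pure a (tensor_scale c t) - scl c (pure a t) | c a t.
        a \<in> OqSU3 q \<and> t \<in> tensor_carrier q}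
   \<union> {pure a t | a t. a \<in> OqSU3 q \<and> t \<in> prolong_ideal q})"

definition left_coinvariant :: "real \<Rightarrow> tensor \<Rightarrow> bool"
  where "left_coinvariant q \<sigma> \<longleftrightarrow> coaction q \<sigma> - pure unit \<sigma> \<in> comod_null q"

definition nondegenerate :: "real \<Rightarrow> tensor \<Rightarrow> bool"
  where "nondegenerate q \<sigma> \<longleftrightarrow> \<not> prolong_eq q (wedge q (wedge q \<sigma> \<sigma>) \<sigma>) 0"

definition commutes_with_OqF3 :: "real \<Rightarrow> tensor \<Rightarrow> bool" where
  "commutes_with_OqF3 q \<sigma> \<longleftrightarrow>
     (\<forall>b\<in>OqF3 q. prolong_eq q (wedge q (b, 0) \<sigma>) (wedge q \<sigma> (b, 0)))"

end

theory Submission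
  imports Defs
begin

text \<open>
  Write \<open>A\<close> and \<open>B\<close> for the quantum coordinate algebras of \<open>SU\<^sub>3\<close> and \<open>F\<^sub>3\<close>. Moving all coefficients to the left
  sends a product of \<open>n\<close> one-forms over \<open>B\<close> to its coordinates in \<open>A \<otimes> (\<Lambda>\<^sup>1)\<^sup>\<otimes>\<^sup>n\<close>. This map is injective, because the
  unit of \<open>A\<close> is a sum of products of elements of weights \<open>-p\<close> and \<open>p\<close>, for every weight \<open>p\<close>. In these coordinates
  the degree-two relations of the maximal prolongation are dual to the commutation relations between the root vectors
  modulo the left ideal generated by the \<open>K\<^sub>i - 1\<close>: the letters \<open>e\<^sub>\<gamma>\<close>, \<open>f\<^sub>\<gamma>\<close> square to zero and commute up to scalars and
  multiples of \<open>e\<^sub>1\<^sub>2 f\<^sub>1\<^sub>2\<close>.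

  A left coinvariant two-form is therefore a constant combination of the three products \<open>e\<^sub>\<gamma> f\<^sub>\<gamma>\<close>. The right action of
  \<open>A\<close> on \<open>\<Lambda>\<^sup>1\<close> is diagonal except that it sends \<open>e\<^sub>1\<close> to \<open>e\<^sub>1\<^sub>2\<close> and \<open>f\<^sub>1\<close> to \<open>f\<^sub>1\<^sub>2\<close>; commuting with an element of \<open>B\<close> detected by
  \<open>F\<^sub>2\<close> forces the coefficient of \<open>e\<^sub>1 f\<^sub>1\<close> to vanish. The cube of the form then only involves words of length six in the
  four letters \<open>e\<^sub>2, e\<^sub>1\<^sub>2, f\<^sub>2, f\<^sub>1\<^sub>2\<close>. Each such word repeats a letter, and reordering makes it zero.
\<close>

section \<open>Linear functionals on monoid rings\<close>

text \<open>The degree-two relations must be known from both sides. Coinvariance and centrality can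
  be exploited only if the ideal has no relations beyond the expected ones
  (\<open>prolong_invariant\<close>, \<open>rel2_satisfies_relations2\<close>). Reducing the cube to
  zero needs the expected ones to be present (\<open>relations2\<close>); they come from products of
  two elements of B, each detecting one root vector at the counit. In degree six only membership in
  the ideal and injectivity of the coordinates matter, so no basis of the higher prolongation is
  computed.

  The simple roots behave differently because of the choice E_12 = E_2 E_1 - q^(-1) E_1 E_2: in its
  coproduct the mixed term starting with E_2 cancels, the one starting with E_1 survives. Hence the
  right action moves e_1 and f_1 and no other letter.

  Objects defined by an arbitrary choice (Sweedler legs, lifts of elements of Lambda^1 to A^+) are
  first rewritten through translation operators on functionals of words, where identities can be
  checked one letter at a time.\<close>

definition lsum :: "('b \<Rightarrow> complex) \<Rightarrow> ('b \<Rightarrow>\<^sub>0 complex) \<Rightarrow> complex"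
  where "lsum h z = (\<Sum>k\<in>Poly_Mapping.keys z. Poly_Mapping.lookup z k * h k)"

lemma lsum_superset:
  "finite S \<Longrightarrow> Poly_Mapping.keys z \<subseteq> S \<Longrightarrow> lsum h z = (\<Sum>k\<in>S. Poly_Mapping.lookup z k * h k)"
  unfolding lsum_def by (rule sum.mono_neutral_left) (auto simp: in_keys_iff)

lemma lsum_add: "lsum h (x + y) = lsum h x + lsum h y"
  using lsum_superset[of "Poly_Mapping.keys x \<union> Poly_Mapping.keys y" x h]
    lsum_superset[of "Poly_Mapping.keys x \<union> Poly_Mapping.keys y" y h]
    lsum_superset[of "Poly_Mapping.keys x \<union> Poly_Mapping.keys y" "x + y" h]
    Poly_Mapping.keys_add[of x y]
  by (simp add: lookup_add distrib_right sum.distrib)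

lemma lsum_zero [simp]: "lsum h 0 = 0"
  by (simp add: lsum_def)

lemma lsum_single [simp]: "lsum h (Poly_Mapping.single k c) = c * h k"
  by (auto simp: lsum_def)

lemma lsum_scl: "lsum h (scl c x) = c * lsum h x"
proof -
  have "lsum h (scl c x) = (\<Sum>k\<in>Poly_Mapping.keys x. Poly_Mapping.lookup (scl c x) k * h k)"
    by (rule lsum_superset) (auto simp: in_keys_iff lookup_scl)
  then show ?thesis
    by (simp add: lsum_def lookup_scl sum_distrib_left mult.assoc)
qed

lemma scl_minus_one: "scl (- 1) x = - x"
  by (intro poly_mapping_eqI) (simp add: lookup_scl)

lemma lsum_uminus: "lsum h (- x) = - lsum h x"
  using lsum_scl[of h "- 1" x] by (simp add: scl_minus_one)

lemma lsum_diff: "lsum h (x - y) = lsum h x - lsum h y"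
  using lsum_add[of h x "- y"] by (simp add: lsum_uminus)

lemma lsum_one [simp]: "lsum h 1 = h 0"
  using lsum_single[of h 0 1] by simp

lemma lsum_fun_add: "lsum (\<lambda>k. h k + h' k) z = lsum h z + lsum h' z"
  by (simp add: lsum_def distrib_left sum.distrib)

lemma lsum_fun_scale: "lsum (\<lambda>k. c * h k) z = c * lsum h z"
  by (simp add: lsum_def sum_distrib_left mult_ac)

lemma poly_mapping_single_induct [case_names zero add single]:
  assumes "P 0" and "\<And>x y. P x \<Longrightarrow> P y \<Longrightarrow> P (x + y)" and "\<And>k c. P (Poly_Mapping.single k c)"
  shows "P (z :: 'b \<Rightarrow>\<^sub>0 complex)"
proof -
  have *: "P (\<Sum>k\<in>S. Poly_Mapping.single k (Poly_Mapping.lookup z k))" if "finite S" for S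
    using that by (induction S) (auto intro: assms)
  have "z = (\<Sum>k\<in>Poly_Mapping.keys z. Poly_Mapping.single k (Poly_Mapping.lookup z k))"
  proof (rule poly_mapping_eqI)
    fix k
    show "Poly_Mapping.lookup z k = Poly_Mapping.lookup
      (\<Sum>k\<in>Poly_Mapping.keys z. Poly_Mapping.single k (Poly_Mapping.lookup z k)) k"
      by (auto simp: lookup_sum lookup_single when_def in_keys_iff)
  qed
  with *[of "Poly_Mapping.keys z"] show ?thesis by simp
qed

text \<open>Both \<open>pairing\<close> and \<open>\<star>\<close> are instances of
  \<open>lsum\<close>, evaluated on products of words or of their coproducts; this turns such a
  value into an iterated one.\<close>

lemma lsum_mult: "lsum h (x * y) = lsum (\<lambda>k. lsum (\<lambda>l. h (k + l)) y) x"
proof (induction x rule: poly_mapping_single_induct)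
  case (single k c)
  show ?case
  proof (induction y rule: poly_mapping_single_induct)
    case (single l d)
    then show ?case by (simp add: mult_single)
  qed (simp_all add: lsum_add distrib_left)
qed (simp_all add: lsum_add distrib_right)

lemma pairing_lsum: "pairing x f = lsum f x"
  by (simp add: pairing_def lsum_def)

lemma lsum_fw [simp]: "lsum h (fw ws) = h (FWord ws)"
  by (simp add: fw_def)

lemma lsum_tw [simp]: "lsum h (tw v w) = h (FWord v, FWord w)"
  by (simp add: tw_def)

lemma FWord_add: "FWord v + FWord w = FWord (v @ w)"
  by (simp add: plus_fword_def)

lemma FWord_Nil: "FWord [] = 0"
  by (simp add: zero_fword_def)

lemma letters_add [simp]: "letters (v + w) = letters v @ letters w"
  by (simp add: plus_fword_def)

lemma letters_zero [simp]: "letters 0 = []"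
  by (simp add: zero_fword_def)

lemma fw_mult: "fw v * fw w = fw (v @ w)"
  by (simp add: fw_def mult_single FWord_add)

lemma fw_Nil: "fw [] = 1"
  by (simp add: fw_def FWord_Nil)

lemma fword_rev_induct [case_names zero snoc]:
  assumes "P 0" and "\<And>w x. P w \<Longrightarrow> P (w + FWord [x])"
  shows "P w"
proof -
  have "P (FWord ws)" for ws
  proof (induction ws rule: rev_induct)
    case (snoc x xs)
    then show ?case using assms(2)[of "FWord xs" x] by (simp add: FWord_add)
  qed (simp add: FWord_Nil assms)
  then show ?thesis by (cases w) simp
qed

lemma fword_induct [case_names zero cons]:
  assumes "P 0" and "\<And>x w. P w \<Longrightarrow> P (FWord [x] + w)"
  shows "P w"
proof -
  have "P (FWord ws)" for ws
  proof (induction ws)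
    case (Cons x xs)
    then show ?case using assms(2)[of "FWord xs" x] by (simp add: FWord_add)
  qed (simp add: FWord_Nil assms)
  then show ?thesis by (cases w) simp
qed

global_interpretation fn: vector_space fscale
  by standard (auto simp: fscale_def fun_eq_iff algebra_simps)

section \<open>The convolution algebra of functionals\<close>

text \<open>The left action of a generator and, with \<open>lt\<close>, the right action, written as
  translations of the argument so that no representative of the coproduct is chosen. They make sense
  on all functionals, before any relation is imposed.\<close>

definition rt :: "gen \<Rightarrow> fnl \<Rightarrow> fnl" where "rt x f = (\<lambda>w. f (w + FWord [x]))"

definition lt :: "gen \<Rightarrow> fnl \<Rightarrow> fnl" where "lt x f = (\<lambda>w. f (FWord [x] + w))"

lemma conv_lsum: "(f \<star> g) w = lsum (\<lambda>(v, v'). f v * g v') (coprod_word w)"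
  by (auto simp: conv_def lsum_def intro!: sum.cong)

lemma coprod_word_zero [simp]: "coprod_word 0 = 1"
  by (simp add: coprod_word_def)

lemma coprod_word_add: "coprod_word (v + w) = coprod_word v * coprod_word w"
  by (simp add: coprod_word_def)

lemma coprod_word_single: "coprod_word (FWord [x]) = coprod_gen x"
  by (simp add: coprod_word_def)

lemma conv_at_zero [simp]: "(f \<star> g) 0 = f 0 * g 0"
  by (simp add: conv_lsum zero_prod_def)

lemma conv_add_left: "(f + f') \<star> g = f \<star> g + f' \<star> g"
  by (simp add: fun_eq_iff conv_def sum.distrib[symmetric] algebra_simps split_def)

lemma conv_add_right: "f \<star> (g + g') = f \<star> g + f \<star> g'"
  by (simp add: fun_eq_iff conv_def sum.distrib[symmetric] algebra_simps split_def)

lemma conv_fscale_left: "fscale c f \<star> g = fscale c (f \<star> g)"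
  by (simp add: fun_eq_iff conv_def fscale_def sum_distrib_left algebra_simps split_def)

lemma conv_fscale_right: "f \<star> fscale c g = fscale c (f \<star> g)"
  by (simp add: fun_eq_iff conv_def fscale_def sum_distrib_left algebra_simps split_def)

lemma conv_zero_left [simp]: "0 \<star> g = 0"
  by (simp add: fun_eq_iff conv_def)

lemma conv_zero_right [simp]: "f \<star> 0 = 0"
  by (simp add: fun_eq_iff conv_def)

lemma conv_uminus_left: "(- f) \<star> g = - (f \<star> g)"
  using conv_fscale_left[of "- 1" f g] by simp

lemma conv_uminus_right: "f \<star> (- g) = - (f \<star> g)"
  using conv_fscale_right[of f "- 1" g] by simp

lemma conv_diff_left: "(f - f') \<star> g = f \<star> g - f' \<star> g"
  using conv_add_left[of f "- f'" g] by (simp add: conv_uminus_left)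

lemma conv_diff_right: "f \<star> (g - g') = f \<star> g - f \<star> g'"
  using conv_add_right[of f g "- g'"] by (simp add: conv_uminus_right)

lemma conv_sum_left: "(\<Sum>i\<in>S. f i) \<star> g = (\<Sum>i\<in>S. f i \<star> g)"
  by (induction S rule: infinite_finite_induct) (simp_all add: conv_add_left del: plus_fun_apply zero_fun_apply)

lemma conv_sum_right: "f \<star> (\<Sum>i\<in>S. g i) = (\<Sum>i\<in>S. f \<star> g i)"
  by (induction S rule: infinite_finite_induct) (simp_all add: conv_add_right del: plus_fun_apply zero_fun_apply)

lemma conv_sum_list_left: "(\<Sum>i\<leftarrow>xs. f i) \<star> g = (\<Sum>i\<leftarrow>xs. f i \<star> g)"
  by (induction xs) (simp_all add: conv_add_left del: plus_fun_apply zero_fun_apply)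

lemma conv_sum_list_right: "f \<star> (\<Sum>i\<leftarrow>xs. g i) = (\<Sum>i\<leftarrow>xs. f \<star> g i)"
  by (induction xs) (simp_all add: conv_add_right del: plus_fun_apply zero_fun_apply)

lemmas conv_linear = conv_add_left conv_add_right conv_fscale_left conv_fscale_right
  conv_uminus_left conv_uminus_right conv_diff_left conv_diff_right

lemma rt_add [simp]: "rt x (f + g) = rt x f + rt x g"
  and rt_diff [simp]: "rt x (f - g) = rt x f - rt x g"
  and rt_uminus [simp]: "rt x (- f) = - rt x f"
  and rt_zero [simp]: "rt x 0 = 0"
  and rt_fscale [simp]: "rt x (fscale c f) = fscale c (rt x f)"
  by (auto simp: rt_def fscale_def fun_eq_iff)

lemma lt_add [simp]: "lt x (f + g) = lt x f + lt x g"
  and lt_diff [simp]: "lt x (f - g) = lt x f - lt x g"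
  and lt_uminus [simp]: "lt x (- f) = - lt x f"
  and lt_zero [simp]: "lt x 0 = 0"
  and lt_fscale [simp]: "lt x (fscale c f) = fscale c (lt x f)"
  by (auto simp: lt_def fscale_def fun_eq_iff)

lemma rt_lt: "rt x (lt y f) = lt y (rt x f)"
  by (simp add: rt_def lt_def add.assoc)

text \<open>Module algebra rules: the coproduct is multiplicative on words, so appending a letter
  multiplies by its coproduct. As simp rules they allow identities between products to be proved by
  peeling letters off a word.\<close>

lemma rt_conv [simp]:
  "rt (E i) (f \<star> g) = rt (E i) f \<star> rt (K i) g + f \<star> rt (E i) g"
  "rt (F i) (f \<star> g) = rt (F i) f \<star> g + rt (Kinv i) f \<star> rt (F i) g"
  "rt (K i) (f \<star> g) = rt (K i) f \<star> rt (K i) g"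
  "rt (Kinv i) (f \<star> g) = rt (Kinv i) f \<star> rt (Kinv i) g"
  by (simp_all add: fun_eq_iff lsum_add coprod_word_add coprod_word_single lsum_mult split_def FWord_Nil lsum_fun_add
      conv_lsum rt_def)

lemma lt_conv [simp]:
  "lt (E i) (f \<star> g) = lt (E i) f \<star> lt (K i) g + f \<star> lt (E i) g"
  "lt (F i) (f \<star> g) = lt (F i) f \<star> g + lt (Kinv i) f \<star> lt (F i) g"
  "lt (K i) (f \<star> g) = lt (K i) f \<star> lt (K i) g"
  "lt (Kinv i) (f \<star> g) = lt (Kinv i) f \<star> lt (Kinv i) g"
  by (simp_all add: fun_eq_iff lsum_add coprod_word_add coprod_word_single lsum_mult split_def FWord_Nil lsum_fun_add
      conv_lsum lt_def)

lemma rt_apply: "f (w + FWord [x]) = rt x f w"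
  by (simp add: rt_def)

lemma lt_apply: "f (FWord [x] + w) = lt x f w"
  by (simp add: lt_def)

text \<open>Peeling off the last letter replaces the factors by translates, hence the generalisation
  over \<open>f\<close>, \<open>g\<close>, \<open>h\<close>; what remains is coassociativity on
  generators.\<close>

lemma conv_assoc: "f \<star> g \<star> h = f \<star> (g \<star> h)"
proof
  fix w
  show "(f \<star> g \<star> h) w = (f \<star> (g \<star> h)) w"
  proof (induction w arbitrary: f g h rule: fword_rev_induct)
    case (snoc w x)
    then show ?case by (cases x) (simp_all add: rt_apply conv_linear)
  qed simp
qed

lemma rt_unit [simp]: "rt x unit = fscale (counit_gen x) unit"
  by (simp add: rt_def unit_def fun_eq_iff fscale_def)

lemma lt_unit [simp]: "lt x unit = fscale (counit_gen x) unit"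
  by (simp add: lt_def unit_def fun_eq_iff fscale_def)

lemma unit_at_zero [simp]: "unit 0 = 1"
  by (simp add: unit_def)

lemma conv_unit_left [simp]: "unit \<star> f = f"
proof
  fix w
  show "(unit \<star> f) w = f w"
  proof (induction w arbitrary: f rule: fword_rev_induct)
    case (snoc w x)
    then show ?case by (cases x) (simp_all add: rt_apply conv_linear)
  qed simp
qed

lemma conv_unit_right [simp]: "f \<star> unit = f"
proof
  fix w
  show "(f \<star> unit) w = f w"
  proof (induction w arbitrary: f rule: fword_rev_induct)
    case (snoc w x)
    then show ?case by (cases x) (simp_all add: rt_apply conv_linear)
  qed simp
qed

section \<open>The dual of \<open>U\<^sub>q(sl\<^sub>3)\<close>\<close>

definition act :: "gen free_alg \<Rightarrow> fnl \<Rightarrow> fnl"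
  where "act X f = (\<lambda>w. pairing X (\<lambda>x. f (w + x)))"

lemma act_add: "act (X + Y) f = act X f + act Y f"
  and act_diff: "act (X - Y) f = act X f - act Y f"
  and act_uminus: "act (- X) f = - act X f"
  and act_zero_left [simp]: "act 0 f = 0"
  and act_scl: "act (scl c X) f = fscale c (act X f)"
  by (auto simp: act_def pairing_lsum lsum_add lsum_diff lsum_uminus lsum_scl fscale_def fun_eq_iff)

lemma act_Nil [simp]: "act (fw []) f = f"
  and act_one [simp]: "act 1 f = f"
  by (simp_all add: act_def pairing_lsum FWord_Nil)

lemma act_Cons: "act (fw (x # xs)) f = rt x (act (fw xs) f)"
  by (simp add: act_def pairing_lsum rt_def add.assoc FWord_add)

lemma act_mult: "act (X * Y) f = act X (act Y f)"
  by (simp add: act_def pairing_lsum lsum_mult add.assoc)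

lemma act_snoc: "act (fw (xs @ [x])) f = act (fw xs) (rt x f)"
  by (simp add: fw_mult[symmetric] act_mult act_Cons)

lemma act_fun_add [simp]: "act X (f + g) = act X f + act X g"
  and act_fun_fscale [simp]: "act X (fscale c f) = fscale c (act X f)"
  and act_fun_zero [simp]: "act X 0 = 0"
  by (simp_all add: act_def pairing_lsum fscale_def fun_eq_iff lsum_fun_add lsum_fun_scale)
    (simp add: lsum_def)

definition rels_hold :: "real \<Rightarrow> fnl \<Rightarrow> bool" where
  "rels_hold q f \<longleftrightarrow> (\<forall>r\<in>Uq_rels q. act r f = 0)"

lemma rels_hold_add: "rels_hold q f \<Longrightarrow> rels_hold q g \<Longrightarrow> rels_hold q (f + g)"
  and rels_hold_fscale: "rels_hold q f \<Longrightarrow> rels_hold q (fscale c f)"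
  and rels_hold_zero: "rels_hold q 0"
  by (simp_all add: rels_hold_def)

lemma rels_hold_sum: "(\<And>i. i \<in> I \<Longrightarrow> rels_hold q (f i)) \<Longrightarrow> rels_hold q (\<Sum>i\<in>I. f i)"
  by (induction I rule: infinite_finite_induct)
    (simp_all add: rels_hold_zero rels_hold_add del: plus_fun_apply zero_fun_apply)

lemma act_eq_0_if_words:
  assumes "\<And>w. act r (act (fw w) f) = 0"
  shows "act r (act y f) = 0"
proof (induction y rule: poly_mapping_single_induct)
  case (single k c)
  have "Poly_Mapping.single k c = scl c (fw (letters k))"
    by (intro poly_mapping_eqI) (simp add: fw_def lookup_scl lookup_single when_def)
  then show ?case by (simp add: act_scl assms)
qed (simp_all add: act_add del: plus_fun_apply zero_fun_apply)

lemma act_word_at_zero: "act (fw (letters v)) f 0 = f v"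
  by (simp add: act_def pairing_lsum)

text \<open>Pairing x r y with \<open>f\<close> means acting on \<open>f\<close> by y, then r, then
  x, and evaluating at the empty word. Asking for the zero functional instead of one value covers
  all x, so only the translates by y remain to be quantified.\<close>

lemma Uq_dual_iff: "f \<in> Uq_dual q \<longleftrightarrow> (\<forall>w. rels_hold q (act (fw w) f))"
proof
  assume f: "f \<in> Uq_dual q"
  have "act r (act (fw w) f) = 0" if r: "r \<in> Uq_rels q" for w r
  proof
    fix v
    have "fw (letters v) * r * fw w \<in> Uq_ideal q"
      unfolding Uq_ideal_def using r by (rule two_sided_ideal.gen)
    then have "pairing (fw (letters v) * r * fw w) f = 0"
      using f unfolding Uq_dual_def by blast
    then have "act (fw (letters v) * r * fw w) f 0 = 0"
      by (simp only: act_def add_0_left)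
    then have "act (fw (letters v)) (act r (act (fw w) f)) 0 = 0"
      by (simp only: act_mult)
    then show "act r (act (fw w) f) v = 0 v"
      by (simp only: act_word_at_zero zero_fun_apply)
  qed
  then show "\<forall>w. rels_hold q (act (fw w) f)" unfolding rels_hold_def by blast
next
  assume f: "\<forall>w. rels_hold q (act (fw w) f)"
  have "pairing x f = 0" if "x \<in> two_sided_ideal (Uq_rels q)" for x
    using that
  proof (induction rule: two_sided_ideal.induct)
    case (gen r x y)
    have "act r (act y f) = 0"
      by (rule act_eq_0_if_words) (use f gen in \<open>unfold rels_hold_def, blast\<close>)
    then have "act (x * r * y) f 0 = 0" by (simp only: act_mult act_fun_zero zero_fun_apply)
    then show ?case by (simp only: act_def add_0_left)
  qed (simp_all add: pairing_lsum lsum_add)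
  then show "f \<in> Uq_dual q" unfolding Uq_dual_def Uq_ideal_def by blast
qed

lemma Uq_dual_rt: "f \<in> Uq_dual q \<Longrightarrow> rt x f \<in> Uq_dual q"
  unfolding Uq_dual_iff by (simp only: act_snoc[symmetric] simp_thms)

lemma Uq_dual_rels: "f \<in> Uq_dual q \<Longrightarrow> rels_hold q f"
  unfolding Uq_dual_iff by (metis act_Nil)

lemma Uq_dual_add: "f \<in> Uq_dual q \<Longrightarrow> g \<in> Uq_dual q \<Longrightarrow> f + g \<in> Uq_dual q"
  and Uq_dual_fscale: "f \<in> Uq_dual q \<Longrightarrow> fscale c f \<in> Uq_dual q"
  and Uq_dual_zero: "0 \<in> Uq_dual q"
  by (auto simp: Uq_dual_iff rels_hold_add rels_hold_fscale rels_hold_zero)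

lemma all_nodes: "(\<forall>i. P i) \<longleftrightarrow> P N1 \<and> P N2"
  by (metis node.exhaust)

section \<open>The relations as rewriting rules for translations\<close>

locale sl3 =
  fixes q :: real
  assumes q0: "q \<noteq> 0" and q2: "q\<^sup>2 \<noteq> 1"
begin

abbreviation Q :: complex where "Q \<equiv> complex_of_real q"
abbreviation D :: "fnl set" where "D \<equiv> Uq_dual q"

declare q0 [simp]
lemma Q0: "Q \<noteq> 0" using q0 by simp
lemma Q2 [simp]: "Q\<^sup>2 \<noteq> 1" "Q * Q \<noteq> 1"
  using q2 by (metis of_real_1 of_real_eq_iff of_real_power, metis of_real_1 of_real_eq_iff of_real_mult power2_eq_square)
lemma Qdiff [simp]: "Q - 1 / Q \<noteq> 0" "Q \<noteq> 1 / Q" "Q - inverse Q \<noteq> 0"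
  using Q2 by (metis Q0 nonzero_eq_divide_eq right_minus_eq,
    metis Q0 nonzero_eq_divide_eq, metis Q0 right_inverse right_minus_eq)

lemma Qcancel: "Q * inverse Q = 1" "inverse Q * Q = 1"
    "Q * (inverse Q * x) = x" "inverse Q * (Q * x) = x" for x
  by (simp_all add: mult.assoc[symmetric])

definition br :: "node \<Rightarrow> fnl \<Rightarrow> fnl"
  where "br i f = fscale (inverse (Q - inverse Q)) (rt (K i) f - rt (Kinv i) f)"

text \<open>Turns ideal membership into identities for \<open>rt\<close>. The rules for K are
  oriented inward: on the inside K meets a weight vector and becomes a scalar.\<close>

lemma rels_hold_iff: "rels_hold q f \<longleftrightarrow>
   (\<forall>i. rt (K i) (rt (Kinv i) f) = f \<and> rt (Kinv i) (rt (K i) f) = f) \<and>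
   (\<forall>i j. rt (K i) (rt (K j) f) = rt (K j) (rt (K i) f)) \<and>
   (\<forall>i j. rt (K i) (rt (E j) f) = fscale (if i = j then Q\<^sup>2 else inverse Q) (rt (E j) (rt (K i) f))) \<and>
   (\<forall>i j. rt (K i) (rt (F j) f) = fscale (if i = j then inverse Q ^ 2 else Q) (rt (F j) (rt (K i) f))) \<and>
   (\<forall>i j. rt (E i) (rt (F j) f) = rt (F j) (rt (E i) f) + (if i = j then br i f else 0)) \<and>
   (\<forall>i j. i \<noteq> j \<longrightarrow> rt (E i) (rt (E i) (rt (E j) f)) =
      fscale (Q + inverse Q) (rt (E i) (rt (E j) (rt (E i) f))) - rt (E j) (rt (E i) (rt (E i) f))) \<and>
   (\<forall>i j. i \<noteq> j \<longrightarrow> rt (F i) (rt (F i) (rt (F j) f)) =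
      fscale (Q + inverse Q) (rt (F i) (rt (F j) (rt (F i) f))) - rt (F j) (rt (F i) (rt (F i) f)))"
proof -
  have 1: "(\<forall>r\<in>{g i | i. True}. P r) \<longleftrightarrow> (\<forall>i. P (g i))" for P and g :: "node \<Rightarrow> gen free_alg"
    by auto
  have 2: "(\<forall>r\<in>{g i j | i j. True}. P r) \<longleftrightarrow> (\<forall>i j. P (g i j))" for P and g :: "node \<Rightarrow> node \<Rightarrow> gen free_alg"
    by auto
  have 3: "(\<forall>r\<in>{g i j | i j. i \<noteq> j}. P r) \<longleftrightarrow> (\<forall>i j. i \<noteq> j \<longrightarrow> P (g i j))" for P and g :: "node \<Rightarrow> node \<Rightarrow> gen free_alg"
    by auto
  have e: "(a - b - c = 0) = (a = b + c)" "(a - b + c = 0) = (a = b - c)" "(a - b = 0) = (a = b)" for a b c :: fnl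
    by (auto simp: algebra_simps eq_diff_eq)
  have p: "Q powi cartan i j = (if i = j then Q\<^sup>2 else inverse Q)"
    "Q powi (- cartan i j) = (if i = j then inverse Q ^ 2 else Q)" for i j
    by (auto simp: cartan_def power_int_minus power_inverse)
  have b: "act (if i = j then scl (1 / (Q - 1 / Q)) (fw [K i] - fw [Kinv i]) else 0) f = (if i = j then br i f else 0)" for i j
    by (simp add: act_scl act_diff act_Cons br_def divide_inverse)
  show ?thesis
    unfolding rels_hold_def Uq_rels_def ball_Un 1 2 3 act_diff act_add act_scl b p
    unfolding act_Cons act_Nil act_one e(1) e(2)
    by (simp only: e(3) divide_inverse mult_1 all_conj_distrib conj_assoc)
qed

lemma D_rt [simp]: "f \<in> D \<Longrightarrow> rt x f \<in> D"
  by (rule Uq_dual_rt)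

lemmas D_rels = Uq_dual_rels[THEN rels_hold_iff[THEN iffD1]]

lemmas D_K_Kinv [simp] = D_rels[THEN conjunct1, rule_format, THEN conjunct1]
  and D_Kinv_K [simp] = D_rels[THEN conjunct1, rule_format, THEN conjunct2]
  and D_KK = D_rels[THEN conjunct2, THEN conjunct1, rule_format]
  and D_KE = D_rels[THEN conjunct2, THEN conjunct2, THEN conjunct1, rule_format]
  and D_KF = D_rels[THEN conjunct2, THEN conjunct2, THEN conjunct2, THEN conjunct1, rule_format]
  and D_EF = D_rels[THEN conjunct2, THEN conjunct2, THEN conjunct2, THEN conjunct2, THEN conjunct1, rule_format]
  and D_EEE = D_rels[THEN conjunct2, THEN conjunct2, THEN conjunct2, THEN conjunct2, THEN conjunct2, THEN conjunct1, rule_format]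
  and D_FFF = D_rels[THEN conjunct2, THEN conjunct2, THEN conjunct2, THEN conjunct2, THEN conjunct2, THEN conjunct2, rule_format]

lemma fscale_swap: "x = fscale c y \<Longrightarrow> c \<noteq> 0 \<Longrightarrow> y = fscale (inverse c) x"
  by simp

lemma D_KinvE: "f \<in> D \<Longrightarrow> rt (Kinv i) (rt (E j) f) = fscale (if i = j then inverse Q ^ 2 else Q) (rt (E j) (rt (Kinv i) f))"
proof -
  assume f: "f \<in> D"
  have "rt (E j) (rt (Kinv i) f) = rt (Kinv i) (rt (K i) (rt (E j) (rt (Kinv i) f)))"
    using f by simp
  also have "\<dots> = fscale (if i = j then Q\<^sup>2 else inverse Q) (rt (Kinv i) (rt (E j) f))"
    using f by (subst D_KE) auto
  finally have "rt (Kinv i) (rt (E j) f) = fscale (inverse (if i = j then Q\<^sup>2 else inverse Q)) (rt (E j) (rt (Kinv i) f))"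
    by (rule fscale_swap) simp
  moreover have "inverse (if i = j then Q\<^sup>2 else inverse Q) = (if i = j then inverse Q ^ 2 else Q)"
    by (simp add: power_inverse)
  ultimately show ?thesis by (simp only:)
qed

lemma D_KinvF: "f \<in> D \<Longrightarrow> rt (Kinv i) (rt (F j) f) = fscale (if i = j then Q\<^sup>2 else inverse Q) (rt (F j) (rt (Kinv i) f))"
proof -
  assume f: "f \<in> D"
  have "rt (F j) (rt (Kinv i) f) = rt (Kinv i) (rt (K i) (rt (F j) (rt (Kinv i) f)))"
    using f by simp
  also have "\<dots> = fscale (if i = j then inverse Q ^ 2 else Q) (rt (Kinv i) (rt (F j) f))"
    using f by (subst D_KF) auto
  finally have "rt (Kinv i) (rt (F j) f) = fscale (inverse (if i = j then inverse Q ^ 2 else Q)) (rt (F j) (rt (Kinv i) f))"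
    by (rule fscale_swap) simp
  moreover have "inverse (if i = j then inverse Q ^ 2 else Q) = (if i = j then Q\<^sup>2 else inverse Q)"
    by (simp add: power_inverse)
  ultimately show ?thesis by (simp only:)
qed

lemma D_Kinv_K_comm: "f \<in> D \<Longrightarrow> rt (Kinv i) (rt (K j) f) = rt (K j) (rt (Kinv i) f)"
proof -
  assume f: "f \<in> D"
  have "rt (Kinv i) (rt (K j) f) = rt (Kinv i) (rt (K j) (rt (K i) (rt (Kinv i) f)))"
    using f by simp
  also have "\<dots> = rt (Kinv i) (rt (K i) (rt (K j) (rt (Kinv i) f)))"
    using f by (subst D_KK) simp_all
  finally show ?thesis using f by simp
qed

lemma D_Kinv_Kinv: "f \<in> D \<Longrightarrow> rt (Kinv i) (rt (Kinv j) f) = rt (Kinv j) (rt (Kinv i) f)"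
proof -
  assume f: "f \<in> D"
  have "rt (Kinv j) (rt (Kinv i) f) = rt (Kinv j) (rt (Kinv i) (rt (K j) (rt (Kinv j) f)))"
    using f by simp
  also have "\<dots> = rt (Kinv j) (rt (K j) (rt (Kinv i) (rt (Kinv j) f)))"
    using f by (subst D_Kinv_K_comm) simp_all
  finally show ?thesis using f by simp
qed

lemmas D_comm = D_KE D_KF D_KinvE D_KinvF D_EF

text \<open>This is the compatibility of the coproduct with the defining relations, seen from the
  dual.\<close>

lemma rels_hold_conv:
  assumes f: "f \<in> D" and g: "g \<in> D"
  shows "rels_hold q (f \<star> g)"
proof -
  have EE: "rt (E i) (rt (E i) (rt (E j) (f \<star> g))) =
      fscale (Q + inverse Q) (rt (E i) (rt (E j) (rt (E i) (f \<star> g)))) - rt (E j) (rt (E i) (rt (E i) (f \<star> g)))"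
    if ij: "i \<noteq> j" for i j
  proof -
    have K3: "rt (K i) (rt (K j) (rt (K i) g)) = rt (K i) (rt (K i) (rt (K j) g))"
      "rt (K j) (rt (K i) (rt (K i) g)) = rt (K i) (rt (K i) (rt (K j) g))"
      "rt (K j) (rt (K i) g) = rt (K i) (rt (K j) g)"
      by (simp_all only: D_KK[OF D_rt[OF g], of j i] D_KK[OF g, of j i])
    \<comment> \<open>Once every K is pushed inward, the pure terms agree by the Serre relation of
      each factor, and the mixed terms cancel by identities between powers of q.\<close>
    show ?thesis
      by (simp add: D_KE conv_linear f g ij ij[symmetric],
          simp add: conv_linear D_EEE[OF f ij] D_EEE[OF g ij] K3,
          simp add: fun_eq_iff fscale_def algebra_simps power2_eq_square Qcancel)
  qed
  have FF: "rt (F i) (rt (F i) (rt (F j) (f \<star> g))) =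
      fscale (Q + inverse Q) (rt (F i) (rt (F j) (rt (F i) (f \<star> g)))) - rt (F j) (rt (F i) (rt (F i) (f \<star> g)))"
    if ij: "i \<noteq> j" for i j
  proof -
    have K3: "rt (Kinv i) (rt (Kinv j) (rt (Kinv i) f)) = rt (Kinv i) (rt (Kinv i) (rt (Kinv j) f))"
      "rt (Kinv j) (rt (Kinv i) (rt (Kinv i) f)) = rt (Kinv i) (rt (Kinv i) (rt (Kinv j) f))"
      "rt (Kinv j) (rt (Kinv i) f) = rt (Kinv i) (rt (Kinv j) f)"
      by (simp_all only: D_Kinv_Kinv[OF D_rt[OF f], of j i] D_Kinv_Kinv[OF f, of j i])
    show ?thesis
      by (simp add: D_KinvF conv_linear f g ij ij[symmetric],
          simp add: conv_linear D_FFF[OF f ij] D_FFF[OF g ij] K3,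
          simp add: fun_eq_iff fscale_def algebra_simps power2_eq_square Qcancel)
  qed
  have EF: "rt (E i) (rt (F j) (f \<star> g)) = rt (F j) (rt (E i) (f \<star> g)) + (if i = j then br i (f \<star> g) else 0)" for i j
    using f g
    by (simp add: D_comm conv_linear, simp add: br_def conv_linear, simp add: fun_eq_iff fscale_def algebra_simps power2_eq_square Qcancel)
  show ?thesis
    unfolding rels_hold_iff
    using EE FF EF f g D_KK[OF f] D_KK[OF g]
    by (simp add: D_KE D_KF D_KinvF conv_linear fn.scale_right_distrib D_Kinv_K_comm)
qed

text \<open>By \<open>rt_conv\<close> a translate of a product is a sum of products of translates,
  all again in \<open>D\<close>; so checking the relations on untranslated products is
  enough.\<close>

lemma D_conv [simp]: "f \<in> D \<Longrightarrow> g \<in> D \<Longrightarrow> f \<star> g \<in> D"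
proof -
  have "rels_hold q (act (fw w) (f \<star> g))" if "f \<in> D" "g \<in> D" for w
    using that
  proof (induction w arbitrary: f g rule: rev_induct)
    case (snoc x xs)
    then show ?case by (cases x) (simp_all add: act_snoc rels_hold_add del: plus_fun_apply)
  qed (simp add: rels_hold_conv)
  then show "f \<in> D \<Longrightarrow> g \<in> D \<Longrightarrow> f \<star> g \<in> D" by (simp add: Uq_dual_iff)
qed

end

section \<open>The Hopf algebra generated by the matrix coefficients\<close>

declare One_nat_def [simp del]

lemma sum_1_3: "(\<Sum>a\<in>{1..3::nat}. h a) = h 1 + h 2 + (h 3 :: 'a::comm_monoid_add)"
proof -
  have "{1..3::nat} = {1, 2, 3}" by auto
  then show ?thesis by (simp add: add.assoc)
qed

lemma nat_1_3: "i \<in> {1..3::nat} \<longleftrightarrow> i = 1 \<or> i = 2 \<or> i = 3"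
  by auto

lemma sum_apply: "(\<Sum>i\<in>S. f i) x = (\<Sum>i\<in>S. f i x)"
  by (induction S rule: infinite_finite_induct) simp_all

lemma sum_list_apply: "(\<Sum>i\<leftarrow>xs. f i) x = (\<Sum>i\<leftarrow>xs. f i x)"
  by (induction xs) simp_all

lemma lsum_fun_sum_list: "lsum (\<lambda>k. \<Sum>i\<leftarrow>xs. h i k) z = (\<Sum>i\<leftarrow>xs. lsum (h i) z)"
proof (induction xs)
  case Nil
  show ?case by (simp add: lsum_def)
qed (simp add: lsum_fun_add)

lemma sum_list_product:
  "(\<Sum>t\<leftarrow>ts. f t) * (\<Sum>t'\<leftarrow>ts'. g t') = (\<Sum>t\<leftarrow>ts. \<Sum>t'\<leftarrow>ts'. f t * g t' :: complex)"
  by (induction ts) (simp_all add: distrib_right sum_list_const_mult)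

lemma lsum_fun_scale_right: "lsum (\<lambda>k. h k * c) z = lsum h z * c"
  using lsum_fun_scale[of c h z] by (simp add: mult.commute)

lemma is_coproduct_conv:
  assumes "is_coproduct f ts" and "is_coproduct g ts'"
  shows "is_coproduct (f \<star> g) [(a \<star> a', b \<star> b'). (a, b) \<leftarrow> ts, (a', b') \<leftarrow> ts']"
proof -
  have ff: "f (v + w) = (\<Sum>t\<leftarrow>ts. fst t v * snd t w)" for v w
    using assms(1) by (simp add: is_coproduct_def split_def)
  have gg: "g (v + w) = (\<Sum>t\<leftarrow>ts'. fst t v * snd t w)" for v w
    using assms(2) by (simp add: is_coproduct_def split_def)
  have "(f \<star> g) (v + w) = (\<Sum>t\<leftarrow>ts. \<Sum>t'\<leftarrow>ts'. (fst t \<star> fst t') v * (snd t \<star> snd t') w)" for v w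
  proof -
    have "(f \<star> g) (v + w) = lsum (\<lambda>p. lsum (\<lambda>r. f (fst p + fst r) * g (snd p + snd r)) (coprod_word w)) (coprod_word v)"
      by (simp add: conv_lsum coprod_word_add lsum_mult split_def)
    also have "\<dots> = lsum (\<lambda>p. lsum (\<lambda>r. \<Sum>t\<leftarrow>ts. \<Sum>t'\<leftarrow>ts'. (fst t (fst p) * fst t' (snd p)) * (snd t (fst r) * snd t' (snd r)))
        (coprod_word w)) (coprod_word v)"
      by (simp add: ff gg sum_list_product mult_ac)
    also have "\<dots> = (\<Sum>t\<leftarrow>ts. \<Sum>t'\<leftarrow>ts'. (fst t \<star> fst t') v * (snd t \<star> snd t') w)"
    proof -
      have "lsum (\<lambda>p. lsum (\<lambda>r. (a (fst p) * a' (snd p)) * (b (fst r) * b' (snd r))) (coprod_word w)) (coprod_word v)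
          = (a \<star> a') v * (b \<star> b') w" for a a' b b' :: fnl
        by (simp add: conv_lsum split_def lsum_fun_scale lsum_fun_scale_right)
      then show ?thesis by (simp add: lsum_fun_sum_list)
    qed
    finally show ?thesis .
  qed
  moreover have "(\<Sum>t\<leftarrow>concat (map (\<lambda>t. map (\<lambda>t'. (fst t \<star> fst t', snd t \<star> snd t')) ts') ts). fst t v * snd t w)
     = (\<Sum>t\<leftarrow>ts. \<Sum>t'\<leftarrow>ts'. (fst t \<star> fst t') v * (snd t \<star> snd t') w)" for v w
    by (induction ts) (simp_all add: o_def)
  ultimately show ?thesis by (simp add: is_coproduct_def split_def)
qed

text \<open>The antipode reverses words and thereby exchanges right and left translations; sign and
  K-factor come from S(E_i) = -E_i K_i^(-1) and S(F_i) = -K_i F_i.\<close>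

lemma dual_antipode_rt:
  "rt (E i) (dual_antipode f) = - dual_antipode (lt (Kinv i) (lt (E i) f))"
  "rt (F i) (dual_antipode f) = - dual_antipode (lt (F i) (lt (K i) f))"
  "rt (K i) (dual_antipode f) = dual_antipode (lt (Kinv i) f)"
  "rt (Kinv i) (dual_antipode f) = dual_antipode (lt (K i) f)"
  by (simp_all add: fun_eq_iff rt_def lt_def dual_antipode_def antipode_word_def pairing_lsum
      lsum_mult lsum_uminus add.assoc[symmetric] FWord_add)

lemma dual_antipode_at_zero [simp]: "dual_antipode f 0 = f 0"
  by (simp add: dual_antipode_def antipode_word_def pairing_lsum)

lemma dual_antipode_add [simp]: "dual_antipode (f + g) = dual_antipode f + dual_antipode g"
  and dual_antipode_fscale [simp]: "dual_antipode (fscale c f) = fscale c (dual_antipode f)"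
  by (simp_all add: fun_eq_iff dual_antipode_def pairing_lsum fscale_def plus_fun_def lsum_fun_add lsum_fun_scale)

lemma dual_antipode_zero [simp]: "dual_antipode 0 = 0"
  using dual_antipode_fscale[of 0 0] by simp

lemma dual_antipode_uminus [simp]: "dual_antipode (- f) = - dual_antipode f"
  using dual_antipode_fscale[of "- 1" f] by simp

lemma dual_antipode_unit [simp]: "dual_antipode unit = unit"
proof
  fix w
  show "dual_antipode unit w = unit w"
  proof (induction w rule: fword_rev_induct)
    case (snoc w x)
    then show ?case by (cases x) (simp_all add: rt_apply dual_antipode_rt)
  qed simp
qed

lemma Uq_dual_lt: "f \<in> Uq_dual q \<Longrightarrow> lt x f \<in> Uq_dual q"
proof -
  have "act X (lt x f) = lt x (act X f)" for X f
    by (simp add: act_def lt_def add.assoc)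
  then show "f \<in> Uq_dual q \<Longrightarrow> lt x f \<in> Uq_dual q"
    by (simp add: Uq_dual_iff rels_hold_def)
qed

context sl3
begin

lemma D_lt [simp]: "f \<in> D \<Longrightarrow> lt x f \<in> D"
  by (rule Uq_dual_lt)

text \<open>\<open>D\<close> is controlled through translations at the end of a word. A value at x y
  w is therefore read as a value at the empty word after translating by w, then y, then x, where the
  rules for \<open>rt\<close> apply.\<close>

lemma D_lt_K_Kinv [simp]:
  assumes f: "f \<in> D"
  shows "lt (K i) (lt (Kinv i) f) = f" "lt (Kinv i) (lt (K i) f) = f"
proof -
  have *: "rt x (rt y (act (fw (letters w)) f)) 0 = f (FWord [x] + (FWord [y] + w))" for w x y
    by (simp add: rt_def act_def pairing_lsum add.assoc)
  have D: "act (fw ws) f \<in> D" for ws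
    by (induction ws) (simp_all add: act_Cons f)
  show "lt (K i) (lt (Kinv i) f) = f" "lt (Kinv i) (lt (K i) f) = f"
    using *[of "K i" "Kinv i"] *[of "Kinv i" "K i"] by (simp_all add: fun_eq_iff lt_def D act_word_at_zero)
qed

lemma dual_antipode_conv:
  assumes "f \<in> D" and "g \<in> D"
  shows "dual_antipode (f \<star> g) = dual_antipode g \<star> dual_antipode f"
proof
  fix w
  show "dual_antipode (f \<star> g) w = (dual_antipode g \<star> dual_antipode f) w"
    using assms
  proof (induction w arbitrary: f g rule: fword_rev_induct)
    case (snoc w x)
    then show ?case
      by (cases x) (simp_all add: rt_apply dual_antipode_rt conv_uminus_left conv_uminus_right)
  qed simp
qed

section \<open>The matrix coefficients and their antipodes\<close>

definition u :: "nat \<Rightarrow> nat \<Rightarrow> fnl" where "u = u_mat q"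
definition v :: "nat \<Rightarrow> nat \<Rightarrow> fnl" where "v i j = dual_antipode (u i j)"

lemma u_at_zero [simp]: "u i j 0 = of_bool (i = j)"
  by (simp add: u_def u_mat_def)

lemma u_list_append:
  "j \<in> {1..3} \<Longrightarrow> i \<in> {1..3} \<Longrightarrow> u_list q i j (xs @ ys) = (\<Sum>a\<in>{1..3}. u_list q i a xs * u_list q a j ys)"
proof (induction xs arbitrary: i)
  case Nil
  then show ?case unfolding nat_1_3 by (auto simp: sum_1_3)
next
  case (Cons x xs)
  then show ?case
    by (simp add: sum_distrib_left sum_distrib_right mult.assoc) (rule sum.swap)
qed

lemma u_add: "i \<in> {1..3} \<Longrightarrow> j \<in> {1..3} \<Longrightarrow> u i j (x + y) = (\<Sum>a\<in>{1..3}. u i a x * u a j y)"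
  by (simp add: u_def u_mat_def u_list_append)

lemma u_single: "i \<in> {1..3} \<Longrightarrow> j \<in> {1..3} \<Longrightarrow> u i j (FWord [x]) = u_gen q i j x"
  unfolding nat_1_3 by (auto simp: u_def u_mat_def sum_1_3)

lemma rt_u_gen: "i \<in> {1..3} \<Longrightarrow> j \<in> {1..3} \<Longrightarrow> rt x (u i j) = (\<Sum>a\<in>{1..3}. fscale (u_gen q a j x) (u i a))"
  by (auto simp: rt_def u_add u_single fun_eq_iff fscale_def sum_1_3 mult.commute)

lemma lt_u_gen: "i \<in> {1..3} \<Longrightarrow> j \<in> {1..3} \<Longrightarrow> lt x (u i j) = (\<Sum>a\<in>{1..3}. fscale (u_gen q i a x) (u a j))"
  by (auto simp: lt_def u_add u_single fun_eq_iff fscale_def sum_1_3)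

lemma rt_u [simp]:
  assumes "i \<in> {1..3}"
  shows "rt (E N1) (u i 1) = u i 2" "rt (E N1) (u i 2) = 0" "rt (E N1) (u i 3) = 0"
    "rt (E N2) (u i 1) = 0" "rt (E N2) (u i 2) = u i 3" "rt (E N2) (u i 3) = 0"
    "rt (F N1) (u i 1) = 0" "rt (F N1) (u i 2) = u i 1" "rt (F N1) (u i 3) = 0"
    "rt (F N2) (u i 1) = 0" "rt (F N2) (u i 2) = 0" "rt (F N2) (u i 3) = u i 2"
    "rt (K N1) (u i 1) = fscale (inverse Q) (u i 1)" "rt (K N1) (u i 2) = fscale Q (u i 2)" "rt (K N1) (u i 3) = u i 3"
    "rt (K N2) (u i 1) = u i 1" "rt (K N2) (u i 2) = fscale (inverse Q) (u i 2)" "rt (K N2) (u i 3) = fscale Q (u i 3)"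
    "rt (Kinv N1) (u i 1) = fscale Q (u i 1)" "rt (Kinv N1) (u i 2) = fscale (inverse Q) (u i 2)" "rt (Kinv N1) (u i 3) = u i 3"
    "rt (Kinv N2) (u i 1) = u i 1" "rt (Kinv N2) (u i 2) = fscale Q (u i 2)" "rt (Kinv N2) (u i 3) = fscale (inverse Q) (u i 3)"
  using assms by (simp_all add: rt_u_gen sum_1_3 power_int_minus)

lemma lt_u [simp]:
  assumes "j \<in> {1..3}"
  shows "lt (E N1) (u 2 j) = u 1 j" "lt (E N1) (u 1 j) = 0" "lt (E N1) (u 3 j) = 0"
    "lt (E N2) (u 1 j) = 0" "lt (E N2) (u 3 j) = u 2 j" "lt (E N2) (u 2 j) = 0"
    "lt (F N1) (u 2 j) = 0" "lt (F N1) (u 1 j) = u 2 j" "lt (F N1) (u 3 j) = 0"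
    "lt (F N2) (u 1 j) = 0" "lt (F N2) (u 3 j) = 0" "lt (F N2) (u 2 j) = u 3 j"
    "lt (K N1) (u 1 j) = fscale (inverse Q) (u 1 j)" "lt (K N1) (u 2 j) = fscale Q (u 2 j)" "lt (K N1) (u 3 j) = u 3 j"
    "lt (K N2) (u 1 j) = u 1 j" "lt (K N2) (u 2 j) = fscale (inverse Q) (u 2 j)" "lt (K N2) (u 3 j) = fscale Q (u 3 j)"
    "lt (Kinv N1) (u 1 j) = fscale Q (u 1 j)" "lt (Kinv N1) (u 2 j) = fscale (inverse Q) (u 2 j)" "lt (Kinv N1) (u 3 j) = u 3 j"
    "lt (Kinv N2) (u 1 j) = u 1 j" "lt (Kinv N2) (u 2 j) = fscale Q (u 2 j)" "lt (Kinv N2) (u 3 j) = fscale (inverse Q) (u 3 j)"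
  using assms by (simp_all add: lt_u_gen sum_1_3 power_int_minus)

lemma v_at_zero [simp]: "v i j 0 = of_bool (i = j)"
  by (simp add: v_def)

lemma rt_v [simp]:
  assumes "j \<in> {1..3}"
  shows "rt (E N1) (v 2 j) = fscale (- Q) (v 1 j)" "rt (E N1) (v 1 j) = 0" "rt (E N1) (v 3 j) = 0"
    "rt (E N2) (v 1 j) = 0" "rt (E N2) (v 3 j) = fscale (- Q) (v 2 j)" "rt (E N2) (v 2 j) = 0"
    "rt (F N1) (v 2 j) = 0" "rt (F N1) (v 1 j) = fscale (- inverse Q) (v 2 j)" "rt (F N1) (v 3 j) = 0"
    "rt (F N2) (v 1 j) = 0" "rt (F N2) (v 3 j) = 0" "rt (F N2) (v 2 j) = fscale (- inverse Q) (v 3 j)"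
    "rt (K N1) (v 1 j) = fscale Q (v 1 j)" "rt (K N1) (v 2 j) = fscale (inverse Q) (v 2 j)" "rt (K N1) (v 3 j) = v 3 j"
    "rt (K N2) (v 1 j) = v 1 j" "rt (K N2) (v 2 j) = fscale Q (v 2 j)" "rt (K N2) (v 3 j) = fscale (inverse Q) (v 3 j)"
    "rt (Kinv N1) (v 1 j) = fscale (inverse Q) (v 1 j)" "rt (Kinv N1) (v 2 j) = fscale Q (v 2 j)" "rt (Kinv N1) (v 3 j) = v 3 j"
    "rt (Kinv N2) (v 1 j) = v 1 j" "rt (Kinv N2) (v 2 j) = fscale (inverse Q) (v 2 j)" "rt (Kinv N2) (v 3 j) = fscale Q (v 3 j)"
  using assms by (simp_all add: v_def dual_antipode_rt)

lemma bracket_one: "(Q - inverse Q) * (inverse (Q - inverse Q) * x) = x"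
  by (metis Qdiff(3) mult.assoc mult_1 right_inverse)

text \<open>The span of row \<open>i\<close> is stable under every \<open>rt x\<close>, so the
  relations need only be checked on its three entries, that is, in the vector
  representation.\<close>

lemma u_D [simp]: "i \<in> {1..3} \<Longrightarrow> j \<in> {1..3} \<Longrightarrow> u i j \<in> D"
proof -
  assume i: "i \<in> {1..3}" and j: "j \<in> {1..3}"
  have c: "x + inverse Q * (inverse (Q - inverse Q) * x) = Q * (inverse (Q - inverse Q) * x)"
    "x + inverse Q * (x * inverse (Q - inverse Q)) = Q * (x * inverse (Q - inverse Q))" for x
    using bracket_one[of x] by (simp_all add: algebra_simps)
  have r: "rels_hold q (u i j)" if "j \<in> {1..3}" for j
    using that i unfolding nat_1_3[of j] rels_hold_iff
    by (elim disjE) (simp_all add: all_nodes br_def power2_eq_square mult.assoc Qcancel, simp_all add: fun_eq_iff fscale_def Qcancel algebra_simps c)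
  have "rels_hold q (act (fw w) (u i j))" for w
    using j
  proof (induction w arbitrary: j rule: rev_induct)
    case (snoc x xs)
    have "act (fw xs) (\<Sum>a\<in>{1..3}. fscale (u_gen q a j x) (u i a)) = (\<Sum>a\<in>{1..3}. fscale (u_gen q a j x) (act (fw xs) (u i a)))"
      by (simp add: sum_1_3)
    then show ?case
      using snoc i by (simp add: act_snoc rt_u_gen) (intro rels_hold_sum rels_hold_fscale, auto)
  qed (simp add: r)
  then show ?thesis by (simp add: Uq_dual_iff)
qed

lemma dual_antipode_lt:
  "lt (E i) (dual_antipode f) = - dual_antipode (rt (E i) (rt (Kinv i) f))"
  "lt (F i) (dual_antipode f) = - dual_antipode (rt (K i) (rt (F i) f))"
  "lt (K i) (dual_antipode f) = dual_antipode (rt (Kinv i) f)"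
  "lt (Kinv i) (dual_antipode f) = dual_antipode (rt (K i) f)"
  by (simp_all add: fun_eq_iff rt_def lt_def dual_antipode_def antipode_word_def pairing_lsum
      lsum_mult lsum_uminus add.assoc FWord_add)

lemma lt_v [simp]:
  assumes "i \<in> {1..3}"
  shows "lt (E N1) (v i 1) = fscale (- Q) (v i 2)" "lt (E N1) (v i 2) = 0" "lt (E N1) (v i 3) = 0"
    "lt (E N2) (v i 1) = 0" "lt (E N2) (v i 2) = fscale (- Q) (v i 3)" "lt (E N2) (v i 3) = 0"
    "lt (F N1) (v i 1) = 0" "lt (F N1) (v i 2) = fscale (- inverse Q) (v i 1)" "lt (F N1) (v i 3) = 0"
    "lt (F N2) (v i 1) = 0" "lt (F N2) (v i 2) = 0" "lt (F N2) (v i 3) = fscale (- inverse Q) (v i 2)"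
    "lt (K N1) (v i 1) = fscale Q (v i 1)" "lt (K N1) (v i 2) = fscale (inverse Q) (v i 2)" "lt (K N1) (v i 3) = v i 3"
    "lt (K N2) (v i 1) = v i 1" "lt (K N2) (v i 2) = fscale Q (v i 2)" "lt (K N2) (v i 3) = fscale (inverse Q) (v i 3)"
    "lt (Kinv N1) (v i 1) = fscale (inverse Q) (v i 1)" "lt (Kinv N1) (v i 2) = fscale Q (v i 2)" "lt (Kinv N1) (v i 3) = v i 3"
    "lt (Kinv N2) (v i 1) = v i 1" "lt (Kinv N2) (v i 2) = fscale (inverse Q) (v i 2)" "lt (Kinv N2) (v i 3) = fscale Q (v i 3)"
  using assms by (simp_all add: v_def dual_antipode_lt)

lemma v_add: "i \<in> {1..3} \<Longrightarrow> j \<in> {1..3} \<Longrightarrow> v i j (x + y) = (\<Sum>a\<in>{1..3}. v a j x * v i a y)"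
  by (simp add: v_def dual_antipode_def antipode_word_def pairing_lsum lsum_mult u_add sum_1_3
      lsum_fun_add lsum_fun_scale lsum_fun_scale_right mult.commute)

lemma v_D [simp]: "i \<in> {1..3} \<Longrightarrow> j \<in> {1..3} \<Longrightarrow> v i j \<in> D"
proof -
  assume i: "i \<in> {1..3}" and j: "j \<in> {1..3}"
  have c: "x + inverse Q * (inverse (Q - inverse Q) * x) = Q * (inverse (Q - inverse Q) * x)"
    "x + inverse Q * (x * inverse (Q - inverse Q)) = Q * (x * inverse (Q - inverse Q))" for x
    using bracket_one[of x] by (simp_all add: algebra_simps)
  have r: "rels_hold q (v i j)" if "i \<in> {1..3}" for i
    using that j unfolding nat_1_3[of i] rels_hold_iff
    by (elim disjE) (simp_all add: all_nodes br_def power2_eq_square mult.assoc Qcancel, simp_all add: fun_eq_iff fscale_def Qcancel algebra_simps c)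
  have "rels_hold q (act (fw w) (v i j))" for w
    using i
  proof (induction w arbitrary: i rule: rev_induct)
    case (snoc x xs)
    have "rt x (v i j) = (\<Sum>a\<in>{1..3}. fscale (v i a (FWord [x])) (v a j))"
      using snoc.prems j by (auto simp: rt_def v_add fun_eq_iff fscale_def sum_1_3 mult.commute)
    moreover have "act (fw xs) (\<Sum>a\<in>{1..3}. fscale (v i a (FWord [x])) (v a j)) = (\<Sum>a\<in>{1..3}. fscale (v i a (FWord [x])) (act (fw xs) (v a j)))"
      by (simp add: sum_1_3)
    ultimately show ?case
      using snoc j by (simp add: act_snoc) (intro rels_hold_sum rels_hold_fscale, auto)
  qed (simp add: r)
  then show ?thesis by (simp add: Uq_dual_iff)
qed

text \<open>The eigenvalue of the squared antipode on \<open>u i j\<close>; see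
  \<open>dual_antipode_v\<close>.\<close>

definition wq :: "nat \<Rightarrow> nat \<Rightarrow> complex" where "wq i j = Q powi (2 * (int i - int j))"

lemma wq_simps [simp]: "wq i i = 1" "wq 1 2 = inverse Q ^ 2" "wq 2 3 = inverse Q ^ 2" "wq 1 3 = inverse Q ^ 4"
  "wq 2 1 = Q ^ 2" "wq 3 2 = Q ^ 2" "wq 3 1 = Q ^ 4"
  by (simp_all add: wq_def power_int_minus power_inverse)

lemma wq_step: "wq i 1 = Q ^ 2 * wq i 2" "wq i 2 = Q ^ 2 * wq i 3"
proof -
  have "wq i j = Q ^ 2 * wq i (j + 1)" for j
    using power_int_add[of Q 2 "2 * (int i - int (j + 1))"] by (simp add: wq_def)
  from this[of 1] this[of 2] show "wq i 1 = Q ^ 2 * wq i 2" "wq i 2 = Q ^ 2 * wq i 3"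
    by simp_all
qed

lemma dual_antipode_v: "i \<in> {1..3} \<Longrightarrow> j \<in> {1..3} \<Longrightarrow> dual_antipode (v i j) = fscale (wq i j) (u i j)"
proof
  fix w
  assume i: "i \<in> {1..3}"
  show "j \<in> {1..3} \<Longrightarrow> dual_antipode (v i j) w = fscale (wq i j) (u i j) w"
  proof (induction w arbitrary: j rule: fword_rev_induct)
    case zero
    then show ?case by (simp add: fscale_def)
  next
    case (snoc w x)
    have IH: "dual_antipode (v i 1) w = wq i 1 * u i 1 w" "dual_antipode (v i 2) w = wq i 2 * u i 2 w"
      "dual_antipode (v i 3) w = wq i 3 * u i 3 w"
      by (simp_all add: snoc.IH fscale_def)
    obtain n where "x = E n \<or> x = F n \<or> x = K n \<or> x = Kinv n" by (cases x) auto
    moreover have "j = 1 \<or> j = 2 \<or> j = 3" using snoc.prems unfolding nat_1_3 .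
    ultimately show ?case
      by (cases n; elim disjE; simp add: rt_apply dual_antipode_rt i del: atLeastAtMost_iff;
          simp add: fscale_def IH wq_step power2_eq_square mult.assoc Qcancel)
  qed
qed

text \<open>A generated description of \<open>OqSU3 q\<close>, which is defined as an intersection.
  Closure under the antipode holds because its square multiplies \<open>u i j\<close> by a scalar,
  so iterating it leads back to \<open>u\<close> and \<open>v\<close>.\<close>

inductive_set OA :: "fnl set" where
  OA_unit: "unit \<in> OA"
| OA_u: "i \<in> {1..3} \<Longrightarrow> j \<in> {1..3} \<Longrightarrow> u i j \<in> OA"
| OA_v: "i \<in> {1..3} \<Longrightarrow> j \<in> {1..3} \<Longrightarrow> v i j \<in> OA"
| OA_add: "f \<in> OA \<Longrightarrow> g \<in> OA \<Longrightarrow> f + g \<in> OA"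
| OA_fscale: "f \<in> OA \<Longrightarrow> fscale c f \<in> OA"
| OA_conv: "f \<in> OA \<Longrightarrow> g \<in> OA \<Longrightarrow> f \<star> g \<in> OA"

lemma unit_D: "unit \<in> D"
proof -
  have r: "rels_hold q unit"
    unfolding rels_hold_iff by (simp add: br_def)
  have "rels_hold q (act (fw w) unit)" for w
    by (induction w rule: rev_induct) (simp_all add: act_snoc r rels_hold_fscale)
  then show ?thesis by (simp add: Uq_dual_iff)
qed

lemma OA_D: "f \<in> OA \<Longrightarrow> f \<in> D"
  by (induction rule: OA.induct) (simp_all add: unit_D Uq_dual_add Uq_dual_fscale del: atLeastAtMost_iff plus_fun_apply)

lemma is_coproduct_add: "is_coproduct f ts \<Longrightarrow> is_coproduct g ts' \<Longrightarrow> is_coproduct (f + g) (ts @ ts')"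
  by (simp add: is_coproduct_def)

lemma is_coproduct_fscale: "is_coproduct f ts \<Longrightarrow> is_coproduct (fscale c f) (map (\<lambda>(a, b). (fscale c a, b)) ts)"
  by (simp add: is_coproduct_def fscale_def split_def o_def sum_list_const_mult mult.assoc)

lemma OA_coproduct: "f \<in> OA \<Longrightarrow> \<exists>ts. set ts \<subseteq> OA \<times> OA \<and> is_coproduct f ts"
proof (induction rule: OA.induct)
  case OA_unit
  show ?case
    by (rule exI[of _ "[(unit, unit)]"]) (simp add: is_coproduct_def OA.OA_unit, simp add: unit_def)
next
  case (OA_u i j)
  then show ?case
    by (intro exI[of _ "[(u i 1, u 1 j), (u i 2, u 2 j), (u i 3, u 3 j)]"])
      (auto simp: is_coproduct_def OA.OA_u u_add sum_1_3 add.assoc)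
next
  case (OA_v i j)
  then show ?case
    by (intro exI[of _ "[(v 1 j, v i 1), (v 2 j, v i 2), (v 3 j, v i 3)]"])
      (auto simp: is_coproduct_def OA.OA_v v_add sum_1_3 add.assoc)
next
  case (OA_add f g)
  then obtain ts ts' where "set ts \<subseteq> OA \<times> OA" "is_coproduct f ts" "set ts' \<subseteq> OA \<times> OA" "is_coproduct g ts'"
    by blast
  then show ?case
    by (intro exI[of _ "ts @ ts'"]) (auto intro: is_coproduct_add simp del: plus_fun_apply)
next
  case (OA_fscale f c)
  then obtain ts where "set ts \<subseteq> OA \<times> OA" "is_coproduct f ts" by blast
  then show ?case
    by (intro exI[of _ "map (\<lambda>(a, b). (fscale c a, b)) ts"]) (auto intro: is_coproduct_fscale OA.OA_fscale)
next
  case (OA_conv f g)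
  then obtain ts ts' where ts: "set ts \<subseteq> OA \<times> OA" "is_coproduct f ts" "set ts' \<subseteq> OA \<times> OA" "is_coproduct g ts'"
    by blast
  have "set [(a \<star> a', b \<star> b'). (a, b) \<leftarrow> ts, (a', b') \<leftarrow> ts'] \<subseteq> OA \<times> OA"
    using ts by (auto intro: OA.OA_conv)
  then show ?case using is_coproduct_conv[OF ts(2,4)] by blast
qed

lemma OA_antipode: "f \<in> OA \<Longrightarrow> dual_antipode f \<in> OA"
proof (induction rule: OA.induct)
  case (OA_u i j)
  then show ?case using OA.OA_v[of i j] by (simp add: v_def)
qed (simp_all add: OA.intros dual_antipode_v dual_antipode_conv OA_D del: atLeastAtMost_iff plus_fun_apply)

lemma hopf_OA: "hopf_subalgebra q OA"
  unfolding hopf_subalgebra_def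
  by (intro conjI ballI allI subsetI OA_unit OA_add OA_fscale OA_conv OA_D OA_antipode OA_coproduct)

lemma OqSU3_eq: "OqSU3 q = OA"
proof
  show "OqSU3 q \<subseteq> OA"
    unfolding OqSU3_def
    by (rule Inter_lower, rule CollectI, intro conjI ballI hopf_OA) (rule OA_u[unfolded u_def])
  have "f \<in> S" if f: "f \<in> OA" and S: "hopf_subalgebra q S" and uS: "\<forall>i\<in>{1..3}. \<forall>j\<in>{1..3}. u_mat q i j \<in> S" for f S
  proof -
    have cl: "unit \<in> S" "\<And>f g. f \<in> S \<Longrightarrow> g \<in> S \<Longrightarrow> f + g \<in> S" "\<And>f g. f \<in> S \<Longrightarrow> g \<in> S \<Longrightarrow> f \<star> g \<in> S"
      "\<And>c f. f \<in> S \<Longrightarrow> fscale c f \<in> S" "\<And>f. f \<in> S \<Longrightarrow> dual_antipode f \<in> S"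
      using S unfolding hopf_subalgebra_def by blast+
    have uv: "u i j \<in> S" "v i j \<in> S" if "i \<in> {1..3}" "j \<in> {1..3}" for i j
      using uS that cl(5) unfolding u_def v_def by blast+
    from f show ?thesis
      by induction (blast intro: cl uv)+
  qed
  then show "OA \<subseteq> OqSU3 q" unfolding OqSU3_def by (intro subsetI InterI) (elim CollectE conjE)
qed

end

section \<open>Weight spaces\<close>

lemma tang_cases: "\<gamma> = TE A1 \<or> \<gamma> = TE A2 \<or> \<gamma> = TE A12 \<or> \<gamma> = TF A1 \<or> \<gamma> = TF A2 \<or> \<gamma> = TF A12"
proof (cases \<gamma>)
  case (TE r)
  then show ?thesis by (cases r) simp_all
next
  case (TF r)
  then show ?thesis by (cases r) simp_all
qed

lemma tang_UNIV: "UNIV = {TE A1, TE A2, TE A12, TF A1, TF A2, TF A12}"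
  by (rule UNIV_eq_I) (use tang_cases in simp)

lemma finite_tang [simp]: "finite (UNIV :: tang set)"
  by (simp add: tang_UNIV)

lemma sum_tang: "(\<Sum>\<gamma>\<in>UNIV. h \<gamma>) = h (TE A1) + h (TE A2) + h (TE A12) + h (TF A1) + h (TF A2) + (h (TF A12) :: 'a::comm_monoid_add)"
  by (simp add: tang_UNIV add.assoc)

lemma all_tang: "(\<forall>\<gamma>. P \<gamma>) \<longleftrightarrow> P (TE A1) \<and> P (TE A2) \<and> P (TE A12) \<and> P (TF A1) \<and> P (TF A2) \<and> P (TF A12)"
proof
  assume *: "P (TE A1) \<and> P (TE A2) \<and> P (TE A12) \<and> P (TF A1) \<and> P (TF A2) \<and> P (TF A12)"
  show "\<forall>\<gamma>. P \<gamma>"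
  proof
    fix \<gamma>
    show "P \<gamma>" using tang_cases[of \<gamma>] * by (elim disjE) simp_all
  qed
qed simp

context sl3
begin

lemma OA_zero: "0 \<in> OA"
  using OA_fscale[OF OA_unit, of 0] by simp

lemma OA_uminus: "f \<in> OA \<Longrightarrow> - f \<in> OA"
  using OA_fscale[of f "- 1"] by simp

lemma OA_diff: "f \<in> OA \<Longrightarrow> g \<in> OA \<Longrightarrow> f - g \<in> OA"
  using OA_add[of f "- g"] OA_uminus[of g] by simp

lemma OA_sum_list: "(\<And>x. x \<in> set xs \<Longrightarrow> f x \<in> OA) \<Longrightarrow> (\<Sum>x\<leftarrow>xs. f x) \<in> OA"
  by (induction xs) (simp_all add: OA_zero OA_add del: plus_fun_apply zero_fun_apply)

lemma OA_rt: "f \<in> OA \<Longrightarrow> rt x f \<in> OA"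
proof -
  assume "f \<in> OA"
  then obtain ts where ts: "set ts \<subseteq> OA \<times> OA" "is_coproduct f ts"
    using OA_coproduct by blast
  have "rt x f = (\<Sum>t\<leftarrow>ts. fscale (snd t (FWord [x])) (fst t))"
    using ts(2) by (simp add: fun_eq_iff rt_def is_coproduct_def split_def sum_list_apply fscale_def mult.commute)
  also have "\<dots> \<in> OA"
    using ts(1) by (intro OA_sum_list OA_fscale) auto
  finally show ?thesis .
qed

lemmas OA_closed = OA_unit OA_add OA_fscale OA_conv OA_zero OA_uminus OA_diff OA_rt

lemma sweedler_OA:
  assumes "a \<in> OA"
  shows "set (sweedler OA OA a) \<subseteq> OA \<times> OA" "is_coproduct a (sweedler OA OA a)"
  using someI_ex[OF OA_coproduct[OF assms]] unfolding sweedler_def by blast+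

text \<open>Pairing the second Sweedler leg with X is translation by X, whichever legs
  \<open>sweedler\<close> has chosen.\<close>

lemma lact_eq: "a \<in> OA \<Longrightarrow> lact q X a = act X a"
  using sweedler_OA(2)[of a]
  by (simp add: fun_eq_iff lact_def OqSU3_eq is_coproduct_def split_def sum_list_apply fscale_def act_def pairing_lsum
      lsum_fun_sum_list lsum_fun_scale lsum_fun_scale_right mult.commute)

text \<open>\<open>K\<^sub>i \<triangleright> a = q\<^bsup>p\<^sub>i\<^esup> a\<close>; in particular \<open>W 0\<close> is \<open>B\<close>.\<close>
definition W :: "int \<times> int \<Rightarrow> fnl set" where
  "W p = {a \<in> OA. rt (K N1) a = fscale (Q powi fst p) a \<and> rt (K N2) a = fscale (Q powi snd p) a}"

lemma W_OA: "a \<in> W p \<Longrightarrow> a \<in> OA"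
  by (simp add: W_def)

lemma W_D: "a \<in> W p \<Longrightarrow> a \<in> D"
  by (simp add: W_OA OA_D)

lemma W_K: "a \<in> W p \<Longrightarrow> rt (K N1) a = fscale (Q powi fst p) a" "a \<in> W p \<Longrightarrow> rt (K N2) a = fscale (Q powi snd p) a"
  by (simp_all add: W_def)

lemma W_Kinv:
  assumes a: "a \<in> W p"
  shows "rt (Kinv N1) a = fscale (Q powi - fst p) a" "rt (Kinv N2) a = fscale (Q powi - snd p) a"
proof -
  have "a = fscale (Q powi fst p) (rt (Kinv N1) a)" "a = fscale (Q powi snd p) (rt (Kinv N2) a)"
    using D_Kinv_K[OF W_D[OF a]] W_K[OF a] by (metis rt_fscale)+
  then show "rt (Kinv N1) a = fscale (Q powi - fst p) a" "rt (Kinv N2) a = fscale (Q powi - snd p) a"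
    by (metis fscale_swap power_int_minus power_int_eq_0_iff Q0)+
qed

lemma OqF3_eq: "OqF3 q = W 0"
proof -
  have "act (fw [K i]) b = rt (K i) b" "act (fw [Kinv i]) b = rt (Kinv i) b" for i b
    by (simp_all add: act_Cons)
  then show ?thesis
    using W_Kinv[of _ 0]
    by (auto simp: OqF3_def OqSU3_eq W_def lact_eq all_nodes)
qed

lemma W_zero: "0 \<in> W p"
  by (simp add: W_def OA_zero)

lemma W_unit: "unit \<in> W 0"
  by (simp add: W_def OA_unit)

lemma W_add: "a \<in> W p \<Longrightarrow> b \<in> W p \<Longrightarrow> a + b \<in> W p"
  by (simp add: W_def OA_add fn.scale_right_distrib)

lemma W_fscale: "a \<in> W p \<Longrightarrow> fscale c a \<in> W p"
  by (simp add: W_def OA_fscale mult.commute)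

lemma W_uminus: "a \<in> W p \<Longrightarrow> - a \<in> W p"
  using W_fscale[of a p "- 1"] by simp

lemma W_diff: "a \<in> W p \<Longrightarrow> b \<in> W p \<Longrightarrow> a - b \<in> W p"
  using W_add[of a p "- b"] W_uminus[of b p] by simp

lemma W_sum: "(\<And>i. i \<in> I \<Longrightarrow> f i \<in> W p) \<Longrightarrow> (\<Sum>i\<in>I. f i) \<in> W p"
  by (induction I rule: infinite_finite_induct) (simp_all add: W_zero W_add del: plus_fun_apply zero_fun_apply)

lemma W_conv: "a \<in> W p \<Longrightarrow> b \<in> W r \<Longrightarrow> a \<star> b \<in> W (p + r)"
  by (simp add: W_def OA_conv conv_linear power_int_add mult.commute)

lemma W_rt_K: "a \<in> W p \<Longrightarrow> rt (K i) a \<in> W p"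
  using W_fscale[of a p] W_K[of a p] by (cases i) auto

lemma W_rt_Kinv: "a \<in> W p \<Longrightarrow> rt (Kinv i) a \<in> W p"
  using W_fscale[of a p] W_Kinv[of a p] by (cases i) auto

lemma W_rt_E: "a \<in> W p \<Longrightarrow> rt (E N1) a \<in> W (p + (2, -1))" "a \<in> W p \<Longrightarrow> rt (E N2) a \<in> W (p + (-1, 2))"
  using W_D[of a p] by (auto simp: W_def OA_rt D_KE power_int_add power_int_diff power_int_minus divide_inverse mult.commute)

lemma W_rt_F: "a \<in> W p \<Longrightarrow> rt (F N1) a \<in> W (p + (-2, 1))" "a \<in> W p \<Longrightarrow> rt (F N2) a \<in> W (p + (1, -2))"
  using W_D[of a p] by (auto simp: W_def OA_rt D_KF power_int_add power_int_diff power_int_minus divide_inverse mult.commute power_inverse)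

text \<open>A real number of absolute value one is 1 or -1, so q is not a root of unity and a
  K-eigenvalue determines its weight.\<close>

lemma Q_powi_inj:
  assumes "Q powi m = Q powi n"
  shows "m = n"
proof -
  have pos: False if k: "Q ^ k = 1" "k > 0" for k :: nat
  proof -
    have "q ^ k = 1" using k(1) by (metis of_real_1 of_real_eq_iff of_real_power)
    then have "\<bar>q\<bar> ^ k = 1" by (metis abs_one power_abs)
    then have "\<bar>q\<bar> = 1" using k(2) by (metis abs_ge_zero power_eq_imp_eq_base power_one zero_le_one)
    then show False using q2 by (metis abs_1 power2_abs power_one)
  qed
  have one: "Q powi (m - n) = 1"
    using assms by (simp add: power_int_diff)
  then have "Q ^ nat \<bar>m - n\<bar> = 1"
  proof (cases "m - n \<ge> 0")
    case False
    then have "inverse (Q ^ nat (n - m)) = 1" using one by (simp add: power_int_def power_inverse)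
    then have "Q ^ nat (n - m) = 1" by (metis inverse_1 inverse_inverse_eq)
    then show ?thesis using False by simp
  qed (simp add: power_int_def)
  then have "nat \<bar>m - n\<bar> = 0" using pos by (metis gr0I)
  then show ?thesis by simp
qed

text \<open>The weights of the vector representation under \<open>K N1\<close> and
  \<open>K N2\<close>: right weights of the columns of \<open>u\<close>, left weights of its rows.
  The last branch stands for index 3.\<close>

fun eps :: "nat \<Rightarrow> int \<times> int" where
  "eps n = (if n = 1 then (-1, 0) else if n = 2 then (1, -1) else (0, 1))"

lemma u_W: "i \<in> {1..3} \<Longrightarrow> j \<in> {1..3} \<Longrightarrow> u i j \<in> W (eps j)"
  using OA_u[of i j] unfolding nat_1_3[of j]
  by (elim disjE) (simp_all add: W_def power_int_minus)

lemma v_W: "i \<in> {1..3} \<Longrightarrow> j \<in> {1..3} \<Longrightarrow> v i j \<in> W (- eps i)"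
  using OA_v[of i j] unfolding nat_1_3[of i]
  by (elim disjE) (simp_all add: W_def power_int_minus)

text \<open>Left weights; they decide which elements of \<open>U\<^sub>q(sl\<^sub>3)\<close> a functional can detect.\<close>
definition left_weight :: "int \<times> int \<Rightarrow> fnl \<Rightarrow> bool" where
  "left_weight p a \<longleftrightarrow> lt (K N1) a = fscale (Q powi fst p) a \<and> lt (K N2) a = fscale (Q powi snd p) a"

lemma left_weight_rt: "left_weight p a \<Longrightarrow> left_weight p (rt x a)"
  by (simp add: left_weight_def rt_lt[symmetric])

lemma left_weight_zero: "left_weight p 0"
  by (simp add: left_weight_def)

lemma left_weight_diff: "left_weight p a \<Longrightarrow> left_weight p b \<Longrightarrow> left_weight p (a - b)"
  by (simp add: left_weight_def fn.scale_right_diff_distrib)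

lemma left_weight_fscale: "left_weight p a \<Longrightarrow> left_weight p (fscale c a)"
  by (simp add: left_weight_def mult.commute)

lemma left_weight_conv: "left_weight p a \<Longrightarrow> left_weight r b \<Longrightarrow> left_weight (p + r) (a \<star> b)"
  by (simp add: left_weight_def conv_linear power_int_add mult.commute)

lemma left_weight_u: "i \<in> {1..3} \<Longrightarrow> j \<in> {1..3} \<Longrightarrow> left_weight (eps i) (u i j)"
  unfolding nat_1_3[of i]
  by (elim disjE) (simp_all add: left_weight_def power_int_minus)

lemma left_weight_v: "i \<in> {1..3} \<Longrightarrow> j \<in> {1..3} \<Longrightarrow> left_weight (- eps j) (v i j)"
  unfolding nat_1_3[of j]
  by (elim disjE) (simp_all add: left_weight_def power_int_minus)

text \<open>At the empty word left and right translation by K coincide, so a nonzero value forces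
  the two weights to agree. This is how most evaluations below are seen to vanish.\<close>

lemma ev_zero:
  assumes a: "a \<in> W r" and "left_weight p a" and "p \<noteq> r"
  shows "a 0 = 0"
proof (rule ccontr)
  assume Nop_support: "a 0 \<noteq> 0"
  have e: "lt (K n) a 0 = rt (K n) a 0" for n
    by (simp add: rt_def lt_def)
  have "Q powi fst p * a 0 = lt (K N1) a 0" "Q powi snd p * a 0 = lt (K N2) a 0"
    using assms(2) by (simp_all add: left_weight_def fscale_def)
  then have "Q powi fst p * a 0 = Q powi fst r * a 0" "Q powi snd p * a 0 = Q powi snd r * a 0"
    unfolding e W_K[OF a] by (simp_all add: fscale_def)
  then have "fst p = fst r" "snd p = snd r"
    using Nop_support Q_powi_inj by auto
  then show False using assms(3) by (simp add: prod_eq_iff)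
qed

section \<open>Partitions of unity\<close>

text \<open>Left translations act through the summed index and leave the sum invariant, so the
  induction peels letters off the front; in \<open>sum_u_v\<close> right translations take this
  part.\<close>

lemma sum_v_u: "p \<in> {1..3} \<Longrightarrow> j \<in> {1..3} \<Longrightarrow> (\<Sum>l\<in>{1..3}. v p l \<star> u l j) = fscale (of_bool (p = j)) unit"
proof
  fix w
  assume p: "p \<in> {1..3}" and j: "j \<in> {1..3}"
  show "(\<Sum>l\<in>{1..3}. v p l \<star> u l j) w = fscale (of_bool (p = j)) unit w"
  proof (induction w rule: fword_induct)
    case zero
    then show ?case using p j unfolding nat_1_3 by (auto simp: sum_1_3 fscale_def)
  next
    case (cons x w)
    have lt: "lt x (\<Sum>l\<in>{1..3}. v p l \<star> u l j) = fscale (counit_gen x) (\<Sum>l\<in>{1..3}. v p l \<star> u l j)"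
    proof -
      obtain n where "x = E n \<or> x = F n \<or> x = K n \<or> x = Kinv n" by (cases x) auto
      then show ?thesis
        by (cases n; elim disjE; simp add: sum_1_3 conv_linear p j del: atLeastAtMost_iff; simp add: Qcancel)
    qed
    then show ?case
      using cons unfolding lt_apply lt lt_fscale lt_unit by (simp add: fscale_def)
  qed
qed

lemma sum_u_v: "a \<in> {1..3} \<Longrightarrow> r \<in> {1..3} \<Longrightarrow> (\<Sum>m\<in>{1..3}. u a m \<star> v m r) = fscale (of_bool (a = r)) unit"
proof
  fix w
  assume a: "a \<in> {1..3}" and r: "r \<in> {1..3}"
  show "(\<Sum>m\<in>{1..3}. u a m \<star> v m r) w = fscale (of_bool (a = r)) unit w"
  proof (induction w rule: fword_rev_induct)
    case zero
    then show ?case using a r unfolding nat_1_3 by (auto simp: sum_1_3 fscale_def)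
  next
    case (snoc w x)
    have rt: "rt x (\<Sum>m\<in>{1..3}. u a m \<star> v m r) = fscale (counit_gen x) (\<Sum>m\<in>{1..3}. u a m \<star> v m r)"
    proof -
      obtain n where "x = E n \<or> x = F n \<or> x = K n \<or> x = Kinv n" by (cases x) auto
      then show ?thesis
        by (cases n; elim disjE; simp add: sum_1_3 conv_linear a r del: atLeastAtMost_iff; simp add: Qcancel)
    qed
    then show ?case
      using snoc unfolding rt_apply rt rt_fscale rt_unit by (simp add: fscale_def)
  qed
qed

text \<open>The antipode of \<open>sum_u_v\<close>. It serves for \<open>evaluable_v\<close>, where
  the first legs are antipodes of entries of \<open>v\<close>.\<close>

lemma sum_S2u_v: "r \<in> {1..3} \<Longrightarrow> a \<in> {1..3} \<Longrightarrow>
   (\<Sum>m\<in>{1..3}. fscale (wq m r) (u m r) \<star> v a m) = fscale (of_bool (a = r)) unit"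
proof -
  assume r: "r \<in> {1..3}" and a: "a \<in> {1..3}"
  have "fscale (of_bool (a = r)) unit = dual_antipode (\<Sum>m\<in>{1..3}. u a m \<star> v m r)"
    using sum_u_v[OF a r] by simp
  also have "\<dots> = (\<Sum>m\<in>{1..3}. fscale (wq m r) (u m r) \<star> v a m)"
    using a r by (simp add: sum_1_3 dual_antipode_conv dual_antipode_v v_def[of a, symmetric])
  finally show ?thesis by simp
qed

end

section \<open>The first-order calculus\<close>

lemma tang6 [case_names E1 E2 E12 F1 F2 F12]:
  obtains "\<gamma> = TE A1" | "\<gamma> = TE A2" | "\<gamma> = TE A12" | "\<gamma> = TF A1" | "\<gamma> = TF A2" | "\<gamma> = TF A12"
  using tang_cases by blast

lemma Uq_star_two:
  assumes "ws \<noteq> ws'"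
  shows "Uq_star (fw ws - scl c (fw ws')) = star_word (FWord ws) - scl (cnj c) (star_word (FWord ws'))"
proof -
  let ?x = "fw ws - scl c (fw ws')"
  have "Uq_star ?x = (\<Sum>w\<in>{FWord ws, FWord ws'}. scl (cnj (Poly_Mapping.lookup ?x w)) (star_word w))"
    unfolding Uq_star_def
    by (rule sum.mono_neutral_left) (auto simp: in_keys_iff lookup_minus lookup_scl fw_def lookup_single when_def split: if_splits)
  also have "\<dots> = star_word (FWord ws) - scl (cnj c) (star_word (FWord ws'))"
    using assms by (simp add: lookup_minus lookup_scl fw_def lookup_single when_def)
  finally show ?thesis .
qed

lemma Uq_star_fw: "Uq_star (fw ws) = star_word (FWord ws)"
  by (simp add: Uq_star_def fw_def)

context sl3
begin

fun tv :: "tang \<Rightarrow> fnl \<Rightarrow> fnl" where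
  "tv (TE A1) f = rt (E N1) f"
| "tv (TE A2) f = rt (E N2) f"
| "tv (TE A12) f = rt (E N2) (rt (E N1) f) - fscale (inverse Q) (rt (E N1) (rt (E N2) f))"
| "tv (TF A1) f = rt (K N1) (rt (F N1) f)"
| "tv (TF A2) f = rt (K N2) (rt (F N2) f)"
| "tv (TF A12) f = rt (K N1) (rt (F N1) (rt (K N2) (rt (F N2) f)))
     - fscale (inverse Q) (rt (K N2) (rt (F N2) (rt (K N1) (rt (F N1) f))))"

lemma act_tvec: "act (tvec q \<gamma>) f = tv \<gamma> f"
proof -
  have "\<forall>\<gamma>. act (tvec q \<gamma>) f = tv \<gamma> f"
    unfolding all_tang
    by (simp add: Uq_star_fw Uq_star_two star_word_def fw_mult act_diff act_scl act_Cons divide_inverse)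
  then show ?thesis by blast
qed

text \<open>The shift of the K-weights by a root vector, given for simple roots by the Cartan
  matrix.\<close>

fun wt :: "tang \<Rightarrow> int \<times> int" where
  "wt (TE A1) = (2, -1)"
| "wt (TE A2) = (-1, 2)"
| "wt (TE A12) = (1, 1)"
| "wt (TF A1) = (-2, 1)"
| "wt (TF A2) = (1, -2)"
| "wt (TF A12) = (-1, -1)"

fun kk :: "posroot \<Rightarrow> fnl \<Rightarrow> fnl" where
  "kk A1 f = rt (K N1) f"
| "kk A2 f = rt (K N2) f"
| "kk A12 f = rt (K N2) (rt (K N1) f)"

text \<open>The right action on \<open>\<Lambda>\<^sup>1\<close>: \<open>e\<^sub>\<delta> a = \<Sum>\<^sub>\<gamma> (Nop \<delta> \<gamma> \<triangleright> a) e\<^sub>\<gamma>\<close>, read off from the coproducts of the root vectors.\<close>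
fun Nop :: "tang \<Rightarrow> tang \<Rightarrow> fnl \<Rightarrow> fnl" where
  "Nop (TE \<delta>) (TE \<gamma>) f = (if \<delta> = \<gamma> then kk \<gamma> f
     else if \<delta> = A1 \<and> \<gamma> = A12 then fscale (1 - inverse Q ^ 2) (rt (E N2) (rt (K N1) f)) else 0)"
| "Nop (TF \<delta>) (TF \<gamma>) f = (if \<delta> = \<gamma> then kk \<gamma> f
     else if \<delta> = A1 \<and> \<gamma> = A12 then fscale (Q - inverse Q) (rt (K N2) (rt (F N2) (rt (K N1) f))) else 0)"
| "Nop (TE \<delta>) (TF \<gamma>) f = 0"
| "Nop (TF \<delta>) (TE \<gamma>) f = 0"

lemma tv_linear [simp]: "tv \<gamma> (f + g) = tv \<gamma> f + tv \<gamma> g" "tv \<gamma> (f - g) = tv \<gamma> f - tv \<gamma> g" "tv \<gamma> 0 = 0"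
  "tv \<gamma> (fscale c f) = fscale c (tv \<gamma> f)"
  by (cases \<gamma> rule: tang6; simp add: fn.scale_right_distrib fn.scale_right_diff_distrib mult.commute)+

lemma kk_linear [simp]: "kk \<gamma> (f + g) = kk \<gamma> f + kk \<gamma> g" "kk \<gamma> (f - g) = kk \<gamma> f - kk \<gamma> g" "kk \<gamma> 0 = 0"
  "kk \<gamma> (fscale c f) = fscale c (kk \<gamma> f)"
  by (cases \<gamma>; simp)+

lemma Nop_linear [simp]: "Nop \<delta> \<gamma> (f + g) = Nop \<delta> \<gamma> f + Nop \<delta> \<gamma> g"
   "Nop \<delta> \<gamma> (f - g) = Nop \<delta> \<gamma> f - Nop \<delta> \<gamma> g" "Nop \<delta> \<gamma> 0 = 0"
  "Nop \<delta> \<gamma> (fscale c f) = fscale c (Nop \<delta> \<gamma> f)"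
  by (cases \<delta>; cases \<gamma>; simp add: fn.scale_right_distrib fn.scale_right_diff_distrib mult.commute)+

lemma tv_sum_list: "tv \<gamma> (\<Sum>x\<leftarrow>xs. f x) = (\<Sum>x\<leftarrow>xs. tv \<gamma> (f x))"
  by (induction xs) (simp_all del: plus_fun_apply zero_fun_apply)

lemma Nop_unit: "Nop \<delta> \<gamma> unit = (if \<delta> = \<gamma> then unit else 0)"
proof -
  have "kk r unit = unit" for r by (cases r) simp_all
  then show ?thesis by (cases \<delta>; cases \<gamma>) simp_all
qed

text \<open>The coproduct of a root vector has the form sum of X_\<delta> \<otimes>
  N_\<delta>\<gamma> plus 1 \<otimes> X_\<gamma>. For E_12 the mixed term E_2 \<otimes> (K_2 E_1 -
  q^(-1) E_1 K_2) is zero, while E_1 \<otimes> (E_2 K_1 - q^(-1) K_1 E_2) equals (1 - q^(-2)) E_1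
  \<otimes> E_2 K_1; this is the off-diagonal entry of \<open>Nop\<close>.\<close>

lemma tv_conv:
  assumes "f \<in> D" and "g \<in> D"
  shows "tv \<gamma> (f \<star> g) = (\<Sum>\<delta>\<in>UNIV. tv \<delta> f \<star> Nop \<delta> \<gamma> g) + f \<star> tv \<gamma> g"
proof -
  have K: "rt (K N2) (rt (K N1) g) = rt (K N1) (rt (K N2) g)" "rt (K N2) (rt (K N1) f) = rt (K N1) (rt (K N2) f)"
    using assms D_KK by blast+
  have "\<forall>\<gamma>. tv \<gamma> (f \<star> g) = (\<Sum>\<delta>\<in>UNIV. tv \<delta> f \<star> Nop \<delta> \<gamma> g) + f \<star> tv \<gamma> g"
    unfolding all_tang sum_tang
    using assms
    by (simp add: D_KE D_KF D_KinvF K conv_linear,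
        simp add: fun_eq_iff fscale_def algebra_simps power2_eq_square power3_eq_cube power4_eq_xxxx Qcancel)
  then show ?thesis by blast
qed

text \<open>Coassociativity read in matrix form: it makes the right action on Lambda^1
  associative.\<close>

lemma Nop_conv:
  assumes "f \<in> D" and "g \<in> D"
  shows "Nop \<delta> \<gamma> (f \<star> g) = (\<Sum>\<epsilon>\<in>UNIV. Nop \<delta> \<epsilon> f \<star> Nop \<epsilon> \<gamma> g)"
proof -
  have K: "rt (K N2) (rt (K N1) g) = rt (K N1) (rt (K N2) g)" using assms D_KK by blast
  have "\<forall>\<delta> \<gamma>. Nop \<delta> \<gamma> (f \<star> g) = (\<Sum>\<epsilon>\<in>UNIV. Nop \<delta> \<epsilon> f \<star> Nop \<epsilon> \<gamma> g)"
    unfolding all_tang sum_tang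
    using assms by (simp add: conv_linear fn.scale_right_distrib K)
  then show ?thesis by blast
qed

lemma Nop_OA: "f \<in> OA \<Longrightarrow> Nop \<delta> \<gamma> f \<in> OA"
  by (cases \<delta> rule: tang6; cases \<gamma> rule: tang6) (simp_all add: OA_closed)

lemma tv_W: "f \<in> W p \<Longrightarrow> tv \<gamma> f \<in> W (p + wt \<gamma>)"
proof (cases \<gamma> rule: tang6)
  case E12
  assume f: "f \<in> W p"
  have "rt (E N2) (rt (E N1) f) \<in> W (p + (1, 1))" "rt (E N1) (rt (E N2) f) \<in> W (p + (1, 1))"
    using W_rt_E(2)[OF W_rt_E(1)[OF f]] W_rt_E(1)[OF W_rt_E(2)[OF f]] by (simp_all add: add.assoc)
  then show ?thesis using E12 by (simp add: W_diff W_fscale)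
next
  case F12
  assume f: "f \<in> W p"
  have "rt (K N1) (rt (F N1) (rt (K N2) (rt (F N2) f))) \<in> W (p + (-1, -1))"
    "rt (K N2) (rt (F N2) (rt (K N1) (rt (F N1) f))) \<in> W (p + (-1, -1))"
    using W_rt_K[OF W_rt_F(1)[OF W_rt_K[OF W_rt_F(2)[OF f]]]] W_rt_K[OF W_rt_F(2)[OF W_rt_K[OF W_rt_F(1)[OF f]]]]
    by (simp_all add: add.assoc)
  then show ?thesis using F12 by (simp add: W_diff W_fscale)
qed (simp_all add: W_rt_E W_rt_F W_rt_K)

lemma Nop_W: "f \<in> W p \<Longrightarrow> Nop \<delta> \<gamma> f \<in> W (p + wt \<gamma> - wt \<delta>)"
proof -
  assume f: "f \<in> W p"
  have "\<forall>\<delta> \<gamma>. Nop \<delta> \<gamma> f \<in> W (p + wt \<gamma> - wt \<delta>)"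
    unfolding all_tang
    using W_rt_E(2)[OF W_rt_K[OF f]] W_rt_K[OF W_rt_F(2)[OF W_rt_K[OF f]]]
    by (simp add: W_zero W_fscale W_rt_K f add_diff_eq[symmetric] zero_prod_def[symmetric])
  then show ?thesis by blast
qed

lemma tv_left_weight: "left_weight p f \<Longrightarrow> left_weight p (tv \<gamma> f)"
  by (cases \<gamma> rule: tang6) (simp_all add: left_weight_rt left_weight_diff left_weight_fscale)

lemma Nop_left_weight: "left_weight p f \<Longrightarrow> left_weight p (Nop \<delta> \<gamma> f)"
  by (cases \<delta> rule: tang6; cases \<gamma> rule: tang6) (simp_all add: left_weight_rt left_weight_diff left_weight_fscale left_weight_zero)

text \<open>\<open>\<Sum> a\<^sub>i (X \<triangleright> b\<^sub>i) = \<langle>X, c\<rangle> 1\<close>, for example for \<open>a\<^sub>i \<otimes> b\<^sub>i = S(c\<^sub>(\<^sub>1\<^sub>)) \<otimes> c\<^sub>(\<^sub>2\<^sub>)\<close>.\<close>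
definition evaluates :: "fnl \<Rightarrow> (fnl \<times> fnl) list \<Rightarrow> bool" where
  "evaluates c ts \<longleftrightarrow> (\<forall>ws. (\<Sum>t\<leftarrow>ts. fst t \<star> act (fw ws) (snd t)) = fscale (c (FWord ws)) unit)"

lemma evaluates_rt:
  assumes "evaluates c ts"
  shows "evaluates (rt x c) (map (\<lambda>t. (fst t, rt x (snd t))) ts)"
  using assms by (simp add: evaluates_def o_def rt_def[of x c] FWord_add act_snoc[symmetric])

text \<open>The first legs are multiplied in reverse order, as for an antipode, so the inner sum
  collapses first. Each letter replaces \<open>c\<close> and \<open>c'\<close> by translates, hence
  the generalisation.\<close>

lemma evaluates_conv_aux:
  assumes "evaluates c ts" and "evaluates c' ts'"
  shows "(\<Sum>t'\<leftarrow>ts'. \<Sum>t\<leftarrow>ts. fst t' \<star> (fst t \<star> act (fw ws) (snd t \<star> snd t'))) = fscale ((c \<star> c') (FWord ws)) unit"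
  using assms
proof (induction ws arbitrary: c c' ts ts' rule: rev_induct)
  case Nil
  have "(\<Sum>t\<leftarrow>ts. fst t \<star> (snd t \<star> g)) = fscale (c 0) g" for g
    using Nil(1)[unfolded evaluates_def, rule_format, of "[]"]
    by (simp add: conv_sum_list_left[symmetric] conv_assoc[symmetric] conv_fscale_left FWord_Nil)
  then have "(\<Sum>t'\<leftarrow>ts'. \<Sum>t\<leftarrow>ts. fst t' \<star> (fst t \<star> (snd t \<star> snd t'))) = (\<Sum>t'\<leftarrow>ts'. fscale (c 0) (fst t' \<star> snd t'))"
    by (simp add: conv_sum_list_right[symmetric] conv_fscale_right)
  also have "\<dots> = fscale (c 0) (\<Sum>t'\<leftarrow>ts'. fst t' \<star> snd t')"
    by (induction ts') (simp_all add: fn.scale_right_distrib del: plus_fun_apply zero_fun_apply)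
  also have "\<dots> = fscale (c 0 * c' 0) unit"
    using Nil(2)[unfolded evaluates_def, rule_format, of "[]"] by (simp add: FWord_Nil)
  finally show ?case by (simp add: FWord_Nil)
next
  case (snoc x ws)
  have IH: "(\<Sum>t'\<leftarrow>ts'. \<Sum>t\<leftarrow>ts. fst t' \<star> (fst t \<star> act (fw ws) (rt y (snd t) \<star> rt z (snd t')))) = fscale ((rt y c \<star> rt z c') (FWord ws)) unit"
    for y z using snoc.IH[OF evaluates_rt[OF snoc.prems(1)] evaluates_rt[OF snoc.prems(2)]] by (simp add: o_def)
  have IH1: "(\<Sum>t'\<leftarrow>ts'. \<Sum>t\<leftarrow>ts. fst t' \<star> (fst t \<star> act (fw ws) (rt y (snd t) \<star> (snd t')))) = fscale ((rt y c \<star> c') (FWord ws)) unit"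
    for y using snoc.IH[OF evaluates_rt[OF snoc.prems(1)] snoc.prems(2)] by (simp add: o_def)
  have IH2: "(\<Sum>t'\<leftarrow>ts'. \<Sum>t\<leftarrow>ts. fst t' \<star> (fst t \<star> act (fw ws) ((snd t) \<star> rt z (snd t')))) = fscale ((c \<star> rt z c') (FWord ws)) unit"
    for z using snoc.IH[OF snoc.prems(1) evaluates_rt[OF snoc.prems(2)]] by (simp add: o_def)
  have a: "(c \<star> c') (FWord (ws @ [x])) = rt x (c \<star> c') (FWord ws)"
    by (simp add: rt_def FWord_add)
  show ?case unfolding a act_snoc
    by (cases x) (simp_all add: conv_add_right sum_list_addf IH IH1 IH2 del: plus_fun_apply, simp_all add: fn.scale_left_distrib)
qed

lemma evaluates_general:
  assumes "evaluates c ts"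
  shows "(\<Sum>t\<leftarrow>ts. fst t \<star> act X (snd t)) = fscale (pairing X c) unit"
proof (induction X rule: poly_mapping_single_induct)
  case zero
  show ?case by (induction ts) (simp_all add: pairing_lsum del: plus_fun_apply zero_fun_apply)
next
  case (add x y)
  then show ?case
    by (simp add: act_add conv_add_right sum_list_addf pairing_lsum lsum_add fn.scale_left_distrib del: plus_fun_apply)
next
  case (single k d)
  have "Poly_Mapping.single k d = scl d (fw (letters k))"
    by (intro poly_mapping_eqI) (simp add: fw_def lookup_scl lookup_single when_def)
  moreover have "(\<Sum>t\<leftarrow>ts. fscale d (f t)) = fscale d (\<Sum>t\<leftarrow>ts. f t)" for f :: "_ \<Rightarrow> fnl"
    by (induction ts) (simp_all add: fn.scale_right_distrib del: plus_fun_apply zero_fun_apply)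
  ultimately show ?case
    using assms[unfolded evaluates_def, rule_format, of "letters k"]
    by (simp add: act_scl conv_fscale_right pairing_lsum lsum_scl)
qed

text \<open>For the functionals used below, \<open>p\<close> and \<open>r\<close> are the left and
  the right weight of \<open>c\<close>.\<close>

definition evaluable :: "int \<times> int \<Rightarrow> int \<times> int \<Rightarrow> fnl \<Rightarrow> bool" where
  "evaluable p r c \<longleftrightarrow> (\<exists>ts. set ts \<subseteq> W (- p) \<times> W r \<and> evaluates c ts)"

lemma evaluable_conv: "evaluable p r c \<Longrightarrow> evaluable p' r' c' \<Longrightarrow> evaluable (p + p') (r + r') (c \<star> c')"
proof -
  assume "evaluable p r c" "evaluable p' r' c'"
  then obtain ts ts' where ts: "set ts \<subseteq> W (- p) \<times> W r" "evaluates c ts" "set ts' \<subseteq> W (- p') \<times> W r'" "evaluates c' ts'"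
    by (auto simp: evaluable_def)
  let ?l = "concat (map (\<lambda>t'. map (\<lambda>t. (fst t' \<star> fst t, snd t \<star> snd t')) ts) ts')"
  have "evaluates (c \<star> c') ?l"
    unfolding evaluates_def
  proof
    fix ws
    have "(\<Sum>t\<leftarrow>?l. fst t \<star> act (fw ws) (snd t)) = (\<Sum>t'\<leftarrow>ts'. \<Sum>t\<leftarrow>ts. fst t' \<star> (fst t \<star> act (fw ws) (snd t \<star> snd t')))"
      by (induction ts') (simp_all add: o_def conv_assoc del: plus_fun_apply zero_fun_apply)
    then show "(\<Sum>t\<leftarrow>?l. fst t \<star> act (fw ws) (snd t)) = fscale ((c \<star> c') (FWord ws)) unit"
      using evaluates_conv_aux[OF ts(2,4)] by simp
  qed
  moreover have "set ?l \<subseteq> W (- (p + p')) \<times> W (r + r')"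
  proof
    fix z assume "z \<in> set ?l"
    then obtain t t' where z: "t \<in> set ts" "t' \<in> set ts'" "z = (fst t' \<star> fst t, snd t \<star> snd t')" by auto
    have "t \<in> W (- p) \<times> W r" "t' \<in> W (- p') \<times> W r'" using z ts by blast+
    then have "fst t' \<star> fst t \<in> W (- p' + - p)" "snd t \<star> snd t' \<in> W (r + r')"
      by (intro W_conv; simp add: mem_Times_iff)+
    then show "z \<in> W (- (p + p')) \<times> W (r + r')" using z by (simp add: algebra_simps)
  qed
  ultimately show ?thesis unfolding evaluable_def by blast
qed

lemma evaluable_u:
  assumes "p \<in> {1..3}" and "j \<in> {1..3}"
  shows "evaluable (eps p) (eps j) (u p j)"
proof -
  have a: "act (fw ws) (u l j) = (\<Sum>a\<in>{1..3}. fscale (u a j (FWord ws)) (u l a))" if "l \<in> {1..3}" for l ws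
    using that assms by (auto simp: act_def pairing_lsum u_add fun_eq_iff fscale_def sum_1_3 mult.commute)
  have "(\<Sum>l\<in>{1..3}. v p l \<star> act (fw ws) (u l j)) = fscale (u p j (FWord ws)) unit" for ws
  proof -
    have "(\<Sum>l\<in>{1..3}. v p l \<star> act (fw ws) (u l j)) = (\<Sum>a\<in>{1..3}. fscale (u a j (FWord ws)) (\<Sum>l\<in>{1..3}. v p l \<star> u l a))"
      by (simp add: a conv_sum_right conv_fscale_right fn.scale_sum_right) (rule sum.swap)
    also have "\<dots> = fscale (u p j (FWord ws)) unit"
      using assms(1) unfolding sum_1_3 nat_1_3[of p]
      by (elim disjE) (simp_all add: sum_v_u[unfolded sum_1_3])
    finally show ?thesis .
  qed
  then have "evaluates (u p j) [(v p 1, u 1 j), (v p 2, u 2 j), (v p 3, u 3 j)]"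
    by (simp add: evaluates_def sum_1_3 add.assoc)
  moreover have "set [(v p 1, u 1 j), (v p 2, u 2 j), (v p 3, u 3 j)] \<subseteq> W (- eps p) \<times> W (eps j)"
    using assms by (simp add: u_W v_W del: eps.simps)
  ultimately show ?thesis unfolding evaluable_def by blast
qed

text \<open>The coproduct of v_jr has legs v_mr and v_jm, and S(v_mr) is the squared antipode of
  u_mr; this is the origin of \<open>wq\<close>.\<close>

lemma evaluable_v:
  assumes "j \<in> {1..3}" and "r \<in> {1..3}"
  shows "evaluable (- eps r) (- eps j) (v j r)"
proof -
  have a: "act (fw ws) (v j m) = (\<Sum>a\<in>{1..3}. fscale (v j a (FWord ws)) (v a m))" if "m \<in> {1..3}" for m ws
    using that assms by (auto simp: act_def pairing_lsum v_add fun_eq_iff fscale_def sum_1_3 mult.commute)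
  have "(\<Sum>m\<in>{1..3}. fscale (wq m r) (u m r) \<star> act (fw ws) (v j m)) = fscale (v j r (FWord ws)) unit" for ws
  proof -
    have "(\<Sum>m\<in>{1..3}. fscale (wq m r) (u m r) \<star> act (fw ws) (v j m))
        = (\<Sum>a\<in>{1..3}. fscale (v j a (FWord ws)) (\<Sum>m\<in>{1..3}. fscale (wq m r) (u m r) \<star> v a m))"
      by (simp only: a conv_sum_right conv_fscale_right fn.scale_sum_right cong: sum.cong) (rule sum.swap)
    also have "\<dots> = fscale (v j r (FWord ws)) unit"
      using assms(2) unfolding sum_1_3 nat_1_3[of r]
      by (elim disjE) (simp_all add: sum_S2u_v[unfolded sum_1_3] del: wq_simps)
    finally show ?thesis .
  qed
  then have "evaluates (v j r) [(fscale (wq 1 r) (u 1 r), v j 1), (fscale (wq 2 r) (u 2 r), v j 2), (fscale (wq 3 r) (u 3 r), v j 3)]"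
    by (simp add: evaluates_def sum_1_3 add.assoc)
  moreover have "set [(fscale (wq 1 r) (u 1 r), v j 1), (fscale (wq 2 r) (u 2 r), v j 2), (fscale (wq 3 r) (u 3 r), v j 3)] \<subseteq> W (eps r) \<times> W (- eps j)"
    using assms by (simp add: u_W v_W W_fscale del: eps.simps)
  ultimately show ?thesis unfolding evaluable_def by (metis minus_minus)
qed

text \<open>The existence of these for all \<open>p\<close> says that A is strongly graded by the
  weight lattice, with B in degree zero.\<close>

definition unit_partition :: "int \<times> int \<Rightarrow> (fnl \<times> fnl) list \<Rightarrow> bool" where
  "unit_partition p ts \<longleftrightarrow> set ts \<subseteq> W (- p) \<times> W p \<and> (\<Sum>t\<leftarrow>ts. fst t \<star> snd t) = unit"

lemma unit_partition_evaluates: "evaluates c ts \<Longrightarrow> c 0 = 1 \<Longrightarrow> set ts \<subseteq> W (- p) \<times> W p \<Longrightarrow> unit_partition p ts"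
  by (auto simp: unit_partition_def evaluates_def FWord_Nil dest: spec[of _ "[]"])

lemma unit_partition_eps:
  assumes "i \<in> {1..3}"
  shows "\<exists>ts. unit_partition (eps i) ts" "\<exists>ts. unit_partition (- eps i) ts"
proof -
  obtain ts where "set ts \<subseteq> W (- eps i) \<times> W (eps i)" "evaluates (u i i) ts"
    using evaluable_u[OF assms assms] unfolding evaluable_def by blast
  then show "\<exists>ts. unit_partition (eps i) ts" using unit_partition_evaluates[of "u i i" ts "eps i"] by (auto simp del: eps.simps)
  obtain ts where "set ts \<subseteq> W (- (- eps i)) \<times> W (- eps i)" "evaluates (v i i) ts"
    using evaluable_v[OF assms assms] unfolding evaluable_def by blast
  then show "\<exists>ts. unit_partition (- eps i) ts" using unit_partition_evaluates[of "v i i" ts "- eps i"] by (auto simp del: eps.simps)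
qed

lemma unit_partition_add: "\<exists>ts. unit_partition p ts \<Longrightarrow> \<exists>ts. unit_partition r ts \<Longrightarrow> \<exists>ts. unit_partition (p + r) ts"
proof -
  assume "\<exists>ts. unit_partition p ts" "\<exists>ts. unit_partition r ts"
  then obtain ts ts' where ts: "set ts \<subseteq> W (- p) \<times> W p" "(\<Sum>t\<leftarrow>ts. fst t \<star> snd t) = unit"
     "set ts' \<subseteq> W (- r) \<times> W r" "(\<Sum>t\<leftarrow>ts'. fst t \<star> snd t) = unit"
    by (auto simp: unit_partition_def)
  let ?l = "concat (map (\<lambda>t'. map (\<lambda>t. (fst t' \<star> fst t, snd t \<star> snd t')) ts) ts')"
  have "(\<Sum>t\<leftarrow>?l. fst t \<star> snd t) = (\<Sum>t'\<leftarrow>ts'. \<Sum>t\<leftarrow>ts. fst t' \<star> (fst t \<star> snd t \<star> snd t'))"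
    by (induction ts') (simp_all add: o_def conv_assoc del: plus_fun_apply zero_fun_apply)
  also have "\<dots> = unit"
    by (simp add: conv_sum_list_right[symmetric] conv_sum_list_left[symmetric] ts)
  finally have "(\<Sum>t\<leftarrow>?l. fst t \<star> snd t) = unit" .
  moreover have "set ?l \<subseteq> W (- (p + r)) \<times> W (p + r)"
  proof
    fix z assume "z \<in> set ?l"
    then obtain t t' where z: "t \<in> set ts" "t' \<in> set ts'" "z = (fst t' \<star> fst t, snd t \<star> snd t')" by auto
    have "t \<in> W (- p) \<times> W p" "t' \<in> W (- r) \<times> W r" using z ts by blast+
    then have "fst t' \<star> fst t \<in> W (- r + - p)" "snd t \<star> snd t' \<in> W (p + r)"
      by (intro W_conv; simp add: mem_Times_iff)+
    then show "z \<in> W (- (p + r)) \<times> W (p + r)" using z by (simp add: algebra_simps)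
  qed
  ultimately show ?thesis unfolding unit_partition_def by blast
qed

text \<open>Partitions multiply, and the weights of the first and third basis vectors together with
  their negatives generate the lattice.\<close>

lemma unit_partition_ex: "\<exists>ts. unit_partition p ts"
proof -
  have z: "\<exists>ts. unit_partition 0 ts"
    by (rule exI[of _ "[(unit, unit)]"]) (simp add: unit_partition_def W_unit)
  have b: "\<exists>ts. unit_partition (1, 0) ts" "\<exists>ts. unit_partition (-1, 0) ts" "\<exists>ts. unit_partition (0, 1) ts" "\<exists>ts. unit_partition (0, -1) ts"
    using unit_partition_eps[of 1] unit_partition_eps[of 3] by simp_all
  have n: "\<exists>ts. unit_partition (int n, 0) ts" "\<exists>ts. unit_partition (- int n, 0) ts" "\<exists>ts. unit_partition (0, int n) ts" "\<exists>ts. unit_partition (0, - int n) ts" for n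
  proof (induction n)
    case 0
    { case 1 then show ?case using z by (simp add: zero_prod_def) }
    { case 2 then show ?case using z by (simp add: zero_prod_def) }
    { case 3 then show ?case using z by (simp add: zero_prod_def) }
    { case 4 then show ?case using z by (simp add: zero_prod_def) }
  next
    case (Suc n)
    { case 1 then show ?case using unit_partition_add[OF b(1) Suc(1)] by simp }
    { case 2 then show ?case using unit_partition_add[OF b(2) Suc(2)] by simp }
    { case 3 then show ?case using unit_partition_add[OF b(3) Suc(3)] by simp }
    { case 4 then show ?case using unit_partition_add[OF b(4) Suc(4)] by simp }
  qed
  have "\<exists>ts. unit_partition (m, 0) ts" "\<exists>ts. unit_partition (0, m) ts" for m
  proof -
    show "\<exists>ts. unit_partition (m, 0) ts" using n(1,2)[of "nat \<bar>m\<bar>"] by (cases "0 \<le> m") simp_all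
    show "\<exists>ts. unit_partition (0, m) ts" using n(3,4)[of "nat \<bar>m\<bar>"] by (cases "0 \<le> m") simp_all
  qed
  from unit_partition_add[OF this(1)[of "fst p"] this(2)[of "snd p"]] show ?thesis by simp
qed

text \<open>Elements of \<open>B\<close> on which, at the counit, only the root vector \<open>\<gamma>\<close> is nonzero.\<close>
fun coord :: "tang \<Rightarrow> fnl" where
  "coord (TE A1) = u 2 1 \<star> v 1 1"
| "coord (TE A2) = u 3 2 \<star> v 2 2"
| "coord (TE A12) = u 3 1 \<star> v 1 1"
| "coord (TF A1) = u 1 2 \<star> v 2 2"
| "coord (TF A2) = u 2 3 \<star> v 3 3"
| "coord (TF A12) = u 1 3 \<star> v 3 3"

lemma coord_W: "coord \<gamma> \<in> W 0"
proof -
  have "u i j \<star> v j j \<in> W 0" if "i \<in> {1..3}" "j \<in> {1..3}" for i j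
    using W_conv[OF u_W[OF that] v_W[OF that(2,2)]] by (simp del: eps.simps)
  then show ?thesis by (cases \<gamma> rule: tang6) simp_all
qed

lemma coord_left_weight: "left_weight (wt \<gamma>) (coord \<gamma>)"
proof -
  have "left_weight (eps i - eps j) (u i j \<star> v j j)" if "i \<in> {1..3}" "j \<in> {1..3}" for i j
    using left_weight_conv[OF left_weight_u[OF that] left_weight_v[OF that(2,2)]] by (simp del: eps.simps)
  from this[of 2 1] this[of 3 2] this[of 3 1] this[of 1 2] this[of 2 3] this[of 1 3]
  show ?thesis by (cases \<gamma> rule: tang6) simp_all
qed

lemma coord_evaluable: "evaluable (wt \<gamma>) 0 (coord \<gamma>)"
proof -
  have "evaluable (eps i - eps j) 0 (u i j \<star> v j j)" if "i \<in> {1..3}" "j \<in> {1..3}" for i j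
    using evaluable_conv[OF evaluable_u[OF that] evaluable_v[OF that(2,2)]] by (simp del: eps.simps)
  from this[of 2 1] this[of 3 2] this[of 3 1] this[of 1 2] this[of 2 3] this[of 1 3]
  show ?thesis by (cases \<gamma> rule: tang6) simp_all
qed

lemma coord_at_zero [simp]: "coord \<gamma> 0 = 0"
  by (cases \<gamma> rule: tang6) simp_all

lemma wt_inj: "wt \<gamma> = wt \<delta> \<Longrightarrow> \<gamma> = \<delta>"
  by (cases \<gamma> rule: tang6; cases \<delta> rule: tang6) simp_all

lemma tv_coord_same: "tv \<gamma> (coord \<gamma>) 0 \<noteq> 0"
  by (cases \<gamma> rule: tang6) (simp_all add: conv_linear, simp_all add: fscale_def)

text \<open>Different root vectors have different weights, so \<open>ev_zero\<close>
  applies.\<close>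

lemma tv_coord_other: "\<delta> \<noteq> \<gamma> \<Longrightarrow> tv \<delta> (coord \<gamma>) 0 = 0"
proof -
  assume "\<delta> \<noteq> \<gamma>"
  then have "wt \<gamma> \<noteq> 0 + wt \<delta>" using wt_inj[of \<gamma> \<delta>] by auto
  then show ?thesis by (rule ev_zero[OF tv_W[OF coord_W] tv_left_weight[OF coord_left_weight]])
qed

lemma pairing_tvec: "pairing (tvec q \<gamma>) f = tv \<gamma> f 0"
  unfolding act_tvec[symmetric] by (simp add: act_def)

text \<open>A multiple of \<open>coord \<gamma>\<close> shows that the choice in
  \<open>lam_right\<close> has a candidate. Any candidate gives the same result: it vanishes at the
  counit, so in the Leibniz rule only its prescribed first derivatives survive.\<close>

lemma lam_right_eq:
  assumes "a \<in> OA"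
  shows "lam_right q (lam_basis \<gamma>) a \<delta> = Nop \<gamma> \<delta> a 0"
proof -
  let ?P = "\<lambda>y. y \<in> OqSU3_plus q \<and> lam_class q y = lam_basis \<gamma>"
  let ?y0 = "fscale (inverse (tv \<gamma> (coord \<gamma>) 0)) (coord \<gamma>)"
  have "?P ?y0"
    using tv_coord_same[of \<gamma>] tv_coord_other[of _ \<gamma>] coord_W[of \<gamma>]
    by (auto simp: OqSU3_plus_def OqSU3_eq dual_counit_def lam_class_def lam_basis_def fun_eq_iff pairing_tvec W_OA OA_fscale)
      (simp_all add: fscale_def)
  then have P: "?P (SOME y. ?P y)" by (rule someI[of ?P])
  define y where "y = (SOME y. ?P y)"
  have y: "y \<in> OA" "y 0 = 0" "\<And>\<epsilon>. tv \<epsilon> y 0 = of_bool (\<epsilon> = \<gamma>)"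
    using P unfolding y_def[symmetric]
    by (auto simp: OqSU3_plus_def OqSU3_eq dual_counit_def lam_class_def lam_basis_def pairing_tvec fun_eq_iff)
  have "lam_right q (lam_basis \<gamma>) a \<delta> = tv \<delta> (y \<star> a) 0"
    by (simp add: lam_right_def lam_class_def pairing_tvec y_def)
  also have "\<dots> = (\<Sum>\<epsilon>\<in>UNIV. of_bool (\<epsilon> = \<gamma>) * Nop \<epsilon> \<delta> a 0)"
    using y assms by (simp add: tv_conv OA_D sum_apply)
  also have "\<dots> = Nop \<gamma> \<delta> a 0"
    by (simp add: of_bool_def if_distrib[of "\<lambda>x. x * _"] cong: if_cong)
  finally show ?thesis .
qed

text \<open>The right multiplication \<open>m a\<close> of a form by \<open>a \<in> A\<close>.\<close>
definition FR :: "form \<Rightarrow> fnl \<Rightarrow> form" where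
  "FR m a = (\<lambda>\<gamma>. \<Sum>\<delta>\<in>UNIV. m \<delta> \<star> Nop \<delta> \<gamma> a)"

text \<open>Being the action of a fixed element, \<open>Nop\<close> can be evaluated on the second
  Sweedler leg, which is how \<open>form_right\<close> uses it.\<close>

lemma Nop_act: "\<exists>X. \<forall>f. Nop \<delta> \<gamma> f = act X f"
proof -
  have 1: "\<exists>X. \<forall>f. kk r f = act X f" for r
  proof (cases r)
    case A1 show ?thesis by (rule exI[of _ "fw [K N1]"]) (simp add: A1 act_Cons)
  next
    case A2 show ?thesis by (rule exI[of _ "fw [K N2]"]) (simp add: A2 act_Cons)
  next
    case A12 show ?thesis by (rule exI[of _ "fw [K N2, K N1]"]) (simp add: A12 act_Cons)
  qed
  have 2: "\<exists>X. \<forall>f. act X f = 0" by (rule exI[of _ 0]) simp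
  have 3: "\<exists>X. \<forall>f. fscale c (rt (E N2) (rt (K N1) f)) = act X f" for c
    by (rule exI[of _ "scl c (fw [E N2, K N1])"]) (simp add: act_Cons act_scl)
  have 4: "\<exists>X. \<forall>f. fscale c (rt (K N2) (rt (F N2) (rt (K N1) f))) = act X f" for c
    by (rule exI[of _ "scl c (fw [K N2, F N2, K N1])"]) (simp add: act_Cons act_scl)
  show ?thesis by (cases \<delta> rule: tang6; cases \<gamma> rule: tang6; simp add: 1 2 3 4 del: kk.simps)
qed

lemma Nop_sweedler:
  assumes "is_coproduct c ts"
  shows "Nop \<delta> \<gamma> c = (\<Sum>t\<leftarrow>ts. fscale (Nop \<delta> \<gamma> (snd t) 0) (fst t))"
proof -
  obtain X where X: "\<forall>f. Nop \<delta> \<gamma> f = act X f" using Nop_act by blast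
  have "act X c = (\<Sum>t\<leftarrow>ts. fscale (act X (snd t) 0) (fst t))"
    using assms
    by (simp add: fun_eq_iff is_coproduct_def split_def sum_list_apply fscale_def act_def pairing_lsum
        lsum_fun_sum_list lsum_fun_scale lsum_fun_scale_right mult.commute)
  then show ?thesis using X by simp
qed

lemma form_right_eq: "c \<in> OA \<Longrightarrow> form_right q m c = FR m c"
proof
  fix \<delta>
  assume c: "c \<in> OA"
  let ?ts = "sweedler OA OA c"
  have ts: "set ?ts \<subseteq> OA \<times> OA" "is_coproduct c ?ts" using sweedler_OA[OF c] by auto
  have "(\<Sum>t\<leftarrow>?ts. fscale (lam_right q (lam_basis \<gamma>) (snd t) \<delta>) (m \<gamma> \<star> fst t)) = m \<gamma> \<star> Nop \<gamma> \<delta> c" for \<gamma>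
  proof -
    have "(\<Sum>t\<leftarrow>?ts. fscale (lam_right q (lam_basis \<gamma>) (snd t) \<delta>) (m \<gamma> \<star> fst t))
       = (\<Sum>t\<leftarrow>?ts. m \<gamma> \<star> fscale (Nop \<gamma> \<delta> (snd t) 0) (fst t))"
      using ts(1) by (intro arg_cong[where f = sum_list] map_cong) (auto simp: lam_right_eq conv_fscale_right)
    also have "\<dots> = m \<gamma> \<star> Nop \<gamma> \<delta> c"
      by (simp add: conv_sum_list_right[symmetric] Nop_sweedler[OF ts(2)])
    finally show ?thesis .
  qed
  then show "form_right q m c \<delta> = FR m c \<delta>"
    by (simp add: form_right_def FR_def OqSU3_eq split_def)
qed

lemma FR_add: "FR m (a + b) = FR m a + FR m b"
  and FR_diff: "FR m (a - b) = FR m a - FR m b"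
  and FR_form_add: "FR (m + n) a = FR m a + FR n a"
  and FR_left: "FR (form_left b m) a = form_left b (FR m a)"
  and FR_scale: "FR (form_scale c m) a = form_scale c (FR m a)"
  and FR_fscale: "FR m (fscale c a) = form_scale c (FR m a)"
  and FR_zero: "FR m 0 = 0"
  and FR_form_zero: "FR 0 a = 0"
  by (simp_all add: FR_def fun_eq_iff[where 'a = tang] form_left_def form_scale_def conv_add_right conv_add_left conv_diff_right sum.distrib
     sum_subtractf conv_assoc conv_sum_right conv_fscale_left conv_fscale_right fn.scale_sum_right)

lemma FR_unit: "FR m unit = m"
  by (simp add: FR_def Nop_unit fun_eq_iff[where 'a = tang] if_distrib[of "\<lambda>x. _ \<star> x"] cong: if_cong)

lemma FR_conv: "a \<in> D \<Longrightarrow> b \<in> D \<Longrightarrow> FR m (a \<star> b) = FR (FR m a) b"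
proof
  fix \<gamma>
  assume "a \<in> D" "b \<in> D"
  then have "FR m (a \<star> b) \<gamma> = (\<Sum>\<delta>\<in>UNIV. \<Sum>\<epsilon>\<in>UNIV. m \<delta> \<star> Nop \<delta> \<epsilon> a \<star> Nop \<epsilon> \<gamma> b)"
    by (simp add: FR_def Nop_conv conv_sum_right conv_assoc)
  also have "\<dots> = (\<Sum>\<epsilon>\<in>UNIV. \<Sum>\<delta>\<in>UNIV. m \<delta> \<star> Nop \<delta> \<epsilon> a \<star> Nop \<epsilon> \<gamma> b)"
    by (rule sum.swap)
  also have "\<dots> = FR (FR m a) b \<gamma>"
    by (simp add: FR_def conv_sum_left)
  finally show "FR m (a \<star> b) \<gamma> = FR (FR m a) b \<gamma>" .
qed

text \<open>The differential extended beyond A, so that the Leibniz rule can be stated on all of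
  \<open>D\<close>.\<close>

definition dd :: "fnl \<Rightarrow> form" where "dd a = (\<lambda>\<gamma>. tv \<gamma> a)"

lemma dif_eq: "a \<in> OA \<Longrightarrow> dif q a = dd a"
  by (simp add: dif_def dd_def lact_eq act_tvec)

lemma dd_conv: "a \<in> D \<Longrightarrow> b \<in> D \<Longrightarrow> dd (a \<star> b) = FR (dd a) b + form_left a (dd b)"
  by (simp add: dd_def FR_def form_left_def fun_eq_iff[where 'a = tang] tv_conv)

section \<open>One-forms over B as forms with coefficients of matching weight\<close>

abbreviation M :: "form set" where "M \<equiv> Omega1F3 q"

definition sing :: "tang \<Rightarrow> fnl \<Rightarrow> form" where "sing \<gamma> a = (\<lambda>\<delta>. if \<delta> = \<gamma> then a else 0)"

lemma M_W: "m \<in> M \<Longrightarrow> m \<gamma> \<in> W (wt \<gamma>)"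
proof (induction arbitrary: \<gamma> rule: Omega1F3.induct)
  case (dif b)
  then show ?case using tv_W[of b 0 \<gamma>] by (simp add: OqF3_eq dif_eq W_OA dd_def)
next
  case (add m n)
  show ?case using W_add[OF add.IH(1)[of \<gamma>] add.IH(2)[of \<gamma>]] unfolding plus_fun_def by simp
next
  case (left b m)
  then show ?case using W_conv[of b 0 "m \<gamma>" "wt \<gamma>"] by (simp add: form_left_def OqF3_eq)
next
  case (right b m)
  have "m \<delta> \<star> Nop \<delta> \<gamma> b \<in> W (wt \<gamma>)" for \<delta>
    using W_conv[OF right(3) Nop_W[of b 0 \<delta> \<gamma>], of \<delta>] right(1) by (simp add: OqF3_eq)
  then show ?case
    using right(1) by (simp add: OqF3_eq form_right_eq W_OA FR_def W_sum)
qed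

lemma M_zero: "0 \<in> M"
proof -
  have "form_left 0 (dif q unit) \<in> M"
    by (intro Omega1F3.intros) (simp_all add: OqF3_eq W_zero W_unit)
  moreover have "form_left 0 (dif q unit) = 0" by (simp add: form_left_def fun_eq_iff)
  ultimately show ?thesis by simp
qed

lemma M_sum_list: "(\<And>x. x \<in> set xs \<Longrightarrow> f x \<in> M) \<Longrightarrow> (\<Sum>x\<leftarrow>xs. f x) \<in> M"
  by (induction xs) (simp_all add: M_zero Omega1F3.add del: plus_fun_apply zero_fun_apply)

text \<open>Legs evaluating \<open>coord \<gamma>\<close> make the sum of the a_i db_i a multiple of
  e_\<gamma>, since no other root vector sees \<open>coord \<gamma>\<close>. The weight of
  \<open>a\<close> cancels that of the a_i, so the coefficients are in B.\<close>

lemma sing_M: "a \<in> W (wt \<gamma>) \<Longrightarrow> sing \<gamma> a \<in> M"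
proof -
  assume a: "a \<in> W (wt \<gamma>)"
  obtain ts where ts: "set ts \<subseteq> W (- wt \<gamma>) \<times> W 0" "evaluates (coord \<gamma>) ts"
    using coord_evaluable[of \<gamma>] unfolding evaluable_def by blast
  define a' where "a' = fscale (inverse (tv \<gamma> (coord \<gamma>) 0)) a"
  have a': "a' \<in> W (wt \<gamma>)" using a by (simp add: a'_def W_fscale)
  have "(\<Sum>t\<leftarrow>ts. form_left (a' \<star> fst t) (dif q (snd t))) \<in> M"
  proof (rule M_sum_list)
    fix t assume "t \<in> set ts"
    then have "fst t \<in> W (- wt \<gamma>)" "snd t \<in> W 0" using ts by auto
    then show "form_left (a' \<star> fst t) (dif q (snd t)) \<in> M"
      using W_conv[OF a', of "fst t" "- wt \<gamma>"] by (intro Omega1F3.intros) (simp_all add: OqF3_eq)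
  qed
  moreover have "(\<Sum>t\<leftarrow>ts. form_left (a' \<star> fst t) (dif q (snd t))) = sing \<gamma> a"
  proof
    fix \<delta>
    have "(\<Sum>t\<leftarrow>ts. form_left (a' \<star> fst t) (dif q (snd t))) \<delta> = (\<Sum>t\<leftarrow>ts. a' \<star> (fst t \<star> act (tvec q \<delta>) (snd t)))"
      using ts(1) by (subst sum_list_apply) (intro arg_cong[where f = sum_list] map_cong refl, auto simp: form_left_def dif_def lact_eq W_OA conv_assoc)
    also have "\<dots> = fscale (tv \<delta> (coord \<gamma>) 0) a'"
      by (simp add: conv_sum_list_right[symmetric] evaluates_general[OF ts(2)] conv_fscale_right pairing_tvec)
    also have "\<dots> = sing \<gamma> a \<delta>"
      using tv_coord_same[of \<gamma>] tv_coord_other[of \<delta> \<gamma>] by (simp add: sing_def a'_def)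
    finally show "(\<Sum>t\<leftarrow>ts. form_left (a' \<star> fst t) (dif q (snd t))) \<delta> = sing \<gamma> a \<delta>" .
  qed
  ultimately show ?thesis by simp
qed

text \<open>From here on membership in the inductively generated bimodule is a componentwise weight
  condition.\<close>

lemma M_iff: "m \<in> M \<longleftrightarrow> (\<forall>\<gamma>. m \<gamma> \<in> W (wt \<gamma>))"
proof
  assume *: "\<forall>\<gamma>. m \<gamma> \<in> W (wt \<gamma>)"
  have "m = (\<Sum>\<gamma>\<leftarrow>[TE A1, TE A2, TE A12, TF A1, TF A2, TF A12]. sing \<gamma> (m \<gamma>))"
    using tang_cases by (auto simp: fun_eq_iff[where 'a = tang] all_tang sing_def)
  also have "\<dots> \<in> M" using * by (intro M_sum_list sing_M) auto
  finally show "m \<in> M" .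
qed (use M_W in blast)

end

section \<open>Embedding the tensor algebra into \<open>A \<otimes> \<Lambda>\<^sup>1 \<otimes> \<dots> \<otimes> \<Lambda>\<^sup>1\<close>\<close>

declare plus_fun_apply [simp del] zero_fun_apply [simp del]

lemma single_fw: "Poly_Mapping.single k c = scl c (fw (letters k))"
  by (intro poly_mapping_eqI) (simp add: fw_def lookup_scl lookup_single when_def)

lemma free_alg_induct [case_names zero add scl word]:
  assumes "P 0" and "\<And>x y. P x \<Longrightarrow> P y \<Longrightarrow> P (x + y)" and "\<And>c x. P x \<Longrightarrow> P (scl c x)" and "\<And>ws. P (fw ws)"
  shows "P (x :: 'a free_alg)"
  by (induction x rule: poly_mapping_single_induct) (simp_all add: assms single_fw)

lemma scl_eq_mult: "scl c x = Poly_Mapping.single 0 c * (x :: 'a free_alg)"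
  unfolding scl_def by (rule mult_map_scale_conv_mult)

lemma scl_mult_left: "scl c x * y = scl c (x * y :: 'a free_alg)"
  by (simp add: scl_eq_mult mult.assoc)

lemma scl_mult_right: "x * scl c y = scl c (x * y :: 'a free_alg)"
proof -
  have "x * Poly_Mapping.single 0 c = Poly_Mapping.single 0 c * x"
    by (induction x rule: poly_mapping_single_induct) (simp_all add: distrib_left distrib_right mult_single mult.commute)
  then show ?thesis by (simp add: scl_eq_mult mult.assoc[symmetric])
qed

lemma lin_ext_superset:
  "finite S \<Longrightarrow> Poly_Mapping.keys z \<subseteq> S \<Longrightarrow> lin_ext g z = (\<Sum>k\<in>S. scl (Poly_Mapping.lookup z k) (g k))"
  unfolding lin_ext_def by (rule sum.mono_neutral_left) (auto simp: in_keys_iff)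

lemma lin_ext_add: "lin_ext g (x + y) = lin_ext g x + lin_ext g y"
  using lin_ext_superset[of "Poly_Mapping.keys x \<union> Poly_Mapping.keys y" x g]
    lin_ext_superset[of "Poly_Mapping.keys x \<union> Poly_Mapping.keys y" y g]
    lin_ext_superset[of "Poly_Mapping.keys x \<union> Poly_Mapping.keys y" "x + y" g]
    Poly_Mapping.keys_add[of x y]
  by (simp add: lookup_add formal.scale_left_distrib sum.distrib)

lemma lin_ext_zero [simp]: "lin_ext g 0 = 0"
  by (simp add: lin_ext_def)

lemma lin_ext_scl: "lin_ext g (scl c x) = scl c (lin_ext g x)"
proof -
  have "lin_ext g (scl c x) = (\<Sum>k\<in>Poly_Mapping.keys x. scl (Poly_Mapping.lookup (scl c x) k) (g k))"
    by (rule lin_ext_superset) (auto simp: in_keys_iff lookup_scl)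
  then show ?thesis by (simp add: lin_ext_def lookup_scl formal.scale_sum_right)
qed

lemma lin_ext_fw [simp]: "lin_ext g (fw ws) = g (FWord ws)"
  by (simp add: lin_ext_def fw_def)

lemma tensor_left_add: "tensor_left b (x + y) = tensor_left b x + tensor_left b y"
  and tensor_left_scl: "tensor_left b (scl c x) = scl c (tensor_left b x)"
  and tensor_left_zero [simp]: "tensor_left b 0 = 0"
  and tensor_left_fw: "tensor_left b (fw (m # ms)) = fw (form_left b m # ms)"
  by (simp_all add: tensor_left_def lin_ext_add lin_ext_scl)

lemma tensor_right_add: "tensor_right q (x + y) b = tensor_right q x b + tensor_right q y b"
  and tensor_right_scl: "tensor_right q (scl c x) b = scl c (tensor_right q x b)"
  and tensor_right_zero [simp]: "tensor_right q 0 b = 0"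
  and tensor_right_fw: "tensor_right q (fw (ms @ [m])) b = fw (ms @ [form_right q m b])"
  by (simp_all add: tensor_right_def lin_ext_add lin_ext_scl)

definition tl_set :: "nat \<Rightarrow> tang list set" where "tl_set n = {\<delta>s. length \<delta>s = n}"

lemma tl_set_0: "tl_set 0 = {[]}"
  by (auto simp: tl_set_def)

lemma finite_tl_set [simp]: "finite (tl_set n)"
  using finite_lists_length_eq[OF finite_tang, of n] by (simp add: tl_set_def)

lemma sum_tl_set_Suc: "(\<Sum>\<delta>s\<in>tl_set (Suc n). h \<delta>s) = (\<Sum>\<epsilon>\<in>UNIV. \<Sum>\<delta>s\<in>tl_set n. (h (\<epsilon> # \<delta>s) :: 'b::comm_monoid_add))"
proof -
  have "(\<Sum>\<epsilon>\<in>UNIV. \<Sum>\<delta>s\<in>tl_set n. h (\<epsilon> # \<delta>s)) = (\<Sum>(\<epsilon>, \<delta>s)\<in>UNIV \<times> tl_set n. h (\<epsilon> # \<delta>s))"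
    by (simp add: sum.cartesian_product)
  also have "\<dots> = (\<Sum>\<delta>s\<in>tl_set (Suc n). h \<delta>s)"
    by (rule sum.reindex_bij_witness[of _ "\<lambda>\<delta>s. (hd \<delta>s, List.tl \<delta>s)" "\<lambda>(\<epsilon>, \<delta>s). \<epsilon> # \<delta>s"])
      (auto simp: tl_set_def length_Suc_conv)
  finally show ?thesis by simp
qed

context sl3
begin

text \<open>The coefficient of \<open>e\<^bsub>\<gamma>\<^sub>1\<^esub> \<otimes> \<dots> \<otimes> e\<^bsub>\<gamma>\<^sub>n\<^esub>\<close> in a word of forms, after moving all coefficients to the left.\<close>
fun Ph :: "form list \<Rightarrow> tang list \<Rightarrow> fnl" where
  "Ph [] \<gamma>s = (if \<gamma>s = [] then unit else 0)"
| "Ph (m # ms) [] = 0"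
| "Ph (m # ms) (\<gamma> # \<gamma>s) = FR m (Ph ms \<gamma>s) \<gamma>"

definition Phi :: "form free_alg \<Rightarrow> tang list \<Rightarrow> fnl" where
  "Phi x \<gamma>s = (\<lambda>w. pairing x (\<lambda>k. Ph (letters k) \<gamma>s w))"

lemma Phi_add: "Phi (x + y) \<gamma>s = Phi x \<gamma>s + Phi y \<gamma>s"
  and Phi_diff: "Phi (x - y) \<gamma>s = Phi x \<gamma>s - Phi y \<gamma>s"
  and Phi_uminus: "Phi (- x) \<gamma>s = - Phi x \<gamma>s"
  and Phi_scl: "Phi (scl c x) \<gamma>s = fscale c (Phi x \<gamma>s)"
  and Phi_zero [simp]: "Phi 0 \<gamma>s = 0"
  and Phi_fw: "Phi (fw ms) \<gamma>s = Ph ms \<gamma>s"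
  by (simp_all add: Phi_def pairing_lsum lsum_add lsum_diff lsum_uminus lsum_scl fun_eq_iff fscale_def plus_fun_apply zero_fun_apply)

lemma Phi_sum_list: "Phi (\<Sum>x\<leftarrow>xs. f x) \<gamma>s = (\<Sum>x\<leftarrow>xs. Phi (f x) \<gamma>s)"
  by (induction xs) (simp_all add: Phi_add )

lemma form_scale_apply: "form_scale c m \<gamma> = fscale c (m \<gamma>)"
  by (simp add: form_scale_def)

lemma form_left_apply: "form_left b m \<gamma> = b \<star> m \<gamma>"
  by (simp add: form_left_def)

lemma FR_apply [simp]: "FR m 0 \<gamma> = 0" "FR m (a + b) \<gamma> = FR m a \<gamma> + FR m b \<gamma>" "FR m (a - b) \<gamma> = FR m a \<gamma> - FR m b \<gamma>"
    "FR (m + n) a \<gamma> = FR m a \<gamma> + FR n a \<gamma>" "FR m (fscale c a) \<gamma> = fscale c (FR m a \<gamma>)"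
    "FR (form_scale c m) a \<gamma> = fscale c (FR m a \<gamma>)" "FR (form_left b m) a \<gamma> = b \<star> FR m a \<gamma>"
  by (simp_all add: FR_zero FR_add FR_diff FR_form_add FR_fscale FR_scale FR_left form_scale_apply form_left_apply zero_fun_apply plus_fun_apply)

lemma Phi_Cons: "Phi (fw [m] * x) (\<gamma> # \<gamma>s) = FR m (Phi x \<gamma>s) \<gamma>"
proof (induction x rule: free_alg_induct)
  case (scl c x)
  then show ?case by (simp add: scl_mult_right Phi_scl)
qed (simp_all add: fw_mult Phi_fw distrib_left Phi_add)

lemma Phi_Cons_Nil: "Phi (fw [m] * x) [] = 0"
proof (induction x rule: free_alg_induct)
  case (word ws)
  show ?case by (simp add: fw_mult Phi_fw)
qed (simp_all add: distrib_left Phi_add scl_mult_right Phi_scl )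

lemma fw_Cons: "fw (m # ms) = fw [m] * fw ms"
  by (simp add: fw_mult)

text \<open>The bound \<open>k\<close> is kept because elements of the ideal have vanishing
  coordinates only in low degrees; each prefixed letter raises the bound by one.\<close>

lemma Phi_prefix_zero:
  assumes "\<And>\<gamma>s. length \<gamma>s \<le> k \<Longrightarrow> Phi x \<gamma>s = 0"
  shows "length \<gamma>s \<le> k + length ms \<Longrightarrow> Phi (fw ms * x) \<gamma>s = 0"
proof (induction ms arbitrary: \<gamma>s)
  case Nil
  then show ?case by (simp add: assms fw_Nil)
next
  case (Cons m ms)
  have e: "fw (m # ms) * x = fw [m] * (fw ms * x)"
    by (metis fw_Cons mult.assoc)
  show ?case
  proof (cases \<gamma>s)
    case (Cons \<gamma> \<delta>s)
    then show ?thesis using Cons.IH[of \<delta>s] Cons.prems by (simp add: e Phi_Cons)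
  qed (simp add: e Phi_Cons_Nil)
qed

lemma Phi_prefix_zero_all:
  assumes "\<And>\<gamma>s. Phi x \<gamma>s = 0"
  shows "Phi (fw ms * x) \<gamma>s = 0"
  using Phi_prefix_zero[of "length \<gamma>s" x \<gamma>s ms] assms by simp

definition wts :: "tang list \<Rightarrow> int \<times> int" where "wts \<gamma>s = sum_list (map wt \<gamma>s)"

lemma wts_simps [simp]: "wts [] = 0" "wts (\<gamma> # \<gamma>s) = wt \<gamma> + wts \<gamma>s" "wts (\<gamma>s @ \<delta>s) = wts \<gamma>s + wts \<delta>s"
  by (simp_all add: wts_def)

lemma FR_W: "m \<in> M \<Longrightarrow> a \<in> W p \<Longrightarrow> FR m a \<gamma> \<in> W (wt \<gamma> + p)"
proof -
  assume m: "m \<in> M" and a: "a \<in> W p"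
  have "m \<delta> \<star> Nop \<delta> \<gamma> a \<in> W (wt \<gamma> + p)" for \<delta>
    using W_conv[OF M_W[OF m] Nop_W[OF a], of \<delta> \<delta> \<gamma>] by (simp add: algebra_simps)
  then show ?thesis by (simp add: FR_def W_sum)
qed

lemma Ph_W: "set ms \<subseteq> M \<Longrightarrow> Ph ms \<gamma>s \<in> W (wts \<gamma>s)"
proof (induction ms arbitrary: \<gamma>s)
  case Nil
  then show ?case by (simp add: W_unit W_zero)
next
  case (Cons m ms)
  then show ?case by (cases \<gamma>s) (simp_all add: W_zero FR_W)
qed

lemma Ph_D: "set ms \<subseteq> M \<Longrightarrow> Ph ms \<gamma>s \<in> D"
  using Ph_W W_D by blast

lemma Ph_length: "length ms \<noteq> length \<gamma>s \<Longrightarrow> Ph ms \<gamma>s = 0"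
proof (induction ms arbitrary: \<gamma>s)
  case (Cons m ms)
  then show ?case by (cases \<gamma>s) simp_all
qed auto

section \<open>The tensor algebra modulo linearity and balancing\<close>

definition Nul :: "form free_alg set" where "Nul = {x. (0, x) \<in> tensor_null q}"

definition T :: "form free_alg set" where "T = formal.span {fw ms | ms. ms \<noteq> [] \<and> set ms \<subseteq> M}"

definition TW :: "nat \<Rightarrow> form free_alg set" where "TW n = formal.span {fw ms | ms. length ms = n \<and> set ms \<subseteq> M}"

lemma TW_T: "TW (Suc n) \<subseteq> T"
  unfolding T_def TW_def by (rule formal.span_mono) auto

lemma T_fw: "ms \<noteq> [] \<Longrightarrow> set ms \<subseteq> M \<Longrightarrow> fw ms \<in> T"
  unfolding T_def by (rule formal.span_base) blast

lemma TW_fw: "length ms = n \<Longrightarrow> set ms \<subseteq> M \<Longrightarrow> fw ms \<in> TW n"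
  unfolding TW_def by (rule formal.span_base) blast

lemma T_induct [consumes 1, case_names zero add scl word]:
  assumes "x \<in> T" and "P 0" and "\<And>x y. x \<in> T \<Longrightarrow> y \<in> T \<Longrightarrow> P x \<Longrightarrow> P y \<Longrightarrow> P (x + y)"
    and "\<And>c x. x \<in> T \<Longrightarrow> P x \<Longrightarrow> P (scl c x)" and "\<And>m ms. m \<in> M \<Longrightarrow> set ms \<subseteq> M \<Longrightarrow> P (fw (m # ms))"
  shows "P x"
proof -
  have "x \<in> T \<and> P x"
    using assms(1) unfolding T_def
  proof (induction rule: formal.span_induct)
    case (step x)
    then obtain ms where "x = fw ms" "ms \<noteq> []" "set ms \<subseteq> M" by blast
    then show ?case using assms(5) T_fw[of ms] unfolding T_def by (cases ms) auto
  next
    case base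
    show ?case
      using assms(2,3,4) unfolding formal.subspace_def T_def
      by (auto intro: formal.span_zero formal.span_add formal.span_scale)
  qed
  then show ?thesis ..
qed

lemma TW_induct [consumes 1, case_names zero add scl word]:
  assumes "x \<in> TW n" and "P 0" and "\<And>x y. x \<in> TW n \<Longrightarrow> y \<in> TW n \<Longrightarrow> P x \<Longrightarrow> P y \<Longrightarrow> P (x + y)"
    and "\<And>c x. x \<in> TW n \<Longrightarrow> P x \<Longrightarrow> P (scl c x)" and "\<And>ms. length ms = n \<Longrightarrow> set ms \<subseteq> M \<Longrightarrow> P (fw ms)"
  shows "P x"
proof -
  have "x \<in> TW n \<and> P x"
    using assms(1) unfolding TW_def
  proof (induction rule: formal.span_induct)
    case (step x)
    then obtain ms where "x = fw ms" "length ms = n" "set ms \<subseteq> M" by blast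
    then show ?case using assms(5) TW_fw[of ms n] unfolding TW_def by auto
  next
    case base
    show ?case
      using assms(2,3,4) unfolding formal.subspace_def TW_def
      by (auto intro: formal.span_zero formal.span_add formal.span_scale)
  qed
  then show ?thesis ..
qed

lemma T_closed: "0 \<in> T" "x \<in> T \<Longrightarrow> y \<in> T \<Longrightarrow> x + y \<in> T" "x \<in> T \<Longrightarrow> scl c x \<in> T" "x \<in> T \<Longrightarrow> y \<in> T \<Longrightarrow> x - y \<in> T"
  unfolding T_def by (auto intro: formal.span_zero formal.span_add formal.span_scale formal.span_diff)

lemma TW_closed: "0 \<in> TW n" "x \<in> TW n \<Longrightarrow> y \<in> TW n \<Longrightarrow> x + y \<in> TW n" "x \<in> TW n \<Longrightarrow> scl c x \<in> TW n"
   "x \<in> TW n \<Longrightarrow> y \<in> TW n \<Longrightarrow> x - y \<in> TW n"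
  unfolding TW_def by (auto intro: formal.span_zero formal.span_add formal.span_scale formal.span_diff)

lemma TW_mult: "x \<in> TW n \<Longrightarrow> y \<in> TW k \<Longrightarrow> x * y \<in> TW (n + k)"
proof (induction rule: TW_induct)
  case (word ms)
  from word(3) show ?case
    by (induction rule: TW_induct) (simp_all add: TW_closed distrib_left scl_mult_right fw_mult TW_fw word)
qed (simp_all add: TW_closed distrib_right scl_mult_left)

lemma T_mult: "x \<in> T \<Longrightarrow> y \<in> T \<Longrightarrow> x * y \<in> T"
proof (induction rule: T_induct)
  case (word m ms)
  from word(3) show ?case
    by (induction rule: T_induct) (simp_all add: T_closed distrib_left scl_mult_right fw_mult T_fw word)
qed (simp_all add: T_closed distrib_right scl_mult_left)

lemma Nul_closed: "0 \<in> Nul" "x \<in> Nul \<Longrightarrow> y \<in> Nul \<Longrightarrow> x + y \<in> Nul" "x \<in> Nul \<Longrightarrow> scl c x \<in> Nul" "x \<in> Nul \<Longrightarrow> y \<in> Nul \<Longrightarrow> x - y \<in> Nul"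
  unfolding Nul_def tensor_null_def
  by (auto intro: formal.span_zero formal.span_add formal.span_scale formal.span_diff)

lemma Nul_add_gen: "set ms \<subseteq> M \<Longrightarrow> m \<in> M \<Longrightarrow> n \<in> M \<Longrightarrow> set ns \<subseteq> M \<Longrightarrow>
    fw (ms @ [m + n] @ ns) - fw (ms @ [m] @ ns) - fw (ms @ [n] @ ns) \<in> Nul"
  unfolding Nul_def tensor_null_def by (simp, rule formal.span_base, blast)

lemma Nul_scale_gen: "set ms \<subseteq> M \<Longrightarrow> m \<in> M \<Longrightarrow> set ns \<subseteq> M \<Longrightarrow>
    fw (ms @ [form_scale c m] @ ns) - scl c (fw (ms @ [m] @ ns)) \<in> Nul"
  unfolding Nul_def tensor_null_def by (simp, rule formal.span_base, blast)

lemma Nul_bal_gen: "b \<in> W 0 \<Longrightarrow> set ms \<subseteq> M \<Longrightarrow> m \<in> M \<Longrightarrow> n \<in> M \<Longrightarrow> set ns \<subseteq> M \<Longrightarrow>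
    fw (ms @ [FR m b, n] @ ns) - fw (ms @ [m, form_left b n] @ ns) \<in> Nul"
proof -
  assume *: "b \<in> W 0" "set ms \<subseteq> M" "m \<in> M" "n \<in> M" "set ns \<subseteq> M"
  have "FR m b = form_right q m b" "b \<in> OqF3 q" using *(1) by (simp_all add: form_right_eq W_OA OqF3_eq)
  then show ?thesis
    using * unfolding Nul_def tensor_null_def by (simp, intro formal.span_base, blast)
qed

lemma Nul_induct [consumes 1, case_names zero add scl gadd gscale gbal]:
  assumes "x \<in> Nul" and "P 0" and "\<And>x y. P x \<Longrightarrow> P y \<Longrightarrow> P (x + y)" and "\<And>c x. P x \<Longrightarrow> P (scl c x)"
    and "\<And>ms m n ns. set ms \<subseteq> M \<Longrightarrow> m \<in> M \<Longrightarrow> n \<in> M \<Longrightarrow> set ns \<subseteq> M \<Longrightarrow>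
       P (fw (ms @ [m + n] @ ns) - fw (ms @ [m] @ ns) - fw (ms @ [n] @ ns))"
    and "\<And>ms m c ns. set ms \<subseteq> M \<Longrightarrow> m \<in> M \<Longrightarrow> set ns \<subseteq> M \<Longrightarrow> P (fw (ms @ [form_scale c m] @ ns) - scl c (fw (ms @ [m] @ ns)))"
    and "\<And>b ms m n ns. b \<in> W 0 \<Longrightarrow> set ms \<subseteq> M \<Longrightarrow> m \<in> M \<Longrightarrow> n \<in> M \<Longrightarrow> set ns \<subseteq> M \<Longrightarrow>
       P (fw (ms @ [FR m b, n] @ ns) - fw (ms @ [m, form_left b n] @ ns))"
  shows "P x"
proof -
  have "x \<in> formal.span (
     {fw (ms @ [m + n] @ ns) - fw (ms @ [m] @ ns) - fw (ms @ [n] @ ns) | ms m n ns.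
        set ms \<subseteq> M \<and> m \<in> M \<and> n \<in> M \<and> set ns \<subseteq> M}
   \<union> {fw (ms @ [form_scale c m] @ ns) - scl c (fw (ms @ [m] @ ns)) | c ms m ns.
        set ms \<subseteq> M \<and> m \<in> M \<and> set ns \<subseteq> M}
   \<union> {fw (ms @ [form_right q m b, n] @ ns) - fw (ms @ [m, form_left b n] @ ns) | b ms m n ns.
        b \<in> OqF3 q \<and> set ms \<subseteq> M \<and> m \<in> M \<and> n \<in> M
        \<and> set ns \<subseteq> M})" (is "_ \<in> formal.span ?G")
    using assms(1) unfolding Nul_def tensor_null_def by blast
  then show ?thesis
  proof (induction rule: formal.span_induct)
    case (step x)
    then show ?case
    proof (elim UnE)
      assume "x \<in> {fw (ms @ [form_right q m b, n] @ ns) - fw (ms @ [m, form_left b n] @ ns) | b ms m n ns.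
        b \<in> OqF3 q \<and> set ms \<subseteq> M \<and> m \<in> M \<and> n \<in> M \<and> set ns \<subseteq> M}"
      then obtain b ms m n ns where x: "x = fw (ms @ [form_right q m b, n] @ ns) - fw (ms @ [m, form_left b n] @ ns)"
        "b \<in> OqF3 q" "set ms \<subseteq> M" "m \<in> M" "n \<in> M" "set ns \<subseteq> M" by blast
      have b: "b \<in> W 0" using x(2) unfolding OqF3_eq .
      show "P x" using assms(7)[OF b x(3-6)] x(1) unfolding form_right_eq[OF W_OA[OF b]] by simp
    qed (use assms(5,6) in blast)+
  next
    case base
    show ?case using assms(2-4) unfolding formal.subspace_def by blast
  qed
qed

lemma FR_M: "m \<in> M \<Longrightarrow> b \<in> W 0 \<Longrightarrow> FR m b \<in> M"
  using FR_W[of m b 0] by (simp add: M_iff)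

lemma left_M: "m \<in> M \<Longrightarrow> b \<in> W 0 \<Longrightarrow> form_left b m \<in> M"
  using Omega1F3.left[of b q m] by (simp add: OqF3_eq)

lemma add_M: "m \<in> M \<Longrightarrow> n \<in> M \<Longrightarrow> m + n \<in> M"
  by (rule Omega1F3.add)

lemma scale_M: "m \<in> M \<Longrightarrow> form_scale c m \<in> M"
  by (simp add: M_iff form_scale_apply W_fscale)

lemma Nul_T: "x \<in> Nul \<Longrightarrow> x \<in> T"
  by (induction rule: Nul_induct) (simp_all add: T_closed T_fw add_M scale_M FR_M left_M)

lemma Nul_mult_word_left: "x \<in> Nul \<Longrightarrow> set ks \<subseteq> M \<Longrightarrow> fw ks * x \<in> Nul"
proof (induction rule: Nul_induct)
  case (gadd ms m n ns)
  then show ?case using Nul_add_gen[of "ks @ ms" m n ns] by (simp add: right_diff_distrib fw_mult)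
next
  case (gscale ms m c ns)
  then show ?case using Nul_scale_gen[of "ks @ ms" m ns c] by (simp add: right_diff_distrib fw_mult scl_mult_right)
next
  case (gbal b ms m n ns)
  then show ?case using Nul_bal_gen[of b "ks @ ms" m n ns] by (simp add: right_diff_distrib fw_mult)
qed (simp_all add: Nul_closed distrib_left scl_mult_right)

text \<open>The linear relations are immediate; for balancing over B the point is that forms are a
  right A-module (\<open>FR_conv\<close>). So the coordinates are well defined on the tensor
  algebra.\<close>

lemma Phi_Nul: "x \<in> Nul \<Longrightarrow> Phi x \<gamma>s = 0"
proof (induction arbitrary: \<gamma>s rule: Nul_induct)
  case (gadd ms m n ns)
  have "Phi (fw ([m + n] @ ns) - fw ([m] @ ns) - fw ([n] @ ns)) \<gamma>s = 0" for \<gamma>s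
    by (cases \<gamma>s) (simp_all add: Phi_diff Phi_fw)
  from Phi_prefix_zero_all[OF this, of ms \<gamma>s] show ?case by (simp add: right_diff_distrib fw_mult)
next
  case (gscale ms m c ns)
  have "Phi (fw ([form_scale c m] @ ns) - scl c (fw ([m] @ ns))) \<gamma>s = 0" for \<gamma>s
    by (cases \<gamma>s) (simp_all add: Phi_diff Phi_scl Phi_fw)
  from Phi_prefix_zero_all[OF this, of ms \<gamma>s] show ?case by (simp add: right_diff_distrib fw_mult scl_mult_right)
next
  case (gbal b ms m n ns)
  have "Phi (fw ([FR m b, n] @ ns) - fw ([m, form_left b n] @ ns)) \<gamma>s = 0" for \<gamma>s
  proof (cases \<gamma>s)
    case (Cons \<gamma> \<delta>s)
    show ?thesis
    proof (cases \<delta>s)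
      case (Cons \<delta> \<epsilon>s)
      have "FR n (Ph ns \<epsilon>s) \<delta> \<in> D" using FR_W[OF gbal(4) Ph_W[OF gbal(5)]] W_D by blast
      then show ?thesis using Cons \<open>\<gamma>s = _\<close> gbal W_D
        by (simp add: Phi_diff Phi_fw FR_conv)
    qed (simp add: \<open>\<gamma>s = _\<close> Phi_diff Phi_fw)
  qed (simp add: Phi_diff Phi_fw)
  from Phi_prefix_zero_all[OF this, of ms \<gamma>s] show ?case by (simp add: right_diff_distrib fw_mult)
qed (simp_all add: Phi_add Phi_scl )

section \<open>Coordinates of products\<close>

fun PhA :: "form list \<Rightarrow> fnl \<Rightarrow> tang list \<Rightarrow> fnl" where
  "PhA [] a \<gamma>s = (if \<gamma>s = [] then a else 0)"
| "PhA (m # ms) a [] = 0"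
| "PhA (m # ms) a (\<gamma> # \<gamma>s) = FR m (PhA ms a \<gamma>s) \<gamma>"

text \<open>The matrix of the right action of A on a tensor power of Lambda^1: a coefficient coming
  from the right passes the last letter first. Words of different lengths are unrelated.\<close>

fun Mop :: "tang list \<Rightarrow> tang list \<Rightarrow> fnl \<Rightarrow> fnl" where
  "Mop [] [] a = a"
| "Mop (\<delta> # \<delta>s) (\<gamma> # \<gamma>s) a = Nop \<delta> \<gamma> (Mop \<delta>s \<gamma>s a)"
| "Mop _ _ a = 0"

definition RA :: "(tang list \<Rightarrow> fnl) \<Rightarrow> fnl \<Rightarrow> tang list \<Rightarrow> fnl" where
  "RA t a \<gamma>s = (\<Sum>\<delta>s\<in>tl_set (length \<gamma>s). t \<delta>s \<star> Mop \<delta>s \<gamma>s a)"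

lemma Mop_D: "a \<in> OA \<Longrightarrow> Mop \<delta>s \<gamma>s a \<in> OA"
  by (induction \<delta>s \<gamma>s a rule: Mop.induct) (simp_all add: Nop_OA OA_zero)

text \<open>\<open>PhA\<close> carries a coefficient where \<open>Ph\<close> ends in the unit, so a
  word can be cut anywhere and its right part treated as one coefficient.\<close>

lemma Ph_append: "length \<gamma>s = length ms \<Longrightarrow> Ph (ms @ ns) (\<gamma>s @ \<delta>s) = PhA ms (Ph ns \<delta>s) \<gamma>s"
proof (induction ms arbitrary: \<gamma>s)
  case (Cons m ms)
  then show ?case by (cases \<gamma>s) simp_all
qed simp

lemma PhA_append: "length \<gamma>s = length ms \<Longrightarrow> PhA (ms @ ns) a (\<gamma>s @ \<delta>s) = PhA ms (PhA ns a \<delta>s) \<gamma>s"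
proof (induction ms arbitrary: \<gamma>s)
  case (Cons m ms)
  then show ?case by (cases \<gamma>s) simp_all
qed simp

lemma FR_sum: "FR m (\<Sum>i\<in>I. f i) \<gamma> = (\<Sum>i\<in>I. FR m (f i) \<gamma>)"
  by (induction I rule: infinite_finite_induct) simp_all

lemma PhA_RA: "set ms \<subseteq> M \<Longrightarrow> a \<in> OA \<Longrightarrow> PhA ms a \<gamma>s = RA (Ph ms) a \<gamma>s"
proof (induction ms arbitrary: \<gamma>s)
  case Nil
  show ?case
  proof (cases \<gamma>s)
    case (Cons \<gamma> \<gamma>s')
    then have "RA (Ph []) a \<gamma>s = 0"
      unfolding RA_def by (intro sum.neutral) (auto simp: tl_set_def)
    then show ?thesis using Cons by (simp del: Ph.simps)
  qed (simp add: RA_def tl_set_0)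
next
  case (Cons m ms)
  show ?case
  proof (cases \<gamma>s)
    case Nil
    then show ?thesis by (simp add: RA_def tl_set_0)
  next
    case (Cons \<gamma> \<gamma>s')
    have "PhA (m # ms) a \<gamma>s = (\<Sum>\<delta>s\<in>tl_set (length \<gamma>s'). FR m (Ph ms \<delta>s \<star> Mop \<delta>s \<gamma>s' a) \<gamma>)"
      using Cons Cons.IH[of \<gamma>s'] Cons.prems by (simp add: RA_def FR_sum)
    also have "\<dots> = (\<Sum>\<delta>s\<in>tl_set (length \<gamma>s'). \<Sum>\<epsilon>\<in>UNIV. FR m (Ph ms \<delta>s) \<epsilon> \<star> Nop \<epsilon> \<gamma> (Mop \<delta>s \<gamma>s' a))"
      using Cons.prems by (intro sum.cong refl) (simp add: FR_conv Ph_D Mop_D OA_D, simp add: FR_def)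
    also have "\<dots> = (\<Sum>\<epsilon>\<in>UNIV. \<Sum>\<delta>s\<in>tl_set (length \<gamma>s'). FR m (Ph ms \<delta>s) \<epsilon> \<star> Nop \<epsilon> \<gamma> (Mop \<delta>s \<gamma>s' a))"
      by (rule sum.swap)
    also have "\<dots> = RA (Ph (m # ms)) a \<gamma>s"
      using Cons by (simp add: RA_def sum_tl_set_Suc)
    finally show ?thesis .
  qed
qed

lemma RA_add: "RA (\<lambda>\<gamma>s. s \<gamma>s + t \<gamma>s) a \<gamma>s = RA s a \<gamma>s + RA t a \<gamma>s"
  and RA_fscale: "RA (\<lambda>\<gamma>s. fscale c (t \<gamma>s)) a \<gamma>s = fscale c (RA t a \<gamma>s)"
  and RA_zero: "RA (\<lambda>\<gamma>s. 0) a \<gamma>s = 0"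
  by (simp_all add: RA_def conv_add_left sum.distrib conv_fscale_left fn.scale_sum_right)

text \<open>The coefficient of the right factor has to pass through all letters of the left one,
  hence \<open>RA\<close>.\<close>

lemma Phi_mult_word:
  assumes "x \<in> T" and "set ns \<subseteq> M" and "length \<delta>s = length ns"
  shows "Phi (x * fw ns) (\<gamma>s @ \<delta>s) = RA (Phi x) (Ph ns \<delta>s) \<gamma>s"
  using assms(1)
proof (induction rule: T_induct)
  case (word m ms)
  let ?ms = "m # ms"
  have "Ph (?ms @ ns) (\<gamma>s @ \<delta>s) = RA (Ph ?ms) (Ph ns \<delta>s) \<gamma>s"
  proof (cases "length \<gamma>s = length ?ms")
    case True
    then show ?thesis
      using word Ph_append[OF True, of ns \<delta>s] PhA_RA[of ?ms "Ph ns \<delta>s" \<gamma>s] W_OA[OF Ph_W[OF assms(2)]] by (simp del: Ph.simps PhA.simps)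
  next
    case False
    then have "RA (Ph ?ms) (Ph ns \<delta>s) \<gamma>s = 0"
      unfolding RA_def by (intro sum.neutral) (auto simp: tl_set_def Ph_length simp del: Ph.simps)
    moreover have "Ph (?ms @ ns) (\<gamma>s @ \<delta>s) = 0"
      using False assms(3) by (intro Ph_length) simp
    ultimately show ?thesis by simp
  qed
  then show ?case by (simp add: fw_mult Phi_fw[abs_def] del: Ph.simps)
qed (simp_all add: RA_zero distrib_right Phi_add[abs_def] RA_add scl_mult_left Phi_scl[abs_def] RA_fscale Phi_zero[abs_def])

lemma Phi_tensor_right:
  assumes "x \<in> T" and "b \<in> OA"
  shows "Phi (tensor_right q x b) \<gamma>s = RA (Phi x) b \<gamma>s"
  using assms(1)
proof (induction rule: T_induct)
  case (word m ms)
  obtain ns n where e: "m # ms = ns @ [n]" by (metis list.distinct(1) rev_exhaust)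
  have sub: "set (ns @ [n]) \<subseteq> M" using word e by (metis insert_subset list.simps(15))
  have "Ph (ns @ [FR n b]) \<gamma>s = PhA (ns @ [n]) b \<gamma>s"
  proof (cases "length \<gamma>s = Suc (length ns)")
    case True
    then obtain \<gamma>s' \<gamma> where g: "\<gamma>s = \<gamma>s' @ [\<gamma>]" "length \<gamma>s' = length ns"
      by (metis length_Suc_conv_rev)
    then show ?thesis by (simp add: Ph_append PhA_append FR_unit)
  next
    case False
    then have "RA (Ph (ns @ [n])) b \<gamma>s = 0"
      unfolding RA_def by (intro sum.neutral) (auto simp: tl_set_def Ph_length simp del: Ph.simps)
    then show ?thesis using False PhA_RA[OF sub assms(2)] Ph_length[of "ns @ [FR n b]" \<gamma>s] by simp
  qed
  then show ?case
    using PhA_RA[OF sub assms(2)] unfolding e tensor_right_fw form_right_eq[OF assms(2)] by (simp add: Phi_fw[abs_def])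
qed (simp_all add: RA_zero tensor_right_add tensor_right_scl Phi_add[abs_def] RA_add Phi_scl[abs_def] RA_fscale Phi_zero[abs_def])

lemma Phi_tensor_left: "x \<in> T \<Longrightarrow> Phi (tensor_left b x) \<gamma>s = b \<star> Phi x \<gamma>s"
proof (induction rule: T_induct)
  case (word m ms)
  then show ?case by (cases \<gamma>s) (simp_all add: tensor_left_fw Phi_fw)
qed (simp_all add: tensor_left_add tensor_left_scl Phi_add Phi_scl conv_linear)

lemma D_closed [simp]: "0 \<in> D" "f \<in> D \<Longrightarrow> g \<in> D \<Longrightarrow> f + g \<in> D" "f \<in> D \<Longrightarrow> fscale c f \<in> D" "f \<in> D \<Longrightarrow> g \<in> D \<Longrightarrow> f - g \<in> D"
  using Uq_dual_add[of f q "- g"] Uq_dual_fscale[of g q "- 1"]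
  by (simp_all add: Uq_dual_zero Uq_dual_add Uq_dual_fscale)

section \<open>Right coordinates, a dual basis and injectivity\<close>

fun ki :: "posroot \<Rightarrow> fnl \<Rightarrow> fnl" where
  "ki A1 f = rt (Kinv N1) f"
| "ki A2 f = rt (Kinv N2) f"
| "ki A12 f = rt (Kinv N1) (rt (Kinv N2) f)"

lemma ki_linear [simp]: "ki r (f + g) = ki r f + ki r g" "ki r (f - g) = ki r f - ki r g" "ki r 0 = 0"
  "ki r (fscale c f) = fscale c (ki r f)"
  by (cases r; simp)+

lemma ki_D [simp]: "f \<in> D \<Longrightarrow> ki r f \<in> D"
  by (cases r) simp_all

lemma kk_D [simp]: "f \<in> D \<Longrightarrow> kk r f \<in> D"
  by (cases r) simp_all

lemma Nop_D [simp]: "f \<in> D \<Longrightarrow> Nop \<delta> \<gamma> f \<in> D"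
  by (cases \<delta>; cases \<gamma>) simp_all

lemma ki_W: "f \<in> W p \<Longrightarrow> ki r f \<in> W p"
  by (cases r) (simp_all add: W_rt_Kinv)

lemma ki_kk [simp]: "f \<in> D \<Longrightarrow> ki r (kk r f) = f" "f \<in> D \<Longrightarrow> kk r (ki r f) = f"
  by (cases r; simp)+

text \<open>Coordinates with respect to the basis \<open>e\<^sub>\<gamma>\<close> of \<open>A \<otimes> \<Lambda>\<^sup>1\<close> as a right \<open>A\<close>-module.\<close>
fun right_coord :: "form \<Rightarrow> tang \<Rightarrow> fnl" where
  "right_coord t (TE r) = ki r (t (TE r) - (if r = A12 then Nop (TE A1) (TE A12) (ki A1 (t (TE A1))) else 0))"
| "right_coord t (TF r) = ki r (t (TF r) - (if r = A12 then Nop (TF A1) (TF A12) (ki A1 (t (TF A1))) else 0))"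

lemma right_coord_linear: "right_coord (\<lambda>\<delta>. s \<delta> + t \<delta>) \<gamma> = right_coord s \<gamma> + right_coord t \<gamma>" "right_coord (\<lambda>\<delta>. fscale c (t \<delta>)) \<gamma> = fscale c (right_coord t \<gamma>)" "right_coord (\<lambda>\<delta>. 0) \<gamma> = 0"
  by (cases \<gamma>; simp del: ki.simps Nop.simps add: fn.scale_right_diff_distrib)+

text \<open>The matrix \<open>Nop\<close> has invertible diagonal and one off-diagonal entry for
  each sign, so a single back substitution inverts it.\<close>

lemma right_coord_sum_Nop:
  assumes "\<And>\<gamma>. t \<gamma> \<in> D"
  shows "right_coord (\<lambda>\<delta>. \<Sum>\<gamma>\<in>UNIV. Nop \<gamma> \<delta> (t \<gamma>)) \<gamma> = t \<gamma>"
  by (cases \<gamma> rule: tang6) (simp_all add: sum_tang assms del: ki.simps kk.simps)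

lemma sum_Nop_right_coord:
  assumes "\<And>\<gamma>. t \<gamma> \<in> D"
  shows "(\<Sum>\<gamma>\<in>UNIV. Nop \<gamma> \<delta> (right_coord t \<gamma>)) = t \<delta>"
  by (cases \<delta> rule: tang6) (simp_all add: sum_tang assms del: ki.simps kk.simps)

lemma right_coord_W: "m \<in> M \<Longrightarrow> right_coord m \<gamma> \<in> W (wt \<gamma>)"
proof -
  assume m: "m \<in> M"
  have "Nop (TE A1) (TE A12) (ki A1 (m (TE A1))) \<in> W (wt (TE A12))" "Nop (TF A1) (TF A12) (ki A1 (m (TF A1))) \<in> W (wt (TF A12))"
    using Nop_W[OF ki_W[OF M_W[OF m]], of "TE A1" "TE A12" A1 "TE A1"] Nop_W[OF ki_W[OF M_W[OF m]], of "TF A1" "TF A12" A1 "TF A1"]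
    by (simp_all del: wt.simps Nop.simps ki.simps)
  then show ?thesis
    using m by (cases \<gamma> rule: tang6) (simp_all add: ki_W W_diff M_W W_zero del: wt.simps Nop.simps ki.simps)
qed

lemma M_D: "m \<in> M \<Longrightarrow> m \<gamma> \<in> D"
  using M_W W_D by blast

lemma FR_right_coord:
  assumes m: "m \<in> M" and a: "a \<in> D"
  shows "right_coord (FR m a) \<gamma> = right_coord m \<gamma> \<star> a"
proof -
  have D: "right_coord m \<gamma> \<in> D" for \<gamma> using right_coord_W[OF m] W_D by blast
  have "FR m a = (\<lambda>\<delta>. \<Sum>\<gamma>\<in>UNIV. Nop \<gamma> \<delta> (right_coord m \<gamma> \<star> a))"
  proof
    fix \<delta>
    have "FR m a \<delta> = (\<Sum>\<epsilon>\<in>UNIV. (\<Sum>\<gamma>\<in>UNIV. Nop \<gamma> \<epsilon> (right_coord m \<gamma>)) \<star> Nop \<epsilon> \<delta> a)"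
      by (simp add: FR_def sum_Nop_right_coord M_D[OF m] del: Nop.simps right_coord.simps)
    also have "\<dots> = (\<Sum>\<gamma>\<in>UNIV. \<Sum>\<epsilon>\<in>UNIV. Nop \<gamma> \<epsilon> (right_coord m \<gamma>) \<star> Nop \<epsilon> \<delta> a)"
      unfolding conv_sum_left by (rule sum.swap)
    also have "\<dots> = (\<Sum>\<gamma>\<in>UNIV. Nop \<gamma> \<delta> (right_coord m \<gamma> \<star> a))"
      by (simp add: Nop_conv[OF D a] del: Nop.simps right_coord.simps)
    finally show "FR m a \<delta> = (\<Sum>\<gamma>\<in>UNIV. Nop \<gamma> \<delta> (right_coord m \<gamma> \<star> a))" .
  qed
  then show ?thesis using right_coord_sum_Nop[of "\<lambda>\<gamma>. right_coord m \<gamma> \<star> a"] D a by (simp del: Nop.simps right_coord.simps)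
qed

text \<open>The form e_\<gamma> x, written in left coordinates.\<close>

definition xi :: "tang \<Rightarrow> fnl \<Rightarrow> form" where "xi \<gamma> x = (\<lambda>\<delta>. Nop \<gamma> \<delta> x)"

lemma xi_M: "x \<in> W (wt \<gamma>) \<Longrightarrow> xi \<gamma> x \<in> M"
  using Nop_W[of x "wt \<gamma>" \<gamma>] by (simp add: M_iff xi_def del: Nop.simps)

lemma FR_xi: "x \<in> D \<Longrightarrow> b \<in> D \<Longrightarrow> FR (xi \<gamma> x) b = xi \<gamma> (x \<star> b)"
  by (simp add: FR_def xi_def Nop_conv del: Nop.simps)

text \<open>The sign is chosen so that the first leg x has weight \<open>wt \<gamma>\<close>, which
  puts e_\<gamma> x into \<open>M\<close>.\<close>

definition weight_partition :: "tang \<Rightarrow> (fnl \<times> fnl) list" where "weight_partition \<gamma> = (SOME ts. unit_partition (- wt \<gamma>) ts)"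

lemma weight_partition: "t \<in> set (weight_partition \<gamma>) \<Longrightarrow> fst t \<in> W (wt \<gamma>)" "t \<in> set (weight_partition \<gamma>) \<Longrightarrow> snd t \<in> W (- wt \<gamma>)"
  "(\<Sum>t\<leftarrow>weight_partition \<gamma>. fst t \<star> snd t) = unit"
proof -
  have "unit_partition (- wt \<gamma>) (weight_partition \<gamma>)" unfolding weight_partition_def using someI_ex[OF unit_partition_ex] .
  then show "t \<in> set (weight_partition \<gamma>) \<Longrightarrow> fst t \<in> W (wt \<gamma>)" "t \<in> set (weight_partition \<gamma>) \<Longrightarrow> snd t \<in> W (- wt \<gamma>)"
    "(\<Sum>t\<leftarrow>weight_partition \<gamma>. fst t \<star> snd t) = unit"
    by (auto simp: unit_partition_def mem_Times_iff)
qed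

definition dual_basis :: "(tang \<times> fnl \<times> fnl) list" where
  "dual_basis = concat (map (\<lambda>\<gamma>. map (Pair \<gamma>) (weight_partition \<gamma>)) [TE A1, TE A2, TE A12, TF A1, TF A2, TF A12])"

definition dual_basis_form :: "tang \<times> fnl \<times> fnl \<Rightarrow> form" where "dual_basis_form l = xi (fst l) (fst (snd l))"
definition dual_basis_coord :: "tang \<times> fnl \<times> fnl \<Rightarrow> form \<Rightarrow> fnl" where "dual_basis_coord l m = snd (snd l) \<star> right_coord m (fst l)"

lemma dual_basis: "l \<in> set dual_basis \<Longrightarrow> fst (snd l) \<in> W (wt (fst l))" "l \<in> set dual_basis \<Longrightarrow> snd (snd l) \<in> W (- wt (fst l))"
  by (auto simp: dual_basis_def dest: weight_partition(1,2))

lemma dual_basis_form_M: "l \<in> set dual_basis \<Longrightarrow> dual_basis_form l \<in> M"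
  by (simp add: dual_basis_form_def xi_M dual_basis)

lemma dual_basis_coord_W: "l \<in> set dual_basis \<Longrightarrow> m \<in> M \<Longrightarrow> dual_basis_coord l m \<in> W 0"
  using W_conv[OF dual_basis(2) right_coord_W, of l m "fst l"] by (simp add: dual_basis_coord_def)

text \<open>Inserting 1 = sum of x_i y_i in front of the right coordinate m_\<gamma> gives summands
  (e_\<gamma> x_i)(y_i m_\<gamma>) whose second factors lie in B. So \<open>M\<close> is a finitely
  generated projective right B-module.\<close>

lemma M_decomp:
  assumes m: "m \<in> M"
  shows "m = (\<Sum>l\<leftarrow>dual_basis. FR (dual_basis_form l) (dual_basis_coord l m))"
proof
  fix \<delta>
  have "(\<Sum>l\<leftarrow>dual_basis. FR (dual_basis_form l) (dual_basis_coord l m)) \<delta> = (\<Sum>l\<leftarrow>dual_basis. Nop (fst l) \<delta> (fst (snd l) \<star> (snd (snd l) \<star> right_coord m (fst l))))"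
    by (subst sum_list_apply, intro arg_cong[where f = sum_list] map_cong refl)
      (simp add: dual_basis_form_def FR_xi W_D[OF dual_basis(1)] W_D[OF dual_basis_coord_W[OF _ m]], simp add: xi_def dual_basis_coord_def)
  also have "\<dots> = (\<Sum>\<gamma>\<leftarrow>[TE A1, TE A2, TE A12, TF A1, TF A2, TF A12]. \<Sum>t\<leftarrow>weight_partition \<gamma>. Nop \<gamma> \<delta> (fst t \<star> (snd t \<star> right_coord m \<gamma>)))"
    by (simp add: dual_basis_def o_def add.assoc del: Nop.simps right_coord.simps)
  also have "\<dots> = (\<Sum>\<gamma>\<leftarrow>[TE A1, TE A2, TE A12, TF A1, TF A2, TF A12]. Nop \<gamma> \<delta> (right_coord m \<gamma>))"
  proof -
    have "(\<Sum>t\<leftarrow>weight_partition \<gamma>. Nop \<gamma> \<delta> (fst t \<star> (snd t \<star> right_coord m \<gamma>))) = Nop \<gamma> \<delta> (right_coord m \<gamma>)" for \<gamma>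
    proof -
      have "(\<Sum>t\<leftarrow>ts. Nop \<gamma> \<delta> (fst t \<star> (snd t \<star> a))) = Nop \<gamma> \<delta> ((\<Sum>t\<leftarrow>ts. fst t \<star> snd t) \<star> a)" for ts a
        by (induction ts) (simp_all add: conv_add_left conv_assoc del: Nop.simps)
      then show ?thesis by (simp add: weight_partition(3) del: Nop.simps right_coord.simps)
    qed
    then show ?thesis by (simp del: Nop.simps right_coord.simps)
  qed
  also have "\<dots> = m \<delta>"
    using sum_Nop_right_coord[of m \<delta>] M_D[OF m] by (simp add: sum_tang add.assoc del: Nop.simps right_coord.simps)
  finally show "m \<delta> = (\<Sum>l\<leftarrow>dual_basis. FR (dual_basis_form l) (dual_basis_coord l m)) \<delta>" by simp
qed

lemma Nul_fw_zero: "set ms \<subseteq> M \<Longrightarrow> set ns \<subseteq> M \<Longrightarrow> fw (ms @ 0 # ns) \<in> Nul"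
proof -
  have "form_scale 0 0 = 0" by (simp add: form_scale_def fun_eq_iff[where 'a = tang] zero_fun_apply)
  then show "set ms \<subseteq> M \<Longrightarrow> set ns \<subseteq> M \<Longrightarrow> fw (ms @ 0 # ns) \<in> Nul"
    using Nul_scale_gen[of ms 0 ns 0] by (simp add: M_zero)
qed

lemma Nul_sum_list:
  assumes "\<And>l. l \<in> set xs \<Longrightarrow> f l \<in> M" and ns: "set ns \<subseteq> M"
  shows "fw ((\<Sum>l\<leftarrow>xs. f l) # ns) - (\<Sum>l\<leftarrow>xs. fw (f l # ns)) \<in> Nul"
  using assms(1)
proof (induction xs)
  case Nil
  show ?case using Nul_fw_zero[of "[]" ns] ns by simp
next
  case (Cons x xs)
  have "(\<Sum>l\<leftarrow>xs. f l) \<in> M" using Cons.prems by (intro M_sum_list) auto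
  then have "fw ((f x + (\<Sum>l\<leftarrow>xs. f l)) # ns) - fw (f x # ns) - fw ((\<Sum>l\<leftarrow>xs. f l) # ns) \<in> Nul"
    using Nul_add_gen[of "[]" "f x" "\<Sum>l\<leftarrow>xs. f l" ns] Cons.prems ns by simp
  from Nul_closed(2)[OF this Cons.IH] Cons.prems show ?case by (simp add: algebra_simps)
qed

lemma Nul_sum_list_mem: "(\<And>l. l \<in> set xs \<Longrightarrow> f l \<in> Nul) \<Longrightarrow> (\<Sum>l\<leftarrow>xs. f l) \<in> Nul"
  by (induction xs) (simp_all add: Nul_closed)

text \<open>Balancing moves the B-coefficients of the first form into the next tensor factor. The
  coordinates of the remaining factors depend on those of \<open>x\<close> alone, so they vanish
  with them; this drives the induction in \<open>Phi_injective\<close>.\<close>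

lemma TW_decomp:
  assumes "x \<in> TW (Suc (Suc n))"
  shows "\<exists>z. (\<forall>l\<in>set dual_basis. z l \<in> TW (Suc n)) \<and> x - (\<Sum>l\<leftarrow>dual_basis. fw [dual_basis_form l] * z l) \<in> Nul \<and>
     (\<forall>l\<in>set dual_basis. \<forall>\<gamma>s. Phi (z l) \<gamma>s = snd (snd l) \<star> right_coord (\<lambda>\<delta>. Phi x (\<delta> # \<gamma>s)) (fst l))"
  using assms
proof (induction rule: TW_induct)
  case zero
  have "(\<Sum>l\<leftarrow>dual_basis. fw [dual_basis_form l] * 0) = 0" by (induction dual_basis) simp_all
  then show ?case
    by (intro exI[of _ "\<lambda>_. 0"]) (simp add: TW_closed Nul_closed right_coord_linear del: right_coord.simps)
next
  case (add x y)
  then obtain z z' where z: "\<forall>l\<in>set dual_basis. z l \<in> TW (Suc n)" "x - (\<Sum>l\<leftarrow>dual_basis. fw [dual_basis_form l] * z l) \<in> Nul"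
     "\<forall>l\<in>set dual_basis. \<forall>\<gamma>s. Phi (z l) \<gamma>s = snd (snd l) \<star> right_coord (\<lambda>\<delta>. Phi x (\<delta> # \<gamma>s)) (fst l)"
     "\<forall>l\<in>set dual_basis. z' l \<in> TW (Suc n)" "y - (\<Sum>l\<leftarrow>dual_basis. fw [dual_basis_form l] * z' l) \<in> Nul"
     "\<forall>l\<in>set dual_basis. \<forall>\<gamma>s. Phi (z' l) \<gamma>s = snd (snd l) \<star> right_coord (\<lambda>\<delta>. Phi y (\<delta> # \<gamma>s)) (fst l)"
    by blast
  have "x + y - (\<Sum>l\<leftarrow>dual_basis. fw [dual_basis_form l] * (z l + z' l)) \<in> Nul"
    using Nul_closed(2)[OF z(2,5)] by (simp add: distrib_left sum_list_addf algebra_simps)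
  then show ?case
    using z by (intro exI[of _ "\<lambda>l. z l + z' l"]) (simp add: TW_closed Phi_add right_coord_linear conv_add_right del: right_coord.simps)
next
  case (scl c x)
  then obtain z where z: "\<forall>l\<in>set dual_basis. z l \<in> TW (Suc n)" "x - (\<Sum>l\<leftarrow>dual_basis. fw [dual_basis_form l] * z l) \<in> Nul"
     "\<forall>l\<in>set dual_basis. \<forall>\<gamma>s. Phi (z l) \<gamma>s = snd (snd l) \<star> right_coord (\<lambda>\<delta>. Phi x (\<delta> # \<gamma>s)) (fst l)"
    by blast
  have "(\<Sum>l\<leftarrow>xs. fw [dual_basis_form l] * scl c (z l)) = scl c (\<Sum>l\<leftarrow>xs. fw [dual_basis_form l] * z l)" for xs
    by (induction xs) (simp_all add: formal.scale_right_distrib scl_mult_right)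
  then have "scl c x - (\<Sum>l\<leftarrow>dual_basis. fw [dual_basis_form l] * scl c (z l)) \<in> Nul"
    using Nul_closed(3)[OF z(2), of c] by (simp add: formal.scale_right_diff_distrib)
  then show ?case
    using z by (intro exI[of _ "\<lambda>l. scl c (z l)"]) (simp add: TW_closed Phi_scl right_coord_linear conv_fscale_right del: right_coord.simps)
next
  case (word ms)
  then obtain m n' ns where ms: "ms = m # n' # ns" and len: "length ns = n" by (auto simp: length_Suc_conv)
  have M: "m \<in> M" "n' \<in> M" "set ns \<subseteq> M" using word ms by auto
  let ?z = "\<lambda>l. fw (form_left (dual_basis_coord l m) n' # ns)"
  have 1: "\<forall>l\<in>set dual_basis. ?z l \<in> TW (Suc n)"
    using M len by (auto intro!: TW_fw left_M dual_basis_coord_W)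
  have "fw ms - (\<Sum>l\<leftarrow>dual_basis. fw (FR (dual_basis_form l) (dual_basis_coord l m) # n' # ns)) \<in> Nul"
    using Nul_sum_list[of dual_basis "\<lambda>l. FR (dual_basis_form l) (dual_basis_coord l m)" "n' # ns"] M
    by (simp add: FR_M dual_basis_form_M dual_basis_coord_W M_decomp[OF M(1), symmetric] ms)
  moreover have "(\<Sum>l\<leftarrow>dual_basis. fw (FR (dual_basis_form l) (dual_basis_coord l m) # n' # ns) - fw [dual_basis_form l] * ?z l) \<in> Nul"
    using M Nul_bal_gen[of _ "[]" _ n' ns] by (intro Nul_sum_list_mem) (simp add: dual_basis_form_M dual_basis_coord_W fw_mult)
  ultimately have "fw ms - (\<Sum>l\<leftarrow>dual_basis. fw (FR (dual_basis_form l) (dual_basis_coord l m) # n' # ns)) + (\<Sum>l\<leftarrow>dual_basis. fw (FR (dual_basis_form l) (dual_basis_coord l m) # n' # ns) - fw [dual_basis_form l] * ?z l) \<in> Nul"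
    by (rule Nul_closed(2))
  then have 2: "fw ms - (\<Sum>l\<leftarrow>dual_basis. fw [dual_basis_form l] * ?z l) \<in> Nul"
    by (simp add: sum_list_subtractf)
  have 3: "\<forall>l\<in>set dual_basis. \<forall>\<gamma>s. Phi (?z l) \<gamma>s = snd (snd l) \<star> right_coord (\<lambda>\<delta>. Phi (fw ms) (\<delta> # \<gamma>s)) (fst l)"
  proof (intro ballI allI)
    fix l \<gamma>s assume "l \<in> set dual_basis"
    have D: "Ph (n' # ns) \<gamma>s \<in> D" using M by (intro Ph_D) simp
    have "Phi (?z l) \<gamma>s = dual_basis_coord l m \<star> Ph (n' # ns) \<gamma>s"
      by (cases \<gamma>s) (simp_all add: Phi_fw)
    also have "\<dots> = snd (snd l) \<star> right_coord (FR m (Ph (n' # ns) \<gamma>s)) (fst l)"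
      using FR_right_coord[OF M(1) D, of "fst l"] by (simp only: dual_basis_coord_def conv_assoc)
    finally show "Phi (?z l) \<gamma>s = snd (snd l) \<star> right_coord (\<lambda>\<delta>. Phi (fw ms) (\<delta> # \<gamma>s)) (fst l)"
      unfolding ms Phi_fw Ph.simps(3) .
  qed
  show ?case using 1 2 3 by (intro exI[of _ ?z] conjI)
qed

lemma TW_1: "x \<in> TW (Suc 0) \<Longrightarrow> (\<lambda>\<gamma>. Phi x [\<gamma>]) \<in> M \<and> x - fw [\<lambda>\<gamma>. Phi x [\<gamma>]] \<in> Nul"
proof (induction rule: TW_induct)
  case zero
  have "(\<lambda>\<gamma>. 0 :: fnl) = (0 :: form)" by (simp add: fun_eq_iff[where 'a = tang] zero_fun_apply)
  then show ?case using Nul_fw_zero[of "[]" "[]"] M_zero Nul_closed(4)[OF Nul_closed(1)] by simp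
next
  case (add x y)
  have e: "(\<lambda>\<gamma>. Phi (x + y) [\<gamma>]) = (\<lambda>\<gamma>. Phi x [\<gamma>]) + (\<lambda>\<gamma>. Phi y [\<gamma>])"
    by (simp add: fun_eq_iff[where 'a = tang] Phi_add plus_fun_apply)
  let ?m = "\<lambda>\<gamma>. Phi x [\<gamma>]" let ?n = "\<lambda>\<gamma>. Phi y [\<gamma>]"
  have "fw [?m + ?n] - fw [?m] - fw [?n] \<in> Nul"
    using Nul_add_gen[of "[]" ?m ?n "[]"] add by simp
  then have "(x - fw [?m]) + (y - fw [?n]) - (fw [?m + ?n] - fw [?m] - fw [?n]) \<in> Nul"
    using Nul_closed(4)[OF Nul_closed(2)] add by blast
  then show ?case unfolding e using add by (simp add: add_M algebra_simps)
next
  case (scl c x)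
  have e: "(\<lambda>\<gamma>. Phi (scl c x) [\<gamma>]) = form_scale c (\<lambda>\<gamma>. Phi x [\<gamma>])"
    by (simp add: fun_eq_iff[where 'a = tang] Phi_scl form_scale_apply)
  let ?m = "\<lambda>\<gamma>. Phi x [\<gamma>]"
  have "fw [form_scale c ?m] - scl c (fw [?m]) \<in> Nul"
    using Nul_scale_gen[of "[]" ?m "[]" c] scl by simp
  then have "scl c (x - fw [?m]) - (fw [form_scale c ?m] - scl c (fw [?m])) \<in> Nul"
    using Nul_closed(4)[OF Nul_closed(3)] scl by blast
  then show ?case unfolding e using scl by (simp add: scale_M formal.scale_right_diff_distrib)
next
  case (word ms)
  then obtain m where "ms = [m]" "m \<in> M" by (auto simp: length_Suc_conv)
  moreover have "(\<lambda>\<gamma>. Phi (fw [m]) [\<gamma>]) = m"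
    by (simp add: fun_eq_iff[where 'a = tang] Phi_fw FR_unit)
  ultimately show ?case by (simp add: Nul_closed)
qed

theorem Phi_injective: "x \<in> TW (Suc n) \<Longrightarrow> (\<And>\<gamma>s. Phi x \<gamma>s = 0) \<Longrightarrow> x \<in> Nul"
proof (induction n arbitrary: x)
  case 0
  have "(\<lambda>\<gamma>. Phi x [\<gamma>]) = (0 :: form)"
  proof
    fix \<gamma> show "Phi x [\<gamma>] = (0 :: form) \<gamma>" unfolding 0(2) by (simp add: zero_fun_apply)
  qed
  then have "x - fw [0] \<in> Nul" using TW_1[OF 0(1)] by simp
  from Nul_closed(2)[OF this Nul_fw_zero[of "[]" "[]"]] show ?case by simp
next
  case (Suc n)
  obtain z where z: "\<forall>l\<in>set dual_basis. z l \<in> TW (Suc n)" "x - (\<Sum>l\<leftarrow>dual_basis. fw [dual_basis_form l] * z l) \<in> Nul"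
     "\<forall>l\<in>set dual_basis. \<forall>\<gamma>s. Phi (z l) \<gamma>s = snd (snd l) \<star> right_coord (\<lambda>\<delta>. Phi x (\<delta> # \<gamma>s)) (fst l)"
    using TW_decomp[OF Suc.prems(1)] by blast
  have "z l \<in> Nul" if "l \<in> set dual_basis" for l
    using z(1,3) that by (intro Suc.IH) (simp_all add: Suc.prems(2) right_coord_linear del: right_coord.simps)
  then have "(\<Sum>l\<leftarrow>dual_basis. fw [dual_basis_form l] * z l) \<in> Nul"
    by (intro Nul_sum_list_mem Nul_mult_word_left) (simp_all add: dual_basis_form_M)
  from Nul_closed(2)[OF z(2) this] show ?case by simp
qed

section \<open>The degree-two relations\<close>

definition J :: "form free_alg set" where "J = {x. (0, x) \<in> prolong_ideal q}"

lemma J_Nul: "x \<in> Nul \<Longrightarrow> x \<in> J"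
  unfolding J_def Nul_def by (simp add: prolong_ideal.null)

lemma J_closed: "0 \<in> J" "x \<in> J \<Longrightarrow> y \<in> J \<Longrightarrow> x + y \<in> J" "x \<in> J \<Longrightarrow> scl c x \<in> J"
proof -
  show "0 \<in> J" by (rule J_Nul) (rule Nul_closed)
  show "x \<in> J \<Longrightarrow> y \<in> J \<Longrightarrow> x + y \<in> J"
    unfolding J_def using prolong_ideal.add[of "(0, x)" q "(0, y)"] by simp
  show "x \<in> J \<Longrightarrow> scl c x \<in> J"
    unfolding J_def using prolong_ideal.scale[of "(0, x)" q c] by (simp add: tensor_scale_def)
qed

lemma J_diff: "x \<in> J \<Longrightarrow> y \<in> J \<Longrightarrow> x - y \<in> J"
  using J_closed(2)[OF _ J_closed(3), of x y "- 1"] by (simp add: scl_minus_one)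

lemma carrier_iff: "(b, y) \<in> tensor_carrier q \<longleftrightarrow> b \<in> W 0 \<and> y \<in> T"
  by (simp add: tensor_carrier_def T_def OqF3_eq)

text \<open>\<open>wedge\<close> with zero in degree 0 still produces formal words containing the
  zero form; these are null but not equal to 0.\<close>

lemma tensor_left_zero_Nul: "x \<in> T \<Longrightarrow> tensor_left 0 x \<in> Nul"
proof (induction rule: T_induct)
  case (word m ms)
  have "form_left 0 m = 0" by (simp add: form_left_def fun_eq_iff[where 'a = tang] zero_fun_apply)
  then show ?case using Nul_fw_zero[of "[]" ms] word by (simp add: tensor_left_fw)
qed (simp_all add: Nul_closed tensor_left_add tensor_left_scl)

lemma snoc_of_Cons: "set (m # ms) \<subseteq> S \<Longrightarrow> \<exists>ns n. m # ms = ns @ [n] \<and> set ns \<subseteq> S \<and> n \<in> S"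
  by (metis append_butlast_last_id insert_subset last_in_set list.distinct(1) list.simps(15) set_append subset_eq Un_subset_iff)

lemma tensor_right_zero_Nul: "x \<in> T \<Longrightarrow> tensor_right q x 0 \<in> Nul"
proof (induction rule: T_induct)
  case (word m ms)
  then obtain ns n where e: "m # ms = ns @ [n]" "set ns \<subseteq> M" "n \<in> M" using snoc_of_Cons[of m ms M] by auto
  have "form_right q n 0 = 0" by (simp add: form_right_eq OA_zero FR_zero)
  then show ?case using Nul_fw_zero[of ns "[]"] e(2) unfolding e(1) tensor_right_fw by simp
qed (simp_all add: Nul_closed tensor_right_add tensor_right_scl)

lemma tensor_left_T: "x \<in> T \<Longrightarrow> b \<in> W 0 \<Longrightarrow> tensor_left b x \<in> T"
proof (induction rule: T_induct)
  case (word m ms)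
  then show ?case by (simp add: tensor_left_fw T_fw left_M)
qed (simp_all add: T_closed tensor_left_add tensor_left_scl)

lemma tensor_right_T: "x \<in> T \<Longrightarrow> b \<in> W 0 \<Longrightarrow> tensor_right q x b \<in> T"
proof (induction rule: T_induct)
  case (word m ms)
  then obtain ns n where e: "m # ms = ns @ [n]" "set ns \<subseteq> M" "n \<in> M" using snoc_of_Cons[of m ms M] by auto
  then show ?case using word(3) unfolding e(1) tensor_right_fw by (simp add: T_fw form_right_eq W_OA FR_M)
qed (simp_all add: T_closed tensor_right_add tensor_right_scl)

lemma J_mult_left: "y \<in> T \<Longrightarrow> x \<in> T \<Longrightarrow> x \<in> J \<Longrightarrow> y * x \<in> J"
proof -
  assume *: "y \<in> T" "x \<in> T" "x \<in> J"
  have "wedge q (0, y) (0, x) \<in> prolong_ideal q"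
    using * by (intro prolong_ideal.left) (simp_all add: carrier_iff W_zero J_def)
  then have "tensor_left 0 x + tensor_right q y 0 + y * x \<in> J" by (simp add: J_def)
  from J_diff[OF this J_closed(2)[OF J_Nul[OF tensor_left_zero_Nul] J_Nul[OF tensor_right_zero_Nul]]] *
  show ?thesis by fastforce
qed

lemma J_mult_right: "y \<in> T \<Longrightarrow> x \<in> T \<Longrightarrow> x \<in> J \<Longrightarrow> x * y \<in> J"
proof -
  assume *: "y \<in> T" "x \<in> T" "x \<in> J"
  have "wedge q (0, x) (0, y) \<in> prolong_ideal q"
    using * by (intro prolong_ideal.right) (simp_all add: carrier_iff W_zero J_def)
  then have "tensor_left 0 y + tensor_right q x 0 + x * y \<in> J" by (simp add: J_def)
  from J_diff[OF this J_closed(2)[OF J_Nul[OF tensor_left_zero_Nul] J_Nul[OF tensor_right_zero_Nul]]] *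
  show ?thesis by fastforce
qed

section \<open>Upper bound for the ideal in degree two\<close>

definition rel2 :: "(tang \<Rightarrow> tang \<Rightarrow> fnl) set" where
  "rel2 = {t. \<exists>ts. set ts \<subseteq> W 0 \<times> W 0 \<and> (\<forall>\<gamma>. (\<Sum>s\<leftarrow>ts. fst s \<star> tv \<gamma> (snd s)) = 0) \<and>
     (\<forall>\<gamma> \<delta>. t \<gamma> \<delta> = (\<Sum>s\<leftarrow>ts. fst s \<star> tv \<gamma> (tv \<delta> (snd s))))}"

lemma rel2I: "set ts \<subseteq> W 0 \<times> W 0 \<Longrightarrow> (\<And>\<gamma>. (\<Sum>s\<leftarrow>ts. fst s \<star> tv \<gamma> (snd s)) = 0) \<Longrightarrow>
     (\<And>\<gamma> \<delta>. t \<gamma> \<delta> = (\<Sum>s\<leftarrow>ts. fst s \<star> tv \<gamma> (tv \<delta> (snd s)))) \<Longrightarrow> t \<in> rel2"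
  unfolding rel2_def by blast

lemma rel2E:
  assumes "t \<in> rel2"
  obtains ts where "set ts \<subseteq> W 0 \<times> W 0" "\<And>\<gamma>. (\<Sum>s\<leftarrow>ts. fst s \<star> tv \<gamma> (snd s)) = 0"
    "\<And>\<gamma> \<delta>. t \<gamma> \<delta> = (\<Sum>s\<leftarrow>ts. fst s \<star> tv \<gamma> (tv \<delta> (snd s)))"
  using assms unfolding rel2_def by blast

lemma rel2_zero: "(\<lambda>\<gamma> \<delta>. 0) \<in> rel2"
  by (rule rel2I[of "[]"]) simp_all

lemma rel2_add: "s \<in> rel2 \<Longrightarrow> t \<in> rel2 \<Longrightarrow> (\<lambda>\<gamma> \<delta>. s \<gamma> \<delta> + t \<gamma> \<delta>) \<in> rel2"
proof (elim rel2E)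
  fix ts ts'
  assume *: "set ts \<subseteq> W 0 \<times> W 0" "\<And>\<gamma>. (\<Sum>s\<leftarrow>ts. fst s \<star> tv \<gamma> (snd s)) = 0"
    "\<And>\<gamma> \<delta>. s \<gamma> \<delta> = (\<Sum>s\<leftarrow>ts. fst s \<star> tv \<gamma> (tv \<delta> (snd s)))"
    "set ts' \<subseteq> W 0 \<times> W 0" "\<And>\<gamma>. (\<Sum>s\<leftarrow>ts'. fst s \<star> tv \<gamma> (snd s)) = 0"
    "\<And>\<gamma> \<delta>. t \<gamma> \<delta> = (\<Sum>s\<leftarrow>ts'. fst s \<star> tv \<gamma> (tv \<delta> (snd s)))"
  show ?thesis by (rule rel2I[of "ts @ ts'"]) (simp_all add: *)
qed

lemma rel2_left: "b \<in> W 0 \<Longrightarrow> t \<in> rel2 \<Longrightarrow> (\<lambda>\<gamma> \<delta>. b \<star> t \<gamma> \<delta>) \<in> rel2"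
proof (elim rel2E)
  fix ts
  assume *: "set ts \<subseteq> W 0 \<times> W 0" "\<And>\<gamma>. (\<Sum>s\<leftarrow>ts. fst s \<star> tv \<gamma> (snd s)) = 0"
    "\<And>\<gamma> \<delta>. t \<gamma> \<delta> = (\<Sum>s\<leftarrow>ts. fst s \<star> tv \<gamma> (tv \<delta> (snd s)))" and b: "b \<in> W 0"
  have "b \<star> fst s \<in> W 0 \<and> snd s \<in> W 0" if "s \<in> set ts" for s
    using *(1) that W_conv[OF b, of "fst s" 0] by auto
  then have sub: "set (map (\<lambda>s. (b \<star> fst s, snd s)) ts) \<subseteq> W 0 \<times> W 0" by auto
  show ?thesis
    by (rule rel2I[OF sub]) (simp_all add: o_def conv_assoc conv_sum_list_right[symmetric] *(2,3))
qed

lemma rel2_fscale: "t \<in> rel2 \<Longrightarrow> (\<lambda>\<gamma> \<delta>. fscale c (t \<gamma> \<delta>)) \<in> rel2"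
  using rel2_left[of "fscale c unit" t] by (simp add: W_fscale W_unit conv_fscale_left)

lemma rel2_right:
  assumes t: "t \<in> rel2" and b: "b \<in> W 0"
  shows "(\<lambda>\<gamma> \<delta>. \<Sum>\<gamma>'\<in>UNIV. \<Sum>\<delta>'\<in>UNIV. t \<gamma>' \<delta>' \<star> Nop \<gamma>' \<gamma> (Nop \<delta>' \<delta> b)) \<in> rel2"
  using t
proof (rule rel2E)
  fix ts
  assume ts: "set ts \<subseteq> W 0 \<times> W 0" "\<And>\<gamma>. (\<Sum>s\<leftarrow>ts. fst s \<star> tv \<gamma> (snd s)) = 0"
    "\<And>\<gamma> \<delta>. t \<gamma> \<delta> = (\<Sum>s\<leftarrow>ts. fst s \<star> tv \<gamma> (tv \<delta> (snd s)))"
  \<comment> \<open>Modelled on (sum a dc) b = sum a d(cb) - sum (ac) db, so the new list again has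
    vanishing first-order sums.\<close>
  let ?l = "map (\<lambda>s. (fst s, snd s \<star> b)) ts @ map (\<lambda>s. (- (fst s \<star> snd s), b)) ts"
  have mem: "fst s \<in> W 0" "snd s \<in> W 0" if "s \<in> set ts" for s using ts(1) that by auto
  have bD: "b \<in> D" using b W_D by blast
  have D: "snd s \<in> D" if "s \<in> set ts" for s using mem that W_D by blast
  have sub: "set ?l \<subseteq> W 0 \<times> W 0"
    using mem W_conv[of _ 0 _ 0] b by (auto intro!: W_uminus)
  have z: "(\<Sum>s\<leftarrow>ts. fst s \<star> (tv \<gamma> (snd s) \<star> g)) = 0" for \<gamma> g
    using ts(2)[of \<gamma>] by (simp add: conv_assoc[symmetric] conv_sum_list_left[symmetric])
  have sl: "(\<Sum>s\<leftarrow>xs. \<Sum>i\<in>I. h s i) = (\<Sum>i\<in>I. \<Sum>s\<leftarrow>xs. (h s i :: fnl))" for xs :: "(fnl \<times> fnl) list" and I :: "tang set" and h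
    by (induction xs) (simp_all add: sum.distrib)
  have "(\<Sum>s\<leftarrow>?l. fst s \<star> tv \<gamma> (snd s)) = 0" for \<gamma>
  proof -
    have "(\<Sum>s\<leftarrow>?l. fst s \<star> tv \<gamma> (snd s)) = (\<Sum>s\<leftarrow>ts. fst s \<star> tv \<gamma> (snd s \<star> b) + - (fst s \<star> snd s) \<star> tv \<gamma> b)"
      by (simp add: o_def sum_list_addf)
    also have "\<dots> = (\<Sum>s\<leftarrow>ts. \<Sum>\<delta>\<in>UNIV. fst s \<star> (tv \<delta> (snd s) \<star> Nop \<delta> \<gamma> b))"
      by (intro arg_cong[where f = sum_list] map_cong refl)
        (simp add: tv_conv[OF D bD] conv_add_right conv_sum_right conv_uminus_left conv_assoc)
    also have "\<dots> = 0" unfolding sl z by simp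
    finally show ?thesis .
  qed
  moreover have "(\<Sum>\<gamma>'\<in>UNIV. \<Sum>\<delta>'\<in>UNIV. t \<gamma>' \<delta>' \<star> Nop \<gamma>' \<gamma> (Nop \<delta>' \<delta> b)) = (\<Sum>s\<leftarrow>?l. fst s \<star> tv \<gamma> (tv \<delta> (snd s)))" for \<gamma> \<delta>
  proof -
    have "(\<Sum>s\<leftarrow>?l. fst s \<star> tv \<gamma> (tv \<delta> (snd s))) = (\<Sum>s\<leftarrow>ts. fst s \<star> tv \<gamma> (tv \<delta> (snd s \<star> b)) + - (fst s \<star> snd s) \<star> tv \<gamma> (tv \<delta> b))"
      by (simp add: o_def sum_list_addf)
    \<comment> \<open>Two applications of the Leibniz rule: the terms with one derivative on
      \<open>snd s\<close> vanish by \<open>z\<close>, and the term with none is cancelled by the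
      second half of \<open>?l\<close>.\<close>
    also have "\<dots> = (\<Sum>s\<leftarrow>ts. (\<Sum>\<delta>'\<in>UNIV. \<Sum>\<gamma>'\<in>UNIV. fst s \<star> (tv \<gamma>' (tv \<delta>' (snd s)) \<star> Nop \<gamma>' \<gamma> (Nop \<delta>' \<delta> b)))
        + (\<Sum>\<delta>'\<in>UNIV. fst s \<star> (tv \<delta>' (snd s) \<star> tv \<gamma> (Nop \<delta>' \<delta> b)))
        + (\<Sum>\<gamma>'\<in>UNIV. fst s \<star> (tv \<gamma>' (snd s) \<star> Nop \<gamma>' \<gamma> (tv \<delta> b))))"
    proof (intro arg_cong[where f = sum_list] map_cong refl)
      fix s assume "s \<in> set ts"
      then have s: "snd s \<in> D" "\<And>\<gamma>. tv \<gamma> (snd s) \<in> D" using D mem tv_W W_D by blast+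
      have bb: "\<And>\<gamma>. tv \<gamma> b \<in> D" using tv_W[OF b] W_D by blast
      have ts: "tv \<gamma> (\<Sum>i\<in>I. h i) = (\<Sum>i\<in>I. tv \<gamma> (h i))" for I :: "tang set" and h
        by (induction I rule: infinite_finite_induct) simp_all
      show "fst s \<star> tv \<gamma> (tv \<delta> (snd s \<star> b)) + - (fst s \<star> snd s) \<star> tv \<gamma> (tv \<delta> b) =
         (\<Sum>\<delta>'\<in>UNIV. \<Sum>\<gamma>'\<in>UNIV. fst s \<star> (tv \<gamma>' (tv \<delta>' (snd s)) \<star> Nop \<gamma>' \<gamma> (Nop \<delta>' \<delta> b)))
        + (\<Sum>\<delta>'\<in>UNIV. fst s \<star> (tv \<delta>' (snd s) \<star> tv \<gamma> (Nop \<delta>' \<delta> b)))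
        + (\<Sum>\<gamma>'\<in>UNIV. fst s \<star> (tv \<gamma>' (snd s) \<star> Nop \<gamma>' \<gamma> (tv \<delta> b)))"
        by (simp add: tv_conv s bD bb ts conv_add_right conv_sum_right conv_uminus_left conv_assoc sum.distrib add_ac del: Nop.simps)
    qed
    also have "\<dots> = (\<Sum>s\<leftarrow>ts. \<Sum>\<delta>'\<in>UNIV. \<Sum>\<gamma>'\<in>UNIV. fst s \<star> (tv \<gamma>' (tv \<delta>' (snd s)) \<star> Nop \<gamma>' \<gamma> (Nop \<delta>' \<delta> b)))"
      unfolding sum_list_addf sl z by simp
    also have "\<dots> = (\<Sum>\<delta>'\<in>UNIV. \<Sum>\<gamma>'\<in>UNIV. t \<gamma>' \<delta>' \<star> Nop \<gamma>' \<gamma> (Nop \<delta>' \<delta> b))"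
      unfolding sl ts(3) conv_sum_list_left conv_assoc ..
    also have "\<dots> = (\<Sum>\<gamma>'\<in>UNIV. \<Sum>\<delta>'\<in>UNIV. t \<gamma>' \<delta>' \<star> Nop \<gamma>' \<gamma> (Nop \<delta>' \<delta> b))"
      by (rule sum.swap)
    finally show ?thesis by (rule sym)
  qed
  ultimately show ?thesis by (intro rel2I[OF sub])
qed

lemma Phi_T_Nil: "x \<in> T \<Longrightarrow> Phi x [] = 0"
  by (induction rule: T_induct) (simp_all add: Phi_add Phi_scl Phi_fw)

lemma Mop_zero [simp]: "Mop \<delta>s \<gamma>s 0 = 0"
  by (induction \<delta>s \<gamma>s "0 :: fnl" rule: Mop.induct) (simp_all del: Nop.simps)

lemma RA_zero_right: "RA t 0 \<gamma>s = 0"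
  by (simp add: RA_def)

lemma Phi_suffix_zero:
  assumes x: "x \<in> T" and y: "y \<in> T" and z: "\<And>\<gamma>s. length \<gamma>s \<le> k \<Longrightarrow> Phi x \<gamma>s = 0"
    and len: "length \<gamma>s \<le> Suc k"
  shows "Phi (x * y) \<gamma>s = 0"
  using y
proof (induction rule: T_induct)
  case (word m ms)
  let ?n = "length (m # ms)"
  show ?case
  proof (cases "length \<gamma>s < ?n")
    case True
    from x show ?thesis
    proof (induction rule: T_induct)
      case (word n ns)
      then show ?case using True Ph_length[of "(n # ns) @ (m # ms)" \<gamma>s] by (simp add: fw_mult Phi_fw del: Ph.simps)
    qed (simp_all add: distrib_right scl_mult_left Phi_add Phi_scl)
  next
    case False
    define a where "a = take (length \<gamma>s - ?n) \<gamma>s"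
    define b where "b = drop (length \<gamma>s - ?n) \<gamma>s"
    have ab: "\<gamma>s = a @ b" "length b = ?n" "length a \<le> k" using False len by (auto simp: a_def b_def)
    have "Phi (x * fw (m # ms)) (a @ b) = RA (Phi x) (Ph (m # ms) b) a"
      using word ab by (intro Phi_mult_word x) auto
    also have "\<dots> = 0"
      unfolding RA_def using ab(3) by (intro sum.neutral) (simp add: tl_set_def z)
    finally show ?thesis by (simp add: ab)
  qed
qed (simp_all add: distrib_left scl_mult_right Phi_add Phi_scl)

lemma Phi_prefix_zero_T:
  assumes y: "y \<in> T" and z: "\<And>\<gamma>s. length \<gamma>s \<le> k \<Longrightarrow> Phi x \<gamma>s = 0"
    and len: "length \<gamma>s \<le> Suc k"
  shows "Phi (y * x) \<gamma>s = 0"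
  using y
proof (induction rule: T_induct)
  case (word m ms)
  show ?case by (rule Phi_prefix_zero[of k]) (use z len in auto)
qed (simp_all add: distrib_right scl_mult_left Phi_add Phi_scl)

lemma RA_two: "RA t b [\<gamma>, \<delta>] = (\<Sum>\<gamma>'\<in>UNIV. \<Sum>\<delta>'\<in>UNIV. t [\<gamma>', \<delta>'] \<star> Nop \<gamma>' \<gamma> (Nop \<delta>' \<delta> b))"
  by (simp add: RA_def sum_tl_set_Suc tl_set_0 del: Nop.simps)

text \<open>Ideal elements vanish in degrees 0 and 1, so multiplying by a form of positive degree
  lands in degree three or higher. In degree two only the B-bimodule operations act, and
  \<open>rel2\<close> is closed under them.\<close>

lemma prolong_invariant:
  assumes "t \<in> prolong_ideal q"
  shows "fst t = 0 \<and> snd t \<in> T \<and> (\<forall>\<gamma>. Phi (snd t) [\<gamma>] = 0) \<and> (\<lambda>\<gamma> \<delta>. Phi (snd t) [\<gamma>, \<delta>]) \<in> rel2"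
  using assms
proof (induction rule: prolong_ideal.induct)
  case (null t)
  then have "fst t = 0" "snd t \<in> Nul" unfolding Nul_def tensor_null_def by auto
  then show ?case by (simp add: Nul_T Phi_Nul rel2_zero)
next
  case (gen ts)
  have mem: "fst s \<in> W 0" "snd s \<in> W 0" if "s \<in> set ts" for s
    using gen(1) that unfolding OqF3_eq by auto
  have z: "(\<Sum>s\<leftarrow>ts. fst s \<star> tv \<gamma> (snd s)) = 0" for \<gamma>
  proof -
    have "(\<Sum>s\<leftarrow>ts. form_left (fst s) (dif q (snd s))) \<gamma> = 0"
      using gen(2) by (simp add: split_def zero_fun_apply)
    moreover have "(\<Sum>s\<leftarrow>ts. form_left (fst s) (dif q (snd s))) \<gamma> = (\<Sum>s\<leftarrow>ts. fst s \<star> tv \<gamma> (snd s))"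
      by (subst sum_list_apply, intro arg_cong[where f = sum_list] map_cong refl)
        (simp add: form_left_apply dif_eq W_OA[OF mem(2)] dd_def)
    ultimately show ?thesis by simp
  qed
  have M: "dif q b \<in> M" if "b \<in> W 0" for b using that by (intro Omega1F3.dif) (simp add: OqF3_eq)
  let ?x = "\<Sum>s\<leftarrow>ts. fw [dif q (fst s), dif q (snd s)]"
  have T: "?x \<in> T"
    using mem by (induction ts) (simp_all add: T_closed T_fw M)
  have 1: "Phi ?x [\<gamma>] = 0" for \<gamma>
    unfolding Phi_sum_list by (induction ts) (simp_all add: Phi_fw)
  have 2: "Phi ?x [\<gamma>, \<delta>] = (\<Sum>s\<leftarrow>map (\<lambda>s. (- fst s, snd s)) ts. fst s \<star> tv \<gamma> (tv \<delta> (snd s)))" for \<gamma> \<delta>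
  proof -
    \<comment> \<open>The coefficient of db dc is X_\<gamma>(b X_\<delta> c) - b X_\<gamma>
      X_\<delta> c; the first terms add up to X_\<gamma> of zero, and the sign is absorbed into
      b.\<close>
    have "Phi ?x [\<gamma>, \<delta>] = (\<Sum>s\<leftarrow>ts. tv \<gamma> (fst s \<star> tv \<delta> (snd s)) - fst s \<star> tv \<gamma> (tv \<delta> (snd s)))"
      unfolding Phi_sum_list
    proof (intro arg_cong[where f = sum_list] map_cong refl)
      fix s assume s: "s \<in> set ts"
      have D: "fst s \<in> D" "tv \<delta> (snd s) \<in> D" using mem[OF s] tv_W W_D by blast+
      have "FR (dd (fst s)) (tv \<delta> (snd s)) \<gamma> = tv \<gamma> (fst s \<star> tv \<delta> (snd s)) - fst s \<star> tv \<gamma> (tv \<delta> (snd s))"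
        using dd_conv[OF D] by (simp add: dd_def fun_eq_iff[where 'a = tang] plus_fun_apply form_left_apply)
      then show "Phi (fw [dif q (fst s), dif q (snd s)]) [\<gamma>, \<delta>] = tv \<gamma> (fst s \<star> tv \<delta> (snd s)) - fst s \<star> tv \<gamma> (tv \<delta> (snd s))"
        using mem[OF s] by (simp add: Phi_fw dif_eq W_OA FR_unit, simp add: dd_def)
    qed
    also have "\<dots> = tv \<gamma> (\<Sum>s\<leftarrow>ts. fst s \<star> tv \<delta> (snd s)) - (\<Sum>s\<leftarrow>ts. fst s \<star> tv \<gamma> (tv \<delta> (snd s)))"
      by (simp add: tv_sum_list sum_list_subtractf)
    also have "\<dots> = (\<Sum>s\<leftarrow>ts. (- fst s) \<star> tv \<gamma> (tv \<delta> (snd s)))"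
      unfolding z tv_linear(3) by (induction ts) (simp_all add: conv_uminus_left del: minus_apply uminus_apply)
    finally show ?thesis by (simp add: o_def)
  qed
  have sub: "set (map (\<lambda>s. (- fst s, snd s)) ts) \<subseteq> W 0 \<times> W 0" using mem by (auto intro: W_uminus)
  have "(\<Sum>s\<leftarrow>map (\<lambda>s. (- fst s, snd s)) ts. fst s \<star> tv \<gamma> (snd s)) = - (\<Sum>s\<leftarrow>ts. fst s \<star> tv \<gamma> (snd s))" for \<gamma>
    by (induction ts) (simp_all add: conv_uminus_left del: minus_apply uminus_apply)
  then have "(\<lambda>\<gamma> \<delta>. Phi ?x [\<gamma>, \<delta>]) \<in> rel2"
    using z by (intro rel2I[OF sub _ 2]) simp
  then show ?case using T 1 by (simp add: split_def)
next
  case (add s t)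
  then show ?case by (simp add: T_closed Phi_add rel2_add)
next
  case (scale t c)
  then show ?case by (simp add: tensor_scale_def T_closed Phi_scl rel2_fscale)
next
  case (left s t)
  obtain b y where s: "s = (b, y)" "b \<in> W 0" "y \<in> T" using left(1) carrier_iff by (cases s) auto
  define x where "x = snd t"
  have t: "t = (0, x)" "x \<in> T" "\<And>\<gamma>. Phi x [\<gamma>] = 0" "(\<lambda>\<gamma> \<delta>. Phi x [\<gamma>, \<delta>]) \<in> rel2"
    using left(3) by (auto simp: x_def prod_eq_iff)
  have z: "Phi x \<gamma>s = 0" if "length \<gamma>s \<le> 1" for \<gamma>s
    using that t(3) Phi_T_Nil[OF t(2)] by (cases \<gamma>s) (auto simp: length_Suc_conv)
  have P: "Phi (tensor_left b x + tensor_right q y 0 + y * x) \<gamma>s = b \<star> Phi x \<gamma>s" if "length \<gamma>s \<le> 2" for \<gamma>s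
    using that Phi_prefix_zero_T[OF s(3) z, of 1 \<gamma>s]
    by (simp add: Phi_add Phi_tensor_left[OF t(2)] Phi_tensor_right[OF s(3) OA_zero] RA_zero_right)
  have T: "tensor_left b x + tensor_right q y 0 + y * x \<in> T"
    using s t by (intro T_closed tensor_left_T tensor_right_T T_mult W_zero)
  show ?case using T P[of "[_]"] P[of "[_, _]"] rel2_left[OF s(2) t(4)] by (simp add: s t)
next
  case (right s t)
  obtain b y where s: "s = (b, y)" "b \<in> W 0" "y \<in> T" using right(1) carrier_iff by (cases s) auto
  define x where "x = snd t"
  have t: "t = (0, x)" "x \<in> T" "\<And>\<gamma>. Phi x [\<gamma>] = 0" "(\<lambda>\<gamma> \<delta>. Phi x [\<gamma>, \<delta>]) \<in> rel2"
    using right(3) by (auto simp: x_def prod_eq_iff)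
  have z: "Phi x \<gamma>s = 0" if "length \<gamma>s \<le> 1" for \<gamma>s
    using that t(3) Phi_T_Nil[OF t(2)] by (cases \<gamma>s) (auto simp: length_Suc_conv)
  have P: "Phi (tensor_left 0 y + tensor_right q x b + x * y) \<gamma>s = RA (Phi x) b \<gamma>s" if "length \<gamma>s \<le> 2" for \<gamma>s
    using that Phi_suffix_zero[OF t(2) s(3) z, of 1 \<gamma>s]
    by (simp add: Phi_add Phi_tensor_left[OF s(3)] Phi_tensor_right[OF t(2) W_OA[OF s(2)]])
  have T: "tensor_left 0 y + tensor_right q x b + x * y \<in> T"
    using s t by (intro T_closed tensor_left_T tensor_right_T T_mult W_zero)
  have "RA (Phi x) b [\<gamma>] = 0" for \<gamma>
    by (simp add: RA_def sum_tl_set_Suc tl_set_0 t(3))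
  then show ?case using T P[of "[_]"] P[of "[_, _]"] rel2_right[OF t(4) s(2)] by (simp add: s t RA_two del: Nop.simps)
qed

section \<open>Commutation relations of the root vectors on B\<close>

lemma br_eigen:
  assumes "f \<in> D" and "rt (K i) f = fscale c f" and "c \<noteq> 0"
  shows "br i f = fscale (inverse (Q - inverse Q) * (c - inverse c)) f"
proof -
  have "f = fscale c (rt (Kinv i) f)"
    using D_Kinv_K[OF assms(1), of i] unfolding assms(2) by simp
  then have "rt (Kinv i) f = fscale (inverse c) f" using assms(3) by (rule fscale_swap)
  then show ?thesis by (simp add: br_def assms(2) fn.scale_left_diff_distrib[symmetric])
qed

text \<open>The bracket acts by the quantum integer of the weight; its values at 1, -1 and 0 suffice
  for the second-order operators on B.\<close>

lemma br_pos: "f \<in> D \<Longrightarrow> rt (K i) f = fscale Q f \<Longrightarrow> br i f = f"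
  using br_eigen[of f i Q] Q0 Qdiff(3) by simp

lemma br_neg: "f \<in> D \<Longrightarrow> rt (K i) f = fscale (inverse Q) f \<Longrightarrow> br i f = - f"
proof -
  have "inverse (Q - inverse Q) * (inverse Q - Q) = - 1"
    using Qdiff(3) by (metis left_inverse minus_diff_eq mult_minus_right)
  then show "f \<in> D \<Longrightarrow> rt (K i) f = fscale (inverse Q) f \<Longrightarrow> br i f = - f"
    using br_eigen[of f i "inverse Q"] Q0 by simp
qed

lemma br_zero: "f \<in> D \<Longrightarrow> rt (K i) f = f \<Longrightarrow> br i f = 0"
  using br_eigen[of f i 1] by simp

text \<open>An entry \<open>(X, Y, l, z, Z)\<close> stands for the relation \<open>Y X \<equiv> l X Y + z Z\<close> in \<open>U\<^sub>q(sl\<^sub>3)\<close> modulo the left ideal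
  generated by the \<open>K\<^sub>i - 1\<close>.\<close>
definition swap_table :: "(tang \<times> tang \<times> complex \<times> complex \<times> tang) list" where
  "swap_table = [(TE A1, TE A2, inverse Q, 1, TE A12), (TE A1, TE A12, Q, 0, TE A1), (TE A12, TE A2, Q, 0, TE A1),
     (TF A1, TF A2, Q, - Q, TF A12), (TF A1, TF A12, inverse Q, 0, TE A1), (TF A12, TF A2, inverse Q, 0, TE A1),
     (TF A2, TE A1, Q, 0, TE A1), (TF A1, TE A2, Q, 0, TE A1),
     (TF A12, TE A1, inverse Q, inverse Q, TF A2), (TF A12, TE A2, inverse Q, - (inverse Q * inverse Q), TF A1),
     (TF A1, TE A12, inverse Q, inverse Q * (inverse Q * inverse Q), TE A2), (TF A2, TE A12, inverse Q, - (inverse Q * inverse Q), TE A1)]"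

text \<open>The coefficient of F_2 E_2 - F_1 E_1 when E_12 is moved past F_12; see
  \<open>PZ_rel\<close>.\<close>

definition mu :: complex where "mu = inverse Q ^ 3 - inverse Q ^ 5"

lemma Qpow: "Q ^ 3 = Q * (Q * Q)" "Q ^ 4 = Q * (Q * (Q * Q))" "inverse Q ^ 3 = inverse Q * (inverse Q * inverse Q)"
   "inverse Q ^ 4 = inverse Q * (inverse Q * (inverse Q * inverse Q))"
   "inverse Q ^ 5 = inverse Q * (inverse Q * (inverse Q * (inverse Q * inverse Q)))"
   "Q\<^sup>2 = Q * Q" "inverse Q ^ 2 = inverse Q * inverse Q"
   "inverse Q ^ 6 = inverse Q * (inverse Q * (inverse Q * (inverse Q * (inverse Q * inverse Q))))"
  by (simp_all only: power_numeral_reduce pred_numeral_simps Num.BitM.simps power_numeral_even power_numeral_odd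
      Let_def power_one_right mult.assoc power2_eq_square power3_eq_cube power4_eq_xxxx numeral_One power_0 mult_1_right)

text \<open>As \<open>c\<close> has weight zero, every K moved inward becomes a scalar. The rows
  pairing E_12 or F_12 with a simple root vector of the same sign are the Serre relations.\<close>

lemma swap_table_rel:
  assumes c: "c \<in> W 0" and "(X, Y, l, z, Z) \<in> set swap_table"
  shows "tv Y (tv X c) = fscale l (tv X (tv Y c)) + fscale z (tv Z c)"
proof -
  have cD: "c \<in> D" using c W_D by blast
  have K: "rt (K i) c = c" "rt (Kinv i) c = c" for i
    using W_K[OF c] W_Kinv[OF c] by (cases i; simp)+
  note EE = D_EEE[OF cD, of N1 N2] D_EEE[OF cD, of N2 N1]
  note FF = D_FFF[OF cD, of N1 N2] D_FFF[OF cD, of N2 N1]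
  show ?thesis
    using assms(2) unfolding swap_table_def
    by (simp only: set_simps insert_iff empty_iff prod.inject, elim disjE conjE FalseE;
      simp add: cD K D_KE D_KF D_EF br_pos br_neg br_zero;
      simp add: EE FF K cD fun_eq_iff fscale_def plus_fun_apply algebra_simps Qpow Qcancel)
qed

lemma PZ_rel:
  assumes c: "c \<in> W 0"
  shows "tv (TE A1) (tv (TF A1) c) = fscale (inverse Q ^ 2) (tv (TF A1) (tv (TE A1) c))"
    "tv (TE A2) (tv (TF A2) c) = fscale (inverse Q ^ 2) (tv (TF A2) (tv (TE A2) c))"
    "tv (TE A12) (tv (TF A12) c) = fscale (inverse Q ^ 2) (tv (TF A12) (tv (TE A12) c))
       + fscale mu (tv (TF A2) (tv (TE A2) c) - tv (TF A1) (tv (TE A1) c))"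
proof -
  have cD: "c \<in> D" using c W_D by blast
  have K: "rt (K i) c = c" "rt (Kinv i) c = c" for i
    using W_K[OF c] W_Kinv[OF c] by (cases i; simp)+
  show "tv (TE A1) (tv (TF A1) c) = fscale (inverse Q ^ 2) (tv (TF A1) (tv (TE A1) c))"
    "tv (TE A2) (tv (TF A2) c) = fscale (inverse Q ^ 2) (tv (TF A2) (tv (TE A2) c))"
    "tv (TE A12) (tv (TF A12) c) = fscale (inverse Q ^ 2) (tv (TF A12) (tv (TE A12) c))
       + fscale mu (tv (TF A2) (tv (TE A2) c) - tv (TF A1) (tv (TE A1) c))"
    by (simp add: cD K D_KE D_KF D_EF br_pos br_neg br_zero;
      simp add: mu_def fun_eq_iff fscale_def plus_fun_apply algebra_simps Qpow Qcancel)+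
qed

section \<open>Second-order test functions and the relations they produce\<close>

fun Nop_support :: "tang \<Rightarrow> tang \<Rightarrow> bool" where
  "Nop_support (TE a) (TE b) \<longleftrightarrow> a = b \<or> a = A1 \<and> b = A12"
| "Nop_support (TF a) (TF b) \<longleftrightarrow> a = b \<or> a = A1 \<and> b = A12"
| "Nop_support _ _ \<longleftrightarrow> False"

lemma Nop_Nop_support: "\<not> Nop_support \<delta> \<gamma> \<Longrightarrow> Nop \<delta> \<gamma> f = 0"
  by (cases \<delta>; cases \<gamma>) auto

lemma Nop_same: "f \<in> W 0 \<Longrightarrow> Nop \<gamma> \<gamma> f = f"
proof -
  assume f: "f \<in> W 0"
  have "kk r f = f" for r using W_K[OF f] by (cases r) simp_all
  then show ?thesis by (cases \<gamma>) simp_all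
qed

lemma ev_Leibniz2:
  assumes b: "b \<in> W 0" and b': "b' \<in> W 0" and "b 0 = 0"
  shows "tv X (tv Y (b \<star> b')) 0 = (\<Sum>Z\<in>UNIV. \<Sum>V\<in>UNIV. tv V (tv Z b) 0 * Nop V X (Nop Z Y b') 0)
     + (\<Sum>Z\<in>UNIV. tv Z b 0 * tv X (Nop Z Y b') 0) + (\<Sum>V\<in>UNIV. tv V b 0 * Nop V X (tv Y b') 0)"
proof -
  have D: "b \<in> D" "b' \<in> D" "\<And>Z. tv Z b \<in> D" "\<And>Z. tv Z b' \<in> D"
    using W_D b b' tv_W by blast+
  have ts: "tv \<gamma> (\<Sum>i\<in>I. h i) = (\<Sum>i\<in>I. tv \<gamma> (h i))" for \<gamma> and I :: "tang set" and h
    by (induction I rule: infinite_finite_induct) simp_all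
  show ?thesis
    by (simp add: tv_conv D ts plus_fun_apply sum_apply assms(3) sum.distrib del: Nop.simps)
qed

text \<open>The order of the factors matches the operator X Y: the inner Y differentiates the first
  factor and X the second.\<close>

definition coord2 :: "tang \<Rightarrow> tang \<Rightarrow> fnl" where "coord2 X Y = coord Y \<star> coord X"

lemma coord2_W: "coord2 X Y \<in> W 0"
  using W_conv[OF coord_W coord_W, of Y X] by (simp add: coord2_def)

lemma coord2_left_weight: "left_weight (wt X + wt Y) (coord2 X Y)"
  using left_weight_conv[OF coord_left_weight coord_left_weight, of Y X] by (simp add: coord2_def add.commute)

lemma coord2_evaluable: "evaluable (wt X + wt Y) 0 (coord2 X Y)"
  using evaluable_conv[OF coord_evaluable coord_evaluable, of Y X] by (simp add: coord2_def add.commute)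

lemma coord2_ev_other: "wt \<gamma> + wt \<delta> \<noteq> wt X + wt Y \<Longrightarrow> tv \<gamma> (tv \<delta> (coord2 X Y)) 0 = 0"
  using ev_zero[OF tv_W[OF tv_W[OF coord2_W]] tv_left_weight[OF tv_left_weight[OF coord2_left_weight]], of X Y \<delta> \<gamma>] by (simp add: add.commute)

text \<open>By the weight hypothesis both derivatives cannot fall on \<open>coord P\<close>. With
  one derivative on each factor, only P contributes on the first.\<close>

lemma coord2_ev:
  assumes "\<And>V Z. Nop_support V X \<Longrightarrow> Nop_support Z Y \<Longrightarrow> wt V + wt Z \<noteq> wt P"
  shows "tv X (tv Y (coord2 R P)) 0 = tv P (coord P) 0 * (tv X (Nop P Y (coord R)) 0 + Nop P X (tv Y (coord R)) 0)"
proof -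
  have z: "tv V (tv Z (coord P)) 0 * Nop V X (Nop Z Y (coord R)) 0 = 0" for V Z
  proof (cases "Nop_support V X \<and> Nop_support Z Y")
    case True
    then have "wt P \<noteq> 0 + wt Z + wt V" using assms[of V Z] by (simp add: add.commute)
    then have "tv V (tv Z (coord P)) 0 = 0"
      by (rule ev_zero[OF tv_W[OF tv_W[OF coord_W]] tv_left_weight[OF tv_left_weight[OF coord_left_weight]]])
    then show ?thesis by simp
  next
    case False
    then have "Nop V X (Nop Z Y (coord R)) = 0" using Nop_Nop_support[of V X] Nop_Nop_support[of Z Y] by auto
    then show ?thesis by (simp add: zero_fun_apply)
  qed
  have s: "(\<Sum>Z\<in>UNIV. tv Z (coord P) 0 * h Z) = tv P (coord P) 0 * h P" for h
  proof -
    have "(\<Sum>Z\<in>UNIV. tv Z (coord P) 0 * h Z) = (\<Sum>Z\<in>UNIV. if Z = P then tv P (coord P) 0 * h P else 0)"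
      using tv_coord_other[of _ P] by (intro sum.cong) auto
    then show ?thesis by simp
  qed
  show ?thesis
    unfolding coord2_def ev_Leibniz2[OF coord_W coord_W coord_at_zero] z s by (simp add: distrib_left del: Nop.simps)
qed

text \<open>A first derivative has to fall on \<open>coord P\<close> and leaves
  \<open>Nop P Z\<close> of \<open>coord R\<close> at the counit. By weight this can be nonzero only
  for an off-diagonal entry, which gives the two excluded pairs.\<close>

lemma coord2_T_zero:
  assumes "\<not> (P = TE A1 \<and> R = TE A2)" and "\<not> (P = TF A1 \<and> R = TF A2)"
  shows "tv Z (coord2 R P) 0 = 0"
proof -
  have D: "coord P \<in> D" "coord R \<in> D" using coord_W W_D by blast+
  have "tv V (coord P) 0 * Nop V Z (coord R) 0 = 0" for V
  proof (cases "V = P \<and> Nop_support P Z")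
    case True
    have "Nop P Z (coord R) 0 = 0"
    proof (cases "P = Z")
      case True
      then show ?thesis by (simp add: Nop_same[OF coord_W])
    next
      case False
      then have "P = TE A1 \<and> Z = TE A12 \<or> P = TF A1 \<and> Z = TF A12"
        using True by (cases P; cases Z) auto
      then have "wt R \<noteq> 0 + wt Z - wt P"
        using assms wt_inj[of R "TE A2"] wt_inj[of R "TF A2"] by auto
      then show ?thesis by (rule ev_zero[OF Nop_W[OF coord_W] Nop_left_weight[OF coord_left_weight]])
    qed
    then show ?thesis using True by simp
  next
    case False
    then show ?thesis using tv_coord_other[of V P] Nop_Nop_support[of P Z "coord R"] by (cases "V = P") (simp_all add: zero_fun_apply)
  qed
  then have "(\<Sum>V\<in>UNIV. tv V (coord P) 0 * Nop V Z (coord R) 0) = 0" by (intro sum.neutral) blast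
  then show ?thesis
    unfolding coord2_def tv_conv[OF D] by (simp add: plus_fun_apply sum_apply)
qed

text \<open>Legs a_i, b_i evaluating \<open>c\<close> satisfy sum of a_i db_i = 0 when all first
  derivatives of \<open>c\<close> vanish at the counit, so the sum of d(a a_i) db_i lies in the
  ideal; by the Leibniz rule its coordinates are second derivatives of \<open>c\<close> times
  \<open>a\<close>, up to sign.\<close>

lemma rel_J:
  assumes "evaluable p 0 c" and z: "\<And>Z. tv Z c 0 = 0" and a: "a \<in> W p"
  shows "\<exists>x\<in>TW 2. x \<in> J \<and> (\<forall>\<gamma> \<delta>. Phi x [\<gamma>, \<delta>] = fscale (tv \<gamma> (tv \<delta> c) 0) a)"
proof -
  obtain ts where ts: "set ts \<subseteq> W (- p) \<times> W 0" "evaluates c ts" using assms(1) unfolding evaluable_def by blast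
  let ?l = "map (\<lambda>t. (a \<star> fst t, snd t)) ts"
  have mem: "a \<star> fst t \<in> W 0" "snd t \<in> W 0" if "t \<in> set ts" for t
    using W_conv[OF a, of "fst t" "- p"] ts(1) that by auto
  have h: "(\<Sum>t\<leftarrow>ts. (a \<star> fst t) \<star> act X (snd t)) = fscale (act X c 0) a" for X
    using evaluates_general[OF ts(2), of X]
    by (simp add: conv_assoc conv_sum_list_right[symmetric] conv_fscale_right act_def)
  let ?x = "\<Sum>t\<leftarrow>ts. fw [dif q (a \<star> fst t), dif q (snd t)]"
  have M: "dif q b \<in> M" if "b \<in> W 0" for b using that by (intro Omega1F3.dif) (simp add: OqF3_eq)
  have "(0, \<Sum>(b, c)\<leftarrow>?l. fw [dif q b, dif q c]) \<in> prolong_ideal q"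
  proof (rule prolong_ideal.gen)
    show "set ?l \<subseteq> OqF3 q \<times> OqF3 q" using mem by (auto simp: OqF3_eq)
    show "(\<Sum>(b, c)\<leftarrow>?l. form_left b (dif q c)) = 0"
    proof
      fix \<gamma>
      have "(\<Sum>t\<leftarrow>ts. form_left (a \<star> fst t) (dif q (snd t))) \<gamma> = (\<Sum>t\<leftarrow>ts. (a \<star> fst t) \<star> act (tvec q \<gamma>) (snd t))"
        by (subst sum_list_apply, intro arg_cong[where f = sum_list] map_cong refl)
          (simp add: form_left_apply dif_eq W_OA[OF mem(2)] dd_def act_tvec)
      then show "(\<Sum>(b, c)\<leftarrow>?l. form_left b (dif q c)) \<gamma> = 0 \<gamma>"
        unfolding h by (simp add: o_def split_def act_tvec z zero_fun_apply)
    qed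
  qed
  then have J: "?x \<in> J" by (simp add: J_def o_def split_def)
  have TW: "?x \<in> TW 2"
    using mem by (induction ts) (simp_all add: TW_closed TW_fw M)
  have P: "Phi ?x [\<gamma>, \<delta>] = - fscale (tv \<gamma> (tv \<delta> c) 0) a" for \<gamma> \<delta>
  proof -
    have "Phi ?x [\<gamma>, \<delta>] = (\<Sum>t\<leftarrow>ts. tv \<gamma> ((a \<star> fst t) \<star> tv \<delta> (snd t)) - (a \<star> fst t) \<star> tv \<gamma> (tv \<delta> (snd t)))"
      unfolding Phi_sum_list
    proof (intro arg_cong[where f = sum_list] map_cong refl)
      fix t assume t: "t \<in> set ts"
      have D: "a \<star> fst t \<in> D" "tv \<delta> (snd t) \<in> D" using mem[OF t] tv_W W_D by blast+
      have "FR (dd (a \<star> fst t)) (tv \<delta> (snd t)) \<gamma> = tv \<gamma> ((a \<star> fst t) \<star> tv \<delta> (snd t)) - (a \<star> fst t) \<star> tv \<gamma> (tv \<delta> (snd t))"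
        using dd_conv[OF D] by (simp add: dd_def fun_eq_iff[where 'a = tang] plus_fun_apply form_left_apply)
      then show "Phi (fw [dif q (a \<star> fst t), dif q (snd t)]) [\<gamma>, \<delta>] = tv \<gamma> ((a \<star> fst t) \<star> tv \<delta> (snd t)) - (a \<star> fst t) \<star> tv \<gamma> (tv \<delta> (snd t))"
        using mem[OF t] by (simp add: Phi_fw dif_eq W_OA FR_unit, simp add: dd_def)
    qed
    also have "\<dots> = tv \<gamma> (\<Sum>t\<leftarrow>ts. (a \<star> fst t) \<star> tv \<delta> (snd t)) - (\<Sum>t\<leftarrow>ts. (a \<star> fst t) \<star> tv \<gamma> (tv \<delta> (snd t)))"
      by (simp add: tv_sum_list sum_list_subtractf)
    also have "\<dots> = - fscale (tv \<gamma> (tv \<delta> c) 0) a"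
      using h[of "tvec q \<delta>"] h[of "tvec q \<gamma> * tvec q \<delta>"] by (simp add: act_mult act_tvec z)
    finally show ?thesis .
  qed
  have "- ?x \<in> J" "- ?x \<in> TW 2"
    using J_closed(3)[OF J, of "- 1"] TW_closed(3)[OF TW, of "- 1"] unfolding scl_minus_one .
  moreover have "\<forall>\<gamma> \<delta>. Phi (- ?x) [\<gamma>, \<delta>] = fscale (tv \<gamma> (tv \<delta> c) 0) a"
    unfolding Phi_uminus P by simp
  ultimately show ?thesis by blast
qed

text \<open>Coefficient families realised inside the ideal: the lower bound matching
  \<open>rel2\<close>.\<close>

definition relations2 :: "(tang \<Rightarrow> tang \<Rightarrow> fnl) set" where
  "relations2 = {t. \<exists>x\<in>TW 2. x \<in> J \<and> (\<forall>\<gamma> \<delta>. Phi x [\<gamma>, \<delta>] = t \<gamma> \<delta>)}"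

lemma relations2_zero: "(\<lambda>\<gamma> \<delta>. 0) \<in> relations2"
  unfolding relations2_def using J_closed(1) TW_closed(1)[of 2] by force

lemma relations2_add: "s \<in> relations2 \<Longrightarrow> t \<in> relations2 \<Longrightarrow> (\<lambda>\<gamma> \<delta>. s \<gamma> \<delta> + t \<gamma> \<delta>) \<in> relations2"
proof -
  assume "s \<in> relations2" "t \<in> relations2"
  then obtain x y where "x \<in> TW 2" "x \<in> J" "\<forall>\<gamma> \<delta>. Phi x [\<gamma>, \<delta>] = s \<gamma> \<delta>" "y \<in> TW 2" "y \<in> J" "\<forall>\<gamma> \<delta>. Phi y [\<gamma>, \<delta>] = t \<gamma> \<delta>"
    unfolding relations2_def by blast
  then have "x + y \<in> TW 2" "x + y \<in> J" "\<forall>\<gamma> \<delta>. Phi (x + y) [\<gamma>, \<delta>] = s \<gamma> \<delta> + t \<gamma> \<delta>"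
    by (simp_all add: TW_closed J_closed Phi_add)
  then show ?thesis unfolding relations2_def by blast
qed

lemma relations2_sum_list: "(\<And>l. l \<in> set xs \<Longrightarrow> f l \<in> relations2) \<Longrightarrow> (\<lambda>\<gamma> \<delta>. \<Sum>l\<leftarrow>xs. f l \<gamma> \<delta>) \<in> relations2"
  by (induction xs) (simp_all add: relations2_zero relations2_add)

lemma relations2_rel:
  assumes "\<not> (P = TE A1 \<and> R = TE A2)" and "\<not> (P = TF A1 \<and> R = TF A2)" and "a \<in> W (wt R + wt P)"
  shows "(\<lambda>\<gamma> \<delta>. fscale (tv \<gamma> (tv \<delta> (coord2 R P)) 0) a) \<in> relations2"
  using rel_J[OF coord2_evaluable coord2_T_zero[OF assms(1,2)] assms(3)] unfolding relations2_def by blast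

definition swap_relation :: "tang \<Rightarrow> tang \<Rightarrow> complex \<Rightarrow> fnl \<Rightarrow> tang \<Rightarrow> tang \<Rightarrow> fnl" where
  "swap_relation X Y l a = (\<lambda>\<gamma> \<delta>. if \<gamma> = X \<and> \<delta> = Y then a else if \<gamma> = Y \<and> \<delta> = X then fscale l a else 0)"

lemma swap_table_facts:
  assumes "(X, Y, l, z, Z) \<in> set swap_table"
  shows "\<not> (Y = TE A1 \<and> X = TE A2)" "\<not> (Y = TF A1 \<and> X = TF A2)" "X \<noteq> Y" "\<not> Nop_support Y X"
    "Nop_support V X \<Longrightarrow> Nop_support V' Y \<Longrightarrow> wt V + wt V' \<noteq> wt Y"
    "wt \<gamma> + wt \<delta> = wt X + wt Y \<Longrightarrow> \<gamma> = X \<and> \<delta> = Y \<or> \<gamma> = Y \<and> \<delta> = X"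
proof -
  have "\<forall>(X, Y, l, z, Z)\<in>set swap_table. \<not> (Y = TE A1 \<and> X = TE A2) \<and> \<not> (Y = TF A1 \<and> X = TF A2) \<and> X \<noteq> Y \<and> \<not> Nop_support Y X"
    by (simp add: swap_table_def)
  then show "\<not> (Y = TE A1 \<and> X = TE A2)" "\<not> (Y = TF A1 \<and> X = TF A2)" "X \<noteq> Y" "\<not> Nop_support Y X"
    using assms by auto
  have "\<forall>V V'. \<forall>(X, Y, l, z, Z)\<in>set swap_table. Nop_support V X \<longrightarrow> Nop_support V' Y \<longrightarrow> wt V + wt V' \<noteq> wt Y"
    unfolding all_tang by (simp add: swap_table_def)
  then show "Nop_support V X \<Longrightarrow> Nop_support V' Y \<Longrightarrow> wt V + wt V' \<noteq> wt Y" using assms by blast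
  have "\<forall>\<gamma> \<delta>. \<forall>(X, Y, l, z, Z)\<in>set swap_table. wt \<gamma> + wt \<delta> = wt X + wt Y \<longrightarrow> \<gamma> = X \<and> \<delta> = Y \<or> \<gamma> = Y \<and> \<delta> = X"
    unfolding all_tang by (simp add: swap_table_def, simp add: zero_prod_def)
  then show "wt \<gamma> + wt \<delta> = wt X + wt Y \<Longrightarrow> \<gamma> = X \<and> \<delta> = Y \<or> \<gamma> = Y \<and> \<delta> = X" using assms by blast
qed

text \<open>The first derivatives of \<open>coord2 X Y\<close> vanish at the counit, so the
  lower-order term with coefficient \<open>z\<close> disappears; by weight only X Y and Y X see this
  test function, with values in ratio \<open>l\<close>.\<close>

lemma swap_relation_relations2:
  assumes swap_table: "(X, Y, l, z, Z) \<in> set swap_table" and a: "a \<in> W (wt X + wt Y)"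
  shows "swap_relation X Y l a \<in> relations2"
proof -
  note f = swap_table_facts[OF swap_table]
  define r where "r = tv X (tv Y (coord2 X Y)) 0"
  have "r = tv Y (coord Y) 0 * tv X (coord X) 0"
    unfolding r_def using coord2_ev[of X Y Y X, OF f(5)] f(4)
    by (simp add: Nop_Nop_support Nop_same[OF coord_W] zero_fun_apply)
  then have r0: "r \<noteq> 0" using tv_coord_same by simp
  have r': "tv Y (tv X (coord2 X Y)) 0 = l * r"
    unfolding swap_table_rel[OF coord2_W swap_table] r_def using coord2_T_zero[OF f(1,2), of Z] by (simp add: plus_fun_apply fscale_def)
  have "swap_relation X Y l a = (\<lambda>\<gamma> \<delta>. fscale (tv \<gamma> (tv \<delta> (coord2 X Y)) 0) (fscale (inverse r) a))"
  proof (intro ext)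
    fix \<gamma> \<delta> w
    show "swap_relation X Y l a \<gamma> \<delta> w = fscale (tv \<gamma> (tv \<delta> (coord2 X Y)) 0) (fscale (inverse r) a) w"
    proof (cases "wt \<gamma> + wt \<delta> = wt X + wt Y")
      case True
      then show ?thesis using f(6)[OF True] f(3) r0 r' by (auto simp: swap_relation_def r_def[symmetric] mult.assoc)
    next
      case False
      moreover have "\<not> (\<gamma> = X \<and> \<delta> = Y)" "\<not> (\<gamma> = Y \<and> \<delta> = X)" using False by (auto simp: add.commute)
      ultimately show ?thesis using coord2_ev_other[OF False] by (auto simp: swap_relation_def)
    qed
  qed
  then show ?thesis using relations2_rel[OF f(1,2), of "fscale (inverse r) a"] W_fscale[OF a] by simp
qed

lemma sq_facts:
  "Nop_support V X \<Longrightarrow> Nop_support V' X \<Longrightarrow> wt V + wt V' \<noteq> wt X"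
  "wt \<gamma> + wt \<delta> = wt X + wt X \<Longrightarrow> \<gamma> = X \<and> \<delta> = X"
  by (cases X rule: tang6; cases V rule: tang6; cases V' rule: tang6; simp)
     (cases X rule: tang6; cases \<gamma> rule: tang6; cases \<delta> rule: tang6; simp)

text \<open>The two copies of X fall on different factors in either order, so their value carries
  the factor 1 + q^2 or 1 + q^(-2).\<close>

lemma sq_relations2:
  assumes a: "a \<in> W (wt X + wt X)"
  shows "swap_relation X X 1 a \<in> relations2"
proof -
  define r where "r = tv X (tv X (coord2 X X)) 0"
  have "r = tv X (coord X) 0 * (tv X (coord X) 0 + Nop X X (tv X (coord X)) 0)"
    unfolding r_def using coord2_ev[of X X X X, OF sq_facts(1)] by (simp add: Nop_same[OF coord_W])
  moreover have "\<exists>s. s \<noteq> - 1 \<and> Nop X X (tv X (coord X)) = fscale s (tv X (coord X))"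
  proof -
    \<comment> \<open>Reality of q enters here: squares of real numbers are never -1.\<close>
    have q1: "complex_of_real x * complex_of_real x \<noteq> - 1" for x
    proof
      assume "complex_of_real x * complex_of_real x = - 1"
      then have "complex_of_real (x * x) = complex_of_real (- 1)" by simp
      then have "x * x = - 1" by (simp only: of_real_eq_iff)
      with zero_le_square[of x] show False by linarith
    qed
    have W: "tv X (coord X) \<in> W (wt X)" using tv_W[OF coord_W, of X X] by simp
    have "Nop X X (tv X (coord X)) = fscale (if \<exists>r. X = TE r then Q * Q else inverse Q * inverse Q) (tv X (coord X))"
      using W_K[OF W] by (cases X rule: tang6) (simp_all add: power_int_minus Qpow del: tv.simps coord.simps)
    moreover have "(if \<exists>r. X = TE r then Q * Q else inverse Q * inverse Q) \<noteq> - 1"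
      using q1[of q] q1[of "inverse q"] by simp
    ultimately show ?thesis by blast
  qed
  then obtain s where s: "s \<noteq> - 1" "Nop X X (tv X (coord X)) = fscale s (tv X (coord X))" by blast
  ultimately have "r = tv X (coord X) 0 * (tv X (coord X) 0 * (1 + s))"
    by (simp add: fscale_def algebra_simps)
  moreover have "1 + s \<noteq> 0" using s(1) by (metis add_eq_0_iff)
  ultimately have r0: "r \<noteq> 0" using tv_coord_same by simp
  have "swap_relation X X 1 a = (\<lambda>\<gamma> \<delta>. fscale (tv \<gamma> (tv \<delta> (coord2 X X)) 0) (fscale (inverse r) a))"
  proof (intro ext)
    fix \<gamma> \<delta> w
    show "swap_relation X X 1 a \<gamma> \<delta> w = fscale (tv \<gamma> (tv \<delta> (coord2 X X)) 0) (fscale (inverse r) a) w"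
    proof (cases "wt \<gamma> + wt \<delta> = wt X + wt X")
      case True
      then show ?thesis using sq_facts(2)[OF True] r0 by (auto simp: swap_relation_def r_def[symmetric])
    next
      case False
      then show ?thesis using coord2_ev_other[OF False] by (auto simp: swap_relation_def)
    qed
  qed
  then show ?thesis using relations2_rel[of X X "fscale (inverse r) a"] W_fscale[OF a] by simp
qed

text \<open>The relations of weight zero; the last term is the only one that mixes the roots.\<close>
definition weight_zero_relation :: "fnl \<Rightarrow> fnl \<Rightarrow> fnl \<Rightarrow> tang \<Rightarrow> tang \<Rightarrow> fnl" where
  "weight_zero_relation a b c = (\<lambda>\<gamma> \<delta>. swap_relation (TF A1) (TE A1) (inverse Q ^ 2) a \<gamma> \<delta> + swap_relation (TF A2) (TE A2) (inverse Q ^ 2) b \<gamma> \<delta>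
     + swap_relation (TF A12) (TE A12) (inverse Q ^ 2) c \<gamma> \<delta>
     + (if \<gamma> = TE A12 \<and> \<delta> = TF A12 then fscale mu (b - a) else 0))"

lemma weight_zero_relation_rel:
  assumes P: "(R, P) \<in> {(TF A1, TE A1), (TF A2, TE A2), (TF A12, TE A12)}" and a: "a \<in> W 0"
  shows "weight_zero_relation (fscale (tv (TF A1) (tv (TE A1) (coord2 R P)) 0) a) (fscale (tv (TF A2) (tv (TE A2) (coord2 R P)) 0) a)
     (fscale (tv (TF A12) (tv (TE A12) (coord2 R P)) 0) a) \<in> relations2"
proof -
  have w: "wt R + wt P = 0" and n: "\<not> (P = TE A1 \<and> R = TE A2)" "\<not> (P = TF A1 \<and> R = TF A2)"
    using P by (auto simp: zero_prod_def)
  have u: "\<forall>\<gamma> \<delta>. wt \<gamma> + wt \<delta> = 0 \<longrightarrow> (\<gamma>, \<delta>) \<in> {(TF A1, TE A1), (TF A2, TE A2), (TF A12, TE A12), (TE A1, TF A1), (TE A2, TF A2), (TE A12, TF A12)}"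
    unfolding all_tang by (simp add: zero_prod_def)
  have z: "tv \<gamma> (tv \<delta> (coord2 R P)) 0 = 0" if "(\<gamma>, \<delta>) \<notin> {(TF A1, TE A1), (TF A2, TE A2), (TF A12, TE A12), (TE A1, TF A1), (TE A2, TF A2), (TE A12, TF A12)}" for \<gamma> \<delta>
    using coord2_ev_other[of \<gamma> \<delta> R P] u that w by auto
  have e: "fscale (tv \<gamma> (tv \<delta> (coord2 R P)) 0) a = weight_zero_relation (fscale (tv (TF A1) (tv (TE A1) (coord2 R P)) 0) a) (fscale (tv (TF A2) (tv (TE A2) (coord2 R P)) 0) a)
     (fscale (tv (TF A12) (tv (TE A12) (coord2 R P)) 0) a) \<gamma> \<delta>" for \<gamma> \<delta>
  proof (cases "(\<gamma>, \<delta>) \<in> {(TF A1, TE A1), (TF A2, TE A2), (TF A12, TE A12), (TE A1, TF A1), (TE A2, TF A2), (TE A12, TF A12)}")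
    case True
    then show ?thesis
      unfolding weight_zero_relation_def swap_relation_def
      by (simp only: insert_iff empty_iff prod.inject, elim disjE conjE FalseE;
          simp add: PZ_rel[OF coord2_W] del: tv.simps;
          simp add: plus_fun_apply fscale_def fun_eq_iff algebra_simps del: tv.simps)
  next
    case False
    then show ?thesis using z[OF False] unfolding weight_zero_relation_def swap_relation_def by auto
  qed
  have "(\<lambda>\<gamma> \<delta>. fscale (tv \<gamma> (tv \<delta> (coord2 R P)) 0) a) = weight_zero_relation (fscale (tv (TF A1) (tv (TE A1) (coord2 R P)) 0) a) (fscale (tv (TF A2) (tv (TE A2) (coord2 R P)) 0) a)
     (fscale (tv (TF A12) (tv (TE A12) (coord2 R P)) 0) a)"
    by (intro ext) (rule fun_cong[OF e])
  then show ?thesis using relations2_rel[OF n, of a] a unfolding w by (simp only:)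
qed

lemma weight_zero_relation_add: "weight_zero_relation (a + a') (b + b') (c + c') \<gamma> \<delta> = weight_zero_relation a b c \<gamma> \<delta> + weight_zero_relation a' b' c' \<gamma> \<delta>"
  and weight_zero_relation_fscale: "weight_zero_relation (fscale s a) (fscale s b) (fscale s c) \<gamma> \<delta> = fscale s (weight_zero_relation a b c \<gamma> \<delta>)"
  by (simp_all add: weight_zero_relation_def swap_relation_def fun_eq_iff plus_fun_apply zero_fun_apply fscale_def algebra_simps)

text \<open>The three test functions give a triangular system: off the diagonal only F_12 E_12 can
  have a nonzero value. The third parameter is therefore solved first and used to correct the other
  two.\<close>

lemma weight_zero_relation_relations2:
  assumes a: "a \<in> W 0" and b: "b \<in> W 0" and c: "c \<in> W 0"
  shows "weight_zero_relation a b c \<in> relations2"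
proof -
  let ?e = "\<lambda>X Y R P. tv X (tv Y (coord2 R P)) 0"
  have nz0: "?e R P R P \<noteq> 0" if "(R, P) \<in> {(TF A1, TE A1), (TF A2, TE A2), (TF A12, TE A12)}" for R P
  proof -
    have c: "wt V + wt Z \<noteq> wt P" if "Nop_support V R" "Nop_support Z P" for V Z
      using that \<open>(R, P) \<in> _\<close> by (cases V rule: tang6; cases Z rule: tang6; auto)
    have n: "\<not> Nop_support P R" using that by auto
    show ?thesis using coord2_ev[of R P P R, OF c] n tv_coord_same that
      by (simp add: Nop_Nop_support Nop_same[OF coord_W] zero_fun_apply del: tv.simps Nop.simps coord.simps)
  qed
  have off: "?e X Y R P = 0" if "(R, P) \<in> {(TF A1, TE A1), (TF A2, TE A2), (TF A12, TE A12)}"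
      "(X, Y) \<in> {(TF A1, TE A1), (TF A2, TE A2)}" "P \<noteq> Y" for X Y R P
  proof -
    have c: "wt V + wt Z \<noteq> wt P" if "Nop_support V X" "Nop_support Z Y" for V Z
      using that \<open>(R, P) \<in> _\<close> \<open>(X, Y) \<in> _\<close> by (cases V rule: tang6; cases Z rule: tang6; auto)
    have n: "\<not> Nop_support P X" "\<not> Nop_support P Y" using that by auto
    show ?thesis using coord2_ev[of X Y P R, OF c] n by (simp add: Nop_Nop_support zero_fun_apply del: tv.simps Nop.simps coord.simps)
  qed
  have 3: "weight_zero_relation 0 0 x \<in> relations2" if "x \<in> W 0" for x
    using weight_zero_relation_rel[of "TF A12" "TE A12", OF _ W_fscale[OF that, of "inverse (?e (TF A12) (TE A12) (TF A12) (TE A12))"]]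
      nz0[of "TF A12" "TE A12"] off[of "TF A12" "TE A12"]
    by (simp del: tv.simps coord.simps)
  have 1: "weight_zero_relation x 0 0 \<in> relations2" if x: "x \<in> W 0" for x
  proof -
    let ?k = "inverse (?e (TF A1) (TE A1) (TF A1) (TE A1))"
    have "weight_zero_relation x 0 (fscale (?e (TF A12) (TE A12) (TF A1) (TE A1)) (fscale ?k x)) \<in> relations2"
      using weight_zero_relation_rel[of "TF A1" "TE A1", OF _ W_fscale[OF x, of ?k]] nz0[of "TF A1" "TE A1"] off[of "TF A1" "TE A1"]
      by (simp del: tv.simps coord.simps)
    from relations2_add[OF this 3[OF W_uminus[OF W_fscale[OF W_fscale[OF x]]], of "?e (TF A12) (TE A12) (TF A1) (TE A1)" ?k]]
    show ?thesis by (simp add: weight_zero_relation_add[symmetric] del: tv.simps)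
  qed
  have 2: "weight_zero_relation 0 x 0 \<in> relations2" if x: "x \<in> W 0" for x
  proof -
    let ?k = "inverse (?e (TF A2) (TE A2) (TF A2) (TE A2))"
    have "weight_zero_relation 0 x (fscale (?e (TF A12) (TE A12) (TF A2) (TE A2)) (fscale ?k x)) \<in> relations2"
      using weight_zero_relation_rel[of "TF A2" "TE A2", OF _ W_fscale[OF x, of ?k]] nz0[of "TF A2" "TE A2"] off[of "TF A2" "TE A2"]
      by (simp del: tv.simps coord.simps)
    from relations2_add[OF this 3[OF W_uminus[OF W_fscale[OF W_fscale[OF x]]], of "?e (TF A12) (TE A12) (TF A2) (TE A2)" ?k]]
    show ?thesis by (simp add: weight_zero_relation_add[symmetric] del: tv.simps)
  qed
  from relations2_add[OF relations2_add[OF 1[OF a] 2[OF b]] 3[OF c]] show ?thesis by (simp add: weight_zero_relation_add[symmetric])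
qed

text \<open>One equation for each unordered pair of distinct letters, fifteen in all, which is the
  rank of two-forms on a classical flag manifold with six directions.\<close>

definition satisfies_relations2 :: "(tang \<Rightarrow> tang \<Rightarrow> fnl) \<Rightarrow> bool" where
  "satisfies_relations2 t \<longleftrightarrow> (\<forall>(X, Y, l, z, Z)\<in>set swap_table. t Y X = fscale l (t X Y)) \<and>
     t (TE A1) (TF A1) = fscale (inverse Q ^ 2) (t (TF A1) (TE A1)) \<and>
     t (TE A2) (TF A2) = fscale (inverse Q ^ 2) (t (TF A2) (TE A2)) \<and>
     t (TE A12) (TF A12) = fscale (inverse Q ^ 2) (t (TF A12) (TE A12)) + fscale mu (t (TF A2) (TE A2) - t (TF A1) (TE A1))"

text \<open>The equations leave twenty-one free coefficients, one for each unordered pair including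
  the squares, and each of them is the leading coefficient of a relation already found.\<close>

lemma satisfies_relations2_relations2:
  assumes "\<And>\<gamma> \<delta>. t \<gamma> \<delta> \<in> W (wt \<gamma> + wt \<delta>)" and p: "satisfies_relations2 t"
  shows "t \<in> relations2"
proof -
  let ?A = "\<lambda>\<gamma> \<delta>. \<Sum>l\<leftarrow>swap_table. (case l of (X, Y, l, z, Z) \<Rightarrow> swap_relation X Y l (t X Y)) \<gamma> \<delta>"
  let ?B = "\<lambda>\<gamma> \<delta>. \<Sum>X\<leftarrow>[TE A1, TE A2, TE A12, TF A1, TF A2, TF A12]. swap_relation X X 1 (t X X) \<gamma> \<delta>"
  let ?C = "weight_zero_relation (t (TF A1) (TE A1)) (t (TF A2) (TE A2)) (t (TF A12) (TE A12))"
  have A: "?A \<in> relations2"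
  proof (rule relations2_sum_list)
    fix l assume "l \<in> set swap_table"
    moreover obtain X Y lm z Z where l: "l = (X, Y, lm, z, Z)" by (rule prod_cases5)
    ultimately show "(case l of (X, Y, l, z, Z) \<Rightarrow> swap_relation X Y l (t X Y)) \<in> relations2"
      using swap_relation_relations2[of X Y lm z Z "t X Y"] assms(1) by (simp only: prod.case)
  qed
  have B: "?B \<in> relations2" by (rule relations2_sum_list) (use assms(1) sq_relations2 in blast)
  have C: "?C \<in> relations2"
    using assms(1)[of "TF A1" "TE A1"] assms(1)[of "TF A2" "TE A2"] assms(1)[of "TF A12" "TE A12"]
    by (intro weight_zero_relation_relations2) (simp_all add: zero_prod_def)
  have p': "\<forall>p\<in>set swap_table. case p of (X, Y, l, z, Z) \<Rightarrow> t Y X = fscale l (t X Y)"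
    using p unfolding satisfies_relations2_def by blast
  have eqs: "t (TE A2) (TE A1) = fscale (inverse Q) (t (TE A1) (TE A2))"
    "t (TE A12) (TE A1) = fscale Q (t (TE A1) (TE A12))"
    "t (TE A2) (TE A12) = fscale Q (t (TE A12) (TE A2))"
    "t (TF A2) (TF A1) = fscale Q (t (TF A1) (TF A2))"
    "t (TF A12) (TF A1) = fscale (inverse Q) (t (TF A1) (TF A12))"
    "t (TF A2) (TF A12) = fscale (inverse Q) (t (TF A12) (TF A2))"
    "t (TE A1) (TF A2) = fscale Q (t (TF A2) (TE A1))"
    "t (TE A2) (TF A1) = fscale Q (t (TF A1) (TE A2))"
    "t (TE A1) (TF A12) = fscale (inverse Q) (t (TF A12) (TE A1))"
    "t (TE A2) (TF A12) = fscale (inverse Q) (t (TF A12) (TE A2))"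
    "t (TE A12) (TF A1) = fscale (inverse Q) (t (TF A1) (TE A12))"
    "t (TE A12) (TF A2) = fscale (inverse Q) (t (TF A2) (TE A12))"
    using p' unfolding swap_table_def by simp_all
  note eqs0 = p[unfolded satisfies_relations2_def, THEN conjunct2, THEN conjunct1] p[unfolded satisfies_relations2_def, THEN conjunct2, THEN conjunct2, THEN conjunct1]
    p[unfolded satisfies_relations2_def, THEN conjunct2, THEN conjunct2, THEN conjunct2]
  have e: "t \<gamma> \<delta> = ?A \<gamma> \<delta> + ?B \<gamma> \<delta> + ?C \<gamma> \<delta>" for \<gamma> \<delta>
    by (cases \<gamma> rule: tang6; cases \<delta> rule: tang6; simp add: swap_relation_def weight_zero_relation_def swap_table_def eqs eqs0)
  have "t = (\<lambda>\<gamma> \<delta>. ?A \<gamma> \<delta> + ?B \<gamma> \<delta> + ?C \<gamma> \<delta>)" by (intro ext) (rule fun_cong[OF e])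
  then show ?thesis by (rule ssubst) (rule relations2_add[OF relations2_add[OF A B] C])
qed

text \<open>Summing the operator identities against the left factors kills their first-order terms,
  by the condition built into \<open>rel2\<close>.\<close>

lemma rel2_satisfies_relations2:
  assumes "t \<in> rel2"
  shows "satisfies_relations2 t"
  using assms
proof (rule rel2E)
  fix ts
  assume ts: "set ts \<subseteq> W 0 \<times> W 0" "\<And>\<gamma>. (\<Sum>s\<leftarrow>ts. fst s \<star> tv \<gamma> (snd s)) = 0"
    "\<And>\<gamma> \<delta>. t \<gamma> \<delta> = (\<Sum>s\<leftarrow>ts. fst s \<star> tv \<gamma> (tv \<delta> (snd s)))"
  have mem: "snd s \<in> W 0" if "s \<in> set ts" for s using ts(1) that by auto
  have fs: "(\<Sum>s\<leftarrow>ts. fscale c (f s)) = fscale c (\<Sum>s\<leftarrow>ts. f s)" for c and f :: "_ \<Rightarrow> fnl"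
    by (induction ts) (simp_all add: fn.scale_right_distrib)
  have 1: "t Y X = fscale l (t X Y)" if "(X, Y, l, z, Z) \<in> set swap_table" for X Y l z Z
  proof -
    have "t Y X = (\<Sum>s\<leftarrow>ts. fscale l (fst s \<star> tv X (tv Y (snd s))) + fscale z (fst s \<star> tv Z (snd s)))"
      unfolding ts(3) by (intro arg_cong[where f = sum_list] map_cong refl)
        (simp add: swap_table_rel[OF mem that] conv_add_right conv_fscale_right)
    then show ?thesis by (simp add: sum_list_addf fs ts(2) ts(3))
  qed
  have 2: "t (TE A1) (TF A1) = fscale (inverse Q ^ 2) (t (TF A1) (TE A1))"
    "t (TE A2) (TF A2) = fscale (inverse Q ^ 2) (t (TF A2) (TE A2))"
    unfolding ts(3) fs[symmetric]
    by (intro arg_cong[where f = sum_list] map_cong refl, simp add: PZ_rel[OF mem] conv_fscale_right del: tv.simps)+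
  have 3: "t (TE A12) (TF A12) = fscale (inverse Q ^ 2) (t (TF A12) (TE A12)) + fscale mu (t (TF A2) (TE A2) - t (TF A1) (TE A1))"
    unfolding ts(3) fs[symmetric] sum_list_addf[symmetric] sum_list_subtractf[symmetric]
    by (intro arg_cong[where f = sum_list] map_cong refl, simp add: PZ_rel[OF mem] conv_fscale_right conv_add_right conv_diff_right del: tv.simps)
  have "\<forall>p\<in>set swap_table. case p of (X, Y, l, z, Z) \<Rightarrow> t Y X = fscale l (t X Y)"
  proof
    fix p assume p: "p \<in> set swap_table"
    obtain X Y lm z Z where e: "p = (X, Y, lm, z, Z)" by (rule prod_cases5)
    from p have "t Y X = fscale lm (t X Y)" unfolding e by (rule 1)
    then show "case p of (X, Y, l, z, Z) \<Rightarrow> t Y X = fscale l (t X Y)" unfolding e prod.case .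
  qed
  with 2 3 show ?thesis unfolding satisfies_relations2_def by blast
qed

section \<open>Coinvariant central two-forms\<close>

lemma is_coproductD: "is_coproduct f ts \<Longrightarrow> f (va + w) = (\<Sum>t\<leftarrow>ts. fst t va * snd t w)"
  by (simp add: is_coproduct_def split_def)

text \<open>Gaussian elimination: the right legs of a tensor lie in a subspace as soon as all its slices do.\<close>
lemma legs_in_subspace:
  assumes "fn.subspace S" and "set (map fst ts) \<subseteq> OA" and "\<And>va. (\<Sum>t\<leftarrow>ts. fscale (fst t va) (snd t)) \<in> S"
  shows "\<exists>ts'. set ts' \<subseteq> OA \<times> S \<and> (\<forall>va. (\<Sum>t\<leftarrow>ts'. fscale (fst t va) (snd t)) = (\<Sum>t\<leftarrow>ts. fscale (fst t va) (snd t)))"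
  using assms(2,3)
proof (induction "length ts" arbitrary: ts)
  case 0
  then show ?case by (intro exI[of _ "[]"]) simp
next
  case (Suc n)
  obtain a b rs where ts: "ts = (a, b) # rs" using Suc(2) by (cases ts) auto
  have aO: "a \<in> OA" and rsO: "set (map fst rs) \<subseteq> OA" using Suc.prems(1) ts by auto
  show ?case
  proof (cases "\<forall>va. a va = 0")
    case True
    then have e: "(\<Sum>t\<leftarrow>ts. fscale (fst t va) (snd t)) = (\<Sum>t\<leftarrow>rs. fscale (fst t va) (snd t))" for va
      by (simp add: ts)
    show ?thesis using Suc(1)[of rs] Suc(2) rsO Suc.prems(2) unfolding e by (simp add: ts)
  next
    case False
    then obtain v0 where v0: "a v0 \<noteq> 0" by blast
    define s0 where "s0 = (\<Sum>t\<leftarrow>ts. fscale (fst t v0) (snd t))"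
    define rs' where "rs' = map (\<lambda>t. (fst t - fscale (fst t v0 / a v0) a, snd t)) rs"
    have s0: "s0 \<in> S" using Suc.prems(2) by (simp add: s0_def)
    have e: "(\<Sum>t\<leftarrow>rs'. fscale (fst t va) (snd t)) = (\<Sum>t\<leftarrow>ts. fscale (fst t va) (snd t)) - fscale (a va / a v0) s0" for va
    proof -
      have 1: "(\<Sum>t\<leftarrow>xs. fscale ((fst t - fscale (fst t v0 / a v0) a) va) (snd t))
          = (\<Sum>t\<leftarrow>xs. fscale (fst t va) (snd t)) - fscale (a va / a v0) (\<Sum>t\<leftarrow>xs. fscale (fst t v0) (snd t))" for xs
      proof (induction xs)
        case (Cons x xs)
        have "fscale ((fst x - fscale (fst x v0 / a v0) a) va) (snd x) = fscale (fst x va) (snd x) - fscale (a va / a v0) (fscale (fst x v0) (snd x))"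
          by (simp add: fscale_def fun_eq_iff algebra_simps)
        then show ?case by (simp only: list.map sum_list.Cons Cons.IH fn.scale_right_distrib add_diff_add)
      qed simp
      have 2: "fscale (a va / a v0) (fscale (a v0) b) = fscale (a va) b" using v0 by simp
      show ?thesis
        unfolding s0_def rs'_def ts using 1[of rs] 2 v0 by (simp add: o_def fn.scale_right_distrib)
    qed
    have "set (map fst rs') \<subseteq> OA" using rsO aO by (auto simp: rs'_def intro!: OA_diff OA_fscale)
    moreover have "(\<Sum>t\<leftarrow>rs'. fscale (fst t va) (snd t)) \<in> S" for va
      unfolding e using Suc.prems(2) s0 assms(1) by (intro fn.subspace_diff fn.subspace_scale)
    ultimately obtain ts' where ts': "set ts' \<subseteq> OA \<times> S"
      "\<forall>va. (\<Sum>t\<leftarrow>ts'. fscale (fst t va) (snd t)) = (\<Sum>t\<leftarrow>rs'. fscale (fst t va) (snd t))"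
      using Suc(1)[of rs'] Suc(2) by (auto simp: ts rs'_def)
    have "fscale (fscale (inverse (a v0)) a va) s0 = fscale (a va / a v0) s0" for va
      by (simp add: fscale_def divide_inverse mult_ac)
    then show ?thesis
      using ts' s0 aO e by (intro exI[of _ "(fscale (inverse (a v0)) a, s0) # ts'"]) (auto intro: OA_fscale)
  qed
qed

lemma W_subspace: "fn.subspace (W p)"
  by (simp add: fn.subspace_def W_zero W_add W_fscale)

text \<open>The slices of \<open>f\<close> are left translates, and these commute with K acting from
  the right, so they stay in \<open>W p\<close>; elimination then moves the second legs
  there.\<close>

lemma W_coproduct:
  assumes f: "f \<in> W p"
  shows "\<exists>ts. set ts \<subseteq> OA \<times> W p \<and> is_coproduct f ts"
proof -
  obtain ts where ts: "set ts \<subseteq> OA \<times> OA" "is_coproduct f ts" using OA_coproduct[OF W_OA[OF f]] by blast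
  have e: "(\<Sum>t\<leftarrow>ts. fscale (fst t va) (snd t)) = (\<lambda>w. f (va + w))" for va
    using is_coproductD[OF ts(2)] by (simp add: fun_eq_iff sum_list_apply fscale_def)
  have "(\<lambda>w. f (va + w)) \<in> W p" for va
  proof -
    have "(\<lambda>w. f (va + w)) \<in> OA" unfolding e[symmetric] using ts(1) by (intro OA_sum_list OA_fscale) auto
    moreover have "rt x (\<lambda>w. f (va + w)) = (\<lambda>w. rt x f (va + w))" for x by (simp add: rt_def add.assoc)
    ultimately show ?thesis using W_K[OF f] by (simp add: W_def fscale_def)
  qed
  then obtain ts' where ts': "set ts' \<subseteq> OA \<times> W p" "\<forall>va. (\<Sum>t\<leftarrow>ts'. fscale (fst t va) (snd t)) = (\<Sum>t\<leftarrow>ts. fscale (fst t va) (snd t))"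
    using legs_in_subspace[OF W_subspace, of ts p] ts(1) unfolding e by fastforce
  have "is_coproduct f ts'"
    unfolding is_coproduct_def split_def
  proof (intro allI)
    fix va w
    have "(\<Sum>t\<leftarrow>ts'. fscale (fst t va) (snd t)) w = f (va + w)" using ts'(2) e by simp
    then show "f (va + w) = (\<Sum>t\<leftarrow>ts'. fst t va * snd t w)" by (simp add: sum_list_apply fscale_def)
  qed
  with ts'(1) show ?thesis by blast
qed

text \<open>Componentwise coproducts with second legs of the correct weight supply a candidate for
  the choice in \<open>coact_form\<close>.\<close>

lemma coact_form:
  assumes m: "m \<in> M"
  shows "set (coact_form q m) \<subseteq> OA \<times> M"
    "m \<gamma> (va + w) = (\<Sum>t\<leftarrow>coact_form q m. fst t va * snd t \<gamma> w)"
proof -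
  have "\<forall>\<gamma>. \<exists>ts. set ts \<subseteq> OA \<times> W (wt \<gamma>) \<and> is_coproduct (m \<gamma>) ts" using W_coproduct M_W[OF m] by blast
  then obtain cs where cs: "\<And>\<gamma>. set (cs \<gamma>) \<subseteq> OA \<times> W (wt \<gamma>)" "\<And>\<gamma>. is_coproduct (m \<gamma>) (cs \<gamma>)" by metis
  let ?l = "concat (map (\<lambda>\<gamma>. map (\<lambda>t. (fst t, sing \<gamma> (snd t))) (cs \<gamma>)) [TE A1, TE A2, TE A12, TF A1, TF A2, TF A12])"
  have cs': "a \<in> OA" "b \<in> W (wt \<gamma>)" if "(a, b) \<in> set (cs \<gamma>)" for a b \<gamma> using cs(1)[of \<gamma>] that by auto
  have "set ?l \<subseteq> OA \<times> M" by (auto intro!: sing_M dest: cs' simp del: wt.simps)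
  moreover have "m \<gamma> (va + w) = (\<Sum>(a, n)\<leftarrow>?l. a va * n \<gamma> w)" for \<gamma> va w
  proof -
    have z: "(\<Sum>t\<leftarrow>cs \<delta>. fst t va * sing \<delta> (snd t) \<gamma> w) = (if \<gamma> = \<delta> then m \<delta> (va + w) else 0)" for \<gamma> \<delta>
      unfolding is_coproductD[OF cs(2)] by (simp add: sing_def zero_fun_apply)
    show ?thesis
      by (cases \<gamma> rule: tang6) (simp_all add: split_def o_def z)
  qed
  ultimately have "set ?l \<subseteq> OqSU3 q \<times> M \<and> (\<forall>\<gamma> va w. m \<gamma> (va + w) = (\<Sum>(a, n)\<leftarrow>?l. a va * n \<gamma> w))"
    unfolding OqSU3_eq by (intro conjI allI)
  from someI[of "\<lambda>ts. set ts \<subseteq> OqSU3 q \<times> M \<and> (\<forall>\<gamma> va w. m \<gamma> (va + w) = (\<Sum>(a, n)\<leftarrow>ts. a va * n \<gamma> w))", OF this]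
  have c: "set (coact_form q m) \<subseteq> OqSU3 q \<times> M \<and> (\<forall>\<gamma> va w. m \<gamma> (va + w) = (\<Sum>(a, n)\<leftarrow>coact_form q m. a va * n \<gamma> w))"
    unfolding coact_form_def .
  show "set (coact_form q m) \<subseteq> OA \<times> M" using conjunct1[OF c] unfolding OqSU3_eq .
  show "m \<gamma> (va + w) = (\<Sum>t\<leftarrow>coact_form q m. fst t va * snd t \<gamma> w)"
    using conjunct2[OF c, rule_format, of \<gamma> va w] by (simp only: split_def)
qed

lemma Nop_translate:
  assumes "\<And>va w. f (va + w) = (\<Sum>t\<leftarrow>ts. fst t va * snd t w)"
  shows "Nop \<delta> \<gamma> f (va + w) = (\<Sum>t\<leftarrow>ts. fst t va * Nop \<delta> \<gamma> (snd t) w)"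
proof -
  obtain X where X: "\<forall>f. Nop \<delta> \<gamma> f = act X f" using Nop_act by blast
  have "act X f (va + w) = (\<Sum>t\<leftarrow>ts. fst t va * act X (snd t) w)"
  proof -
    have "f (va + w + x) = (\<Sum>t\<leftarrow>ts. fst t va * snd t (w + x))" for x by (simp only: add.assoc assms)
    then show ?thesis by (simp add: act_def pairing_lsum lsum_fun_sum_list lsum_fun_scale)
  qed
  then show ?thesis using X by simp
qed

text \<open>The coordinates intertwine the coaction with the coproduct of A: \<open>Nop\<close> acts
  through the second leg (\<open>Nop_translate\<close>), and the coproduct is
  multiplicative.\<close>

lemma coact_forms:
  assumes "set ms \<subseteq> M"
  shows "Ph ms \<gamma>s (va + w) = (\<Sum>t\<leftarrow>coact_forms q ms. fst t va * Ph (snd t) \<gamma>s w)"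
  using assms
proof (induction ms arbitrary: \<gamma>s va w)
  case Nil
  have "unit (va + w) = unit va * unit w" by (simp add: unit_def)
  then show ?case by (simp add: zero_fun_apply)
next
  case (Cons m ms)
  have m: "m \<in> M" and ms: "set ms \<subseteq> M" using Cons.prems by auto
  have l: "coact_forms q (m # ms) = concat (map (\<lambda>t. map (\<lambda>t'. (fst t \<star> fst t', snd t # snd t')) (coact_forms q ms)) (coact_form q m))"
    by (simp add: split_def)
  have sl: "(\<Sum>t\<leftarrow>coact_forms q (m # ms). h t) = (\<Sum>t\<leftarrow>coact_form q m. \<Sum>t'\<leftarrow>coact_forms q ms. h (fst t \<star> fst t', snd t # snd t'))" for h :: "_ \<Rightarrow> complex"
  proof -
    have "sum_list (map h (concat (map (\<lambda>t. map (\<lambda>t'. (fst t \<star> fst t', snd t # snd t')) ys) xs)))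
        = (\<Sum>t\<leftarrow>xs. \<Sum>t'\<leftarrow>ys. h (fst t \<star> fst t', snd t # snd t'))" for xs ys
      by (induction xs) (simp_all add: o_def)
    then show ?thesis unfolding l .
  qed
  show ?case
  proof (cases \<gamma>s)
    case Nil
    then show ?thesis unfolding sl by (simp add: zero_fun_apply)
  next
    case (Cons \<gamma> \<gamma>s')
    have c: "(m \<delta> \<star> Nop \<delta> \<gamma> (Ph ms \<gamma>s')) (va + w)
       = (\<Sum>t\<leftarrow>coact_form q m. \<Sum>t'\<leftarrow>coact_forms q ms. (fst t \<star> fst t') va * (snd t \<delta> \<star> Nop \<delta> \<gamma> (Ph (snd t') \<gamma>s')) w)" for \<delta>
    proof -
      let ?A = "map (\<lambda>t. (fst t, snd t \<delta>)) (coact_form q m)"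
      let ?B = "map (\<lambda>t. (fst t, Nop \<delta> \<gamma> (Ph (snd t) \<gamma>s'))) (coact_forms q ms)"
      have A: "is_coproduct (m \<delta>) ?A"
        unfolding is_coproduct_def using coact_form(2)[OF m] by (simp add: o_def)
      have B: "is_coproduct (Nop \<delta> \<gamma> (Ph ms \<gamma>s')) ?B"
        unfolding is_coproduct_def
        using Nop_translate[of "Ph ms \<gamma>s'" "map (\<lambda>t. (fst t, Ph (snd t) \<gamma>s')) (coact_forms q ms)"] Cons.IH[OF ms]
        by (simp add: o_def del: Nop.simps)
      have "(m \<delta> \<star> Nop \<delta> \<gamma> (Ph ms \<gamma>s')) (va + w)
        = (\<Sum>t\<leftarrow>[(a \<star> a', b \<star> b'). (a, b) \<leftarrow> ?A, (a', b') \<leftarrow> ?B]. fst t va * snd t w)"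
        by (rule is_coproductD[OF is_coproduct_conv[OF A B]])
      also have "\<dots> = (\<Sum>t\<leftarrow>coact_form q m. \<Sum>t'\<leftarrow>coact_forms q ms. (fst t \<star> fst t') va * (snd t \<delta> \<star> Nop \<delta> \<gamma> (Ph (snd t') \<gamma>s')) w)"
      proof -
        have "(\<Sum>t\<leftarrow>[(a \<star> a', b \<star> b'). (a, b) \<leftarrow> map (\<lambda>t. (fst t, snd t \<delta>)) xs, (a', b') \<leftarrow> ?B]. fst t va * snd t w)
          = (\<Sum>t\<leftarrow>xs. \<Sum>t'\<leftarrow>coact_forms q ms. (fst t \<star> fst t') va * (snd t \<delta> \<star> Nop \<delta> \<gamma> (Ph (snd t') \<gamma>s')) w)" for xs
          by (induction xs) (simp_all add: o_def del: Nop.simps)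
        then show ?thesis .
      qed
      finally show ?thesis .
    qed
    have sw: "(\<Sum>\<delta>\<in>UNIV. \<Sum>t\<leftarrow>xs. \<Sum>t'\<leftarrow>ys. h \<delta> t t') = (\<Sum>t\<leftarrow>xs. \<Sum>t'\<leftarrow>ys. \<Sum>\<delta>\<in>UNIV. (h \<delta> t t' :: complex))" for xs ys and h :: "tang \<Rightarrow> _"
      by (simp add: sum_tang sum_list_addf)
    have "Ph (m # ms) \<gamma>s (va + w) = (\<Sum>\<delta>\<in>UNIV. (m \<delta> \<star> Nop \<delta> \<gamma> (Ph ms \<gamma>s')) (va + w))"
      by (simp add: Cons FR_def sum_apply del: Nop.simps)
    also have "\<dots> = (\<Sum>t\<leftarrow>coact_form q m. \<Sum>t'\<leftarrow>coact_forms q ms. (fst t \<star> fst t') va * FR (snd t) (Ph (snd t') \<gamma>s') \<gamma> w)"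
      unfolding c sw by (simp add: FR_def sum_apply sum_distrib_left del: Nop.simps)
    finally show ?thesis unfolding sl by (simp add: Cons)
  qed
qed

section \<open>Consequences of coinvariance and centrality\<close>

definition Phi2 :: "form free_alg \<Rightarrow> tang \<Rightarrow> tang \<Rightarrow> fnl" where "Phi2 x \<gamma> \<delta> = Phi x [\<gamma>, \<delta>]"

definition coeff_functional :: "(complex \<times> tang \<times> tang) list \<Rightarrow> (tang \<Rightarrow> tang \<Rightarrow> fnl) \<Rightarrow> fnl" where
  "coeff_functional ps t = (\<Sum>p\<leftarrow>ps. fscale (fst p) (t (fst (snd p)) (snd (snd p))))"

lemma coeff_functional_Phi2: "coeff_functional ps (Phi2 (x + y)) w = coeff_functional ps (Phi2 x) w + coeff_functional ps (Phi2 y) w"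
   "coeff_functional ps (Phi2 (scl c x)) w = c * coeff_functional ps (Phi2 x) w" "coeff_functional ps (Phi2 0) w = 0"
  by (induction ps) (simp_all add: coeff_functional_def Phi2_def Phi_add Phi_scl fscale_def plus_fun_apply zero_fun_apply algebra_simps)

text \<open>Tests formal sums in A \<otimes> Omega by evaluating the first leg at \<open>va\<close>
  and a coefficient of the second at \<open>w\<close>. For lists that kill \<open>rel2\<close> it
  descends to the quotient (\<open>ev2_comod_null\<close>).\<close>

definition ev2 :: "(complex \<times> tang \<times> tang) list \<Rightarrow> gen fword \<Rightarrow> gen fword \<Rightarrow> ((fnl \<times> tensor) \<Rightarrow>\<^sub>0 complex) \<Rightarrow> complex" where
  "ev2 ps va w = lsum (\<lambda>p. fst p va * coeff_functional ps (Phi2 (snd (snd p))) w)"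

lemma ev2_pure: "ev2 ps va w (pure a t) = a va * coeff_functional ps (Phi2 (snd t)) w"
  by (simp add: ev2_def pure_def)

lemma ev2_linear: "ev2 ps va w (x + y) = ev2 ps va w x + ev2 ps va w y" "ev2 ps va w (x - y) = ev2 ps va w x - ev2 ps va w y"
   "ev2 ps va w (scl c x) = c * ev2 ps va w x" "ev2 ps va w 0 = 0"
  by (simp_all add: ev2_def lsum_add lsum_diff lsum_scl)

lemma ev2_sum_list: "ev2 ps va w (\<Sum>i\<leftarrow>xs. f i) = (\<Sum>i\<leftarrow>xs. ev2 ps va w (f i))"
  by (induction xs) (simp_all add: ev2_linear)

definition kills_rel2 :: "(complex \<times> tang \<times> tang) list \<Rightarrow> bool" where "kills_rel2 ps \<longleftrightarrow> (\<forall>t\<in>rel2. coeff_functional ps t = 0)"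

lemma ev2_comod_null:
  assumes "kills_rel2 ps" and "x \<in> comod_null q"
  shows "ev2 ps va w x = 0"
  using assms(2) unfolding comod_null_def
proof (induction rule: formal.span_induct)
  case base
  show ?case by (simp add: formal.subspace_def ev2_linear)
next
  case (step x)
  then show ?case
  proof (elim UnE CollectE exE conjE)
    fix a t assume "x = pure a t" "t \<in> prolong_ideal q"
    then show ?thesis using prolong_invariant[of t] assms(1)
      by (simp add: ev2_pure kills_rel2_def Phi2_def[abs_def] zero_fun_apply)
  qed (simp_all only: ev2_linear ev2_pure, simp_all add: coeff_functional_Phi2 plus_fun_apply fscale_def tensor_scale_def algebra_simps)
qed

lemma Omega2_TW: "\<sigma> \<in> Omega2F3 q \<longleftrightarrow> fst \<sigma> = 0 \<and> snd \<sigma> \<in> TW 2"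
proof -
  have "{fw [m, n] | m n. m \<in> M \<and> n \<in> M} = {fw ms | ms. length ms = 2 \<and> set ms \<subseteq> M}"
    by (auto simp: numeral_2_eq_2 length_Suc_conv) (metis length_Cons list.size(3) list.set(1) list.simps(15) empty_subsetI insert_subset)
  then show ?thesis by (cases \<sigma>) (simp add: Omega2F3_def TW_def)
qed

text \<open>A coefficient functional killing \<open>rel2\<close> is well defined on two-forms and
  compatible with the coactions. For a coinvariant form its value f satisfies f(v w) = \<epsilon>(v)
  f(w); take w empty.\<close>

lemma coinvariant_scalar:
  assumes p: "kills_rel2 ps" and s: "s \<in> TW 2" and co: "left_coinvariant q (0, s)"
  shows "coeff_functional ps (Phi2 s) = fscale (coeff_functional ps (Phi2 s) 0) unit"
proof
  fix va
  have split: "coeff_functional ps (Phi2 x) (va + w) = ev2 ps va w (lin_ext (\<lambda>k. \<Sum>(a, ns)\<leftarrow>coact_forms q (letters k). pure a (0, fw ns)) x)"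
    if "x \<in> TW 2" for x w
    using that
  proof (induction rule: TW_induct)
    case (word ms)
    have "coeff_functional ps (Phi2 (fw ms)) (va + w) = (\<Sum>t\<leftarrow>coact_forms q ms. fst t va * coeff_functional ps (Phi2 (fw (snd t))) w)"
    proof -
      have P: "Phi2 (fw ms) \<gamma> \<delta> (va + w) = (\<Sum>t\<leftarrow>coact_forms q ms. fst t va * Phi2 (fw (snd t)) \<gamma> \<delta> w)" for \<gamma> \<delta>
        unfolding Phi2_def Phi_fw using coact_forms[OF word(2)] .
      show ?thesis
        unfolding coeff_functional_def
        by (induction ps) (simp_all add: plus_fun_apply zero_fun_apply fscale_def P sum_list_addf sum_list_const_mult[symmetric] distrib_left mult_ac)
    qed
    then show ?case by (simp add: ev2_sum_list ev2_pure split_def)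
  qed (simp_all add: coeff_functional_Phi2 lin_ext_add lin_ext_scl ev2_linear)
  \<comment> \<open>The chosen legs of the coproduct of 0 may be nonzero, but they carry no
    two-form.\<close>
  have z: "ev2 ps va w (\<Sum>(a, b)\<leftarrow>sweedler (OqSU3 q) (OqF3 q) 0. pure a (b, 0)) = 0" for w
    by (simp add: ev2_sum_list split_def ev2_pure coeff_functional_Phi2)
  have "ev2 ps va 0 (coaction q (0, s) - pure unit (0, s)) = 0"
    using co unfolding left_coinvariant_def by (intro ev2_comod_null[OF p])
  then have "coeff_functional ps (Phi2 s) (va + 0) = unit va * coeff_functional ps (Phi2 s) 0"
    unfolding split[OF s] coaction_def by (simp add: ev2_linear z ev2_pure)
  then show "coeff_functional ps (Phi2 s) va = fscale (coeff_functional ps (Phi2 s) 0) unit va" by (simp add: fscale_def mult.commute)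
qed

lemma scalar_W: "fscale c unit \<in> W p \<Longrightarrow> p \<noteq> 0 \<Longrightarrow> c = 0"
proof (rule ccontr)
  assume *: "fscale c unit \<in> W p" "p \<noteq> 0" "c \<noteq> 0"
  have "fscale c unit = fscale (Q powi fst p) (fscale c unit)" "fscale c unit = fscale (Q powi snd p) (fscale c unit)"
    using W_K[OF *(1)] by simp_all
  then have "c = Q powi fst p * c" "c = Q powi snd p * c"
    by (auto simp: fscale_def fun_eq_iff unit_def dest: spec[of _ 0])
  then have "Q powi fst p = Q powi 0" "Q powi snd p = Q powi 0" using *(3) by simp_all
  then have "fst p = 0" "snd p = 0" using Q_powi_inj by blast+
  then show False using *(2) by (simp add: prod_eq_iff)
qed

lemma Phi2_W: "x \<in> TW 2 \<Longrightarrow> Phi2 x \<gamma> \<delta> \<in> W (wt \<gamma> + wt \<delta>)"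
proof (induction rule: TW_induct)
  case (word ms)
  then show ?case using Ph_W[of ms "[\<gamma>, \<delta>]"] by (simp add: Phi2_def Phi_fw)
qed (simp_all add: Phi2_def Phi_add Phi_scl W_zero W_add W_fscale)

lemma swap_table_wt: "(X, Y, l, z, Z) \<in> set swap_table \<Longrightarrow> wt X + wt Y \<noteq> 0"
proof -
  have "\<forall>(X, Y, l, z, Z)\<in>set swap_table. wt X + wt Y \<noteq> 0" by (simp add: swap_table_def zero_prod_def)
  then show "(X, Y, l, z, Z) \<in> set swap_table \<Longrightarrow> wt X + wt Y \<noteq> 0" by blast
qed

lemma psiD: "satisfies_relations2 t \<Longrightarrow> (X, Y, l, z, Z) \<in> set swap_table \<Longrightarrow> t Y X = fscale l (t X Y)"
  unfolding satisfies_relations2_def by fast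

text \<open>The defect of this equation is a scalar of nonzero weight, hence zero.\<close>

lemma coinvariant_swap_table:
  assumes s: "s \<in> TW 2" and co: "left_coinvariant q (0, s)" and swap_table: "(X, Y, l, z, Z) \<in> set swap_table"
  shows "Phi2 s Y X = fscale l (Phi2 s X Y)"
proof -
  let ?ps = "[(1, Y, X), (- l, X, Y)]"
  have "kills_rel2 ?ps" unfolding kills_rel2_def using psiD[OF rel2_satisfies_relations2 swap_table] by (simp add: coeff_functional_def)
  moreover have "coeff_functional ?ps (Phi2 s) = Phi2 s Y X - fscale l (Phi2 s X Y)" by (simp add: coeff_functional_def)
  ultimately obtain c where e: "Phi2 s Y X - fscale l (Phi2 s X Y) = fscale c unit"
    using coinvariant_scalar[OF _ s co, of ?ps] by metis
  have "Phi2 s Y X - fscale l (Phi2 s X Y) \<in> W (wt X + wt Y)"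
    using Phi2_W[OF s, of Y X] Phi2_W[OF s, of X Y] by (intro W_diff W_fscale) (simp_all add: add.commute)
  then have "c = 0" unfolding e using scalar_W swap_table_wt[OF swap_table] by blast
  then show ?thesis using e by (simp del: minus_apply)
qed

lemma swap_table_F12_E1: "(TF A12, TE A1, inverse Q, inverse Q, TF A2) \<in> set swap_table"
  by (simp add: swap_table_def)

text \<open>The constants are the defects of the weight-zero equations, that is, the coefficients of
  the class of \<open>s\<close> on the products e f. Only the defect belonging to the first root is
  excluded, by centrality.\<close>

lemma coinvariant_central:
  assumes s: "s \<in> TW 2" and co: "left_coinvariant q (0, s)" and ce: "commutes_with_OqF3 q (0, s)"
  shows "\<exists>c2 c12. satisfies_relations2 (\<lambda>\<gamma> \<delta>. Phi2 s \<gamma> \<delta> - (if \<gamma> = TE A2 \<and> \<delta> = TF A2 then fscale c2 unit else 0)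
      - (if \<gamma> = TE A12 \<and> \<delta> = TF A12 then fscale c12 unit else 0))"
proof -
  let ?t = "Phi2 s"
  have sT: "s \<in> T" using s TW_T[of 1] by (auto simp: numeral_2_eq_2 One_nat_def)
  have p1: "kills_rel2 [(1, TE A1, TF A1), (- (inverse Q ^ 2), TF A1, TE A1)]"
    "kills_rel2 [(1, TE A2, TF A2), (- (inverse Q ^ 2), TF A2, TE A2)]"
    "kills_rel2 [(1, TE A12, TF A12), (- (inverse Q ^ 2), TF A12, TE A12), (- mu, TF A2, TE A2), (mu, TF A1, TE A1)]"
    unfolding kills_rel2_def using rel2_satisfies_relations2 unfolding satisfies_relations2_def
    by (simp_all add: coeff_functional_def fn.scale_right_diff_distrib)
  obtain c1 where c1: "?t (TE A1) (TF A1) - fscale (inverse Q ^ 2) (?t (TF A1) (TE A1)) = fscale c1 unit"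
  proof -
    have "coeff_functional [(1, TE A1, TF A1), (- (inverse Q ^ 2), TF A1, TE A1)] ?t = ?t (TE A1) (TF A1) - fscale (inverse Q ^ 2) (?t (TF A1) (TE A1))"
      by (simp add: coeff_functional_def)
    then show ?thesis using coinvariant_scalar[OF p1(1) s co] that by metis
  qed
  obtain c2 where c2: "?t (TE A2) (TF A2) - fscale (inverse Q ^ 2) (?t (TF A2) (TE A2)) = fscale c2 unit"
  proof -
    have "coeff_functional [(1, TE A2, TF A2), (- (inverse Q ^ 2), TF A2, TE A2)] ?t = ?t (TE A2) (TF A2) - fscale (inverse Q ^ 2) (?t (TF A2) (TE A2))"
      by (simp add: coeff_functional_def)
    then show ?thesis using coinvariant_scalar[OF p1(2) s co] that by metis
  qed
  obtain c12 where c12: "?t (TE A12) (TF A12) - fscale (inverse Q ^ 2) (?t (TF A12) (TE A12)) - fscale mu (?t (TF A2) (TE A2) - ?t (TF A1) (TE A1)) = fscale c12 unit"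
  proof -
    have "coeff_functional [(1, TE A12, TF A12), (- (inverse Q ^ 2), TF A12, TE A12), (- mu, TF A2, TE A2), (mu, TF A1, TE A1)] ?t
      = ?t (TE A12) (TF A12) - fscale (inverse Q ^ 2) (?t (TF A12) (TE A12)) - fscale mu (?t (TF A2) (TE A2) - ?t (TF A1) (TE A1))"
      by (simp add: coeff_functional_def fun_eq_iff fscale_def plus_fun_apply zero_fun_apply algebra_simps)
    then show ?thesis using coinvariant_scalar[OF p1(3) s co] that by metis
  qed
  have "c1 = 0"
  proof -
    \<comment> \<open>\<open>F N2\<close> is the operator in the entry sending f_1 to f_12, so for
      this element the commutator has an e_1 f_12 component coming from e_1 f_1.\<close>
    define b where "b = coord (TF A2)"
    have b: "b \<in> W 0" unfolding b_def by (rule coord_W)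
    have "wedge q (b, 0) (0, s) - wedge q (0, s) (b, 0) \<in> prolong_ideal q"
      using ce b unfolding commutes_with_OqF3_def prolong_eq_def OqF3_eq by blast
    then have "(0, tensor_left b s - tensor_right q s b) \<in> prolong_ideal q" by simp
    from prolong_invariant[OF this] have "(\<lambda>\<gamma> \<delta>. Phi (tensor_left b s - tensor_right q s b) [\<gamma>, \<delta>]) \<in> rel2" by simp
    then have ps: "satisfies_relations2 (\<lambda>\<gamma> \<delta>. b \<star> ?t \<gamma> \<delta> - RA (Phi s) b [\<gamma>, \<delta>])"
      using rel2_satisfies_relations2 by (simp add: Phi_diff Phi_tensor_left[OF sT] Phi_tensor_right[OF sT W_OA[OF b]] Phi2_def)
    have K: "rt (K i) b = b" for i using W_K[OF b] by (cases i) simp_all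
    let ?f = "rt (K N2) (rt (F N2) b)"
    have KF: "rt (K N1) ?f = fscale Q ?f" using W_K(1)[OF tv_W[OF b, of "TF A2"]] by simp
    \<comment> \<open>The extra factor q compared with \<open>2\<close> is the K_1-weight of F_2 b,
      picked up on passing e_1.\<close>
    have 1: "RA (Phi s) b [TE A1, TF A12] = ?t (TE A1) (TF A12) \<star> b + fscale ((Q - inverse Q) * Q) (?t (TE A1) (TF A1) \<star> ?f)"
      unfolding RA_two Phi2_def[symmetric] by (simp add: sum_tang K KF conv_fscale_right)
    have 2: "RA (Phi s) b [TF A12, TE A1] = ?t (TF A12) (TE A1) \<star> b + fscale (Q - inverse Q) (?t (TF A1) (TE A1) \<star> ?f)"
      unfolding RA_two Phi2_def[symmetric] by (simp add: sum_tang K conv_fscale_right)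
    have e: "?t (TE A1) (TF A12) = fscale (inverse Q) (?t (TF A12) (TE A1))"
      by (rule coinvariant_swap_table[OF s co swap_table_F12_E1])
    have "fscale ((Q - inverse Q) * Q) (?t (TE A1) (TF A1) \<star> ?f) = fscale (inverse Q) (fscale (Q - inverse Q) (?t (TF A1) (TE A1) \<star> ?f))"
      using psiD[OF ps swap_table_F12_E1] unfolding 1 2 e by (simp add: conv_linear fn.scale_right_diff_distrib fn.scale_right_distrib)
    moreover have "?t (TE A1) (TF A1) = fscale (inverse Q ^ 2) (?t (TF A1) (TE A1)) + fscale c1 unit"
      using c1 by (simp add: algebra_simps)
    \<comment> \<open>The coefficient of f_1 e_1 cancels because q times q^(-2) is q^(-1); only the
      defect c1 survives.\<close>
    ultimately have "fscale ((Q - inverse Q) * Q * c1) ?f = 0"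
      by (simp add: conv_linear fn.scale_right_distrib Qpow mult.assoc Qcancel) (simp add: mult_ac Qcancel, blast)
    then have "(Q - inverse Q) * Q * c1 * ?f 0 = 0" by (metis fscale_def zero_fun_apply)
    moreover have "?f 0 \<noteq> 0" using tv_coord_same[of "TF A2"] by (simp add: b_def del: coord.simps)
    ultimately show ?thesis using Q0 Qdiff(3) by simp
  qed
  let ?t' = "\<lambda>\<gamma> \<delta>. ?t \<gamma> \<delta> - (if \<gamma> = TE A2 \<and> \<delta> = TF A2 then fscale c2 unit else 0)
      - (if \<gamma> = TE A12 \<and> \<delta> = TF A12 then fscale c12 unit else 0)"
  have n: "\<forall>(X, Y, l, z, Z)\<in>set swap_table. (X, Y) \<notin> {(TE A2, TF A2), (TF A2, TE A2), (TE A12, TF A12), (TF A12, TE A12)}"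
    by (simp add: swap_table_def)
  have "?t' Y X = fscale l (?t' X Y)" if swap_table: "(X, Y, l, z, Z) \<in> set swap_table" for X Y l z Z
  proof -
    have "\<not> (X = TE A2 \<and> Y = TF A2)" "\<not> (Y = TE A2 \<and> X = TF A2)" "\<not> (X = TE A12 \<and> Y = TF A12)" "\<not> (Y = TE A12 \<and> X = TF A12)"
      using bspec[OF n swap_table] by auto
    then show ?thesis using coinvariant_swap_table[OF s co swap_table] by (simp only: if_False diff_zero)
  qed
  then have "\<forall>p\<in>set swap_table. case p of (X, Y, l, z, Z) \<Rightarrow> ?t' Y X = fscale l (?t' X Y)"
    by (intro ballI) (simp only: split_paired_all prod.case)
  moreover have "?t' (TE A1) (TF A1) = fscale (inverse Q ^ 2) (?t' (TF A1) (TE A1))" using c1 \<open>c1 = 0\<close> by simp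
  moreover have "?t' (TE A2) (TF A2) = fscale (inverse Q ^ 2) (?t' (TF A2) (TE A2))" using c2 by (simp add: algebra_simps)
  moreover have "?t' (TE A12) (TF A12) = fscale (inverse Q ^ 2) (?t' (TF A12) (TE A12)) + fscale mu (?t' (TF A2) (TE A2) - ?t' (TF A1) (TE A1))"
    using c12 by (simp add: algebra_simps)
  ultimately show ?thesis unfolding satisfies_relations2_def by blast
qed

section \<open>The cube of a coinvariant central two-form\<close>

text \<open>By \<open>Phi_injective\<close>, a tensor of positive degree n lies in the ideal as soon
  as its coordinates belong to this set.\<close>

definition relation_set :: "nat \<Rightarrow> (tang list \<Rightarrow> fnl) set" where
  "relation_set n = {t. \<exists>x\<in>TW n. x \<in> J \<and> (\<forall>\<gamma>s. Phi x \<gamma>s = t \<gamma>s)}"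

lemma NNlI: "x \<in> TW n \<Longrightarrow> x \<in> J \<Longrightarrow> (\<And>\<gamma>s. Phi x \<gamma>s = t \<gamma>s) \<Longrightarrow> t \<in> relation_set n"
  unfolding relation_set_def by blast

lemma NNlE:
  assumes "t \<in> relation_set n"
  obtains x where "x \<in> TW n" "x \<in> J" "\<And>\<gamma>s. Phi x \<gamma>s = t \<gamma>s"
  using assms unfolding relation_set_def by blast

lemma relation_set_zero: "(\<lambda>\<gamma>s. 0) \<in> relation_set n"
  by (rule NNlI[of 0]) (simp_all add: TW_closed J_closed)

lemma relation_set_add: "s \<in> relation_set n \<Longrightarrow> t \<in> relation_set n \<Longrightarrow> (\<lambda>\<gamma>s. s \<gamma>s + t \<gamma>s) \<in> relation_set n"
proof (elim NNlE)
  fix x y assume "x \<in> TW n" "x \<in> J" "\<And>\<gamma>s. Phi x \<gamma>s = s \<gamma>s" "y \<in> TW n" "y \<in> J" "\<And>\<gamma>s. Phi y \<gamma>s = t \<gamma>s"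
  then show ?thesis by (intro NNlI[of "x + y"]) (simp_all add: TW_closed J_closed Phi_add)
qed

lemma relation_set_diff: "s \<in> relation_set n \<Longrightarrow> t \<in> relation_set n \<Longrightarrow> (\<lambda>\<gamma>s. s \<gamma>s - t \<gamma>s) \<in> relation_set n"
proof (elim NNlE)
  fix x y assume "x \<in> TW n" "x \<in> J" "\<And>\<gamma>s. Phi x \<gamma>s = s \<gamma>s" "y \<in> TW n" "y \<in> J" "\<And>\<gamma>s. Phi y \<gamma>s = t \<gamma>s"
  then show ?thesis by (intro NNlI[of "x - y"]) (simp_all add: TW_closed J_diff Phi_diff)
qed

lemma relation_set_sum: "finite S \<Longrightarrow> (\<And>i. i \<in> S \<Longrightarrow> f i \<in> relation_set n) \<Longrightarrow> (\<lambda>\<gamma>s. \<Sum>i\<in>S. f i \<gamma>s) \<in> relation_set n"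
  by (induction rule: finite_induct) (simp_all add: relation_set_zero relation_set_add)

lemma TW_Phi_length: "x \<in> TW n \<Longrightarrow> length \<gamma>s \<noteq> n \<Longrightarrow> Phi x \<gamma>s = 0"
proof (induction rule: TW_induct)
  case (word ms)
  then show ?case using Ph_length[of ms \<gamma>s] by (simp add: Phi_fw)
qed (simp_all add: Phi_add Phi_scl)

lemma TW_T_pos: "n > 0 \<Longrightarrow> x \<in> TW n \<Longrightarrow> x \<in> T"
  using TW_T[of "n - 1"] by auto

lemma FR_sing: "FR (sing \<gamma> b) f \<delta> = b \<star> Nop \<gamma> \<delta> f"
proof -
  have "sing \<gamma> b \<epsilon> \<star> Nop \<epsilon> \<delta> f = (if \<epsilon> = \<gamma> then b \<star> Nop \<gamma> \<delta> f else 0)" for \<epsilon>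
    by (simp add: sing_def del: Nop.simps)
  then show ?thesis by (simp add: FR_def del: Nop.simps)
qed

section \<open>Relations between words in the four diagonal letters\<close>

definition diagonal_letters :: "tang set" where "diagonal_letters = {TE A2, TE A12, TF A2, TF A12}"

lemma Nop_diagonal_letters: "\<gamma> \<in> diagonal_letters \<Longrightarrow> \<delta> \<noteq> \<gamma> \<Longrightarrow> Nop \<gamma> \<delta> f = 0"
  unfolding diagonal_letters_def by (cases \<delta>) auto

lemma Nop_scalar: "\<exists>c. c \<noteq> 0 \<and> (\<forall>f\<in>W p. Nop \<gamma> \<gamma> f = fscale c f)"
proof -
  have k: "\<exists>c. c \<noteq> 0 \<and> (\<forall>f\<in>W p. kk r f = fscale c f)" for r
  proof (cases r)
    case A1
    then show ?thesis using W_K Q0 by (intro exI[of _ "Q powi fst p"]) auto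
  next
    case A2
    then show ?thesis using W_K Q0 by (intro exI[of _ "Q powi snd p"]) auto
  next
    case A12
    have "kk r f = fscale (Q powi fst p * Q powi snd p) f" if "f \<in> W p" for f
      using W_K[OF that] by (simp add: A12)
    then show ?thesis using Q0 by (intro exI[of _ "Q powi fst p * Q powi snd p"]) auto
  qed
  show ?thesis
  proof (cases \<gamma>)
    case (TE r)
    then show ?thesis using k[of r] by simp
  next
    case (TF r)
    then show ?thesis using k[of r] by simp
  qed
qed

lemma Mop_scalar:
  "set \<gamma>s \<subseteq> diagonal_letters \<Longrightarrow> \<exists>c. c \<noteq> 0 \<and> (\<forall>f\<in>W p. \<forall>\<delta>s. Mop \<gamma>s \<delta>s f = (if \<delta>s = \<gamma>s then fscale c f else 0))"
proof (induction \<gamma>s)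
  case Nil
  have "Mop [] \<delta>s f = (if \<delta>s = [] then fscale 1 f else 0)" for \<delta>s f by (cases \<delta>s) simp_all
  then show ?case by (intro exI[of _ 1]) simp
next
  case (Cons \<gamma> \<gamma>s)
  then obtain c where c: "c \<noteq> 0" "\<And>f \<delta>s. f \<in> W p \<Longrightarrow> Mop \<gamma>s \<delta>s f = (if \<delta>s = \<gamma>s then fscale c f else 0)" by auto
  obtain d where d: "d \<noteq> 0" "\<And>f. f \<in> W p \<Longrightarrow> Nop \<gamma> \<gamma> f = fscale d f" using Nop_scalar[of p \<gamma>] by blast
  have "Mop (\<gamma> # \<gamma>s) \<delta>s f = (if \<delta>s = \<gamma> # \<gamma>s then fscale (c * d) f else 0)" if f: "f \<in> W p" for f \<delta>s
  proof (cases \<delta>s)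
    case (Cons \<delta> \<delta>s')
    have "Nop \<gamma> \<delta> f = (if \<delta> = \<gamma> then fscale d f else 0)"
      using d(2)[OF f] Nop_diagonal_letters[of \<gamma> \<delta> f] Cons.prems by (auto simp del: Nop.simps)
    then show ?thesis using c(2)[OF f, of \<delta>s'] d(2)[OF f] by (simp add: Cons del: Nop.simps)
  qed simp
  then show ?case using c(1) d(1) by (intro exI[of _ "c * d"]) simp
qed

text \<open>\<open>word_relation S n \<beta>\<close>: for every coefficient \<open>a\<close> there is a relation in degree \<open>n\<close> whose monomials are exactly the
  words in \<open>S\<close>, all with scalar multiples of \<open>a\<close> in front.\<close>
definition word_relation :: "tang list set \<Rightarrow> nat \<Rightarrow> int \<times> int \<Rightarrow> bool" where
  "word_relation S n \<beta> \<longleftrightarrow> n > 0 \<and> (\<forall>\<gamma>s\<in>S. set \<gamma>s \<subseteq> diagonal_letters \<and> length \<gamma>s = n \<and> wts \<gamma>s = \<beta>) \<and>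
     (\<exists>\<rho>. (\<forall>\<gamma>s. \<rho> \<gamma>s \<noteq> 0 \<longleftrightarrow> \<gamma>s \<in> S) \<and> (\<forall>a\<in>W \<beta>. (\<lambda>\<gamma>s. fscale (\<rho> \<gamma>s) a) \<in> relation_set n))"

lemma word_relation_words: "word_relation S n \<beta> \<Longrightarrow> \<gamma>s \<in> S \<Longrightarrow> set \<gamma>s \<subseteq> diagonal_letters \<and> length \<gamma>s = n \<and> wts \<gamma>s = \<beta>"
  unfolding word_relation_def by blast

text \<open>A partition of unity for \<beta> splits \<open>a\<close> into sums of (a x_i) y_i: the
  part a x_i goes in front of the new letter, and y_i becomes the coefficient of the given
  relation.\<close>

lemma word_relation_prefix:
  assumes r: "word_relation S n \<beta>" and g: "\<gamma> \<in> diagonal_letters"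
  shows "word_relation ((#) \<gamma> ` S) (Suc n) (wt \<gamma> + \<beta>)"
proof -
  obtain \<rho> where \<rho>: "\<And>\<gamma>s. \<rho> \<gamma>s \<noteq> 0 \<longleftrightarrow> \<gamma>s \<in> S" "\<And>a. a \<in> W \<beta> \<Longrightarrow> (\<lambda>\<gamma>s. fscale (\<rho> \<gamma>s) a) \<in> relation_set n" and n: "n > 0"
    using r unfolding word_relation_def by blast
  obtain c where c: "c \<noteq> 0" "\<And>f. f \<in> W \<beta> \<Longrightarrow> Nop \<gamma> \<gamma> f = fscale c f" using Nop_scalar[of \<beta> \<gamma>] by blast
  define \<rho>' where "\<rho>' \<gamma>s = (case \<gamma>s of [] \<Rightarrow> 0 | \<delta> # \<delta>s \<Rightarrow> if \<delta> = \<gamma> then c * \<rho> \<delta>s else 0)" for \<gamma>s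
  obtain ts where ts: "set ts \<subseteq> W (- \<beta>) \<times> W \<beta>" "(\<Sum>t\<leftarrow>ts. fst t \<star> snd t) = unit"
    using unit_partition_ex[of \<beta>] unfolding unit_partition_def by blast
  have "(\<lambda>\<gamma>s. fscale (\<rho>' \<gamma>s) a) \<in> relation_set (Suc n)" if a: "a \<in> W (wt \<gamma> + \<beta>)" for a
  proof -
    have mem: "a \<star> fst t \<in> W (wt \<gamma>)" "snd t \<in> W \<beta>" if "t \<in> set ts" for t
      using W_conv[OF a, of "fst t" "- \<beta>"] ts(1) that by auto
    have "\<forall>t\<in>set ts. \<exists>x. x \<in> TW n \<and> x \<in> J \<and> (\<forall>\<gamma>s. Phi x \<gamma>s = fscale (\<rho> \<gamma>s) (snd t))"
      using \<rho>(2) mem(2) unfolding relation_set_def by blast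
    then obtain X where X: "\<And>t. t \<in> set ts \<Longrightarrow> X t \<in> TW n" "\<And>t. t \<in> set ts \<Longrightarrow> X t \<in> J"
       "\<And>t \<gamma>s. t \<in> set ts \<Longrightarrow> Phi (X t) \<gamma>s = fscale (\<rho> \<gamma>s) (snd t)" by metis
    have fwT: "fw [sing \<gamma> (a \<star> fst t)] \<in> TW 1" "fw [sing \<gamma> (a \<star> fst t)] \<in> T" if "t \<in> set ts" for t
      using sing_M[OF mem(1)[OF that]] by (simp_all add: TW_fw T_fw)
    show ?thesis
    proof (rule NNlI[of "\<Sum>t\<leftarrow>ts. fw [sing \<gamma> (a \<star> fst t)] * X t"])
      have "\<forall>t\<in>set ts. fw [sing \<gamma> (a \<star> fst t)] * X t \<in> TW (Suc n)"
        using TW_mult[OF fwT(1) X(1), unfolded plus_1_eq_Suc] by blast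
      then show "(\<Sum>t\<leftarrow>ts. fw [sing \<gamma> (a \<star> fst t)] * X t) \<in> TW (Suc n)"
        by (induction ts) (simp_all add: TW_closed)
      have "\<forall>t\<in>set ts. fw [sing \<gamma> (a \<star> fst t)] * X t \<in> J"
        using J_mult_left[OF fwT(2) TW_T_pos[OF n X(1)] X(2)] by blast
      then show "(\<Sum>t\<leftarrow>ts. fw [sing \<gamma> (a \<star> fst t)] * X t) \<in> J"
        by (induction ts) (simp_all add: J_closed)
      fix \<gamma>s
      show "Phi (\<Sum>t\<leftarrow>ts. fw [sing \<gamma> (a \<star> fst t)] * X t) \<gamma>s = fscale (\<rho>' \<gamma>s) a"
      proof (cases \<gamma>s)
        case Nil
        have "(\<Sum>t\<leftarrow>ts. Phi (fw [sing \<gamma> (a \<star> fst t)] * X t) []) = (\<Sum>t\<leftarrow>ts. 0)"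
          by (simp only: Phi_Cons_Nil)
        then show ?thesis by (simp add: Nil \<rho>'_def Phi_sum_list)
      next
        case (Cons \<delta> \<delta>s)
        have "Phi (\<Sum>t\<leftarrow>ts. fw [sing \<gamma> (a \<star> fst t)] * X t) \<gamma>s = (\<Sum>t\<leftarrow>ts. fscale (\<rho>' \<gamma>s) (a \<star> (fst t \<star> snd t)))"
          unfolding Phi_sum_list
        proof (intro arg_cong[where f = sum_list] map_cong refl)
          fix t assume t: "t \<in> set ts"
          show "Phi (fw [sing \<gamma> (a \<star> fst t)] * X t) \<gamma>s = fscale (\<rho>' \<gamma>s) (a \<star> (fst t \<star> snd t))"
          proof (cases "\<delta> = \<gamma>")
            case True
            then show ?thesis using c(2)[OF mem(2)[OF t]]
              by (simp add: Cons Phi_Cons FR_sing X(3)[OF t] \<rho>'_def conv_fscale_right conv_assoc mult.commute del: Nop.simps)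
          next
            case False
            then show ?thesis using Nop_diagonal_letters[OF g False]
              by (simp add: Cons Phi_Cons FR_sing X(3)[OF t] \<rho>'_def del: Nop.simps)
          qed
        qed
        also have "\<dots> = fscale (\<rho>' \<gamma>s) (a \<star> (\<Sum>t\<leftarrow>ts. fst t \<star> snd t))"
          unfolding conv_sum_list_right by (induction ts) (simp_all add: fn.scale_right_distrib)
        finally show ?thesis by (simp add: ts(2))
      qed
    qed
  qed
  moreover have "\<rho>' \<gamma>s \<noteq> 0 \<longleftrightarrow> \<gamma>s \<in> (#) \<gamma> ` S" for \<gamma>s
    using \<rho>(1) c(1) by (cases \<gamma>s) (auto simp: \<rho>'_def)
  ultimately show ?thesis
    using word_relation_words[OF r] g unfolding word_relation_def by auto
qed

text \<open>Now the second part of \<open>a\<close> sits behind the words and has to pass all their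
  letters, which multiplies each word by its own nonzero scalar. This is why
  \<open>word_relation\<close> records supports and not coefficients.\<close>

lemma word_relation_suffix:
  assumes r: "word_relation S n \<beta>" and g: "\<gamma> \<in> diagonal_letters"
  shows "word_relation ((\<lambda>\<gamma>s. \<gamma>s @ [\<gamma>]) ` S) (Suc n) (\<beta> + wt \<gamma>)"
proof -
  obtain \<rho> where \<rho>: "\<And>\<gamma>s. \<rho> \<gamma>s \<noteq> 0 \<longleftrightarrow> \<gamma>s \<in> S" "\<And>a. a \<in> W \<beta> \<Longrightarrow> (\<lambda>\<gamma>s. fscale (\<rho> \<gamma>s) a) \<in> relation_set n" and n: "n > 0"
    using r unfolding word_relation_def by blast
  have "\<forall>\<gamma>s. \<exists>c. set \<gamma>s \<subseteq> diagonal_letters \<longrightarrow> c \<noteq> 0 \<and> (\<forall>f\<in>W (wt \<gamma>). \<forall>\<delta>s. Mop \<gamma>s \<delta>s f = (if \<delta>s = \<gamma>s then fscale c f else 0))"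
    using Mop_scalar by blast
  then obtain c where c: "\<And>\<gamma>s. set \<gamma>s \<subseteq> diagonal_letters \<Longrightarrow> c \<gamma>s \<noteq> 0"
    "\<And>\<gamma>s f \<delta>s. set \<gamma>s \<subseteq> diagonal_letters \<Longrightarrow> f \<in> W (wt \<gamma>) \<Longrightarrow> Mop \<gamma>s \<delta>s f = (if \<delta>s = \<gamma>s then fscale (c \<gamma>s) f else 0)" by metis
  define \<rho>' where "\<rho>' \<gamma>s = (if \<gamma>s \<noteq> [] \<and> last \<gamma>s = \<gamma> then \<rho> (butlast \<gamma>s) * c (butlast \<gamma>s) else 0)" for \<gamma>s
  obtain ts where ts: "set ts \<subseteq> W (- wt \<gamma>) \<times> W (wt \<gamma>)" "(\<Sum>t\<leftarrow>ts. fst t \<star> snd t) = unit"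
    using unit_partition_ex[of "wt \<gamma>"] unfolding unit_partition_def by blast
  have "(\<lambda>\<gamma>s. fscale (\<rho>' \<gamma>s) a) \<in> relation_set (Suc n)" if a: "a \<in> W (\<beta> + wt \<gamma>)" for a
  proof -
    have mem: "a \<star> fst t \<in> W \<beta>" "snd t \<in> W (wt \<gamma>)" if "t \<in> set ts" for t
      using W_conv[OF a, of "fst t" "- wt \<gamma>"] ts(1) that by auto
    have "\<forall>t\<in>set ts. \<exists>x. x \<in> TW n \<and> x \<in> J \<and> (\<forall>\<gamma>s. Phi x \<gamma>s = fscale (\<rho> \<gamma>s) (a \<star> fst t))"
      using \<rho>(2) mem(1) unfolding relation_set_def by blast
    then obtain X where X: "\<And>t. t \<in> set ts \<Longrightarrow> X t \<in> TW n" "\<And>t. t \<in> set ts \<Longrightarrow> X t \<in> J"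
       "\<And>t \<gamma>s. t \<in> set ts \<Longrightarrow> Phi (X t) \<gamma>s = fscale (\<rho> \<gamma>s) (a \<star> fst t)" by metis
    have sM: "sing \<gamma> (snd t) \<in> M" if "t \<in> set ts" for t using sing_M[OF mem(2)[OF that]] .
    have fwT: "fw [sing \<gamma> (snd t)] \<in> TW 1" "fw [sing \<gamma> (snd t)] \<in> T" if "t \<in> set ts" for t
      using sM[OF that] by (simp_all add: TW_fw T_fw)
    have tw: "\<forall>t\<in>set ts. X t * fw [sing \<gamma> (snd t)] \<in> TW (Suc n)"
      using TW_mult[OF X(1) fwT(1), unfolded Suc_eq_plus1[symmetric]] by blast
    show ?thesis
    proof (rule NNlI[of "\<Sum>t\<leftarrow>ts. X t * fw [sing \<gamma> (snd t)]"])
      show "(\<Sum>t\<leftarrow>ts. X t * fw [sing \<gamma> (snd t)]) \<in> TW (Suc n)"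
        using tw by (induction ts) (simp_all add: TW_closed)
      have "\<forall>t\<in>set ts. X t * fw [sing \<gamma> (snd t)] \<in> J"
        using J_mult_right[OF fwT(2) TW_T_pos[OF n X(1)] X(2)] by blast
      then show "(\<Sum>t\<leftarrow>ts. X t * fw [sing \<gamma> (snd t)]) \<in> J"
        by (induction ts) (simp_all add: J_closed)
      fix \<gamma>s
      have "Phi (\<Sum>t\<leftarrow>ts. X t * fw [sing \<gamma> (snd t)]) \<gamma>s = (\<Sum>t\<leftarrow>ts. fscale (\<rho>' \<gamma>s) (a \<star> (fst t \<star> snd t)))"
        unfolding Phi_sum_list
      proof (intro arg_cong[where f = sum_list] map_cong refl)
        fix t assume t: "t \<in> set ts"
        show "Phi (X t * fw [sing \<gamma> (snd t)]) \<gamma>s = fscale (\<rho>' \<gamma>s) (a \<star> (fst t \<star> snd t))"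
        proof (cases \<gamma>s rule: rev_cases)
          case Nil
          have "X t * fw [sing \<gamma> (snd t)] \<in> TW (Suc n)" using tw t by blast
          then show ?thesis using TW_Phi_length[of _ "Suc n" "[]"] by (simp add: Nil \<rho>'_def)
        next
          case (snoc \<delta>s \<delta>)
          have "Phi (X t * fw [sing \<gamma> (snd t)]) \<gamma>s = RA (Phi (X t)) (Ph [sing \<gamma> (snd t)] [\<delta>]) \<delta>s"
            unfolding snoc using sM[OF t] by (intro Phi_mult_word TW_T_pos[OF n X(1)[OF t]]) simp_all
          also have "Ph [sing \<gamma> (snd t)] [\<delta>] = (if \<delta> = \<gamma> then snd t else 0)"
            by (simp add: FR_unit sing_def)
          also have "RA (Phi (X t)) (if \<delta> = \<gamma> then snd t else 0) \<delta>s = fscale (\<rho>' \<gamma>s) (a \<star> (fst t \<star> snd t))"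
          proof (cases "\<delta> = \<gamma>")
            case True
            have "Phi (X t) \<epsilon>s \<star> Mop \<epsilon>s \<delta>s (snd t) = (if \<epsilon>s = \<delta>s then fscale (\<rho>' \<gamma>s) (a \<star> (fst t \<star> snd t)) else 0)" for \<epsilon>s
            proof (cases "\<epsilon>s \<in> S")
              case True
              then have "set \<epsilon>s \<subseteq> diagonal_letters" using word_relation_words[OF r] by blast
              then show ?thesis using c(2)[OF _ mem(2)[OF t], of \<epsilon>s \<delta>s] X(3)[OF t, of \<epsilon>s] \<open>\<delta> = \<gamma>\<close>
                by (simp add: snoc \<rho>'_def conv_fscale_left conv_fscale_right conv_assoc mult.commute)
            next
              case False
              then have "\<rho> \<epsilon>s = 0" using \<rho>(1) by blast
              then show ?thesis using X(3)[OF t, of \<epsilon>s] by (auto simp: snoc \<rho>'_def)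
            qed
            then show ?thesis using True by (simp add: RA_def tl_set_def[of "length \<delta>s"] finite_tl_set[unfolded tl_set_def])
          next
            case False
            then show ?thesis by (simp add: RA_zero_right snoc \<rho>'_def)
          qed
          finally show ?thesis .
        qed
      qed
      also have "\<dots> = fscale (\<rho>' \<gamma>s) (a \<star> (\<Sum>t\<leftarrow>ts. fst t \<star> snd t))"
        unfolding conv_sum_list_right by (induction ts) (simp_all add: fn.scale_right_distrib)
      finally show "Phi (\<Sum>t\<leftarrow>ts. X t * fw [sing \<gamma> (snd t)]) \<gamma>s = fscale (\<rho>' \<gamma>s) a" by (simp add: ts(2))
    qed
  qed
  moreover have "\<rho>' \<gamma>s \<noteq> 0 \<longleftrightarrow> \<gamma>s \<in> (\<lambda>\<gamma>s. \<gamma>s @ [\<gamma>]) ` S" for \<gamma>s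
    using \<rho>(1) c(1) word_relation_words[OF r] by (cases \<gamma>s rule: rev_cases) (auto simp: \<rho>'_def)
  ultimately show ?thesis
    using word_relation_words[OF r] g unfolding word_relation_def by auto
qed

lemma word_relation_ext:
  assumes "word_relation S n \<beta>" and "set us \<subseteq> diagonal_letters" and "set ws \<subseteq> diagonal_letters"
  shows "word_relation ((\<lambda>\<gamma>s. us @ \<gamma>s @ ws) ` S) (length us + n + length ws) (wts us + \<beta> + wts ws)"
proof -
  have 1: "word_relation ((\<lambda>\<gamma>s. \<gamma>s @ ws) ` S) (n + length ws) (\<beta> + wts ws)"
    using assms(3)
  proof (induction ws rule: rev_induct)
    case (snoc \<gamma> ws)
    then have "word_relation ((\<lambda>\<gamma>s. \<gamma>s @ ws) ` S) (n + length ws) (\<beta> + wts ws)" "\<gamma> \<in> diagonal_letters" by auto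
    from word_relation_suffix[OF this] show ?case by (simp add: image_image add.assoc)
  qed (simp add: assms(1))
  show ?thesis
    using assms(2)
  proof (induction us)
    case (Cons \<gamma> us)
    then have "word_relation ((\<lambda>\<gamma>s. us @ \<gamma>s @ ws) ` S) (length us + n + length ws) (wts us + \<beta> + wts ws)" "\<gamma> \<in> diagonal_letters" by auto
    from word_relation_prefix[OF this] show ?case by (simp add: image_image add.assoc)
  qed (use 1 in simp)
qed

definition vanishing_word :: "tang list \<Rightarrow> bool" where "vanishing_word \<gamma>s \<longleftrightarrow> (\<forall>a\<in>W (wts \<gamma>s). (\<lambda>\<delta>s. if \<delta>s = \<gamma>s then a else 0) \<in> relation_set (length \<gamma>s))"

lemma relation_set_vanishing_word:
  assumes "\<And>\<gamma>s. \<rho> \<gamma>s \<noteq> 0 \<Longrightarrow> vanishing_word \<gamma>s \<and> length \<gamma>s = n \<and> wts \<gamma>s = \<beta>" and a: "a \<in> W \<beta>"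
  shows "(\<lambda>\<gamma>s. fscale (\<rho> \<gamma>s) a) \<in> relation_set n"
proof -
  let ?S = "{\<gamma>s. \<rho> \<gamma>s \<noteq> 0}"
  have fin: "finite ?S" by (rule finite_subset[OF _ finite_tl_set[of n]]) (use assms(1) in \<open>auto simp: tl_set_def\<close>)
  have "(\<lambda>\<delta>s. \<Sum>\<gamma>s\<in>?S. if \<delta>s = \<gamma>s then fscale (\<rho> \<gamma>s) a else 0) \<in> relation_set n"
  proof (rule relation_set_sum[OF fin])
    fix \<gamma>s assume "\<gamma>s \<in> ?S"
    then show "(\<lambda>\<delta>s. if \<delta>s = \<gamma>s then fscale (\<rho> \<gamma>s) a else 0) \<in> relation_set n"
      using assms(1)[of \<gamma>s] W_fscale[OF a, of "\<rho> \<gamma>s"] unfolding vanishing_word_def by auto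
  qed
  moreover have "(\<Sum>\<gamma>s\<in>?S. if \<delta>s = \<gamma>s then fscale (\<rho> \<gamma>s) a else 0) = fscale (\<rho> \<delta>s) a" for \<delta>s
    using fin by simp
  ultimately show ?thesis by simp
qed

text \<open>The other words vanish with every coefficient, so they can be subtracted from the
  relation, and the remaining scalar is invertible.\<close>

lemma word_relation_vanishing_word:
  assumes r: "word_relation S n \<beta>" and d: "\<delta>s \<in> S" and z: "\<And>\<gamma>s. \<gamma>s \<in> S \<Longrightarrow> \<gamma>s \<noteq> \<delta>s \<Longrightarrow> vanishing_word \<gamma>s"
  shows "vanishing_word \<delta>s"
  unfolding vanishing_word_def
proof
  fix a assume a: "a \<in> W (wts \<delta>s)"
  have w: "length \<delta>s = n" "wts \<delta>s = \<beta>" using word_relation_words[OF r d] by auto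
  obtain \<rho> where \<rho>: "\<And>\<gamma>s. \<rho> \<gamma>s \<noteq> 0 \<longleftrightarrow> \<gamma>s \<in> S" "\<And>a. a \<in> W \<beta> \<Longrightarrow> (\<lambda>\<gamma>s. fscale (\<rho> \<gamma>s) a) \<in> relation_set n"
    using r unfolding word_relation_def by blast
  define b where "b = fscale (inverse (\<rho> \<delta>s)) a"
  have b: "b \<in> W \<beta>" using a w by (simp add: b_def W_fscale)
  have "(\<lambda>\<gamma>s. fscale ((\<rho>(\<delta>s := 0)) \<gamma>s) b) \<in> relation_set n"
  proof (rule relation_set_vanishing_word[OF _ b])
    fix \<gamma>s assume "(\<rho>(\<delta>s := 0)) \<gamma>s \<noteq> 0"
    then have "\<gamma>s \<in> S" "\<gamma>s \<noteq> \<delta>s" using \<rho>(1)[of \<gamma>s] by (auto split: if_splits)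
    then show "vanishing_word \<gamma>s \<and> length \<gamma>s = n \<and> wts \<gamma>s = \<beta>" using z word_relation_words[OF r] by blast
  qed
  from relation_set_diff[OF \<rho>(2)[OF b] this]
  have "(\<lambda>\<gamma>s. fscale (\<rho> \<gamma>s) b - fscale ((\<rho>(\<delta>s := 0)) \<gamma>s) b) \<in> relation_set n" .
  moreover have "fscale (\<rho> \<gamma>s) b - fscale ((\<rho>(\<delta>s := 0)) \<gamma>s) b = (if \<gamma>s = \<delta>s then a else 0)" for \<gamma>s
    using d \<rho>(1)[of \<delta>s] by (simp add: b_def)
  ultimately show "(\<lambda>\<gamma>s. if \<gamma>s = \<delta>s then a else 0) \<in> relation_set (length \<delta>s)" by (simp only: w)
qed

lemma vanishing_word_step:
  assumes "word_relation S n \<beta>" and "set us \<subseteq> diagonal_letters" and "set ws \<subseteq> diagonal_letters" and "\<delta>s \<in> S"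
    and "\<And>\<gamma>s. \<gamma>s \<in> S \<Longrightarrow> \<gamma>s \<noteq> \<delta>s \<Longrightarrow> vanishing_word (us @ \<gamma>s @ ws)"
  shows "vanishing_word (us @ \<delta>s @ ws)"
  by (rule word_relation_vanishing_word[OF word_relation_ext[OF assms(1-3)]]) (use assms(4,5) in auto)

lemma relations2_relation_set:
  assumes "t \<in> relations2" and "\<And>\<gamma> \<delta>. t' [\<gamma>, \<delta>] = t \<gamma> \<delta>" and "\<And>\<gamma>s. length \<gamma>s \<noteq> 2 \<Longrightarrow> t' \<gamma>s = 0"
  shows "t' \<in> relation_set 2"
proof -
  obtain x where x: "x \<in> TW 2" "x \<in> J" "\<And>\<gamma> \<delta>. Phi x [\<gamma>, \<delta>] = t \<gamma> \<delta>" using assms(1) unfolding relations2_def by blast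
  show ?thesis
  proof (rule NNlI[OF x(1,2)])
    fix \<gamma>s
    show "Phi x \<gamma>s = t' \<gamma>s"
    proof (cases "length \<gamma>s = 2")
      case True
      then obtain \<gamma> \<delta> where "\<gamma>s = [\<gamma>, \<delta>]" by (auto simp: numeral_2_eq_2 length_Suc_conv)
      then show ?thesis using x(3) assms(2) by simp
    qed (use TW_Phi_length[OF x(1)] assms(3) in simp)
  qed
qed

lemma word_relation_two:
  assumes "\<And>\<gamma> \<delta>. \<rho> \<gamma> \<delta> \<noteq> 0 \<Longrightarrow> \<gamma> \<in> diagonal_letters \<and> \<delta> \<in> diagonal_letters \<and> wt \<gamma> + wt \<delta> = \<beta>"
    and "\<And>a. a \<in> W \<beta> \<Longrightarrow> (\<lambda>\<gamma> \<delta>. fscale (\<rho> \<gamma> \<delta>) a) \<in> relations2" and "S = {[\<gamma>, \<delta>] | \<gamma> \<delta>. \<rho> \<gamma> \<delta> \<noteq> 0}"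
  shows "word_relation S 2 \<beta>"
proof -
  define \<rho>' where "\<rho>' \<gamma>s = (if length \<gamma>s = 2 then \<rho> (\<gamma>s ! 0) (\<gamma>s ! 1) else 0)" for \<gamma>s
  have "\<rho>' \<gamma>s \<noteq> 0 \<longleftrightarrow> \<gamma>s \<in> S" for \<gamma>s
    unfolding assms(3) \<rho>'_def by (auto simp: numeral_2_eq_2 length_Suc_conv)
  moreover have "(\<lambda>\<gamma>s. fscale (\<rho>' \<gamma>s) a) \<in> relation_set 2" if "a \<in> W \<beta>" for a
    by (rule relations2_relation_set[OF assms(2)[OF that]]) (simp_all add: \<rho>'_def)
  moreover have "\<forall>\<gamma>s\<in>S. set \<gamma>s \<subseteq> diagonal_letters \<and> length \<gamma>s = 2 \<and> wts \<gamma>s = \<beta>"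
    using assms(1) unfolding assms(3) by auto
  ultimately show ?thesis unfolding word_relation_def by auto
qed

lemma word_relation_sq: "X \<in> diagonal_letters \<Longrightarrow> word_relation {[X, X]} 2 (wt X + wt X)"
proof (rule word_relation_two[of "\<lambda>\<gamma> \<delta>. of_bool (\<gamma> = X \<and> \<delta> = X)"])
  fix a assume "a \<in> W (wt X + wt X)"
  from sq_relations2[OF this] have "swap_relation X X 1 a \<in> relations2" .
  moreover have "swap_relation X X 1 a = (\<lambda>\<gamma> \<delta>. fscale (of_bool (\<gamma> = X \<and> \<delta> = X)) a)"
    unfolding swap_relation_def by (intro ext) simp
  ultimately show "(\<lambda>\<gamma> \<delta>. fscale (of_bool (\<gamma> = X \<and> \<delta> = X)) a) \<in> relations2" by simp
qed (auto split: if_splits)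

lemma word_relation_swap_relation:
  assumes "\<And>a. a \<in> W (wt X + wt Y) \<Longrightarrow> swap_relation X Y l a \<in> relations2" and "X \<in> diagonal_letters" "Y \<in> diagonal_letters" "X \<noteq> Y" "l \<noteq> 0"
  shows "word_relation {[X, Y], [Y, X]} 2 (wt X + wt Y)"
proof (rule word_relation_two[of "\<lambda>\<gamma> \<delta>. if \<gamma> = X \<and> \<delta> = Y then 1 else if \<gamma> = Y \<and> \<delta> = X then l else 0"])
  fix a assume "a \<in> W (wt X + wt Y)"
  from assms(1)[OF this] have "swap_relation X Y l a \<in> relations2" .
  moreover have "swap_relation X Y l a = (\<lambda>\<gamma> \<delta>. fscale (if \<gamma> = X \<and> \<delta> = Y then 1 else if \<gamma> = Y \<and> \<delta> = X then l else 0) a)"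
    unfolding swap_relation_def by (intro ext) simp
  ultimately show "(\<lambda>\<gamma> \<delta>. fscale (if \<gamma> = X \<and> \<delta> = Y then 1 else if \<gamma> = Y \<and> \<delta> = X then l else 0) a) \<in> relations2" by simp
next
  fix \<gamma> \<delta> assume "(if \<gamma> = X \<and> \<delta> = Y then 1 else if \<gamma> = Y \<and> \<delta> = X then l else 0) \<noteq> 0"
  then have "\<gamma> = X \<and> \<delta> = Y \<or> \<gamma> = Y \<and> \<delta> = X" by (auto split: if_splits)
  then show "\<gamma> \<in> diagonal_letters \<and> \<delta> \<in> diagonal_letters \<and> wt \<gamma> + wt \<delta> = wt X + wt Y" using assms(2,3) by (auto simp: add.commute)
next
  show "{[X, Y], [Y, X]} = {[\<gamma>, \<delta>] | \<gamma> \<delta>. (if \<gamma> = X \<and> \<delta> = Y then 1 else if \<gamma> = Y \<and> \<delta> = X then l else 0) \<noteq> 0}"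
    using assms(4,5) by (auto split: if_splits)
qed

text \<open>Commutations involving e_12 or f_12 have only two terms. For the pair of both, a = b = 0
  in the weight-zero relation removes its mixed term.\<close>

lemma word_relation_swap:
  assumes "X \<in> {TE A12, TF A12}" and "Y \<in> diagonal_letters" and "X \<noteq> Y"
  shows "word_relation {[X, Y], [Y, X]} 2 (wt X + wt Y)"
proof -
  have Qi: "inverse Q \<noteq> 0" using Q0 by simp
  have swap_table: "(TE A12, TE A2, Q, 0, TE A1) \<in> set swap_table" "(TF A12, TF A2, inverse Q, 0, TE A1) \<in> set swap_table"
    "(TF A12, TE A2, inverse Q, - (inverse Q * inverse Q), TF A1) \<in> set swap_table" "(TF A2, TE A12, inverse Q, - (inverse Q * inverse Q), TE A1) \<in> set swap_table"
    by (simp_all add: swap_table_def)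
  have "wt (TF A12) + wt (TE A12) = 0" by (simp add: zero_prod_def)
  moreover have "weight_zero_relation 0 0 a = swap_relation (TF A12) (TE A12) (inverse Q ^ 2) a" for a
    unfolding weight_zero_relation_def swap_relation_def by (intro ext) simp
  ultimately have "word_relation {[TF A12, TE A12], [TE A12, TF A12]} 2 (wt (TF A12) + wt (TE A12))"
    using weight_zero_relation_relations2[OF W_zero W_zero] Qi
    by (intro word_relation_swap_relation[of _ _ "inverse Q ^ 2"]) (simp_all add: diagonal_letters_def del: wt.simps)
  moreover have "word_relation {[TE A12, TE A2], [TE A2, TE A12]} 2 (wt (TE A12) + wt (TE A2))"
    by (rule word_relation_swap_relation[OF swap_relation_relations2[OF swap_table(1)]]) (use Q0 in \<open>simp_all add: diagonal_letters_def\<close>)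
  moreover have "word_relation {[TF A12, TF A2], [TF A2, TF A12]} 2 (wt (TF A12) + wt (TF A2))"
    by (rule word_relation_swap_relation[OF swap_relation_relations2[OF swap_table(2)]]) (use Q0 in \<open>simp_all add: diagonal_letters_def\<close>)
  moreover have "word_relation {[TF A12, TE A2], [TE A2, TF A12]} 2 (wt (TF A12) + wt (TE A2))"
    by (rule word_relation_swap_relation[OF swap_relation_relations2[OF swap_table(3)]]) (use Q0 in \<open>simp_all add: diagonal_letters_def\<close>)
  moreover have "word_relation {[TF A2, TE A12], [TE A12, TF A2]} 2 (wt (TF A2) + wt (TE A12))"
    by (rule word_relation_swap_relation[OF swap_relation_relations2[OF swap_table(4)]]) (use Q0 in \<open>simp_all add: diagonal_letters_def\<close>)
  ultimately show ?thesis
    using assms unfolding diagonal_letters_def by (auto simp: insert_commute add.commute simp del: wt.simps)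
qed

lemma mu_nonzero: "mu \<noteq> 0"
proof
  assume "mu = 0"
  then have "inverse Q ^ 3 = inverse Q ^ 3 * inverse Q ^ 2" unfolding mu_def by (simp add: Qpow mult.assoc)
  then have "inverse Q ^ 3 = 0 \<or> inverse Q ^ 2 = 1" by (simp only: mult_cancel_left1)
  then have "inverse Q ^ 2 = 1" using Q0 by simp
  then show False using Q2 by (simp add: power_inverse)
qed

text \<open>The case a = c = 0 of the weight-zero relation. Here the mixed term stays, so reordering
  e_2 and f_2 costs a word e_12 f_12.\<close>

lemma word_relation_EF: "word_relation {[TF A2, TE A2], [TE A2, TF A2], [TE A12, TF A12]} 2 0"
proof -
  define r where "r \<gamma> \<delta> = (if \<gamma> = TF A2 \<and> \<delta> = TE A2 then 1 else if \<gamma> = TE A2 \<and> \<delta> = TF A2 then inverse Q ^ 2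
     else if \<gamma> = TE A12 \<and> \<delta> = TF A12 then mu else 0)" for \<gamma> \<delta>
  have r: "r \<gamma> \<delta> \<noteq> 0 \<longleftrightarrow> \<gamma> = TF A2 \<and> \<delta> = TE A2 \<or> \<gamma> = TE A2 \<and> \<delta> = TF A2 \<or> \<gamma> = TE A12 \<and> \<delta> = TF A12" for \<gamma> \<delta>
    using mu_nonzero Q0 by (simp add: r_def)
  show ?thesis
  proof (rule word_relation_two[of r])
    fix a assume "a \<in> W 0"
    from weight_zero_relation_relations2[OF W_zero this W_zero] have "weight_zero_relation 0 a 0 \<in> relations2" .
    moreover have "weight_zero_relation 0 a 0 = (\<lambda>\<gamma> \<delta>. fscale (r \<gamma> \<delta>) a)"
      unfolding weight_zero_relation_def swap_relation_def r_def by (intro ext) simp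
    ultimately show "(\<lambda>\<gamma> \<delta>. fscale (r \<gamma> \<delta>) a) \<in> relations2" by simp
  next
    fix \<gamma> \<delta> assume "r \<gamma> \<delta> \<noteq> 0"
    then show "\<gamma> \<in> diagonal_letters \<and> \<delta> \<in> diagonal_letters \<and> wt \<gamma> + wt \<delta> = 0" unfolding r by (auto simp: diagonal_letters_def zero_prod_def)
  next
    show "{[TF A2, TE A2], [TE A2, TF A2], [TE A12, TF A12]} = {[\<gamma>, \<delta>] | \<gamma> \<delta>. r \<gamma> \<delta> \<noteq> 0}"
      unfolding r by blast
  qed
qed

section \<open>Rewriting words of length six to zero\<close>

lemma vanishing_word_sq: "X \<in> diagonal_letters \<Longrightarrow> set us \<subseteq> diagonal_letters \<Longrightarrow> set ws \<subseteq> diagonal_letters \<Longrightarrow> vanishing_word (us @ [X, X] @ ws)"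
  by (rule vanishing_word_step[OF word_relation_sq]) auto

lemma vanishing_word_swap:
  assumes "X \<in> {TE A12, TF A12} \<or> Y \<in> {TE A12, TF A12}" and L: "X \<in> diagonal_letters" "Y \<in> diagonal_letters" "set us \<subseteq> diagonal_letters" "set ws \<subseteq> diagonal_letters"
    and z: "vanishing_word (us @ [Y, X] @ ws)"
  shows "vanishing_word (us @ [X, Y] @ ws)"
proof (cases "X = Y")
  case False
  from assms(1) have "\<exists>\<beta>. word_relation {[X, Y], [Y, X]} 2 \<beta>"
  proof
    assume "X \<in> {TE A12, TF A12}"
    then show ?thesis using word_relation_swap[OF _ L(2) False] by blast
  next
    assume "Y \<in> {TE A12, TF A12}"
    then show ?thesis using word_relation_swap[OF _ L(1) False[symmetric]] unfolding insert_commute[of "[X, Y]"] by blast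
  qed
  then obtain \<beta> where "word_relation {[X, Y], [Y, X]} 2 \<beta>" by blast
  then show ?thesis by (rule vanishing_word_step[OF _ L(3,4)]) (use z in auto)
qed (use z in simp)

text \<open>The letter e_12 can be moved past every diagonal letter until the two copies
  meet.\<close>

lemma vanishing_word_double: "set us \<subseteq> diagonal_letters \<Longrightarrow> set vs \<subseteq> diagonal_letters \<Longrightarrow> set ws \<subseteq> diagonal_letters \<Longrightarrow> vanishing_word (us @ [TE A12] @ vs @ [TE A12] @ ws)"
proof (induction vs arbitrary: us)
  case Nil
  then show ?case using vanishing_word_sq[of "TE A12" us ws] by (simp add: diagonal_letters_def)
next
  case (Cons X vs)
  have "vanishing_word ((us @ [X]) @ [TE A12] @ vs @ [TE A12] @ ws)" using Cons.prems by (intro Cons.IH) auto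
  then have "vanishing_word (us @ [TE A12, X] @ vs @ [TE A12] @ ws)"
    by (intro vanishing_word_swap[of "TE A12" X us]) (use Cons.prems in \<open>auto simp: diagonal_letters_def\<close>)
  then show ?case by simp
qed

lemma vanishing_word_double': "\<gamma>s = us @ [TE A12] @ vs @ [TE A12] @ ws \<Longrightarrow> set \<gamma>s \<subseteq> diagonal_letters \<Longrightarrow> vanishing_word \<gamma>s"
  using vanishing_word_double[of us vs ws] by simp

text \<open>The inner f_2 e_2 is rewritten: the term e_2 f_2 creates a square of e_2, and the term
  e_12 f_12 is the word assumed to vanish.\<close>

lemma vanishing_word_EFEF:
  assumes "set us \<subseteq> diagonal_letters" "set ws \<subseteq> diagonal_letters" and "vanishing_word (us @ [TE A2, TE A12, TF A12, TF A2] @ ws)"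
  shows "vanishing_word (us @ [TE A2, TF A2, TE A2, TF A2] @ ws)"
proof -
  have "vanishing_word ((us @ [TE A2]) @ [TF A2, TE A2] @ ([TF A2] @ ws))"
  proof (rule vanishing_word_step[OF word_relation_EF])
    fix \<gamma>s assume "\<gamma>s \<in> {[TF A2, TE A2], [TE A2, TF A2], [TE A12, TF A12]}" "\<gamma>s \<noteq> [TF A2, TE A2]"
    then show "vanishing_word ((us @ [TE A2]) @ \<gamma>s @ ([TF A2] @ ws))"
      using vanishing_word_sq[of "TE A2" us "[TF A2, TF A2] @ ws"] assms by (auto simp: diagonal_letters_def)
  qed (use assms in \<open>auto simp: diagonal_letters_def\<close>)
  then show ?thesis by simp
qed

text \<open>With e_12 f_12 at either end, one rewriting of e_2 f_2 e_2 f_2 produces a second e_12.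
  The word with e_12 f_12 in the middle is obtained by moving these two letters, and the cube of e_2
  f_2 reduces to an intermediate word of that computation.\<close>

lemma vanishing_word_cube: "vanishing_word ([TE A12, TF A12] @ [TE A2, TF A2] @ [TE A2, TF A2])" "vanishing_word ([TE A2, TF A2] @ [TE A12, TF A12] @ [TE A2, TF A2])"
   "vanishing_word ([TE A2, TF A2] @ [TE A2, TF A2] @ [TE A12, TF A12])" "vanishing_word ([TE A2, TF A2] @ [TE A2, TF A2] @ [TE A2, TF A2])"
proof -
  let ?e = "TE A2" and ?f = "TF A2" and ?g = "TE A12" and ?h = "TF A12"
  have "vanishing_word [?g, ?h, ?e, ?g, ?h, ?f]" "vanishing_word [?e, ?g, ?h, ?f, ?g, ?h]"
    using vanishing_word_double[of "[]" "[?h, ?e]" "[?h, ?f]"] vanishing_word_double[of "[?e]" "[?h, ?f]" "[?h]"] by (simp_all add: diagonal_letters_def)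
  then have 1: "vanishing_word [?g, ?h, ?e, ?f, ?e, ?f]" and 2: "vanishing_word [?e, ?f, ?e, ?f, ?g, ?h]"
    using vanishing_word_EFEF[of "[?g, ?h]" "[]"] vanishing_word_EFEF[of "[]" "[?g, ?h]"] by (simp_all add: diagonal_letters_def)
  have "vanishing_word [?g, ?e, ?h, ?f, ?e, ?f]"
    using vanishing_word_swap[of ?e ?h "[?g]" "[?f, ?e, ?f]"] 1 by (simp add: diagonal_letters_def)
  then have 3: "vanishing_word [?e, ?g, ?h, ?f, ?e, ?f]"
    using vanishing_word_swap[of ?e ?g "[]" "[?h, ?f, ?e, ?f]"] by (simp add: diagonal_letters_def)
  then have "vanishing_word [?e, ?g, ?f, ?h, ?e, ?f]"
    using vanishing_word_swap[of ?f ?h "[?e, ?g]" "[?e, ?f]"] by (simp add: diagonal_letters_def)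
  then have 4: "vanishing_word [?e, ?f, ?g, ?h, ?e, ?f]"
    using vanishing_word_swap[of ?f ?g "[?e]" "[?h, ?e, ?f]"] by (simp add: diagonal_letters_def)
  have "vanishing_word [?e, ?f, ?e, ?f, ?e, ?f]"
    using vanishing_word_EFEF[of "[]" "[?e, ?f]"] 3 by (simp add: diagonal_letters_def)
  with 1 2 4 show "vanishing_word ([?g, ?h] @ [?e, ?f] @ [?e, ?f])" "vanishing_word ([?e, ?f] @ [?g, ?h] @ [?e, ?f])"
   "vanishing_word ([?e, ?f] @ [?e, ?f] @ [?g, ?h])" "vanishing_word ([?e, ?f] @ [?e, ?f] @ [?e, ?f])" by simp_all
qed

lemma vanishing_word_cube_all:
  assumes "x \<in> {[TE A2, TF A2], [TE A12, TF A12]}" "y \<in> {[TE A2, TF A2], [TE A12, TF A12]}" "z \<in> {[TE A2, TF A2], [TE A12, TF A12]}"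
  shows "vanishing_word (x @ y @ z)"
proof -
  let ?e = "TE A2" and ?f = "TF A2" and ?g = "TE A12" and ?h = "TF A12"
  have "vanishing_word ([?g, ?h] @ [?g, ?h] @ [?e, ?f])" by (rule vanishing_word_double'[of _ "[]" "[?h]"]) (auto simp: diagonal_letters_def)
  moreover have "vanishing_word ([?g, ?h] @ [?g, ?h] @ [?g, ?h])" by (rule vanishing_word_double'[of _ "[]" "[?h]"]) (auto simp: diagonal_letters_def)
  moreover have "vanishing_word ([?g, ?h] @ [?e, ?f] @ [?g, ?h])" by (rule vanishing_word_double'[of _ "[]" "[?h, ?e, ?f]"]) (auto simp: diagonal_letters_def)
  moreover have "vanishing_word ([?e, ?f] @ [?g, ?h] @ [?g, ?h])" by (rule vanishing_word_double'[of _ "[?e, ?f]" "[?h]"]) (auto simp: diagonal_letters_def)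
  ultimately show ?thesis using assms vanishing_word_cube by (elim insertE emptyE) simp_all
qed

section \<open>Products of forms with constant coefficients\<close>

lemma Mop_linear: "Mop \<delta>s \<gamma>s (a + b) = Mop \<delta>s \<gamma>s a + Mop \<delta>s \<gamma>s b" "Mop \<delta>s \<gamma>s (fscale c a) = fscale c (Mop \<delta>s \<gamma>s a)"
  by (induction \<delta>s \<gamma>s a rule: Mop.induct) (simp_all del: Nop.simps)

lemma Mop_unit: "length \<delta>s = length \<gamma>s \<Longrightarrow> Mop \<delta>s \<gamma>s unit = (if \<delta>s = \<gamma>s then unit else 0)"
  by (induction \<delta>s \<gamma>s rule: list_induct2) (simp_all add: Nop_unit del: Nop.simps)

text \<open>Constants pass through letters unchanged, so for forms with constant coefficients the
  coordinates of a product are products of coordinates.\<close>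

lemma RA_scalar: "RA t (fscale c unit) \<gamma>s = fscale c (t \<gamma>s)"
proof -
  have "RA t (fscale c unit) \<gamma>s = (\<Sum>\<delta>s\<in>tl_set (length \<gamma>s). if \<delta>s = \<gamma>s then fscale c (t \<gamma>s) else 0)"
    unfolding RA_def
    by (intro sum.cong) (auto simp: tl_set_def Mop_linear Mop_unit conv_linear)
  then show ?thesis by (simp add: tl_set_def[of "length \<gamma>s"] finite_tl_set[unfolded tl_set_def])
qed

lemma Phi_mult:
  assumes x: "x \<in> T" and y: "y \<in> TW k" and "length \<delta>s = k"
  shows "Phi (x * y) (\<gamma>s @ \<delta>s) = RA (Phi x) (Phi y \<delta>s) \<gamma>s"
  using y
proof (induction rule: TW_induct)
  case (word ms)
  then show ?case using Phi_mult_word[OF x, of ms \<delta>s \<gamma>s] assms(3) by (simp add: Phi_fw)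
qed (simp_all add: distrib_left scl_mult_right Phi_add Phi_scl RA_def Mop_linear conv_linear sum.distrib fn.scale_sum_right)

text \<open>A partition of unity distributes \<open>a\<close> over two one-forms; the scalar
  \<open>c\<close> accounts for moving the second coefficient past the letter X.\<close>

lemma two_form:
  assumes X: "X \<in> diagonal_letters" and a: "a \<in> W (wt X + wt Y)"
  shows "\<exists>x\<in>TW 2. \<forall>\<gamma>s. Phi x \<gamma>s = (if \<gamma>s = [X, Y] then a else 0)"
proof -
  obtain c where c: "c \<noteq> 0" "\<And>f. f \<in> W (wt Y) \<Longrightarrow> Nop X X f = fscale c f" using Nop_scalar[of "wt Y" X] by blast
  obtain ts where ts: "set ts \<subseteq> W (- wt Y) \<times> W (wt Y)" "(\<Sum>t\<leftarrow>ts. fst t \<star> snd t) = unit"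
    using unit_partition_ex[of "wt Y"] unfolding unit_partition_def by blast
  have mem: "a \<star> fst t \<in> W (wt X)" "snd t \<in> W (wt Y)" if "t \<in> set ts" for t
    using W_conv[OF a, of "fst t" "- wt Y"] ts(1) that by auto
  let ?x = "\<Sum>t\<leftarrow>ts. fw [sing X (a \<star> fst t), sing Y (snd t)]"
  have "\<forall>t\<in>set ts. fw [sing X (a \<star> fst t), sing Y (snd t)] \<in> TW 2"
    using sing_M[OF mem(1)] sing_M[OF mem(2)] by (auto intro!: TW_fw)
  then have tw: "?x \<in> TW 2" by (induction ts) (simp_all add: TW_closed)
  have P: "Phi ?x [\<gamma>, \<delta>] = (if \<gamma> = X \<and> \<delta> = Y then fscale c a else 0)" for \<gamma> \<delta>
  proof -
    have "Phi ?x [\<gamma>, \<delta>] = (\<Sum>t\<leftarrow>ts. if \<gamma> = X \<and> \<delta> = Y then fscale c (a \<star> (fst t \<star> snd t)) else 0)"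
      unfolding Phi_sum_list
    proof (intro arg_cong[where f = sum_list] map_cong refl)
      fix t assume t: "t \<in> set ts"
      have "Phi (fw [sing X (a \<star> fst t), sing Y (snd t)]) [\<gamma>, \<delta>] = (a \<star> fst t) \<star> Nop X \<gamma> (sing Y (snd t) \<delta>)"
        by (simp add: Phi_fw FR_unit FR_sing del: Nop.simps)
      also have "\<dots> = (if \<gamma> = X \<and> \<delta> = Y then fscale c (a \<star> (fst t \<star> snd t)) else 0)"
        using c(2)[OF mem(2)[OF t]] Nop_diagonal_letters[OF X, of \<gamma> "snd t"]
        by (auto simp: sing_def conv_fscale_right conv_assoc simp del: Nop.simps)
      finally show "Phi (fw [sing X (a \<star> fst t), sing Y (snd t)]) [\<gamma>, \<delta>]
         = (if \<gamma> = X \<and> \<delta> = Y then fscale c (a \<star> (fst t \<star> snd t)) else 0)" .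
    qed
    also have "\<dots> = (if \<gamma> = X \<and> \<delta> = Y then fscale c (a \<star> (\<Sum>t\<leftarrow>ts. fst t \<star> snd t)) else 0)"
      unfolding conv_sum_list_right by (induction ts) (simp_all add: fn.scale_right_distrib)
    finally show ?thesis by (simp add: ts(2))
  qed
  have "Phi (scl (inverse c) ?x) \<gamma>s = (if \<gamma>s = [X, Y] then a else 0)" for \<gamma>s
  proof (cases "length \<gamma>s = 2")
    case True
    then obtain \<gamma> \<delta> where g: "\<gamma>s = [\<gamma>, \<delta>]" by (auto simp: numeral_2_eq_2 length_Suc_conv)
    show ?thesis unfolding Phi_scl g P using c(1) by simp
  next
    case False
    then show ?thesis using TW_Phi_length[OF tw False] by (auto simp: Phi_scl)
  qed
  then show ?thesis using TW_closed(3)[OF tw] by blast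
qed

text \<open>The coordinates of the cube are supported on vanishing words, hence equal those of an
  element of the ideal; injectivity transfers membership.\<close>

lemma cube_J:
  assumes x: "x \<in> TW 2" and k: "\<And>\<gamma>s. Phi x \<gamma>s = fscale (k \<gamma>s) unit"
    and supp: "\<And>\<gamma>s. k \<gamma>s \<noteq> 0 \<Longrightarrow> \<gamma>s \<in> {[TE A2, TF A2], [TE A12, TF A12]}"
  shows "x * x * x \<in> J"
proof -
  have T: "x \<in> T" "x * x \<in> T" using x TW_T_pos[of 2] T_mult by auto
  have tw: "x * x * x \<in> TW 6" using TW_mult[OF TW_mult[OF x x] x] by simp
  define \<kappa> where "\<kappa> \<gamma>s = (if length \<gamma>s = 6 then k (drop 4 \<gamma>s) * (k (take 2 (drop 2 \<gamma>s)) * k (take 2 \<gamma>s)) else 0)" for \<gamma>s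
  have e: "\<gamma>s = take 2 \<gamma>s @ take 2 (drop 2 \<gamma>s) @ drop 4 \<gamma>s" for \<gamma>s :: "tang list"
    by (metis append_take_drop_id drop_drop numeral_Bit0)
  have P: "Phi (x * x * x) \<gamma>s = fscale (\<kappa> \<gamma>s) unit" for \<gamma>s
  proof (cases "length \<gamma>s = 6")
    case True
    have "Phi (x * x * x) \<gamma>s = Phi (x * x * x) ((take 2 \<gamma>s @ take 2 (drop 2 \<gamma>s)) @ drop 4 \<gamma>s)"
      using e[of \<gamma>s] by simp
    also have "\<dots> = fscale (k (drop 4 \<gamma>s)) (Phi (x * x) (take 2 \<gamma>s @ take 2 (drop 2 \<gamma>s)))"
      using Phi_mult[OF T(2) x, of "drop 4 \<gamma>s" "take 2 \<gamma>s @ take 2 (drop 2 \<gamma>s)"] True by (simp add: k RA_scalar)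
    also have "Phi (x * x) (take 2 \<gamma>s @ take 2 (drop 2 \<gamma>s)) = fscale (k (take 2 (drop 2 \<gamma>s))) (Phi x (take 2 \<gamma>s))"
      using Phi_mult[OF T(1) x, of "take 2 (drop 2 \<gamma>s)" "take 2 \<gamma>s"] True by (simp add: k RA_scalar)
    finally show ?thesis using True by (simp add: k \<kappa>_def)
  next
    case False
    then show ?thesis using TW_Phi_length[OF tw False] by (simp add: \<kappa>_def)
  qed
  have "(\<lambda>\<gamma>s. fscale (\<kappa> \<gamma>s) unit) \<in> relation_set 6"
  proof (rule relation_set_vanishing_word[OF _ W_unit])
    fix \<gamma>s assume "\<kappa> \<gamma>s \<noteq> 0"
    then have n: "length \<gamma>s = 6" "take 2 \<gamma>s \<in> {[TE A2, TF A2], [TE A12, TF A12]}" "take 2 (drop 2 \<gamma>s) \<in> {[TE A2, TF A2], [TE A12, TF A12]}"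
       "drop 4 \<gamma>s \<in> {[TE A2, TF A2], [TE A12, TF A12]}"
      using supp by (auto simp: \<kappa>_def split: if_splits)
    have w: "wts y = 0" if "y \<in> {[TE A2, TF A2], [TE A12, TF A12]}" for y using that by (auto simp: zero_prod_def)
    have "wts (take 2 \<gamma>s @ take 2 (drop 2 \<gamma>s) @ drop 4 \<gamma>s) = 0" using n w by simp
    then show "vanishing_word \<gamma>s \<and> length \<gamma>s = 6 \<and> wts \<gamma>s = 0"
      using vanishing_word_cube_all[OF n(2-4)] n(1) unfolding e[of \<gamma>s, symmetric] by blast
  qed
  then obtain y where y: "y \<in> TW 6" "y \<in> J" "\<And>\<gamma>s. Phi y \<gamma>s = fscale (\<kappa> \<gamma>s) unit" unfolding relation_set_def by blast
  have "x * x * x - y \<in> Nul"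
    by (rule Phi_injective[of _ 5]) (use TW_closed(4)[OF tw y(1)] P y(3) in \<open>simp_all add: Phi_diff\<close>)
  then have "x * x * x - y + y \<in> J" by (intro J_closed J_Nul y(2))
  then show ?thesis by simp
qed

lemma coinvariant_central_cube:
  assumes s: "s \<in> TW 2" and "left_coinvariant q (0, s)" and "commutes_with_OqF3 q (0, s)"
  shows "s * s * s \<in> J"
proof -
  obtain c2 c12 where satisfies_relations2: "satisfies_relations2 (\<lambda>\<gamma> \<delta>. Phi2 s \<gamma> \<delta> - (if \<gamma> = TE A2 \<and> \<delta> = TF A2 then fscale c2 unit else 0)
      - (if \<gamma> = TE A12 \<and> \<delta> = TF A12 then fscale c12 unit else 0))" (is "satisfies_relations2 ?t")
    using coinvariant_central[OF assms] by blast
  have w: "wt (TE A2) + wt (TF A2) = 0" "wt (TE A12) + wt (TF A12) = 0" by (simp_all add: zero_prod_def)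
  obtain x2 where x2: "x2 \<in> TW 2" "\<And>\<gamma>s. Phi x2 \<gamma>s = (if \<gamma>s = [TE A2, TF A2] then fscale c2 unit else 0)"
    using two_form[of "TE A2" "fscale c2 unit" "TF A2"] W_fscale[OF W_unit] unfolding w by (auto simp: diagonal_letters_def)
  obtain x12 where x12: "x12 \<in> TW 2" "\<And>\<gamma>s. Phi x12 \<gamma>s = (if \<gamma>s = [TE A12, TF A12] then fscale c12 unit else 0)"
    using two_form[of "TE A12" "fscale c12 unit" "TF A12"] W_fscale[OF W_unit] unfolding w by (auto simp: diagonal_letters_def)
  define x where "x = x2 + x12"
  have x: "x \<in> TW 2" using x2(1) x12(1) by (simp add: x_def TW_closed)
  have xxx: "x * x * x \<in> J"
    by (rule cube_J[OF x, of "\<lambda>\<gamma>s. if \<gamma>s = [TE A2, TF A2] then c2 else if \<gamma>s = [TE A12, TF A12] then c12 else 0"])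
      (auto simp: x_def Phi_add x2(2) x12(2) split: if_splits)
  have sx: "s - x \<in> TW 2" using s x by (rule TW_closed)
  \<comment> \<open>Subtracting the constant form \<open>x\<close> removes exactly the two remaining
    defects, so \<open>s - x\<close> satisfies all degree-two equations.\<close>
  have t: "Phi2 (s - x) \<gamma> \<delta> = ?t \<gamma> \<delta>" for \<gamma> \<delta>
    by (simp add: Phi2_def Phi_diff x_def Phi_add x2(2) x12(2) diff_diff_eq del: minus_apply)
  have "(\<lambda>\<gamma> \<delta>. Phi2 (s - x) \<gamma> \<delta>) \<in> relations2"
    by (rule satisfies_relations2_relations2[OF Phi2_W[OF sx]]) (unfold t, rule satisfies_relations2)
  then obtain y where y: "y \<in> TW 2" "y \<in> J" "\<And>\<gamma> \<delta>. Phi y [\<gamma>, \<delta>] = Phi (s - x) [\<gamma>, \<delta>]"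
    unfolding relations2_def Phi2_def by blast
  have "s - x - y \<in> Nul"
  proof (rule Phi_injective[of _ 1])
    show tw: "s - x - y \<in> TW (Suc 1)" using TW_closed(4)[OF sx y(1)] by (simp add: numeral_2_eq_2 One_nat_def)
    fix \<gamma>s
    show "Phi (s - x - y) \<gamma>s = 0"
    proof (cases "length \<gamma>s = Suc 1")
      case True
      then obtain \<gamma> \<delta> where "\<gamma>s = [\<gamma>, \<delta>]" by (auto simp: One_nat_def length_Suc_conv)
      then show ?thesis using y(3) by (simp add: Phi_diff)
    qed (rule TW_Phi_length[OF tw])
  qed
  then have "s - x - y + y \<in> J" by (intro J_closed J_Nul y(2))
  then have d: "s - x \<in> J" by simp
  have T: "s \<in> T" "x \<in> T" "s - x \<in> T" using TW_T_pos[of 2] s x sx by auto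
  \<comment> \<open>Telescoping: every term except the cube of \<open>x\<close> contains the factor
    \<open>s - x\<close>, which lies in the ideal.\<close>
  have "s * s * s = x * x * x + x * x * (s - x) + x * (s - x) * s + (s - x) * s * s" by (simp add: algebra_simps)
  moreover have "x * x * x + x * x * (s - x) + x * (s - x) * s + (s - x) * s * s \<in> J"
    using T d by (intro J_closed xxx J_mult_left J_mult_right T_mult)
  ultimately show ?thesis by simp
qed

lemma degenerate:
  assumes "\<sigma> \<in> Omega2F3 q" and "left_coinvariant q \<sigma>" and "commutes_with_OqF3 q \<sigma>"
  shows "\<not> nondegenerate q \<sigma>"
proof -
  define s where "s = snd \<sigma>"
  have s: "\<sigma> = (0, s)" "s \<in> TW 2" using assms(1) unfolding Omega2_TW s_def by (auto simp: prod_eq_iff)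
  have cube: "s * s * s \<in> J" using coinvariant_central_cube s assms(2,3) by simp
  have T: "s \<in> T" using TW_T_pos[of 2] s(2) by auto
  \<comment> \<open>\<open>wedge\<close> also adds the products with the zero degree-0 parts; these
    are the null words collected in \<open>n\<close>.\<close>
  define n where "n = tensor_left 0 s + tensor_right q s 0"
  have n: "n \<in> Nul" using T by (simp add: n_def Nul_closed tensor_left_zero_Nul tensor_right_zero_Nul)
  have nT: "n + s * s \<in> T" using Nul_T[OF n] T by (intro T_closed T_mult)
  have "wedge q (wedge q \<sigma> \<sigma>) \<sigma> = (0, tensor_left 0 s + tensor_right q (n + s * s) 0 + (n + s * s) * s)"
    by (simp add: s(1) n_def)
  moreover have "tensor_left 0 s + tensor_right q (n + s * s) 0 + (n * s + s * s * s) \<in> J"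
    using T nT by (intro J_closed J_Nul tensor_left_zero_Nul tensor_right_zero_Nul cube J_mult_right[OF T Nul_T[OF n] J_Nul[OF n]])
  ultimately show ?thesis by (simp add: nondegenerate_def prolong_eq_def J_def distrib_right)
qed

end

theorem theorem6p6:
  fixes q :: real
  assumes "q \<noteq> -1" and "q \<noteq> 0" and "q \<noteq> 1"
  shows "\<not> (\<exists>\<sigma>\<in>Omega2F3 q. left_coinvariant q \<sigma> \<and> nondegenerate q \<sigma> \<and> commutes_with_OqF3 q \<sigma>)"
proof -
  interpret sl3 q using assms by unfold_locales (auto simp: power2_eq_1_iff)
  show ?thesis using degenerate by blast
qed

end
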